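(* Let $(X,p)$ be a hypersurface germ in $\mathbb{C}^n$ defined locally by a reduced $f\in\mathcal{O}_{\mathbb{C}^n,p}$. Let $L$ be an $\mathcal{O}_{\mathbb{C}^n,p}$-submodule of $\mathrm{Der}(-\log X)_p$. Suppose that (A) whenever $I_n(L)\subseteq(h)$ for a reduced $h\in\mathcal{O}_{\mathbb{C}^n,p}$, then $h\mid f$ (equivalently, the hypersurface component of the analytic germ $(Z,p)$ defined by $I_n(L)$ is $(X,p)$); and (B) every irreducible hypersurface component $(X_0,p)$ of $(X,p)$ satisfies one of the equivalent conditions $(B_1)$, $(B_2)$, $(B_3)$ listed in the context (for instance, $I_n(L)\nsubseteq(I(X_0))^2$). Then $R(L)$ is the module of germs of logarithmic $1$-forms of $(X,p)$ and $$R(R(L))=\mathrm{Der}(-\log X)_p.$$ If also $L$ is reflexive, then $L=\mathrm{Der}(-\log X)_p$.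
   Context: $\mathcal{O}_{\mathbb{C}^n,p}$, $\mathrm{Der}_{\mathbb{C}^n,p}$, $\Omega^1_{\mathbb{C}^n,p}$ and $\widetilde{\Omega}^1_{\mathbb{C}^n,p}$ denote germs at $p$ of holomorphic functions, holomorphic vector fields, holomorphic $1$-forms and meromorphic $1$-forms. Analytic sets and germs are reduced; $I(X)$ is the ideal of functions vanishing on $X$, and $\mathrm{Der}(-\log X)_p=\{\eta\in\mathrm{Der}_{\mathbb{C}^n,p}:\eta(I(X))\subseteq I(X)\}$. A germ of meromorphic $1$-form $\omega$ is logarithmic for $(X,p)$ if $f\omega$ and $f\,d\omega$ are holomorphic. $\mathcal{M}_q$ is the maximal ideal of $\mathcal{O}_{\mathbb{C}^n,q}$. Fitting ideals: for a module $L$ of vector fields generated by $\eta_1,\ldots,\eta_m$, $\eta_j=\sum_i a_{ij}\frac{\partial}{\partial z_i}$, $I_n(L)$ is the ideal generated by the $n\times n$ minors of $(a_{ij})$. Realization and reflexivity: let $\theta(\eta,\omega)=\omega(\eta)$ be the pairing of vector fields with meromorphic $1$-forms. If $g\cdot\mathrm{Der}_{\mathbb{C}^n,p}\subseteq D\subseteq\mathrm{Der}_{\mathbb{C}^n,p}$ for a submodule $D$ and some nonzero $g$ (equivalently $I_n(D)\ne(0)$), then $R(D)=\{\omega\in\widetilde{\Omega}^1_{\mathbb{C}^n,p}:\theta(D,\omega)\subseteq\mathcal{O}_{\mathbb{C}^n,p}\}$, which is identified with the dual $D^*$ via $\theta$. If $\Omega^1_{\mathbb{C}^n,p}\subseteq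 M\subseteq\frac1g\Omega^1_{\mathbb{C}^n,p}$, then $R(M)=\{\eta\in\mathrm{Der}_{\mathbb{C}^n,p}:\theta(\eta,M)\subseteq\mathcal{O}_{\mathbb{C}^n,p}\}$, identified with $M^*$. $D$ is reflexive if the natural map $D\to D^{**}$ is an isomorphism (equivalently $D=R(R(D))$). Conditions in (B): choose generators $\eta_1,\ldots,\eta_m$ of $L$ and representatives $X',X_0',\eta_i'$ of $X$, $X_0$, $\eta_i$ on a convex open neighborhood $U$ of $p$ (e.g. a polydisc) such that the irreducible decomposition of $X'$ on $U$ corresponds to that of the germ $(X,p)$, each $\eta_i'$ is a section on $U$ of the sheaf $\mathrm{Der}(-\log X')$, and, if the $\eta_i$ generate $\mathrm{Der}(-\log X)_p$, then the $\eta_i'$ generate the sheaf $\mathrm{Der}(-\log X')$ on $U$. Let $L'_{\mathbb{C}}$ be the complex span of the $\eta'_i$, $L'$ the $\mathcal{O}(U)$-module they generate, and $\langle L'\rangle_q=\{\eta(q):\eta\in L'\}$. For $q\in X'_0$ the following are equivalent: (a) some $g\in I_n(L')$ has $dg_{(q)}\neq0$; (b) some $g\in I_n(L')$ has $g\notin\mathcal{M}_q^2$; (c) $q$ is a smooth point of $X'$ and $\mathcal{O}_{\mathbb{C}^n,q}\cdot L'=\mathrm{Der}(-\log X')_q$; (d) $\dim\langle L'\rangle_q=n-1$ and there is a nonzero $\xi\in L'_{\mathbb{C}}$ with $\xi(q)=0$ such that, for $f_0$ a reduced defining equation of $(X_0',q)$, one of the following equivalent conditions holds: $\xi(f_0)=\gamma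 f_0$ with $\gamma(q)\ne0$; $\xi(f_0)$ has nonzero derivative at $q$; $\mathrm{im}(d(\widehat{\xi})_{(q)})\nsubseteq\langle L'\rangle_q$, where for $\xi=\sum_i g_i\frac{\partial}{\partial x_i}$ one sets $d(\widehat{\xi})_{(q)}(v)=\sum_i d(g_i)_{(q)}(v)\frac{\partial}{\partial x_i}(q)$. The equivalent conditions are then: $(B_1)$ $I_n(L)\nsubseteq(I(X_0))^2$ in $\mathcal{O}_{\mathbb{C}^n,p}$; $(B_2)$ for every open $V\subseteq U$ containing $p$ there is a $q\in X_0'\cap V$ satisfying (a)–(d); $(B_3)$ for every open $V\subseteq U$ containing $p$ there is a closed analytic $Y\subseteq V\cap X_0'$ of codimension $\ge2$ in $V$ such that every $q\in X'_0\cap V\setminus Y$ that is a smooth point of $X'$ satisfies (a)–(d). *)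

theory Defs
  imports "HOL-Complex_Analysis.Complex_Analysis" "HOL-Computational_Algebra.Squarefree"
    "HOL-Computational_Algebra.Fraction_Field" "HOL-Library.Function_Algebras"
begin

text \<open>
  The ring of germs of holomorphic functions at a point of $\mathbb{C}^n$, with \<open>n = CARD('n)\<close>,
  is a type \<open>'n hgerm\<close>. A type cannot depend on the point, so a germ at \<open>p\<close> is stored in the
  coordinates centred at \<open>p\<close>: the germ at \<open>p\<close> of \<open>F\<close> is the germ at the origin of
  \<open>\<lambda>h. F (p + h)\<close> (see \<open>germ_at\<close> below). The identification preserves the ring structure and
  the operators $\partial/\partial z_i$.
\<close>

no_notation fps_nth (infixl "$" 75)

definition holo_on :: "(complex^'n \<Rightarrow> complex) \<Rightarrow> (complex^'n) set \<Rightarrow> bool" where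
  "holo_on F U \<longleftrightarrow>
    (\<forall>z\<in>U. \<exists>D. (F has_derivative D) (at z) \<and> (\<forall>c v. D (c *s v) = c * D v))"

definition partial :: "'n \<Rightarrow> (complex^'n \<Rightarrow> complex) \<Rightarrow> complex^'n \<Rightarrow> complex" where
  "partial i F z = deriv (\<lambda>t. F (z + t *s axis i 1)) 0"

lemma holo_on_subset: "holo_on F U \<Longrightarrow> V \<subseteq> U \<Longrightarrow> holo_on F V"
  by (auto simp: holo_on_def)

lemma holo_on_const: "holo_on (\<lambda>_. c) (U :: (complex^'n) set)"
  unfolding holo_on_def by (auto intro!: exI[of _ "\<lambda>_. 0"])

lemma holo_on_uminus:
  assumes "holo_on F U" shows "holo_on (\<lambda>z. - F z) U"
  unfolding holo_on_def
proof
  fix z assume "z \<in> U"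
  then obtain D where "(F has_derivative D) (at z)" "\<forall>c v. D (c *s v) = c * D v"
    using assms by (auto simp: holo_on_def)
  then show "\<exists>D. ((\<lambda>z. - F z) has_derivative D) (at z) \<and> (\<forall>c v. D (c *s v) = c * D v)"
    by (intro exI[of _ "\<lambda>v. - D v"]) (auto intro: derivative_intros)
qed

lemma holo_on_add:
  assumes "holo_on F U" "holo_on G U" shows "holo_on (\<lambda>z. F z + G z) U"
  unfolding holo_on_def
proof
  fix z assume "z \<in> U"
  then obtain D E where "(F has_derivative D) (at z)" "\<forall>c v. D (c *s v) = c * D v"
    "(G has_derivative E) (at z)" "\<forall>c v. E (c *s v) = c * E v"
    using assms unfolding holo_on_def by meson
  then show "\<exists>D. ((\<lambda>z. F z + G z) has_derivative D) (at z) \<and> (\<forall>c v. D (c *s v) = c * D v)"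
    by (intro exI[of _ "\<lambda>v. D v + E v"]) (auto intro: derivative_intros simp: algebra_simps)
qed

lemma holo_on_mult:
  assumes "holo_on F U" "holo_on G U" shows "holo_on (\<lambda>z. F z * G z) U"
  unfolding holo_on_def
proof
  fix z assume "z \<in> U"
  then obtain D E where "(F has_derivative D) (at z)" "\<forall>c v. D (c *s v) = c * D v"
    "(G has_derivative E) (at z)" "\<forall>c v. E (c *s v) = c * E v"
    using assms unfolding holo_on_def by meson
  then show "\<exists>D. ((\<lambda>z. F z * G z) has_derivative D) (at z) \<and> (\<forall>c v. D (c *s v) = c * D v)"
    by (intro exI[of _ "\<lambda>v. F z * E v + D v * G z"])
      (auto intro!: has_derivative_eq_rhs[OF has_derivative_mult] simp: algebra_simps)
qed

lemma holo_on_cong: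
  assumes "open U" "\<And>z. z \<in> U \<Longrightarrow> F z = G z"
  shows "holo_on F U \<longleftrightarrow> holo_on G U"
proof -
  have "(F has_derivative D) (at z) \<longleftrightarrow> (G has_derivative D) (at z)" if "z \<in> U" for z D
    using assms that has_derivative_transform_within_open[of _ D z UNIV U] by auto
  then show ?thesis unfolding holo_on_def by auto
qed

lemma holo_on_continuous: "holo_on F U \<Longrightarrow> continuous_on U F"
  unfolding holo_on_def
  by (meson continuous_at_imp_continuous_on has_derivative_continuous)

lemma bounded_linear_scale_vec: "bounded_linear (\<lambda>t::complex. t *s (v :: complex^'n))"
  by (rule linear_conv_bounded_linear[THEN iffD1])
    (auto intro!: linearI simp: vec_eq_iff algebra_simps)

lemma has_derivative_affine_line:
  fixes z v :: "complex^'n"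
  shows "((\<lambda>t. z + t *s v) has_derivative (\<lambda>t. t *s v)) (at (t::complex))"
  by (auto intro!: derivative_eq_intros bounded_linear_imp_has_derivative bounded_linear_scale_vec)

lemma line_field_derivative:
  fixes F :: "complex^'n \<Rightarrow> complex"
  assumes "(F has_derivative D) (at (z + t *s v))" "\<forall>c v. D (c *s v) = c * D v"
  shows "((\<lambda>t. F (z + t *s v)) has_field_derivative D v) (at t)"
proof -
  have "((\<lambda>t. F (z + t *s v)) has_derivative (\<lambda>t. D (t *s v))) (at t)"
    using has_derivative_compose[OF has_derivative_affine_line assms(1)] by simp
  moreover have "(\<lambda>t. D (t *s v)) = (*) (D v)" using assms(2) by (auto simp: mult.commute)
  ultimately show ?thesis by (simp add: has_field_derivative_def)
qed

lemma partial_eq: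
  assumes "(F has_derivative D) (at z)" "\<forall>c v. D (c *s v) = c * D v"
  shows "partial i F z = D (axis i 1)"
  unfolding partial_def
  by (rule DERIV_imp_deriv, rule line_field_derivative) (use assms in auto)

lemma complex_linear_expand:
  fixes D :: "complex^'n \<Rightarrow> complex"
  assumes "bounded_linear D" "\<forall>c v. D (c *s v) = c * D v"
  shows "D v = (\<Sum>i\<in>UNIV. v $ i * D (axis i 1))"
proof -
  have "D v = D (\<Sum>i\<in>UNIV. v $ i *s axis i 1)"
    by (simp add: basis_expansion)
  also have "\<dots> = (\<Sum>i\<in>UNIV. v $ i * D (axis i 1))"
    using assms by (simp add: linear_sum[OF bounded_linear.linear[OF assms(1)]])
  finally show ?thesis .
qed

lemma holo_on_has_derivative:
  assumes "holo_on F U" "z \<in> U"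
  shows "(F has_derivative (\<lambda>v. \<Sum>i\<in>UNIV. v $ i * partial i F z)) (at z)"
proof -
  obtain D where D: "(F has_derivative D) (at z)" "\<forall>c v. D (c *s v) = c * D v"
    using assms by (auto simp: holo_on_def)
  have "D = (\<lambda>v. \<Sum>i\<in>UNIV. v $ i * partial i F z)"
    by (rule ext, subst complex_linear_expand[OF has_derivative_bounded_linear[OF D(1)] D(2)])
      (simp add: partial_eq[OF D])
  with D show ?thesis by simp
qed

lemma holo_on_compose_line:
  assumes "holo_on F U" "\<And>t. t \<in> S \<Longrightarrow> z + t *s v \<in> U"
  shows "(\<lambda>t. F (z + t *s v)) holomorphic_on S"
  unfolding holomorphic_on_def field_differentiable_def
proof
  fix t assume "t \<in> S"
  then obtain D where "(F has_derivative D) (at (z + t *s v))" "\<forall>c v. D (c *s v) = c * D v"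
    using assms unfolding holo_on_def by meson
  from line_field_derivative[OF this]
  show "\<exists>f'. ((\<lambda>t. F (z + t *s v)) has_field_derivative f') (at t within S)"
    using has_field_derivative_at_within by blast
qed

lemma norm_axis_scale: "norm (t *s axis i (1::complex)) = norm t"
proof -
  have "t *s axis i (1::complex) = axis i t" by (auto simp: vec_eq_iff axis_def)
  moreover have "norm (axis i t) = norm t"
    by (simp add: norm_eq_sqrt_inner inner_axis_axis)
  ultimately show ?thesis by simp
qed

text \<open>Partial derivatives are holomorphic: Cauchy's formula in one coordinate, differentiated
  under the integral sign.\<close>

definition cauchy_partial :: "real \<Rightarrow> 'n \<Rightarrow> (complex^'n \<Rightarrow> complex) \<Rightarrow> complex^'n \<Rightarrow> complex" where
  "cauchy_partial r i F z = integral (cbox 0 1)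
     (\<lambda>t. F (z + (of_real r * exp (2 * of_real pi * \<i> * of_real t)) *s axis i 1)
        * (exp (- (2 * of_real pi * \<i> * of_real t)) / of_real r))"

lemma cauchy_partial:
  assumes "holo_on F U" "cball z r \<subseteq> U" "r > 0"
  shows "partial i F z = cauchy_partial r i F z"
proof -
  define g where "g t = F (z + t *s axis i 1)" for t
  have "g holomorphic_on cball 0 r" unfolding g_def
    by (rule holo_on_compose_line[OF assms(1)])
      (use assms in \<open>auto simp: dist_norm norm_axis_scale subset_eq\<close>)
  then have "continuous_on (cball 0 r) g" "g holomorphic_on ball 0 r"
    using holomorphic_on_imp_continuous_on holomorphic_on_subset ball_subset_cball by blast+
  note c = Cauchy_derivative_integral_circlepath[OF this, of 0]
  have "deriv g 0 = 1 / (2 * of_real pi * \<i>) * contour_integral(circlepath 0 r) (\<lambda>u. g u / (u-0)^2)"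
    using c assms by (auto intro!: DERIV_imp_deriv)
  also have "\<dots> = 1 / (2 * of_real pi * \<i>) * integral {0..1} (\<lambda>t. g (circlepath 0 r t) / (circlepath 0 r t)^2 * 
      vector_derivative (circlepath 0 r) (at t))"
    by (simp add: contour_integral_integral)
  also have "\<dots> = integral {0..1} (\<lambda>t. 1 / (2 * of_real pi * \<i>) * (g (circlepath 0 r t) / (circlepath 0 r t)^2 * 
      vector_derivative (circlepath 0 r) (at t)))"
    by (rule integral_mult_right[symmetric])
  also have "\<dots> = integral {0..1} (\<lambda>t. g (of_real r * exp (2 * of_real pi * \<i> * of_real t))
      * (exp (- (2 * of_real pi * \<i> * of_real t)) / of_real r))"
    using assms(3)
    by (intro integral_cong, subst vector_derivative_circlepath)
      (simp add: circlepath exp_minus field_simps power2_eq_square)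
  finally show ?thesis unfolding partial_def cauchy_partial_def g_def by simp
qed


lemma continuous_on_cauchy_partial:
  assumes "continuous_on V F" "\<And>z. z \<in> W \<Longrightarrow> cball z r \<subseteq> V" "r > 0"
  shows "continuous_on W (cauchy_partial r i F)"
  unfolding cauchy_partial_def[abs_def]
proof (rule integral_continuous_on_param)
  show "continuous_on (W \<times> cbox 0 1)
     (\<lambda>(z, t). F (z + (of_real r * exp (2 * of_real pi * \<i> * of_real t)) *s axis i 1)
        * (exp (- (2 * of_real pi * \<i> * of_real t)) / of_real r))"
    unfolding case_prod_unfold
    by (intro continuous_intros continuous_on_compose2[OF assms(1)] continuous_on_divide
        bounded_linear.continuous_on[OF bounded_linear_scale_vec])
      (use assms in \<open>auto simp: subset_eq dist_norm norm_axis_scale norm_mult\<close>)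
qed


lemma local_cball:
  fixes z :: "'a::metric_space"
  assumes "open U" "z \<in> U"
  shows "\<exists>r>0. \<forall>w\<in>ball z r. cball w r \<subseteq> U"
proof -
  from assms obtain e where e: "e > 0" "ball z e \<subseteq> U" by (meson open_contains_ball)
  have "v \<in> U" if "w \<in> ball z (e/2)" "v \<in> cball w (e/2)" for v w
    by (rule subsetD[OF e(2)]) (use that dist_triangle[of z v w] in simp)
  then have "\<forall>w\<in>ball z (e/2). cball w (e/2) \<subseteq> U" by blast
  then show ?thesis using e(1) half_gt_zero by blast
qed

lemma continuous_on_partial:
  assumes "holo_on F U" "open U"
  shows "continuous_on U (partial i F)"
  unfolding continuous_on_eq_continuous_at[OF assms(2)]
proof
  fix z assume "z \<in> U"
  from local_cball[OF assms(2) this]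
  obtain r where r: "r > 0" "\<And>w. w \<in> ball z r \<Longrightarrow> cball w r \<subseteq> U"
    by blast
  have "continuous_on (ball z r) (cauchy_partial r i F)"
    by (rule continuous_on_cauchy_partial[OF holo_on_continuous[OF assms(1)]]) (rule r, assumption, rule r(1))
  then have "continuous_on (ball z r) (partial i F)"
    by (rule continuous_on_eq) (simp add: cauchy_partial[OF assms(1) r(2) r(1)])
  then show "isCont (partial i F) z"
    using r(1) by (simp add: continuous_on_eq_continuous_at)
qed

definition partial_blinfun :: "(complex^'n \<Rightarrow> complex) \<Rightarrow> complex^'n \<Rightarrow> ((complex^'n) \<Rightarrow>\<^sub>L complex)" where
  "partial_blinfun F z =
     (\<Sum>j\<in>UNIV. blinfun_mult_right (partial j F z) o\<^sub>L Blinfun (\<lambda>v. v $ j))"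

lemma partial_blinfun_apply:
  "blinfun_apply (partial_blinfun F z) v = (\<Sum>j\<in>UNIV. v $ j * partial j F z)"
proof -
  have "blinfun_apply (blinfun_mult_right (partial j F z) o\<^sub>L Blinfun (\<lambda>v. v $ j)) v = v $ j * partial j F z" for j
    unfolding blinfun_apply_blinfun_compose bounded_linear_Blinfun_apply[OF bounded_linear_vec_nth]
    by (simp add: mult.commute)
  then show ?thesis unfolding partial_blinfun_def blinfun.sum_left by (intro sum.cong refl)
qed

lemma partial_blinfun_scale:
  "blinfun_apply (partial_blinfun F z) (c *s v) = c * blinfun_apply (partial_blinfun F z) v"
  by (simp add: partial_blinfun_apply sum_distrib_left mult.assoc)

lemma has_derivative_partial_blinfun:
  assumes "holo_on F U" "z \<in> U"
  shows "(F has_derivative blinfun_apply (partial_blinfun F z)) (at z)"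
  using holo_on_has_derivative[OF assms] by (simp add: partial_blinfun_apply[abs_def])

lemma continuous_on_partial_blinfun:
  assumes "holo_on F U" "open U"
  shows "continuous_on U (partial_blinfun F)"
  unfolding partial_blinfun_def[abs_def]
  by (intro continuous_intros continuous_on_partial[OF assms]
      bounded_linear.continuous_on[OF bounded_linear_blinfun_mult_right])

lemma holo_on_partial:
  fixes F :: "complex^'n \<Rightarrow> complex"
  assumes "holo_on F U" "open U"
  shows "holo_on (partial i F) U"
  unfolding holo_on_def
proof
  fix z assume "z \<in> U"
  from local_cball[OF assms(2) this]
  obtain r where r: "r > 0" "\<And>w. w \<in> ball z r \<Longrightarrow> cball w r \<subseteq> U"
    by blast
  define p :: "real \<Rightarrow> complex^'n" where
    "p t = (of_real r * exp (2 * of_real pi * \<i> * of_real t)) *s axis i 1" for t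
  define c :: "real \<Rightarrow> complex" where
    "c t = exp (- (2 * of_real pi * \<i> * of_real t)) / of_real r" for t
  have cp: "continuous_on S p" for S unfolding p_def
    by (intro continuous_intros bounded_linear.continuous_on[OF bounded_linear_scale_vec])
  have cc: "continuous_on S c" for S unfolding c_def using r(1)
    by (intro continuous_intros continuous_on_divide) auto
  have norm_p: "norm (p t) = r" for t
    using r(1) by (simp add: p_def norm_axis_scale norm_mult)
  have inU: "w + p t \<in> U" if "w \<in> ball z r" for w t
    by (rule subsetD[OF r(2)[OF that]]) (simp add: dist_norm norm_p)
  define fx where "fx w t = blinfun_mult_left (c t) o\<^sub>L partial_blinfun F (w + p t)" for w t
  have cauchy: "cauchy_partial r i F = (\<lambda>w. integral (cbox 0 1) (\<lambda>t. F (w + p t) * c t))"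
    by (simp add: cauchy_partial_def[abs_def] p_def c_def)
  have cont: "continuous_on (ball z r \<times> cbox 0 1) (\<lambda>(w, t). fx w t)"
    unfolding case_prod_unfold fx_def
    by (intro continuous_intros continuous_on_compose2[OF continuous_on_partial_blinfun[OF assms]]
        continuous_on_compose2[OF cp[of UNIV]] continuous_on_compose2[OF cc[of UNIV]]
        bounded_linear.continuous_on[OF bounded_linear_blinfun_mult_left])
      (auto simp: inU)
  have "(cauchy_partial r i F has_derivative integral (cbox 0 1) (fx z)) (at z within ball z r)"
    unfolding cauchy
  proof (rule leibniz_rule[OF _ _ cont])
    fix w t assume w: "w \<in> ball z r"
    have "((\<lambda>w. w + p t) has_derivative (\<lambda>v. v)) (at w)"
      using has_derivative_add[OF has_derivative_ident has_derivative_const[of "p t"]]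
      by simp
    from has_derivative_compose[OF this has_derivative_partial_blinfun[OF assms(1) inU[OF w]]]
    have "((\<lambda>w. F (w + p t) * c t) has_derivative
        (\<lambda>v. blinfun_apply (partial_blinfun F (w + p t)) v * c t)) (at w within ball z r)"
      by (rule has_derivative_at_withinI[OF has_derivative_mult_left])
    moreover have "blinfun_apply (fx w t) = (\<lambda>v. blinfun_apply (partial_blinfun F (w + p t)) v * c t)"
      by (auto simp: fx_def)
    ultimately show "((\<lambda>w. F (w + p t) * c t) has_derivative blinfun_apply (fx w t)) (at w within ball z r)"
      by simp
  next
    fix w assume w: "w \<in> ball z r"
    show "(\<lambda>t. F (w + p t) * c t) integrable_on cbox 0 1"
      by (intro integrable_continuous continuous_intros cp cc
          continuous_on_compose2[OF holo_on_continuous[OF assms(1)]])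
        (auto simp: inU[OF w])
  qed (use r(1) in auto)
  moreover have "at z within ball z r = at z"
    using r(1) by (simp add: at_within_open[of _ "ball z r"])
  ultimately have d: "(cauchy_partial r i F has_derivative integral (cbox 0 1) (fx z)) (at z)"
    by simp
  have A: "(partial i F has_derivative integral (cbox 0 1) (fx z)) (at z)"
    by (rule has_derivative_transform_within_open[OF d, of "ball z r"])
      (simp_all add: r cauchy_partial[OF assms(1) r(2) r(1)])
  have "continuous_on (cbox 0 1) (fx z)"
  proof -
    have "continuous_on (cbox 0 1) (\<lambda>t. (z, t))" by (intro continuous_intros)
    moreover have "(\<lambda>t. (z, t)) ` cbox 0 1 \<subseteq> ball z r \<times> cbox 0 1" using r(1) by auto
    ultimately show ?thesis using continuous_on_compose2[OF cont] by fastforce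
  qed
  then have "fx z integrable_on cbox 0 1" by (rule integrable_continuous)
  note app = blinfun_apply_integral[OF this]
  have B: "blinfun_apply (integral (cbox 0 1) (fx z)) (a *s v) =
      a * blinfun_apply (integral (cbox 0 1) (fx z)) v" for a v
  proof -
    have "blinfun_apply (fx z t) (a *s v) = a * blinfun_apply (fx z t) v" for t
      by (simp add: fx_def partial_blinfun_scale)
    then show ?thesis unfolding app by simp
  qed
  show "\<exists>D. (partial i F has_derivative D) (at z) \<and> (\<forall>c v. D (c *s v) = c * D v)"
    by (rule exI, rule conjI, rule A, intro allI, rule B)
qed

lemma holo_on_zero_product:
  assumes F: "holo_on F (ball 0 r)" and G: "holo_on G (ball 0 r)"
    and FG: "\<And>z. z \<in> ball 0 r \<Longrightarrow> F z * G z = 0"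
    and z0: "z0 \<in> ball 0 r" "F z0 \<noteq> 0" and w: "w \<in> ball 0 r"
  shows "G w = 0"
proof -
  define N where "N = {z \<in> ball 0 r. F z \<noteq> 0}"
  have "N = (F -` (- {0})) \<inter> ball 0 r" by (auto simp: N_def)
  then have "open N"
    using continuous_open_preimage[OF holo_on_continuous[OF F] open_ball, of "- {0}"]
    by (simp add: Int_commute open_Compl)
  let ?l = "\<lambda>t::complex. z0 + t *s (w - z0)"
  have cl: "continuous_on UNIV ?l"
    by (intro continuous_intros bounded_linear.continuous_on[OF bounded_linear_scale_vec])
  define S where "S = ?l -` ball 0 r"
  have "open S" "open (?l -` N)"
    using open_vimage[OF open_ball cl] open_vimage[OF \<open>open N\<close> cl] by (auto simp: S_def)
  have "convex S"
  proof (rule convexI)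
    fix x y :: complex and u v :: real assume *: "x \<in> S" "y \<in> S" "0 \<le> u" "0 \<le> v" "u + v = 1"
    have "?l (u *\<^sub>R x + v *\<^sub>R y) = u *\<^sub>R ?l x + v *\<^sub>R ?l y"
    proof -
      have "u *\<^sub>R ?l x + v *\<^sub>R ?l y = (u + v) *\<^sub>R z0 + (u *\<^sub>R x + v *\<^sub>R y) *s (w - z0)"
        by (auto simp: vec_eq_iff algebra_simps scaleR_conv_of_real[where 'a = complex])
      with * show ?thesis by simp
    qed
    with * show "u *\<^sub>R x + v *\<^sub>R y \<in> S"
      unfolding S_def vimage_eq by (metis convex_ball convexD)
  qed
  have "(\<lambda>t. G (?l t)) 1 = 0"
  proof (rule analytic_continuation_open[of "?l -` N" S "\<lambda>t. G (?l t)" "\<lambda>_. 0"])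
    show "connected S" using \<open>convex S\<close> by (rule convex_connected)
    show "?l -` N \<noteq> {}" using z0 by (auto simp: N_def intro!: exI[of _ 0])
    show "?l -` N \<subseteq> S" by (auto simp: N_def S_def)
    show "(\<lambda>t. G (?l t)) holomorphic_on S"
      by (rule holo_on_compose_line[OF G]) (auto simp: S_def)
    show "1 \<in> S" using w by (simp add: S_def)
    show "G (?l z) = 0" if "z \<in> ?l -` N" for z
      using that FG[of "?l z"] by (auto simp: N_def)
  qed (fact | simp)+
  then show ?thesis by simp
qed

text \<open>Two functions are related if both are holomorphic near the origin and agree there.\<close>

definition hgerm_rel :: "(complex^'n \<Rightarrow> complex) \<Rightarrow> (complex^'n \<Rightarrow> complex) \<Rightarrow> bool" where
  "hgerm_rel F G \<longleftrightarrow>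
    (\<exists>U. open U \<and> 0 \<in> U \<and> holo_on F U \<and> holo_on G U \<and> (\<forall>z\<in>U. F z = G z))"

lemma hgerm_relI:
  "open U \<Longrightarrow> 0 \<in> U \<Longrightarrow> holo_on F U \<Longrightarrow> (\<And>z. z \<in> U \<Longrightarrow> F z = G z) \<Longrightarrow> hgerm_rel F G"
  using holo_on_cong[of U F G] by (auto simp: hgerm_rel_def)

quotient_type 'n hgerm = "complex^('n::finite) \<Rightarrow> complex" / partial: hgerm_rel
proof (rule part_equivpI)
  show "\<exists>F :: complex^'n \<Rightarrow> complex. hgerm_rel F F"
    by (auto intro!: exI[of _ "\<lambda>_. 0"] hgerm_relI[of UNIV] holo_on_const)
  show "symp (hgerm_rel :: (complex^'n \<Rightarrow> complex) \<Rightarrow> _)"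
    by (rule sympI) (fastforce simp: hgerm_rel_def)
  show "transp (hgerm_rel :: (complex^'n \<Rightarrow> complex) \<Rightarrow> _)"
  proof (rule transpI)
    fix F G H :: "complex^'n \<Rightarrow> complex"
    assume "hgerm_rel F G" "hgerm_rel G H"
    then obtain U V where
      "open U" "0 \<in> U" "holo_on F U" "\<forall>z\<in>U. F z = G z"
      "open V" "0 \<in> V" "\<forall>z\<in>V. G z = H z"
      unfolding hgerm_rel_def by blast
    then show "hgerm_rel F H"
      by (intro hgerm_relI[of "U \<inter> V"]) (auto intro: holo_on_subset)
  qed
qed

lemma hgerm_rel_binary:
  assumes "hgerm_rel F F'" "hgerm_rel G G'"
  obtains U where "open U" "0 \<in> U" "holo_on F U" "holo_on F' U" "holo_on G U" "holo_on G' U"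
    "\<And>z. z \<in> U \<Longrightarrow> F z = F' z" "\<And>z. z \<in> U \<Longrightarrow> G z = G' z"
proof -
  from assms obtain U V where
      "open U" "0 \<in> U" "holo_on F U" "holo_on F' U" "\<forall>z\<in>U. F z = F' z"
      "open V" "0 \<in> V" "holo_on G V" "holo_on G' V" "\<forall>z\<in>V. G z = G' z"
      unfolding hgerm_rel_def by blast
  then show thesis by (intro that[of "U \<inter> V"]) (auto intro: holo_on_subset)
qed

lemma hgerm_rel_const: "hgerm_rel (\<lambda>_. c) (\<lambda>_. c)"
  by (auto intro!: hgerm_relI[of UNIV] holo_on_const)

lemma hgerm_rel_add:
  "hgerm_rel F F' \<Longrightarrow> hgerm_rel G G' \<Longrightarrow> hgerm_rel (\<lambda>z. F z + G z) (\<lambda>z. F' z + G' z)"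
  by (erule (1) hgerm_rel_binary, rule hgerm_relI) (auto intro: holo_on_add)

lemma hgerm_rel_mult:
  "hgerm_rel F F' \<Longrightarrow> hgerm_rel G G' \<Longrightarrow> hgerm_rel (\<lambda>z. F z * G z) (\<lambda>z. F' z * G' z)"
  by (erule (1) hgerm_rel_binary, rule hgerm_relI) (auto intro: holo_on_mult)

lemma hgerm_rel_uminus: "hgerm_rel F F' \<Longrightarrow> hgerm_rel (\<lambda>z. - F z) (\<lambda>z. - F' z)"
  unfolding hgerm_rel_def by (fastforce intro: holo_on_uminus)

lemma hgerm_rel_diff:
  "hgerm_rel F F' \<Longrightarrow> hgerm_rel G G' \<Longrightarrow> hgerm_rel (\<lambda>z. F z - G z) (\<lambda>z. F' z - G' z)"
  using hgerm_rel_add[OF _ hgerm_rel_uminus, of F F' G G'] by simp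

lemmas hgerm_rel_intros =
  hgerm_rel_const hgerm_rel_add hgerm_rel_mult hgerm_rel_uminus hgerm_rel_diff

instantiation hgerm :: (finite) comm_ring_1
begin

lift_definition zero_hgerm :: "'a hgerm" is "\<lambda>_. 0"
  by (rule hgerm_rel_const)

lift_definition one_hgerm :: "'a hgerm" is "\<lambda>_. 1"
  by (rule hgerm_rel_const)

lift_definition plus_hgerm :: "'a hgerm \<Rightarrow> 'a hgerm \<Rightarrow> 'a hgerm" is "\<lambda>F G z. F z + G z"
  by (rule hgerm_rel_add)

lift_definition uminus_hgerm :: "'a hgerm \<Rightarrow> 'a hgerm" is "\<lambda>F z. - F z"
  by (rule hgerm_rel_uminus)

lift_definition minus_hgerm :: "'a hgerm \<Rightarrow> 'a hgerm \<Rightarrow> 'a hgerm" is "\<lambda>F G z. F z - G z"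
  by (rule hgerm_rel_diff)

lift_definition times_hgerm :: "'a hgerm \<Rightarrow> 'a hgerm \<Rightarrow> 'a hgerm" is "\<lambda>F G z. F z * G z"
  by (rule hgerm_rel_mult)

instance
proof
  fix a b c :: "'a hgerm"
  show "a * b * c = a * (b * c)"
    by transfer (simp add: algebra_simps hgerm_rel_intros)
  show "a * b = b * a"
    by transfer (simp add: mult.commute hgerm_rel_intros)
  show "1 * a = a" by transfer simp
  show "a + b + c = a + (b + c)"
    by transfer (simp add: algebra_simps hgerm_rel_intros)
  show "a + b = b + a"
    by transfer (simp add: add.commute hgerm_rel_intros)
  show "0 + a = a" by transfer simp
  show "- a + a = 0" by transfer (simp add: hgerm_rel_intros)
  show "a - b = a + - b" by transfer (simp add: hgerm_rel_intros)
  show "(a + b) * c = a * c + b * c"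
    by transfer (simp add: algebra_simps hgerm_rel_intros)
  show "(0 :: 'a hgerm) \<noteq> 1"
    by transfer (auto simp: hgerm_rel_def)
qed

end

lemma hgerm_rel_mult_zero:
  assumes FG: "hgerm_rel F F" "hgerm_rel G G" "hgerm_rel (\<lambda>z. F z * G z) (\<lambda>_. 0)"
    and nz: "\<not> hgerm_rel F (\<lambda>_. 0)"
  shows "hgerm_rel G (\<lambda>_. 0)"
proof -
  obtain U where U: "open U" "0 \<in> U" "holo_on F U" "holo_on G U"
    using hgerm_rel_binary[OF FG(1,2)] by metis
  obtain V where V: "open V" "0 \<in> V" "\<And>z. z \<in> V \<Longrightarrow> F z * G z = 0"
    using FG(3) unfolding hgerm_rel_def by metis
  have "open (U \<inter> V)" "0 \<in> U \<inter> V" using U V by auto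
  then obtain r where r: "r > 0" "ball 0 r \<subseteq> U \<inter> V"
    by (meson open_contains_ball)
  have holo: "holo_on F (ball 0 r)" "holo_on G (ball 0 r)"
    using U(3,4) r(2) by (auto intro: holo_on_subset)
  have "\<exists>z0\<in>ball 0 r. F z0 \<noteq> 0"
  proof (rule ccontr)
    assume "\<not> (\<exists>z0\<in>ball 0 r. F z0 \<noteq> 0)"
    then have "hgerm_rel F (\<lambda>_. 0)"
      using r(1) holo(1) by (intro hgerm_relI[of "ball 0 r"]) auto
    with nz show False by simp
  qed
  then obtain z0 where z0: "z0 \<in> ball 0 r" "F z0 \<noteq> 0" by blast
  have "F z * G z = 0" if "z \<in> ball 0 r" for z using that r(2) V(3) by blast
  then have "G w = 0" if "w \<in> ball 0 r" for w
    using holo_on_zero_product[OF holo _ z0 that] by simp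
  then show ?thesis
    using r(1) holo(2) by (intro hgerm_relI[of "ball 0 r"]) auto
qed

lemma hgerm_mult_eq_zero:
  fixes a b :: "'n::finite hgerm"
  shows "a * b = 0 \<Longrightarrow> a \<noteq> 0 \<Longrightarrow> b = 0"
  by transfer (rule hgerm_rel_mult_zero)

instance hgerm :: (finite) idom
  by standard (use hgerm_mult_eq_zero in blast)

lemma partial_cong:
  assumes "open U" "z \<in> U" "holo_on F U" "\<And>w. w \<in> U \<Longrightarrow> F w = G w"
  shows "partial i F z = partial i G z"
proof -
  obtain D where D: "(F has_derivative D) (at z)" "\<forall>c v. D (c *s v) = c * D v"
    using assms by (auto simp: holo_on_def)
  moreover have "(G has_derivative D) (at z)"
    using has_derivative_transform_within_open[OF D(1) assms(1,2,4)] .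
  ultimately show ?thesis by (simp add: partial_eq)
qed

lemma partial_add:
  assumes "holo_on F U" "holo_on G U" "z \<in> U"
  shows "partial i (\<lambda>z. F z + G z) z = partial i F z + partial i G z"
proof -
  obtain D E where "(F has_derivative D) (at z)" "\<forall>c v. D (c *s v) = c * D v"
    "(G has_derivative E) (at z)" "\<forall>c v. E (c *s v) = c * E v"
    using assms unfolding holo_on_def by meson
  then show ?thesis
    using partial_eq[of "\<lambda>z. F z + G z" "\<lambda>v. D v + E v" z i] partial_eq[of F D z i] partial_eq[of G E z i]
    by (auto intro: derivative_intros simp: algebra_simps)
qed

lemma partial_mult:
  assumes "holo_on F U" "holo_on G U" "z \<in> U"
  shows "partial i (\<lambda>z. F z * G z) z = partial i F z * G z + F z * partial i G z"
proof -
  obtain D E where "(F has_derivative D) (at z)" "\<forall>c v. D (c *s v) = c * D v"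
    "(G has_derivative E) (at z)" "\<forall>c v. E (c *s v) = c * E v"
    using assms unfolding holo_on_def by meson
  then show ?thesis
    using partial_eq[of "\<lambda>z. F z * G z" "\<lambda>v. F z * E v + D v * G z" z i]
      partial_eq[of F D z i] partial_eq[of G E z i] has_derivative_mult[of F D z UNIV G E]
    by (simp add: algebra_simps)
qed

lemma hgerm_rel_partial:
  assumes "hgerm_rel F G" shows "hgerm_rel (partial i F) (partial i G)"
proof -
  obtain U where U: "open U" "0 \<in> U" "holo_on F U" "\<And>z. z \<in> U \<Longrightarrow> F z = G z"
    using assms unfolding hgerm_rel_def by metis
  show ?thesis
    by (rule hgerm_relI[OF U(1,2) holo_on_partial[OF U(3,1)]])
      (rule partial_cong[OF U(1) _ U(3,4)])
qed

lemma hgerm_rel_partial_add: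
  assumes "hgerm_rel F F" "hgerm_rel G G"
  shows "hgerm_rel (partial i (\<lambda>z. F z + G z)) (\<lambda>z. partial i F z + partial i G z)"
proof -
  obtain U where U: "open U" "0 \<in> U" "holo_on F U" "holo_on G U"
    by (rule hgerm_rel_binary[OF assms])
  show ?thesis
    by (rule hgerm_relI[OF U(1,2) holo_on_partial[OF holo_on_add[OF U(3,4)] U(1)]])
      (rule partial_add[OF U(3,4)])
qed

lemma hgerm_rel_partial_mult:
  assumes "hgerm_rel F F" "hgerm_rel G G"
  shows "hgerm_rel (partial i (\<lambda>z. F z * G z)) (\<lambda>z. partial i F z * G z + F z * partial i G z)"
proof -
  obtain U where U: "open U" "0 \<in> U" "holo_on F U" "holo_on G U"
    by (rule hgerm_rel_binary[OF assms])
  show ?thesis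
    by (rule hgerm_relI[OF U(1,2) holo_on_partial[OF holo_on_mult[OF U(3,4)] U(1)]])
      (rule partial_mult[OF U(3,4)])
qed

lift_definition dgerm :: "'n::finite \<Rightarrow> 'n hgerm \<Rightarrow> 'n hgerm" is partial
  by (rule hgerm_rel_partial)

lemma dgerm_add: "dgerm i (a + b) = dgerm i a + dgerm i b"
  by transfer (rule hgerm_rel_partial_add)

lemma dgerm_mult: "dgerm i (a * b) = dgerm i a * b + a * dgerm i b"
  by transfer (rule hgerm_rel_partial_mult)

text \<open>Meromorphic germs form the fraction field \<open>'n hgerm fract\<close>; partial derivatives extend to
  it by the quotient rule.\<close>

lift_definition dmero :: "'n::finite \<Rightarrow> 'n hgerm fract \<Rightarrow> 'n hgerm fract" is
  "\<lambda>i (a, b). (dgerm i a * b - a * dgerm i b, b * b)"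
proof -
  fix i :: 'n and q r :: "'n hgerm \<times> 'n hgerm"
  assume qr: "fractrel q r"
  obtain a b c d where q: "q = (a, b)" "r = (c, d)" by (cases q, cases r)
  from qr have bd: "b \<noteq> 0" "d \<noteq> 0" and e: "a * d = c * b" by (auto simp: q)
  from e have e': "dgerm i a * d + a * dgerm i d = dgerm i c * b + c * dgerm i b"
    by (metis dgerm_mult)
  have "(dgerm i a * b - a * dgerm i b) * (d * d) - (dgerm i c * d - c * dgerm i d) * (b * b)
     = b * d * (dgerm i a * d - dgerm i c * b) - (a * d) * d * dgerm i b + (c * b) * b * dgerm i d"
    by (simp add: algebra_simps)
  also have "\<dots> = b * d * (dgerm i a * d - dgerm i c * b - c * dgerm i b + a * dgerm i d)"
    using e by (simp add: algebra_simps)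
  also have "\<dots> = 0" using e' by (simp add: algebra_simps)
  finally show "fractrel (case q of (a, b) \<Rightarrow> (dgerm i a * b - a * dgerm i b, b * b))
     (case r of (a, b) \<Rightarrow> (dgerm i a * b - a * dgerm i b, b * b))"
    using bd by (simp add: q)
qed

lemma dmero_Fract:
  "b \<noteq> 0 \<Longrightarrow> dmero i (Fraction_Field.Fract a b) =
     Fraction_Field.Fract (dgerm i a * b - a * dgerm i b) (b * b)"
  by transfer simp

interpretation hring: module "(*) :: 'n::finite hgerm \<Rightarrow> 'n hgerm \<Rightarrow> 'n hgerm"
  by standard (simp_all add: algebra_simps)

interpretation hvec: module "(*s) :: 'n::finite hgerm \<Rightarrow> 'n hgerm^'n \<Rightarrow> 'n hgerm^'n"
  by standard (simp_all add: vec_eq_iff algebra_simps)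

lift_definition hvalue :: "'n::finite hgerm \<Rightarrow> complex" is "\<lambda>F. F 0"
  by (auto simp: hgerm_rel_def)

text \<open>Meaningful for \<open>F\<close> holomorphic near \<open>p\<close>.\<close>

definition germ_at :: "complex^'n \<Rightarrow> (complex^'n \<Rightarrow> complex) \<Rightarrow> 'n hgerm" where
  "germ_at p F = abs_hgerm (\<lambda>h. F (p + h))"

text \<open>A vector field $\sum_i \eta_i\,\partial/\partial z_i$ is the vector of its coefficients.\<close>

definition vgerm_at :: "complex^'n \<Rightarrow> (complex^'n \<Rightarrow> complex^'n) \<Rightarrow> 'n hgerm^'n" where
  "vgerm_at p \<eta> = (\<chi> i. germ_at p (\<lambda>z. \<eta> z $ i))"

definition vapply :: "'n::finite hgerm^'n \<Rightarrow> 'n hgerm \<Rightarrow> 'n hgerm" where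
  "vapply \<eta> g = (\<Sum>i\<in>UNIV. \<eta> $ i * dgerm i g)"

text \<open>The $n \times n$ minors are those of the coefficient matrix whose columns are all
  elements of \<open>L\<close>; by \<open>fitting_ideal_span\<close>, any generating set of \<open>L\<close> gives the same ideal.\<close>

definition fitting_ideal :: "('n::finite hgerm^'n) set \<Rightarrow> 'n hgerm set" where
  "fitting_ideal L = hring.span {det A | A. \<forall>j. column j A \<in> L}"

lemma fitting_ideal_span:
  fixes G :: "('n::finite hgerm^'n) set"
  shows "fitting_ideal (hvec.span G) = fitting_ideal G"
proof
  show "fitting_ideal G \<subseteq> fitting_ideal (hvec.span G)"
    unfolding fitting_ideal_def by (rule hring.span_mono) (auto intro: hvec.span_base)
  have rows: "det B \<in> fitting_ideal G" if "finite S" "\<forall>i\<in>S. B $ i \<in> hvec.span G" "\<forall>i. i \<notin> S \<longrightarrow> B $ i \<in> G"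
    for S :: "'n set" and B
    using that
  proof (induction S arbitrary: B rule: finite_induct)
    case empty
    then have "\<forall>j. column j (transpose B) \<in> G"
      by (simp add: column_def transpose_def)
    then have "det (transpose B) \<in> fitting_ideal G"
      unfolding fitting_ideal_def by (intro hring.span_base) blast
    then show ?case by simp
  next
    case (insert k S)
    define P where "P v = (det (\<chi> i. if i = k then v else B $ i) \<in> fitting_ideal G)" for v
    have "B $ k \<in> hvec.span G" using insert.prems by simp
    then have "P (B $ k)"
    proof (rule hvec.span_induct)
      show "P v" if "v \<in> G" for v
        unfolding P_def by (rule insert.IH) (use insert.prems insert.hyps that in auto)
      show "hvec.subspace {v. P v}"
      proof (rule hvec.subspaceI; clarsimp simp: P_def)
        show "det (\<chi> i. if i = k then 0 else B $ i) \<in> fitting_ideal G"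
          using det_row_mul[of k 0 "\<lambda>_. 0" "\<lambda>i. B $ i"]
          by (simp add: fitting_ideal_def hring.span_zero cong: if_cong)
      next
        fix x y assume "det (\<chi> i. if i = k then x else B $ i) \<in> fitting_ideal G"
          "det (\<chi> i. if i = k then y else B $ i) \<in> fitting_ideal G"
        then show "det (\<chi> i. if i = k then x + y else B $ i) \<in> fitting_ideal G"
          using det_row_add[of k "\<lambda>_. x" "\<lambda>_. y" "\<lambda>i. B $ i"]
          by (simp add: fitting_ideal_def hring.span_add cong: if_cong)
      next
        fix c x assume "det (\<chi> i. if i = k then x else B $ i) \<in> fitting_ideal G"
        then show "det (\<chi> i. if i = k then c *s x else B $ i) \<in> fitting_ideal G"
          using det_row_mul[of k c "\<lambda>_. x" "\<lambda>i. B $ i"]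
          by (simp add: fitting_ideal_def hring.span_scale cong: if_cong)
      qed
    qed
    moreover have "(\<chi> i. if i = k then B $ k else B $ i) = B" by (simp add: vec_eq_iff)
    ultimately show ?case by (simp add: P_def)
  qed
  have "det A \<in> fitting_ideal G" if "\<forall>j. column j A \<in> hvec.span G" for A
  proof -
    have "det (transpose A) \<in> fitting_ideal G"
      using that by (intro rows[of UNIV]) (auto simp: column_def transpose_def)
    then show ?thesis by simp
  qed
  then show "fitting_ideal (hvec.span G) \<subseteq> fitting_ideal G"
    unfolding fitting_ideal_def[of "hvec.span G"]
    by (intro hring.span_minimal) (auto simp: fitting_ideal_def hring.subspace_span)
qed

definition ideal_mult :: "'n::finite hgerm set \<Rightarrow> 'n hgerm set \<Rightarrow> 'n hgerm set" where
  "ideal_mult I J = hring.span {a * b | a b. a \<in> I \<and> b \<in> J}"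

definition max_ideal :: "'n::finite hgerm set" where
  "max_ideal = {g. hvalue g = 0}"


subsection \<open>Germs of sets\<close>

text \<open>The germ at \<open>p\<close> of a set is the set up to equality near \<open>p\<close>. In \<open>defined_by\<close> (for finite
  \<open>G\<close>) and in \<open>vanishing_ideal\<close> the choice of representative made by \<open>rep_hgerm\<close> does not
  matter.\<close>

definition germ_eq :: "complex^'n \<Rightarrow> (complex^'n) set \<Rightarrow> (complex^'n) set \<Rightarrow> bool" where
  "germ_eq p X Y \<longleftrightarrow> (\<forall>\<^sub>F z in nhds p. z \<in> X \<longleftrightarrow> z \<in> Y)"

definition germ_le :: "complex^'n \<Rightarrow> (complex^'n) set \<Rightarrow> (complex^'n) set \<Rightarrow> bool" where
  "germ_le p X Y \<longleftrightarrow> (\<forall>\<^sub>F z in nhds p. z \<in> X \<longrightarrow> z \<in> Y)"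

definition defined_by :: "complex^'n \<Rightarrow> (complex^'n) set \<Rightarrow> 'n hgerm set \<Rightarrow> bool" where
  "defined_by p X G \<longleftrightarrow> (\<forall>\<^sub>F z in nhds p. z \<in> X \<longleftrightarrow> (\<forall>g\<in>G. rep_hgerm g (z - p) = 0))"

definition vanishing_ideal :: "complex^'n \<Rightarrow> (complex^'n) set \<Rightarrow> 'n hgerm set" where
  "vanishing_ideal p X = {g. \<forall>\<^sub>F z in nhds p. z \<in> X \<longrightarrow> rep_hgerm g (z - p) = 0}"

definition Der_log :: "complex^'n \<Rightarrow> (complex^'n) set \<Rightarrow> ('n hgerm^'n) set" where
  "Der_log p X = {\<eta>. \<forall>g\<in>vanishing_ideal p X. vapply \<eta> g \<in> vanishing_ideal p X}"

definition analytic_germ :: "complex^'n \<Rightarrow> (complex^'n) set \<Rightarrow> bool" where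
  "analytic_germ p X \<longleftrightarrow> (\<exists>G. finite G \<and> defined_by p X G)"

definition hypersurface_germ :: "complex^'n \<Rightarrow> (complex^'n) set \<Rightarrow> bool" where
  "hypersurface_germ p X \<longleftrightarrow> p \<in> X \<and> (\<exists>g. g \<noteq> 0 \<and> defined_by p X {g})"

definition irreducible_germ :: "complex^'n \<Rightarrow> (complex^'n) set \<Rightarrow> bool" where
  "irreducible_germ p X \<longleftrightarrow> analytic_germ p X \<and> p \<in> X \<and>
    (\<forall>Y Z. analytic_germ p Y \<longrightarrow> analytic_germ p Z \<longrightarrow> germ_eq p X (Y \<union> Z) \<longrightarrow>
      germ_eq p X Y \<or> germ_eq p X Z)"

definition component_germ :: "complex^'n \<Rightarrow> (complex^'n) set \<Rightarrow> (complex^'n) set \<Rightarrow> bool" where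
  "component_germ p X0 X \<longleftrightarrow> irreducible_germ p X0 \<and> germ_le p X0 X \<and>
    (\<forall>Y. irreducible_germ p Y \<longrightarrow> germ_le p X0 Y \<longrightarrow> germ_le p Y X \<longrightarrow> germ_eq p X0 Y)"


subsection \<open>Meromorphic and logarithmic forms, realization, reflexivity\<close>

definition of_germ :: "'n::finite hgerm \<Rightarrow> 'n hgerm fract" where
  "of_germ a = Fraction_Field.Fract a 1"

text \<open>A meromorphic 1-form $\sum_i \omega_i\,dz_i$ is the vector of its coefficients, and a 2-form
  $\sum_{i<j} \alpha_{ij}\,dz_i\wedge dz_j$ the antisymmetric matrix of its coefficients.\<close>

definition pairing :: "'n::finite hgerm^'n \<Rightarrow> 'n hgerm fract^'n \<Rightarrow> 'n hgerm fract" where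
  "pairing \<eta> \<omega> = (\<Sum>i\<in>UNIV. \<omega> $ i * of_germ (\<eta> $ i))"

definition d_form :: "'n::finite hgerm fract^'n \<Rightarrow> 'n hgerm fract^'n^'n" where
  "d_form \<omega> = (\<chi> i j. dmero i (\<omega> $ j) - dmero j (\<omega> $ i))"

definition log_forms :: "'n::finite hgerm \<Rightarrow> ('n hgerm fract^'n) set" where
  "log_forms f = {\<omega>. (\<forall>i. of_germ f * \<omega> $ i \<in> range of_germ) \<and>
    (\<forall>i j. of_germ f * d_form \<omega> $ i $ j \<in> range of_germ)}"

definition R_fields :: "('n::finite hgerm^'n) set \<Rightarrow> ('n hgerm fract^'n) set" where
  "R_fields D = {\<omega>. \<forall>\<eta>\<in>D. pairing \<eta> \<omega> \<in> range of_germ}"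

definition R_forms :: "('n::finite hgerm fract^'n) set \<Rightarrow> ('n hgerm^'n) set" where
  "R_forms M = {\<eta>. \<forall>\<omega>\<in>M. pairing \<eta> \<omega> \<in> range of_germ}"

text \<open>The linear forms on a submodule \<open>D\<close>, extended by zero outside \<open>D\<close> so that equality of
  functions is equality on \<open>D\<close>. The dual is again a module under pointwise operations.\<close>

definition module_dual :: "('a::comm_ring_1 \<Rightarrow> 'b::plus \<Rightarrow> 'b) \<Rightarrow> 'b set \<Rightarrow> ('b \<Rightarrow> 'a) set" where
  "module_dual smul D = {\<phi>.
    (\<forall>x\<in>D. \<forall>y\<in>D. \<phi> (x + y) = \<phi> x + \<phi> y) \<and>
    (\<forall>a. \<forall>x\<in>D. \<phi> (smul a x) = a * \<phi> x) \<and>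
    (\<forall>x. x \<notin> D \<longrightarrow> \<phi> x = 0)}"

text \<open>The natural map to the bidual is automatically linear.\<close>

definition reflexive_module :: "('n::finite hgerm^'n) set \<Rightarrow> bool" where
  "reflexive_module D \<longleftrightarrow>
    (let D' = module_dual (*s) D; D'' = module_dual (\<lambda>a \<phi> x. a * \<phi> x) D'
     in bij_betw (\<lambda>\<eta> \<phi>. if \<phi> \<in> D' then \<phi> \<eta> else 0) D D'')"


subsection \<open>Analytic subsets of open sets\<close>

definition analytic_in :: "(complex^'n) set \<Rightarrow> (complex^'n) set \<Rightarrow> bool" where
  "analytic_in U A \<longleftrightarrow> A \<subseteq> U \<and>
    (\<forall>q\<in>U. \<exists>W G. open W \<and> q \<in> W \<and> W \<subseteq> U \<and> finite G \<and> (\<forall>g\<in>G. holo_on g W) \<and>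
      A \<inter> W = {z\<in>W. \<forall>g\<in>G. g z = 0})"

definition irreducible_in :: "(complex^'n) set \<Rightarrow> (complex^'n) set \<Rightarrow> bool" where
  "irreducible_in U A \<longleftrightarrow> analytic_in U A \<and> A \<noteq> {} \<and>
    (\<forall>B C. analytic_in U B \<longrightarrow> analytic_in U C \<longrightarrow> A = B \<union> C \<longrightarrow> A = B \<or> A = C)"

definition component_in ::
  "(complex^'n) set \<Rightarrow> (complex^'n) set \<Rightarrow> (complex^'n) set \<Rightarrow> bool" where
  "component_in U A X \<longleftrightarrow> irreducible_in U A \<and> A \<subseteq> X \<and>
    (\<forall>B. irreducible_in U B \<longrightarrow> A \<subseteq> B \<longrightarrow> B \<subseteq> X \<longrightarrow> A = B)"

definition vholo_on :: "(complex^'n \<Rightarrow> complex^'m) \<Rightarrow> (complex^'n) set \<Rightarrow> bool" where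
  "vholo_on \<Phi> U \<longleftrightarrow> (\<forall>i. holo_on (\<lambda>z. \<Phi> z $ i) U)"

text \<open>Near \<open>q\<close>, some biholomorphic map straightens \<open>A\<close> to a \<open>d\<close>-dimensional coordinate plane.\<close>

definition submanifold_at :: "nat \<Rightarrow> (complex^'n) set \<Rightarrow> complex^'n \<Rightarrow> bool" where
  "submanifold_at d A q \<longleftrightarrow> q \<in> A \<and>
    (\<exists>W W' \<Phi> \<Psi> S. open W \<and> q \<in> W \<and> open W' \<and>
      vholo_on \<Phi> W \<and> vholo_on \<Psi> W' \<and> \<Phi> ` W = W' \<and> \<Psi> ` W' = W \<and>
      (\<forall>z\<in>W. \<Psi> (\<Phi> z) = z) \<and> (\<forall>w\<in>W'. \<Phi> (\<Psi> w) = w) \<and> card S = d \<and>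
      \<Phi> ` (A \<inter> W) = {w\<in>W'. \<forall>i. i \<notin> (S :: 'n set) \<longrightarrow> w $ i = 0})"

definition smooth_point :: "(complex^'n) set \<Rightarrow> complex^'n \<Rightarrow> bool" where
  "smooth_point A q \<longleftrightarrow> (\<exists>d. submanifold_at d A q)"

text \<open>The dimension of an analytic set is the supremum of its dimensions at its smooth points.\<close>

definition codim_ge2 :: "(complex^'n) set \<Rightarrow> bool" where
  "codim_ge2 (A :: (complex^'n) set) \<longleftrightarrow> (\<forall>q d. submanifold_at d A q \<longrightarrow> d + 2 \<le> CARD('n))"


subsection \<open>The conditions on components\<close>

text \<open>In what follows \<open>E 0, ..., E (m - 1)\<close> are holomorphic vector fields on \<open>U\<close>.
  \<open>span_on\<close> is the module they generate over the holomorphic functions on \<open>U\<close>, \<open>span_const\<close>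
  their complex span, \<open>fitting_on\<close> the ideal generated by the $n \times n$ minors of their
  coefficient matrix. Only values on \<open>U\<close> matter. In \<open>fitting_on\<close>, \<open>\<sigma>\<close> selects the columns of a
  minor; selections that repeat or permute columns contribute nothing new.\<close>

definition span_on ::
  "(complex^'n) set \<Rightarrow> nat \<Rightarrow> (nat \<Rightarrow> complex^'n \<Rightarrow> complex^'n) \<Rightarrow> (complex^'n \<Rightarrow> complex^'n) set" where
  "span_on U m E = {\<eta>. \<exists>c. (\<forall>j<m. holo_on (c j) U) \<and> (\<forall>z\<in>U. \<eta> z = (\<Sum>j<m. c j z *s E j z))}"

definition span_const ::
  "(complex^'n) set \<Rightarrow> nat \<Rightarrow> (nat \<Rightarrow> complex^'n \<Rightarrow> complex^'n) \<Rightarrow> (complex^'n \<Rightarrow> complex^'n) set" where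
  "span_const U m E = {\<eta>. \<exists>c. \<forall>z\<in>U. \<eta> z = (\<Sum>j<m. c j *s E j z)}"

definition fitting_on ::
  "(complex^'n) set \<Rightarrow> nat \<Rightarrow> (nat \<Rightarrow> complex^'n \<Rightarrow> complex^'n) \<Rightarrow> (complex^'n \<Rightarrow> complex) set" where
  "fitting_on U m E = {g. \<exists>c. (\<forall>\<sigma>. holo_on (c \<sigma>) U) \<and>
    (\<forall>z\<in>U. g z = (\<Sum>\<sigma> | range \<sigma> \<subseteq> {..<m}. c \<sigma> z * det (\<chi> i j :: 'n. E (\<sigma> j) z $ i)))}"

definition values_at ::
  "(complex^'n) set \<Rightarrow> nat \<Rightarrow> (nat \<Rightarrow> complex^'n \<Rightarrow> complex^'n) \<Rightarrow> complex^'n \<Rightarrow> (complex^'n) set" where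
  "values_at U m E q = (\<lambda>\<eta>. \<eta> q) ` span_on U m E"

definition adapted ::
  "complex^'n \<Rightarrow> (complex^'n) set \<Rightarrow> ('n hgerm^'n) set \<Rightarrow>
    (complex^'n) set \<Rightarrow> (complex^'n) set \<Rightarrow> nat \<Rightarrow> (nat \<Rightarrow> complex^'n \<Rightarrow> complex^'n) \<Rightarrow> bool" where
  "adapted p X L U X' m E \<longleftrightarrow>
    open U \<and> convex U \<and> p \<in> U \<and> analytic_in U X' \<and> germ_eq p X' X \<and>
    (\<forall>j<m. vholo_on (E j) U) \<and> hvec.span ((\<lambda>j. vgerm_at p (E j)) ` {..<m}) = L \<and>
    (\<forall>A. component_in U A X' \<longrightarrow> component_germ p A X) \<and>
    (\<forall>Z. component_germ p Z X \<longrightarrow> (\<exists>!A. component_in U A X' \<and> germ_eq p A Z)) \<and>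
    (\<forall>q\<in>U. \<forall>j<m. vgerm_at q (E j) \<in> Der_log q X') \<and>
    (L = Der_log p X \<longrightarrow>
      (\<forall>q\<in>U. hvec.span ((\<lambda>j. vgerm_at q (E j)) ` {..<m}) = Der_log q X'))"

definition cond_a where
  "cond_a U m E q \<longleftrightarrow> (\<exists>g\<in>fitting_on U m E. frechet_derivative g (at q) \<noteq> (\<lambda>_. 0))"

definition cond_b where
  "cond_b U m E q \<longleftrightarrow>
    (\<exists>g\<in>fitting_on U m E. germ_at q g \<notin> ideal_mult max_ideal max_ideal)"

definition cond_c where
  "cond_c U X' m E q \<longleftrightarrow>
    smooth_point X' q \<and> hvec.span (vgerm_at q ` span_on U m E) = Der_log q X'"

text \<open>A germ is reduced if it is \<open>squarefree\<close> (in particular nonzero); \<open>f0\<close> is thus a reduced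
  equation of \<open>X0'\<close> at \<open>q\<close>, unique up to a unit.\<close>

definition cond_d ::
  "(complex^'n) set \<Rightarrow> (complex^'n) set \<Rightarrow> nat \<Rightarrow> (nat \<Rightarrow> complex^'n \<Rightarrow> complex^'n) \<Rightarrow>
    complex^'n \<Rightarrow> bool" where
  "cond_d U X0' m E q \<longleftrightarrow>
    vec.dim (values_at U m E q) + 1 = CARD('n) \<and>
    (\<exists>\<xi>\<in>span_const U m E. (\<exists>z\<in>U. \<xi> z \<noteq> 0) \<and> \<xi> q = 0 \<and>
      (\<exists>f0. squarefree f0 \<and> defined_by q X0' {f0} \<and>
        ((\<exists>\<gamma>. vapply (vgerm_at q \<xi>) f0 = \<gamma> * f0 \<and> hvalue \<gamma> \<noteq> 0) \<or>
         (\<exists>i. hvalue (dgerm i (vapply (vgerm_at q \<xi>) f0)) \<noteq> 0) \<or>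
         \<not> range (frechet_derivative \<xi> (at q)) \<subseteq> values_at U m E q)))"

definition good_point where
  "good_point U X' X0' m E q \<longleftrightarrow>
    cond_a U m E q \<or> cond_b U m E q \<or> cond_c U X' m E q \<or> cond_d U X0' m E q"

definition cond_B1 ::
  "complex^'n \<Rightarrow> (complex^'n) set \<Rightarrow> ('n hgerm^'n) set \<Rightarrow> bool" where
  "cond_B1 p X0 L \<longleftrightarrow>
    \<not> fitting_ideal L \<subseteq> ideal_mult (vanishing_ideal p X0) (vanishing_ideal p X0)"

definition cond_B2 ::
  "complex^'n \<Rightarrow> (complex^'n) set \<Rightarrow> (complex^'n) set \<Rightarrow> ('n hgerm^'n) set \<Rightarrow> bool" where
  "cond_B2 p X X0 L \<longleftrightarrow>
    (\<exists>U X' X0' m E. adapted p X L U X' m E \<and> component_in U X0' X' \<and> germ_eq p X0' X0 \<and>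
      (\<forall>V. open V \<and> V \<subseteq> U \<and> p \<in> V \<longrightarrow> (\<exists>q\<in>X0' \<inter> V. good_point U X' X0' m E q)))"

definition cond_B3 ::
  "complex^'n \<Rightarrow> (complex^'n) set \<Rightarrow> (complex^'n) set \<Rightarrow> ('n hgerm^'n) set \<Rightarrow> bool" where
  "cond_B3 p X X0 L \<longleftrightarrow>
    (\<exists>U X' X0' m E. adapted p X L U X' m E \<and> component_in U X0' X' \<and> germ_eq p X0' X0 \<and>
      (\<forall>V. open V \<and> V \<subseteq> U \<and> p \<in> V \<longrightarrow>
        (\<exists>Y. analytic_in V Y \<and> Y \<subseteq> V \<inter> X0' \<and> codim_ge2 Y \<and>
          (\<forall>q\<in>X0' \<inter> V - Y. smooth_point X' q \<longrightarrow> good_point U X' X0' m E q))))"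

end

theory Submission
  imports Defs "HOL-Computational_Algebra.Fundamental_Theorem_Algebra"
begin

text \<open>
  Let \<open>M\<close> be a square matrix with columns in \<open>L\<close> and \<open>\<omega> \<in> R(L)\<close>. By Cramer's rule \<open>det M \<cdot> \<omega>\<close> is
  holomorphic. By (A) every prime common factor of the minors divides \<open>f\<close>, and by (B) its square does
  not divide all of them; hence \<open>f\<omega>\<close> is holomorphic. Both \<open>df\<close> and \<open>f\<omega>\<close> take values divisible by \<open>f\<close> on
  the columns of \<open>M\<close>, so \<open>f\<^sup>2\<close> divides \<open>(df \<and> f\<omega>) det M\<close>; since for each prime factor \<open>\<pi>\<close> of \<open>f\<close> some \<open>det M\<close> is not divisible
  by \<open>\<pi>\<^sup>2\<close>, \<open>f\<close> divides \<open>df \<and> f\<omega>\<close>, that is, \<open>\<omega>\<close> is logarithmic. The pointwise conditions (B2), (B3) imply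
  (B1) because at a point satisfying one of (a)--(d) some minor vanishes to first order at most, whereas
  divisibility of all minors by \<open>\<pi>\<^sup>2\<close> propagates to nearby points.

  The argument uses that the ring of germs is factorial and that a germ vanishing on the zeros of a
  squarefree germ is divisible by it. Both come from Weierstrass preparation along a line.
\<close>

section \<open>Germs and their representatives\<close>

text \<open>Two quantitative devices carry the commutative algebra. The order of vanishing at the
  origin is finite for a nonzero germ and drops when a nonunit factor is cancelled, so every descent
  over factors terminates; and a bounded quotient of germs is holomorphic, so divisibility reduces
  to estimates. An irreducible \<open>a\<close> that does not divide \<open>b\<close> admits a
  nonzero combination \<open>x * a + y * b\<close> constant along a line on which \<open>a\<close>
  is regular. This substitute for a resultant can be cancelled from divisibilities by
  \<open>a\<close>, which gives primality, and cannot vanish on the zeros of \<open>a\<close>, which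
  gives the Nullstellensatz. Since \<open>f\<close> is squarefree, divisibility by \<open>f\<close>
  is tested on one prime factor at a time; (B) then only has to supply, for each prime factor, one
  determinant not divisible by its square. For the pointwise conditions the common measure is
  whether determinants of fields in the span lie in \<open>vanish_order 2\<close>. Condition (B3)
  speaks of smooth points off an exceptional set, so such points have to be exhibited; the
  Nullstellensatz, applied to the cofactor of the prime times one of its partial derivatives,
  provides them.\<close>

definition holo_near :: "complex^'n \<Rightarrow> (complex^'n \<Rightarrow> complex) \<Rightarrow> bool" where
  "holo_near q F \<longleftrightarrow> (\<exists>r>0. holo_on F (ball q r))"

lemma holo_nearI: "open U \<Longrightarrow> q \<in> U \<Longrightarrow> holo_on F U \<Longrightarrow> holo_near q F"
  unfolding holo_near_def by (meson openE holo_on_subset)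

lemma hgerm_rel_holo_near: "hgerm_rel F F \<longleftrightarrow> holo_near 0 F"
proof
  assume "hgerm_rel F F"
  then show "holo_near 0 F" unfolding hgerm_rel_def using holo_nearI by blast
next
  assume "holo_near 0 F"
  then obtain r where "r > 0" "holo_on F (ball 0 r)" unfolding holo_near_def by blast
  then show "hgerm_rel F F" by (intro hgerm_relI[of "ball 0 r"]) auto
qed

lemma hgerm_rel_eventually: "hgerm_rel F G \<Longrightarrow> \<forall>\<^sub>F z in nhds 0. F z = G z"
  unfolding hgerm_rel_def eventually_nhds by blast

lemma holo_near_cong_rel:
  assumes "holo_near 0 F" "\<forall>\<^sub>F z in nhds 0. F z = G z"
  shows "hgerm_rel F G"
proof -
  obtain r where r: "r > 0" "holo_on F (ball 0 r)" using assms unfolding holo_near_def by blast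
  obtain U where "open U" "0 \<in> U" "\<forall>z\<in>U. F z = G z" using assms(2) unfolding eventually_nhds by blast
  with r show ?thesis by (intro hgerm_relI[of "U \<inter> ball 0 r"]) (auto intro: holo_on_subset)
qed

lemma hgerm_rel_rep: "hgerm_rel (rep_hgerm a) (rep_hgerm a)"
  by (rule Quotient3_rep_reflp[OF Quotient3_hgerm])

lemma rep_abs_hgerm: "hgerm_rel F F \<Longrightarrow> hgerm_rel (rep_hgerm (abs_hgerm F)) F"
  by (rule Quotient3_rep_abs[OF Quotient3_hgerm])

lemma eventually_nhds_shift:
  fixes p :: "'a::real_normed_vector"
  shows "(\<forall>\<^sub>F h in nhds 0. P (p + h)) \<longleftrightarrow> (\<forall>\<^sub>F z in nhds p. P z)"
proof -
  have "nhds p = filtermap (\<lambda>h. h + p) (nhds 0)"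
    using filtermap_nhds_shift[of "- p" 0] by simp
  then show ?thesis by (simp add: eventually_filtermap add.commute)
qed

lemma eventually_nhds_shift':
  fixes p :: "'a::real_normed_vector"
  shows "(\<forall>\<^sub>F h in nhds 0. P h) \<longleftrightarrow> (\<forall>\<^sub>F z in nhds p. P (z - p))"
  using eventually_nhds_shift[of "\<lambda>z. P (z - p)" p] by simp

lemma holo_on_shift:
  assumes "holo_on F U"
  shows "holo_on (\<lambda>h. F (p + h)) {h. p + h \<in> U}"
  unfolding holo_on_def
proof clarify
  fix h assume "p + h \<in> U"
  then obtain D where D: "(F has_derivative D) (at (p + h))" "\<forall>c v. D (c *s v) = c * D v"
    using assms unfolding holo_on_def by blast
  have "((\<lambda>h. p + h) has_derivative (\<lambda>v. v)) (at h)" by (auto intro!: derivative_eq_intros)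
  from has_derivative_compose[OF this D(1)] D(2)
  show "\<exists>D. ((\<lambda>h. F (p + h)) has_derivative D) (at h) \<and> (\<forall>c v. D (c *s v) = c * D v)" by blast
qed

lemma holo_near_shift: "holo_near q F \<longleftrightarrow> holo_near 0 (\<lambda>h. F (q + h))"
proof
  assume "holo_near q F"
  then obtain r where r: "r > 0" "holo_on F (ball q r)" unfolding holo_near_def by blast
  have "{h. q + h \<in> ball q r} = ball 0 r" by (auto simp: dist_norm)
  with holo_on_shift[OF r(2), of q] r(1) show "holo_near 0 (\<lambda>h. F (q + h))"
    unfolding holo_near_def by auto
next
  assume "holo_near 0 (\<lambda>h. F (q + h))"
  then obtain r where r: "r > 0" "holo_on (\<lambda>h. F (q + h)) (ball 0 r)" unfolding holo_near_def by blast
  have "{h. - q + h \<in> ball 0 r} = ball q r" by (auto simp: dist_norm norm_minus_commute)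
  with holo_on_shift[OF r(2), of "- q"] r(1) show "holo_near q F"
    unfolding holo_near_def by auto
qed

lemma holo_near_rep: "holo_near q (\<lambda>z. rep_hgerm a (z - q))"
  using hgerm_rel_rep[of a] by (simp add: hgerm_rel_holo_near holo_near_shift[of q])

lemma holo_near_rep0: "holo_near 0 (rep_hgerm a)"
  using holo_near_rep[of 0 a] by simp

lemma rep_germ_at:
  assumes "holo_near q F"
  shows "\<forall>\<^sub>F z in nhds q. rep_hgerm (germ_at q F) (z - q) = F z"
proof -
  have "hgerm_rel (\<lambda>h. F (q + h)) (\<lambda>h. F (q + h))"
    using assms by (simp add: hgerm_rel_holo_near holo_near_shift[of q])
  from hgerm_rel_eventually[OF rep_abs_hgerm[OF this]]
  have "\<forall>\<^sub>F h in nhds 0. rep_hgerm (germ_at q F) h = F (q + h)" by (simp add: germ_at_def)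
  then show ?thesis
    using eventually_nhds_shift'[of "\<lambda>h. rep_hgerm (germ_at q F) h = F (q + h)" q] by simp
qed

lemma hgerm_eq_iff_rel: "a = b \<longleftrightarrow> hgerm_rel (rep_hgerm a) (rep_hgerm b)"
  by (metis Quotient3_hgerm Quotient3_rel_rep)

lemma hgerm_eq_iff: "a = b \<longleftrightarrow> (\<forall>\<^sub>F z in nhds q. rep_hgerm a (z - q) = rep_hgerm b (z - q))"
  unfolding hgerm_eq_iff_rel eventually_nhds_shift'[of "\<lambda>h. rep_hgerm a h = rep_hgerm b h" q, symmetric]
  using hgerm_rel_eventually holo_near_cong_rel holo_near_rep0 by blast

lemma germ_at_eqI:
  assumes "holo_near q F" "\<forall>\<^sub>F z in nhds q. F z = G z"
  shows "germ_at q F = germ_at q G"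
proof -
  have "\<forall>\<^sub>F h in nhds 0. F (q + h) = G (q + h)"
    by (rule eventually_nhds_shift[THEN iffD2, OF assms(2)])
  then have "hgerm_rel (\<lambda>h. F (q + h)) (\<lambda>h. G (q + h))"
    using assms(1) by (intro holo_near_cong_rel) (simp_all add: holo_near_shift[of q])
  then show ?thesis unfolding germ_at_def
    by (metis Quotient3_hgerm Quotient3_rel_abs)
qed

lemma germ_at_rep: "germ_at q (\<lambda>z. rep_hgerm a (z - q)) = a"
  by (simp add: germ_at_def Quotient3_abs_rep[OF Quotient3_hgerm])

lemma holo_near_const [intro]: "holo_near q (\<lambda>_. c)"
  by (rule holo_nearI[of UNIV]) (auto intro: holo_on_const)

lemma holo_near_add [intro]:
  assumes "holo_near q F" "holo_near q G" shows "holo_near q (\<lambda>z. F z + G z)"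
proof -
  obtain r s where "r > 0" "holo_on F (ball q r)" "s > 0" "holo_on G (ball q s)"
    using assms unfolding holo_near_def by blast
  then show ?thesis
    by (intro holo_nearI[of "ball q r \<inter> ball q s"] holo_on_add) (auto intro: holo_on_subset)
qed

lemma holo_near_mult [intro]:
  assumes "holo_near q F" "holo_near q G" shows "holo_near q (\<lambda>z. F z * G z)"
proof -
  obtain r s where "r > 0" "holo_on F (ball q r)" "s > 0" "holo_on G (ball q s)"
    using assms unfolding holo_near_def by blast
  then show ?thesis
    by (intro holo_nearI[of "ball q r \<inter> ball q s"] holo_on_mult) (auto intro: holo_on_subset)
qed

lemma holo_near_uminus [intro]: "holo_near q F \<Longrightarrow> holo_near q (\<lambda>z. - F z)"
  unfolding holo_near_def using holo_on_uminus by blast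

lemma holo_near_diff [intro]:
  "holo_near q F \<Longrightarrow> holo_near q G \<Longrightarrow> holo_near q (\<lambda>z. F z - G z)"
  using holo_near_add[OF _ holo_near_uminus, of q F G] by simp

lemma holo_near_partial [intro]: "holo_near q F \<Longrightarrow> holo_near q (partial i F)"
  unfolding holo_near_def using holo_on_partial by blast

lemma holo_near_sum [intro]:
  "(\<And>x. x \<in> A \<Longrightarrow> holo_near q (F x)) \<Longrightarrow> holo_near q (\<lambda>z. \<Sum>x\<in>A. F x z)"
  by (induction A rule: infinite_finite_induct) auto

lemma holo_near_prod [intro]:
  "(\<And>x. x \<in> A \<Longrightarrow> holo_near q (F x)) \<Longrightarrow> holo_near q (\<lambda>z. \<Prod>x\<in>A. F x z)"
  by (induction A rule: infinite_finite_induct) auto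

lemma holo_near_power [intro]: "holo_near q F \<Longrightarrow> holo_near q (\<lambda>z. F z ^ k)"
  by (induction k) auto

lemma holo_near_cong:
  assumes "holo_near q F" "\<forall>\<^sub>F z in nhds q. F z = G z" shows "holo_near q G"
proof -
  obtain r where r: "r > 0" "holo_on F (ball q r)" using assms(1) unfolding holo_near_def by blast
  obtain U where U: "open U" "q \<in> U" "\<forall>z\<in>U. F z = G z" using assms(2) unfolding eventually_nhds by blast
  have "holo_on G (U \<inter> ball q r)"
    using holo_on_cong[of "U \<inter> ball q r" F G] holo_on_subset[OF r(2), of "U \<inter> ball q r"] U by auto
  then show ?thesis using U r by (intro holo_nearI[of "U \<inter> ball q r"]) auto
qed

lemma holo_near_eventually: "holo_near q F \<Longrightarrow> \<forall>\<^sub>F z in nhds q. holo_near z F"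
  unfolding holo_near_def eventually_nhds
  by (metis centre_in_ball open_ball holo_near_def holo_nearI)

lemma holo_near_continuous: "holo_near q F \<Longrightarrow> isCont F q"
  unfolding holo_near_def using holo_on_continuous
  by (metis centre_in_ball continuous_on_interior interior_open open_ball)

section \<open>Ring operations, derivatives and values of germs\<close>

lemma germ_at_0 [simp]: "germ_at q (\<lambda>_. 0) = 0"
  by (simp add: germ_at_def zero_hgerm_def)

lemma germ_at_1 [simp]: "germ_at q (\<lambda>_. 1) = 1"
  by (simp add: germ_at_def one_hgerm_def)

lemma
  assumes "holo_near q F" "holo_near q G"
  shows germ_at_add: "germ_at q (\<lambda>z. F z + G z) = germ_at q F + germ_at q G"
    and germ_at_mult: "germ_at q (\<lambda>z. F z * G z) = germ_at q F * germ_at q G"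
    and germ_at_diff: "germ_at q (\<lambda>z. F z - G z) = germ_at q F - germ_at q G"
  using assms unfolding germ_at_def hgerm_rel_holo_near holo_near_shift[of q]
  by (simp_all add: plus_hgerm.abs_eq times_hgerm.abs_eq minus_hgerm.abs_eq eq_onp_def hgerm_rel_holo_near)

lemma germ_at_uminus: "holo_near q F \<Longrightarrow> germ_at q (\<lambda>z. - F z) = - germ_at q F"
  using germ_at_diff[of q "\<lambda>_. 0" F] by auto

lemma germ_at_sum:
  "(\<And>x. x \<in> A \<Longrightarrow> holo_near q (F x)) \<Longrightarrow> germ_at q (\<lambda>z. \<Sum>x\<in>A. F x z) = (\<Sum>x\<in>A. germ_at q (F x))"
  by (induction A rule: infinite_finite_induct) (auto simp: germ_at_add holo_near_sum)

lemma germ_at_prod: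
  "(\<And>x. x \<in> A \<Longrightarrow> holo_near q (F x)) \<Longrightarrow> germ_at q (\<lambda>z. \<Prod>x\<in>A. F x z) = (\<Prod>x\<in>A. germ_at q (F x))"
  by (induction A rule: infinite_finite_induct) (auto simp: germ_at_mult holo_near_prod)

lemma germ_at_power: "holo_near q F \<Longrightarrow> germ_at q (\<lambda>z. F z ^ k) = germ_at q F ^ k"
  by (induction k) (auto simp: germ_at_mult holo_near_power)

lemma holo_near_det:
  "(\<And>i j. holo_near q (\<lambda>z. A z $ i $ j)) \<Longrightarrow> holo_near q (\<lambda>z. det (A z))"
  unfolding det_def by (intro holo_near_sum holo_near_mult holo_near_const holo_near_prod)

lemma germ_at_det:
  fixes q :: "complex^'n::finite"
  assumes "\<And>i j. holo_near q (\<lambda>z. A z $ i $ j)"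
  shows "germ_at q (\<lambda>z. det (A z)) = det (\<chi> i j. germ_at q (\<lambda>z. A z $ i $ j))"
proof -
  \<comment> \<open>The signs of permutations enter \<open>det\<close> through
    \<open>of_int\<close>, so integer constants have to be traced through the germ map.\<close>
  have c: "germ_at q (\<lambda>z. of_int k) = of_int k" for k
  proof -
    have n: "germ_at q (\<lambda>z. of_nat n) = of_nat n" for n
      by (induction n) (auto simp: germ_at_add holo_near_const)
    show ?thesis by (cases k) (use n germ_at_uminus germ_at_diff[OF holo_near_uminus[OF holo_near_const] holo_near_const] in
          \<open>auto simp: germ_at_uminus germ_at_add germ_at_diff holo_near_const n\<close>)
  qed
  show ?thesis unfolding det_def
    by (subst germ_at_sum)
      (auto simp: germ_at_mult[OF holo_near_const holo_near_prod] germ_at_prod assms c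
        intro!: sum.cong holo_near_mult holo_near_prod)
qed

lemma dgerm_germ_at:
  assumes "holo_near q F" shows "dgerm i (germ_at q F) = germ_at q (partial i F)"
proof -
  have "holo_near 0 (\<lambda>h. F (q + h))" using assms by (simp add: holo_near_shift[of q])
  moreover have "partial i (\<lambda>h. F (q + h)) = (\<lambda>h. partial i F (q + h))"
    by (rule ext) (simp add: partial_def add.assoc)
  ultimately show ?thesis unfolding germ_at_def
    by (simp add: dgerm.abs_eq eq_onp_def hgerm_rel_holo_near)
qed

lemma hvalue_germ_at: "holo_near q F \<Longrightarrow> hvalue (germ_at q F) = F q"
  by (simp add: germ_at_def hvalue.abs_eq hgerm_rel_holo_near holo_near_shift[of q])

lemma hvalue_rep: "hvalue a = rep_hgerm a 0"
  using hvalue_germ_at[OF holo_near_rep[of 0 a]] germ_at_rep[of 0 a] by simp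

lemma hgerm_at_cases:
  obtains F where "holo_near q F" "a = germ_at q F"
  using germ_at_rep holo_near_rep by metis

lemma
  shows hvalue_add [simp]: "hvalue (a + b) = hvalue a + hvalue b"
    and hvalue_mult [simp]: "hvalue (a * b) = hvalue a * hvalue b"
    and hvalue_diff [simp]: "hvalue (a - b) = hvalue a - hvalue b"
    and hvalue_0 [simp]: "hvalue 0 = 0" and hvalue_1 [simp]: "hvalue 1 = 1"
    and hvalue_uminus [simp]: "hvalue (- a) = - hvalue a"
proof -
  obtain F G where FG: "holo_near 0 F" "a = germ_at 0 F" "holo_near 0 G" "b = germ_at 0 G"
    by (metis hgerm_at_cases)
  then show "hvalue (a + b) = hvalue a + hvalue b" "hvalue (a * b) = hvalue a * hvalue b"
    "hvalue (a - b) = hvalue a - hvalue b" "hvalue (- a) = - hvalue a"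
    by (simp_all flip: germ_at_add germ_at_mult germ_at_diff germ_at_uminus
        add: hvalue_germ_at holo_near_add holo_near_mult holo_near_diff holo_near_uminus)
  show "hvalue 0 = 0" "hvalue 1 = 1"
    using hvalue_germ_at[OF holo_near_const, of 0 0] hvalue_germ_at[OF holo_near_const, of 0 1] by auto
qed

lemma hvalue_sum [simp]: "hvalue (\<Sum>x\<in>A. f x) = (\<Sum>x\<in>A. hvalue (f x))"
  by (induction A rule: infinite_finite_induct) auto

lemma hvalue_power [simp]: "hvalue (a ^ k) = hvalue a ^ k"
  by (induction k) auto

lemma hvalue_prod [simp]: "hvalue (\<Prod>x\<in>A. f x) = (\<Prod>x\<in>A. hvalue (f x))"
  by (induction A rule: infinite_finite_induct) auto

lemma hvalue_det:
  fixes A :: "'n::finite hgerm^'m^'m"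
  shows "hvalue (det A) = det (\<chi> i j. hvalue (A $ i $ j))"
proof -
  have "hvalue (of_nat n :: 'n hgerm) = of_nat n" for n by (induction n) auto
  then have "hvalue (of_int k :: 'n hgerm) = of_int k" for k by (cases k) auto
  then show ?thesis by (simp add: det_def)
qed

text \<open>Representatives are chosen independently of each other, so \<open>rep_hgerm\<close>
  respects the operations only after shrinking the neighbourhood. Arguments about values at nearby
  points combine finitely many such identities on a common neighbourhood.\<close>

lemma rep_mult: "\<forall>\<^sub>F z in nhds q. rep_hgerm (a * b) (z - q) = rep_hgerm a (z - q) * rep_hgerm b (z - q)"
  using rep_germ_at[OF holo_near_mult[OF holo_near_rep[of q a] holo_near_rep[of q b]]]
  by (simp add: germ_at_mult holo_near_rep germ_at_rep)

lemma rep_add: "\<forall>\<^sub>F z in nhds q. rep_hgerm (a + b) (z - q) = rep_hgerm a (z - q) + rep_hgerm b (z - q)"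
  using rep_germ_at[OF holo_near_add[OF holo_near_rep[of q a] holo_near_rep[of q b]]]
  by (simp add: germ_at_add holo_near_rep germ_at_rep)

lemma rep_diff: "\<forall>\<^sub>F z in nhds q. rep_hgerm (a - b) (z - q) = rep_hgerm a (z - q) - rep_hgerm b (z - q)"
  using rep_germ_at[OF holo_near_diff[OF holo_near_rep[of q a] holo_near_rep[of q b]]]
  by (simp add: germ_at_diff holo_near_rep germ_at_rep)

lemma rep_0: "\<forall>\<^sub>F z in nhds q. rep_hgerm 0 (z - q) = 0"
  using rep_germ_at[OF holo_near_const[of q 0]] by simp

lemma rep_1: "\<forall>\<^sub>F z in nhds q. rep_hgerm 1 (z - q) = 1"
  using rep_germ_at[OF holo_near_const[of q 1]] by simp

lemma rep_sum: "\<forall>\<^sub>F z in nhds q. rep_hgerm (\<Sum>x\<in>A. f x) (z - q) = (\<Sum>x\<in>A. rep_hgerm (f x) (z - q))"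
  using rep_germ_at[OF holo_near_sum, of A q "\<lambda>x z. rep_hgerm (f x) (z - q)"]
  by (simp add: germ_at_sum holo_near_rep germ_at_rep)

lemma rep_dgerm: "\<forall>\<^sub>F z in nhds q. rep_hgerm (dgerm i a) (z - q) = partial i (\<lambda>z. rep_hgerm a (z - q)) z"
  using rep_germ_at[OF holo_near_partial[OF holo_near_rep[of q a]]]
  by (simp flip: dgerm_germ_at add: holo_near_rep germ_at_rep)

lemma rep_power: "\<forall>\<^sub>F z in nhds q. rep_hgerm (a ^ k) (z - q) = rep_hgerm a (z - q) ^ k"
  using rep_germ_at[OF holo_near_power[OF holo_near_rep[of q a]]]
  by (simp add: germ_at_power holo_near_rep germ_at_rep)

lemmas rep_eventually = rep_mult rep_add rep_diff rep_0 rep_1 rep_sum rep_dgerm rep_power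
lemmas rep_eventually0 = rep_eventually[where q = 0, unfolded diff_zero]

section \<open>Reciprocals and units\<close>

lemma holo_on_inverse:
  assumes "holo_on F U" "\<And>z. z \<in> U \<Longrightarrow> F z \<noteq> 0" shows "holo_on (\<lambda>z. inverse (F z)) U"
  unfolding holo_on_def
proof
  fix z assume z: "z \<in> U"
  then obtain D where "(F has_derivative D) (at z)" "\<forall>c v. D (c *s v) = c * D v"
    using assms by (auto simp: holo_on_def)
  with assms(2)[OF z] show "\<exists>D. ((\<lambda>z. inverse (F z)) has_derivative D) (at z) \<and> (\<forall>c v. D (c *s v) = c * D v)"
    by (intro exI[of _ "\<lambda>v. - (inverse (F z) * D v * inverse (F z))"])
      (auto intro!: derivative_eq_intros simp: algebra_simps)
qed

lemma holo_on_divide: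
  "holo_on F U \<Longrightarrow> holo_on G U \<Longrightarrow> (\<And>z. z \<in> U \<Longrightarrow> G z \<noteq> 0) \<Longrightarrow> holo_on (\<lambda>z. F z / G z) U"
  unfolding divide_inverse by (intro holo_on_mult holo_on_inverse)

text \<open>A representative that is nonzero at the origin is nonzero nearby and has a holomorphic
  reciprocal there. Thus the ring is local, and being a nonunit means vanishing at the
  point.\<close>

lemma hgerm_unit_iff: "(a :: 'n::finite hgerm) dvd 1 \<longleftrightarrow> hvalue a \<noteq> 0"
proof
  assume "a dvd 1"
  then show "hvalue a \<noteq> 0" by (metis dvdE hvalue_1 hvalue_mult mult_zero_left zero_neq_one)
next
  assume nz: "hvalue a \<noteq> 0"
  obtain r where r: "r > 0" "holo_on (rep_hgerm a) (ball 0 r)"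
    using holo_near_rep0 unfolding holo_near_def by blast
  have "isCont (rep_hgerm a) 0" by (rule holo_near_continuous[OF holo_near_rep0])
  then obtain s where s: "s > 0" "\<And>z. z \<in> ball 0 s \<Longrightarrow> rep_hgerm a z \<noteq> 0"
    using nz continuous_at_avoid[of 0 "rep_hgerm a" 0] unfolding hvalue_rep by auto
  have "holo_on (\<lambda>z. inverse (rep_hgerm a z)) (ball 0 (min r s))"
    by (rule holo_on_inverse) (use r s in \<open>auto intro: holo_on_subset\<close>)
  then have n: "holo_near 0 (\<lambda>z. inverse (rep_hgerm a z))"
    using r s by (intro holo_nearI[of "ball 0 (min r s)"]) auto
  have "germ_at 0 (\<lambda>z. rep_hgerm a z * inverse (rep_hgerm a z)) = germ_at 0 (\<lambda>z. 1)"
  proof (rule germ_at_eqI)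
    show "\<forall>\<^sub>F z in nhds 0. rep_hgerm a z * inverse (rep_hgerm a z) = 1"
      unfolding eventually_nhds using s by (intro exI[of _ "ball 0 s"]) auto
  qed (intro holo_near_mult n holo_near_rep0)
  then have "1 = a * germ_at 0 (\<lambda>z. inverse (rep_hgerm a z))"
    using germ_at_rep[of 0 a] by (simp add: germ_at_mult n holo_near_rep0)
  then show "a dvd 1" by (rule dvdI)
qed

section \<open>Chain rule, parameter integrals, identity theorem\<close>

lemma vholo_on_has_derivative:
  fixes \<Phi> :: "complex^'n \<Rightarrow> complex^'m"
  assumes "vholo_on \<Phi> U" "z \<in> U"
  shows "(\<Phi> has_derivative (\<lambda>v. \<chi> i. \<Sum>j\<in>UNIV. v $ j * partial j (\<lambda>z. \<Phi> z $ i) z)) (at z)"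
    (is "(_ has_derivative ?D) _")
proof -
  have c: "((\<lambda>z. \<Phi> z $ i) has_derivative (\<lambda>v. ?D v $ i)) (at z)" for i
    using holo_on_has_derivative[of "\<lambda>z. \<Phi> z $ i" U z] assms by (simp add: vholo_on_def)
  have "((\<lambda>z. \<Sum>i\<in>UNIV. axis i (\<Phi> z $ i)) has_derivative (\<lambda>v. \<Sum>i\<in>UNIV. axis i (?D v $ i))) (at z)"
  proof (intro has_derivative_sum)
    fix i
    have "linear (axis i :: complex \<Rightarrow> complex^'m)" 
      by (rule linearI) (auto simp: axis_def vec_eq_iff)
    then have "bounded_linear (axis i :: complex \<Rightarrow> complex^'m)"
      by (simp add: linear_conv_bounded_linear)
    from bounded_linear.has_derivative[OF this c]
    show "((\<lambda>z. axis i (\<Phi> z $ i)) has_derivative (\<lambda>v. axis i (?D v $ i))) (at z)" .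
  qed
  moreover have "(\<Sum>i\<in>UNIV. axis i (x $ i)) = x" for x :: "complex^'m"
    by (simp add: vec_eq_iff axis_def if_distrib cong: if_cong)
  ultimately show ?thesis by (simp only:)
qed

lemma holo_on_compose:
  assumes "vholo_on \<Phi> W" "holo_on F U" "\<And>z. z \<in> W \<Longrightarrow> \<Phi> z \<in> U"
  shows "holo_on (\<lambda>z. F (\<Phi> z)) W"
  unfolding holo_on_def
proof
  fix z assume z: "z \<in> W"
  note D = vholo_on_has_derivative[OF assms(1) z]
  obtain E where E: "(F has_derivative E) (at (\<Phi> z))" "\<forall>c v. E (c *s v) = c * E v"
    using assms z unfolding holo_on_def by blast
  have "(\<chi> i. \<Sum>j\<in>UNIV. (c *s v) $ j * partial j (\<lambda>z. \<Phi> z $ i) z)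
      = c *s (\<chi> i. \<Sum>j\<in>UNIV. v $ j * partial j (\<lambda>z. \<Phi> z $ i) z)" for c v
    by (simp add: vec_eq_iff sum_distrib_left mult.assoc)
  with has_derivative_compose[OF D E(1)] E(2)
  show "\<exists>D. ((\<lambda>z. F (\<Phi> z)) has_derivative D) (at z) \<and> (\<forall>c v. D (c *s v) = c * D v)"
    by (intro exI[of _ "\<lambda>v. E (\<chi> i. \<Sum>j\<in>UNIV. v $ j * partial j (\<lambda>z. \<Phi> z $ i) z)"]) auto
qed

lemma partial_compose:
  assumes "vholo_on \<Phi> W" "holo_on F U" "\<And>z. z \<in> W \<Longrightarrow> \<Phi> z \<in> U" "z \<in> W"
  shows "partial j (\<lambda>z. F (\<Phi> z)) z = (\<Sum>i\<in>UNIV. partial j (\<lambda>z. \<Phi> z $ i) z * partial i F (\<Phi> z))"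
proof -
  let ?D = "\<lambda>v. (\<chi> i. \<Sum>j\<in>UNIV. v $ j * partial j (\<lambda>z. \<Phi> z $ i) z)"
  have lin: "?D (c *s v) = c *s ?D v" for c v
    by (simp add: vec_eq_iff sum_distrib_left mult.assoc)
  let ?E = "\<lambda>v. \<Sum>i\<in>UNIV. v $ i * partial i F (\<Phi> z)"
  have E: "(F has_derivative ?E) (at (\<Phi> z))"
    by (rule holo_on_has_derivative[OF assms(2)]) (use assms in auto)
  have E': "?E (c *s v) = c * ?E v" for c v
    by (simp add: sum_distrib_left mult.assoc)
  have "partial j (\<lambda>z. F (\<Phi> z)) z = ?E (?D (axis j 1))"
    by (rule partial_eq[OF has_derivative_compose[OF vholo_on_has_derivative[OF assms(1,4)] E]])
      (metis E' lin)
  moreover have "?D (axis j 1) $ i = partial j (\<lambda>z. \<Phi> z $ i) z" for i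
    by (simp add: axis_def if_distrib if_distribR cong: if_cong)
  ultimately show ?thesis by simp
qed

lemma holo_on_compose_outer:
  assumes "holo_on F U" "f holomorphic_on S" "open S" "\<And>z. z \<in> U \<Longrightarrow> F z \<in> S"
  shows "holo_on (\<lambda>z. f (F z)) U"
  unfolding holo_on_def
proof
  fix z assume z: "z \<in> U"
  then obtain D where D: "(F has_derivative D) (at z)" "\<forall>c v. D (c *s v) = c * D v"
    using assms by (auto simp: holo_on_def)
  have "(f has_field_derivative deriv f (F z)) (at (F z))"
    using assms z holomorphic_derivI by blast
  then have "(f has_derivative (*) (deriv f (F z))) (at (F z))" by (simp add: has_field_derivative_def)
  from has_derivative_compose[OF D(1) this] D(2)
  show "\<exists>D. ((\<lambda>z. f (F z)) has_derivative D) (at z) \<and> (\<forall>c v. D (c *s v) = c * D v)"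
    by (intro exI[of _ "\<lambda>v. deriv f (F z) * D v"]) auto
qed

lemma holo_on_nth: "holo_on (\<lambda>z. z $ i) U"
  unfolding holo_on_def
  by (intro ballI exI[of _ "\<lambda>v. v $ i"]) (auto intro!: bounded_linear_imp_has_derivative bounded_linear_vec_nth)

lemma holo_on_sum:
  "(\<And>x. x \<in> A \<Longrightarrow> holo_on (F x) U) \<Longrightarrow> holo_on (\<lambda>z. \<Sum>x\<in>A. F x z) U"
  by (induction A rule: infinite_finite_induct) (auto intro: holo_on_add holo_on_const)

lemma holo_on_diff: "holo_on F U \<Longrightarrow> holo_on G U \<Longrightarrow> holo_on (\<lambda>z. F z - G z) U"
  using holo_on_add[OF _ holo_on_uminus, of F U G] by simp

section \<open>Integrals depending on a parameter\<close>

lemma continuous_on_cauchy_partial_param: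
  fixes F :: "complex^'n \<Rightarrow> 's::topological_space \<Rightarrow> complex"
  assumes "continuous_on (V \<times> S) (\<lambda>(z, s). F z s)" "\<And>z. z \<in> W \<Longrightarrow> cball z r \<subseteq> V" "r > 0"
  shows "continuous_on (W \<times> S) (\<lambda>(z, s). cauchy_partial r i (\<lambda>z. F z s) z)"
  unfolding cauchy_partial_def[abs_def] case_prod_unfold
proof (rule integral_continuous_on_param)
  let ?p = "\<lambda>t::real. (of_real r * exp (2 * of_real pi * \<i> * of_real t)) *s axis i (1::complex)"
  have 1: "continuous_on ((W \<times> S) \<times> cbox 0 1) (\<lambda>x. (fst (fst x) + ?p (snd x), snd (fst x)))"
    by (intro continuous_intros bounded_linear.continuous_on[OF bounded_linear_scale_vec])
  have 2: "(\<lambda>x. (fst (fst x) + ?p (snd x), snd (fst x))) ` ((W \<times> S) \<times> cbox 0 1) \<subseteq> V \<times> S"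
    using assms by (auto simp: subset_eq dist_norm norm_axis_scale norm_mult)
  have "continuous_on ((W \<times> S) \<times> cbox 0 1) (\<lambda>x. F (fst (fst x) + ?p (snd x)) (snd (fst x)))"
    using continuous_on_compose2[OF assms(1) 1 2] by simp
  then show "continuous_on ((W \<times> S) \<times> cbox 0 1)
     (\<lambda>(x, t). F (fst x + ?p t) (snd x)
        * (exp (- (2 * of_real pi * \<i> * of_real t)) / of_real r))"
    unfolding case_prod_unfold
    by (intro continuous_intros continuous_on_divide) (use assms in auto)
qed

text \<open>The Leibniz rule asks for derivatives that are jointly continuous in the point and the
  parameter. Cauchy's formula expresses them by values of \<open>F\<close>, so joint continuity of
  \<open>F\<close> suffices.\<close>

lemma holo_on_integral:
  fixes F :: "complex^'n \<Rightarrow> real \<Rightarrow> complex"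
  assumes "open U" "\<And>s. s \<in> cbox 0 1 \<Longrightarrow> holo_on (\<lambda>z. F z s) U"
    and cont: "continuous_on (U \<times> cbox 0 1) (\<lambda>(z, s). F z s)"
  shows "holo_on (\<lambda>z. integral (cbox 0 1) (F z)) U"
  unfolding holo_on_def
proof
  fix z assume "z \<in> U"
  from local_cball[OF assms(1) this]
  obtain r where r: "r > 0" "\<And>w. w \<in> ball z r \<Longrightarrow> cball w r \<subseteq> U" by blast
  have bU: "ball z r \<subseteq> U" using r by (metis centre_in_cball less_imp_le subset_iff)
  define fx where "fx w s = partial_blinfun (\<lambda>z. F z s) w" for w s
  have cp: "continuous_on (ball z r \<times> cbox 0 1) (\<lambda>(w, s). partial j (\<lambda>z. F z s) w)" for j
    by (rule continuous_on_eq[OF continuous_on_cauchy_partial_param[OF cont r(2) r(1)]])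
      (auto simp: cauchy_partial[OF assms(2) r(2) r(1)])
  have "continuous_on (ball z r \<times> cbox 0 1) (\<lambda>x. fx (fst x) (snd x))"
    unfolding fx_def partial_blinfun_def
    using cp unfolding case_prod_unfold
    by (intro continuous_intros bounded_linear.continuous_on[OF bounded_linear_blinfun_mult_right]) auto
  then have cfx: "continuous_on (ball z r \<times> cbox 0 1) (\<lambda>(w, s). fx w s)" by (simp add: case_prod_unfold)
  have "((\<lambda>w. integral (cbox 0 1) (F w)) has_derivative integral (cbox 0 1) (fx z)) (at z within ball z r)"
  proof (rule leibniz_rule[OF _ _ cfx])
    fix w s assume "w \<in> ball z r" "s \<in> cbox (0::real) 1"
    then show "((\<lambda>w. F w s) has_derivative blinfun_apply (fx w s)) (at w within ball z r)"
      unfolding fx_def using has_derivative_partial_blinfun[OF assms(2)] bU has_derivative_at_withinI by blast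
  next
    fix w assume w: "w \<in> ball z r"
    have "continuous_on (cbox 0 1) (\<lambda>s. (w, s))" by (intro continuous_intros)
    moreover have "(\<lambda>s. (w, s)) ` cbox 0 1 \<subseteq> U \<times> cbox 0 1" using w bU by auto
    ultimately have "continuous_on (cbox 0 1) (F w)" using continuous_on_compose2[OF cont] by fastforce
    then show "F w integrable_on cbox 0 1" by (rule integrable_continuous)
  qed (use r(1) in auto)
  moreover have "at z within ball z r = at z"
    using r(1) by (simp add: at_within_open[of _ "ball z r"])
  ultimately have A: "((\<lambda>w. integral (cbox 0 1) (F w)) has_derivative integral (cbox 0 1) (fx z)) (at z)"
    by simp
  have "continuous_on (cbox 0 1) (\<lambda>t. (z, t))" by (intro continuous_intros)
  moreover have "(\<lambda>t. (z, t)) ` cbox 0 1 \<subseteq> ball z r \<times> cbox 0 1" using r(1) by auto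
  ultimately have "continuous_on (cbox 0 1) (fx z)" using continuous_on_compose2[OF cfx] by fastforce
  then have "fx z integrable_on cbox 0 1" by (rule integrable_continuous)
  note app = blinfun_apply_integral[OF this]
  have B: "blinfun_apply (integral (cbox 0 1) (fx z)) (a *s v) =
      a * blinfun_apply (integral (cbox 0 1) (fx z)) v" for a v
    unfolding app by (simp add: fx_def partial_blinfun_scale)
  show "\<exists>D. ((\<lambda>w. integral (cbox 0 1) (F w)) has_derivative D) (at z) \<and> (\<forall>c v. D (c *s v) = c * D v)"
    using A B by blast
qed

lemma holo_on_contour_integral:
  fixes F :: "complex^'n \<Rightarrow> complex \<Rightarrow> complex"
  assumes "open U" "\<rho> \<ge> 0" "\<And>\<zeta>. norm \<zeta> = \<rho> \<Longrightarrow> holo_on (\<lambda>z. F z \<zeta>) U"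
    and cont: "continuous_on (U \<times> sphere 0 \<rho>) (\<lambda>(z, \<zeta>). F z \<zeta>)"
  shows "holo_on (\<lambda>z. contour_integral (circlepath 0 \<rho>) (F z)) U"
proof -
  have n: "norm (circlepath 0 \<rho> s) = \<rho>" for s
    using assms(2) by (simp add: circlepath norm_mult)
  have "contour_integral (circlepath 0 \<rho>) (F z)
     = integral (cbox 0 1) (\<lambda>s. F z (circlepath 0 \<rho> s) * (2 * pi * \<i> * \<rho> * exp (2 * of_real pi * \<i> * s)))" for z
    by (simp add: contour_integral_integral vector_derivative_circlepath)
  moreover have "holo_on (\<lambda>z. integral (cbox 0 1) (\<lambda>s. F z (circlepath 0 \<rho> s) *
      (2 * pi * \<i> * \<rho> * exp (2 * of_real pi * \<i> * s)))) U"
  proof (rule holo_on_integral[OF assms(1)])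
    show "holo_on (\<lambda>z. F z (circlepath 0 \<rho> s) * (2 * pi * \<i> * \<rho> * exp (2 * of_real pi * \<i> * s))) U" for s
      by (intro holo_on_mult holo_on_const assms n)
    have 1: "continuous_on (U \<times> cbox 0 1) (\<lambda>x. (fst x, circlepath 0 \<rho> (snd x)))"
      unfolding circlepath by (intro continuous_intros)
    have 2: "(\<lambda>x. (fst x, circlepath 0 \<rho> (snd x))) ` (U \<times> cbox 0 1) \<subseteq> U \<times> sphere 0 \<rho>"
      using n by auto
    from continuous_on_compose2[OF cont 1 2]
    show "continuous_on (U \<times> cbox 0 1) (\<lambda>(z, s). F z (circlepath 0 \<rho> s) *
      (2 * pi * \<i> * \<rho> * exp (2 * of_real pi * \<i> * s)))"
      unfolding case_prod_unfold by (intro continuous_intros) simp_all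
  qed
  ultimately show ?thesis by simp
qed

text \<open>Restriction to the complex line from \<open>q\<close> to \<open>w\<close> reduces this
  to one variable: the parameters that stay in the ball form a convex, hence connected, open
  set.\<close>

lemma holo_on_ball_identity:
  assumes F: "holo_on F (ball p r)" and q: "q \<in> ball p r" "\<forall>\<^sub>F z in nhds q. F z = 0" and w: "w \<in> ball p r"
  shows "F w = 0"
proof -
  let ?l = "\<lambda>t::complex. q + t *s (w - q)"
  have cl: "continuous_on UNIV ?l"
    by (intro continuous_intros bounded_linear.continuous_on[OF bounded_linear_scale_vec])
  define S where "S = ?l -` ball p r"
  obtain N where N: "open N" "q \<in> N" "\<And>z. z \<in> N \<Longrightarrow> F z = 0"
    using q(2) unfolding eventually_nhds by blast
  have "open S" "open (?l -` N \<inter> S)"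
    using open_vimage[OF open_ball cl] open_vimage[OF \<open>open N\<close> cl] by (auto simp: S_def)
  have "convex S"
  proof (rule convexI)
    fix x y :: complex and u v :: real assume *: "x \<in> S" "y \<in> S" "0 \<le> u" "0 \<le> v" "u + v = 1"
    have "?l (u *\<^sub>R x + v *\<^sub>R y) = u *\<^sub>R ?l x + v *\<^sub>R ?l y"
    proof -
      have "u *\<^sub>R ?l x + v *\<^sub>R ?l y = (u + v) *\<^sub>R q + (u *\<^sub>R x + v *\<^sub>R y) *s (w - q)"
        by (auto simp: vec_eq_iff algebra_simps scaleR_conv_of_real[where 'a = complex])
      with * show ?thesis by simp
    qed
    with * show "u *\<^sub>R x + v *\<^sub>R y \<in> S"
      unfolding S_def vimage_eq by (metis convex_ball convexD)
  qed
  have "(\<lambda>t. F (?l t)) 1 = 0"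
  proof (rule analytic_continuation_open[of "?l -` N \<inter> S" S "\<lambda>t. F (?l t)" "\<lambda>_. 0"])
    show "connected S" using \<open>convex S\<close> by (rule convex_connected)
    have "0 \<in> ?l -` N \<inter> S" using q N by (simp add: S_def)
    then show "?l -` N \<inter> S \<noteq> {}" by blast
    show "(\<lambda>t. F (?l t)) holomorphic_on S"
      by (rule holo_on_compose_line[OF F]) (auto simp: S_def)
    show "1 \<in> S" using w by (simp add: S_def)
    show "open (?l -` N \<inter> S)" by fact
    show "F (?l z) = 0" if "z \<in> ?l -` N \<inter> S" for z using that N by simp
  qed (use \<open>open S\<close> in auto)
  then show ?thesis by simp
qed

section \<open>Order of vanishing\<close>

text \<open>\<open>a \<in> vanish_order k\<close> means that all partial derivatives of order less than \<open>k\<close> vanish at the origin.\<close>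

primrec vanish_order :: "nat \<Rightarrow> 'n::finite hgerm set" where
  "vanish_order 0 = UNIV"
| "vanish_order (Suc k) = {a. hvalue a = 0 \<and> (\<forall>i. dgerm i a \<in> vanish_order k)}"

lemma dgerm_0 [simp]: "dgerm i 0 = 0"
  using dgerm_add[of i 0 0] by (metis add_0 add_cancel_right_right)

lemma dgerm_uminus: "dgerm i (- a) = - dgerm i a"
  using dgerm_add[of i a "- a"] by (simp add: minus_unique)

lemma dgerm_diff: "dgerm i (a - b) = dgerm i a - dgerm i b"
  using dgerm_add[of i a "- b"] by (simp add: dgerm_uminus)

lemma dgerm_sum: "dgerm i (\<Sum>x\<in>A. f x) = (\<Sum>x\<in>A. dgerm i (f x))"
  by (induction A rule: infinite_finite_induct) (auto simp: dgerm_add)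

lemma vanish_order_0: "0 \<in> vanish_order k"
  by (induction k) auto

lemma vanish_order_add: "a \<in> vanish_order k \<Longrightarrow> b \<in> vanish_order k \<Longrightarrow> a + b \<in> vanish_order k"
  by (induction k arbitrary: a b) (auto simp: dgerm_add)

lemma vanish_order_sum: "(\<And>x. x \<in> A \<Longrightarrow> f x \<in> vanish_order k) \<Longrightarrow> (\<Sum>x\<in>A. f x) \<in> vanish_order k"
  by (induction A rule: infinite_finite_induct) (auto simp: vanish_order_0 vanish_order_add)

lemma vanish_order_uminus: "a \<in> vanish_order k \<Longrightarrow> - a \<in> vanish_order k"
  by (induction k arbitrary: a) (auto simp: dgerm_uminus)

lemma vanish_order_diff: "a \<in> vanish_order k \<Longrightarrow> b \<in> vanish_order k \<Longrightarrow> a - b \<in> vanish_order k"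
  using vanish_order_add[OF _ vanish_order_uminus, of a k b] by simp

lemma vanish_order_SucD: "a \<in> vanish_order (Suc k) \<Longrightarrow> a \<in> vanish_order k"
  by (induction k arbitrary: a) auto

lemma vanish_order_mono: "a \<in> vanish_order k \<Longrightarrow> j \<le> k \<Longrightarrow> a \<in> vanish_order j"
  by (induction k) (auto simp: le_Suc_eq dest: vanish_order_SucD simp del: vanish_order.simps(2))

lemma vanish_order_mult:
  "a \<in> vanish_order j \<Longrightarrow> b \<in> vanish_order k \<Longrightarrow> a * b \<in> vanish_order (j + k)"
proof (induction "j + k" arbitrary: j k a b)
  case (Suc n)
  have v: "hvalue a = 0 \<or> hvalue b = 0"
  proof (cases j)
    case 0
    with Suc.hyps(2) obtain k' where "k = Suc k'" by (cases k) auto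
    then show ?thesis using Suc.prems(2) by simp
  next
    case (Suc j')
    then show ?thesis using Suc.prems(1) by simp
  qed
  \<comment> \<open>If \<open>j = 0\<close>, differentiating \<open>a\<close> costs no order, and it
    is enough to give up one order of \<open>b\<close>, because \<open>n = k - 1\<close> in that
    case.\<close>
  have d: "dgerm i a * b \<in> vanish_order n" for i
  proof (cases j)
    case 0
    with Suc.hyps(2) obtain k' where k: "k = Suc k'" "n = 0 + k'" by auto
    have "b \<in> vanish_order k'" using Suc.prems(2) vanish_order_SucD unfolding k by blast
    then show ?thesis using Suc.hyps(1)[OF k(2), of "dgerm i a" b] k(2) by simp
  next
    case (Suc j')
    then have "n = j' + k" using Suc.hyps(2) by simp
    then show ?thesis using Suc.hyps(1)[of j' k "dgerm i a" b] Suc.prems Suc by simp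
  qed
  have e: "a * dgerm i b \<in> vanish_order n" for i
  proof (cases k)
    case 0
    with Suc.hyps(2) obtain j' where j: "j = Suc j'" "n = j' + 0" by auto
    have "a \<in> vanish_order j'" using Suc.prems(1) vanish_order_SucD unfolding j by blast
    then show ?thesis using Suc.hyps(1)[OF j(2), of a "dgerm i b"] j(2) by simp
  next
    case (Suc k')
    then have "n = j + k'" using Suc.hyps(2) by simp
    then show ?thesis using Suc.hyps(1)[of j k' a "dgerm i b"] Suc.prems Suc by simp
  qed
  show ?case unfolding Suc.hyps(2)[symmetric] using v d e
    by (simp add: dgerm_mult vanish_order_add)
qed simp

lemma vanish_order_times: "a \<in> vanish_order k \<Longrightarrow> b * a \<in> vanish_order k"
  using vanish_order_mult[of b 0 a k] by simp

lemma vanish_order_dvd: "a \<in> vanish_order k \<Longrightarrow> a dvd b \<Longrightarrow> b \<in> vanish_order k"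
  using vanish_order_times by (metis dvdE mult.commute)

lemma norm_vector_scale: "norm (t *s z) = norm t * norm (z :: complex^'n)"
  by (simp add: norm_vec_def L2_set_def norm_mult power_mult_distrib real_sqrt_mult flip: sum_distrib_left)

text \<open>Restricted to a line through the origin, a germ all of whose partial derivatives vanish
  has vanishing Taylor series.\<close>

lemma vanish_order_all_imp_0:
  fixes a :: "'n::finite hgerm"
  assumes "\<And>k. a \<in> vanish_order k" shows "a = 0"
proof -
  have der: "(deriv ^^ k) (\<lambda>t. rep_hgerm b (t *s w)) 0 = 0" if "b \<in> vanish_order (Suc k)" for k w and b :: "'n hgerm"
    using that
  proof (induction k arbitrary: b)
    case 0
    then show ?case by (simp add: hvalue_rep)
  next
    case (Suc k)
    obtain r where r: "r > 0" "holo_on (rep_hgerm b) (ball 0 r)"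
      using holo_near_rep0 unfolding holo_near_def by blast
    \<comment> \<open>The derivative of the restriction of \<open>b\<close> to the line through
      \<open>w\<close> is the restriction of this germ, which vanishes to one order less.\<close>
    define c where "c = (\<Sum>i\<in>UNIV. germ_at 0 (\<lambda>_. w $ i) * dgerm i b)"
    have c: "c \<in> vanish_order (Suc k)" unfolding c_def
      using Suc.prems by (intro vanish_order_sum vanish_order_times) simp
    have "\<forall>\<^sub>F z in nhds 0. \<forall>i\<in>UNIV. rep_hgerm (germ_at 0 (\<lambda>_. w $ i) * dgerm i b) z = w $ i * partial i (rep_hgerm b) z"
    proof (rule eventually_ball_finite, simp, rule ballI)
      fix i
      show "\<forall>\<^sub>F z in nhds 0. rep_hgerm (germ_at 0 (\<lambda>_. w $ i) * dgerm i b) z = w $ i * partial i (rep_hgerm b) z"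
        using rep_eventually0(1)[of "germ_at 0 (\<lambda>_. w $ i)" "dgerm i b"] rep_eventually0(7)[of i b]
          rep_germ_at[OF holo_near_const, of 0 "w $ i"]
        by eventually_elim simp
    qed
    then have "\<forall>\<^sub>F z in nhds 0. rep_hgerm c z = (\<Sum>i\<in>UNIV. w $ i * partial i (rep_hgerm b) z)"
      using rep_eventually0(6)[of "\<lambda>i. germ_at 0 (\<lambda>_. w $ i) * dgerm i b" UNIV]
      by eventually_elim (simp add: c_def)
    moreover have lim: "filterlim (\<lambda>t::complex. t *s w) (nhds 0) (nhds 0)"
    proof -
      have "isCont (\<lambda>t::complex. t *s w) 0"
        by (intro bounded_linear.isCont[OF bounded_linear_scale_vec] continuous_ident)
      then show ?thesis
        using tendsto_at_iff_tendsto_nhds[of "\<lambda>t::complex. t *s w" 0] by (simp add: isCont_def)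
    qed
    ultimately have "\<forall>\<^sub>F t in nhds 0. rep_hgerm c (t *s w) = (\<Sum>i\<in>UNIV. w $ i * partial i (rep_hgerm b) (t *s w))"
      by (rule eventually_compose_filterlim)
    moreover have "\<forall>\<^sub>F t in nhds 0. t *s w \<in> ball 0 r"
      using eventually_compose_filterlim[OF eventually_nhds_in_open[of "ball 0 r" 0] lim] r by simp
    ultimately have "\<forall>\<^sub>F t in nhds 0. deriv (\<lambda>t. rep_hgerm b (t *s w)) t = rep_hgerm c (t *s w)"
    proof eventually_elim
      case (elim t)
      let ?D = "\<lambda>v. \<Sum>i\<in>UNIV. v $ i * partial i (rep_hgerm b) (t *s w)"
      have "((\<lambda>t. rep_hgerm b (0 + t *s w)) has_field_derivative ?D w) (at t)"
        by (rule line_field_derivative)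
          (use holo_on_has_derivative[OF r(2) elim(2)] in \<open>simp_all add: sum_distrib_left mult.assoc\<close>)
      with elim show ?case by (simp add: DERIV_imp_deriv)
    qed
    then have "(deriv ^^ k) (deriv (\<lambda>t. rep_hgerm b (t *s w))) 0 = (deriv ^^ k) (\<lambda>t. rep_hgerm c (t *s w)) 0"
      by (intro higher_deriv_cong_ev) auto
    also have "\<dots> = 0" by (rule Suc.IH[OF c])
    finally show ?case by (simp only: funpow_Suc_right o_apply)
  qed
  obtain r where r: "r > 0" "holo_on (rep_hgerm a) (ball 0 r)"
    using holo_near_rep0 unfolding holo_near_def by blast
  have "rep_hgerm a z = 0" if z: "z \<in> ball 0 r" for z
  proof (cases "z = 0")
    case True
    then show ?thesis using assms[of 1] by (simp add: hvalue_rep)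
  next
    case False
    have "(\<lambda>t. rep_hgerm a (0 + t *s z)) holomorphic_on ball 0 (r / norm z)"
      by (rule holo_on_compose_line[OF r(2)]) (use False in \<open>auto simp: norm_vector_scale field_simps\<close>)
    then have "rep_hgerm a (1 *s z) = 0"
      using holomorphic_fun_eq_0_on_ball[of "\<lambda>t. rep_hgerm a (t *s z)" 0 "r / norm z" 1] der[OF assms] z False
      by simp
    then show ?thesis by simp
  qed
  then have "\<forall>\<^sub>F z in nhds 0. rep_hgerm a z = 0"
    unfolding eventually_nhds using r by (intro exI[of _ "ball 0 r"]) auto
  then show ?thesis
    unfolding hgerm_eq_iff[of a 0 0] using rep_eventually0(4) by eventually_elim simp
qed

text \<open>The finite order of a nonzero germ is the induction measure of the factorization
  arguments: cancelling a nonunit factor lowers it by at least one.\<close>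

lemma vanish_order_exact:
  assumes "a \<noteq> 0" obtains k where "a \<in> vanish_order k" "a \<notin> vanish_order (Suc k)"
proof -
  have "\<exists>k. a \<in> vanish_order k \<and> a \<notin> vanish_order (Suc k)"
  proof (rule ccontr)
    assume "\<not> ?thesis"
    then have *: "a \<in> vanish_order k \<Longrightarrow> a \<in> vanish_order (Suc k)" for k by blast
    have "a \<in> vanish_order k" for k
    proof (induction k)
      case (Suc k)
      then show ?case by (rule *)
    qed simp
    with assms show False using vanish_order_all_imp_0 by blast
  qed
  with that show ?thesis by blast
qed

lemma vanish_order_1: "a \<in> vanish_order 1 \<longleftrightarrow> \<not> a dvd 1"
  unfolding One_nat_def vanish_order.simps hgerm_unit_iff by simp

text \<open>Under these hypotheses the multiples of \<open>a\<close> are stable under all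
  derivations and vanish at the origin, hence vanish to every order. Consequently a prime germ
  cannot divide all of its own partial derivatives.\<close>

lemma dvd_dgerm_imp_0:
  fixes a :: "'n::finite hgerm"
  assumes "\<not> a dvd 1" "\<And>i. a dvd dgerm i a" shows "a = 0"
proof -
  have v: "hvalue a = 0" using assms(1) by (simp only: hgerm_unit_iff) blast
  have *: "a * c \<in> vanish_order k" for c k
  proof (induction k arbitrary: c)
    case 0
    show ?case by simp
  next
    case (Suc k)
    have "dgerm i (a * c) \<in> vanish_order k" for i
    proof -
      obtain d where d: "dgerm i a = a * d" using assms(2)[of i] by (rule dvdE)
      have "dgerm i (a * c) = a * (d * c + dgerm i c)"
        unfolding dgerm_mult d by (simp only: distrib_left mult.assoc)
      then show ?thesis using Suc.IH by (simp only:)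
    qed
    then show ?case by (simp only: vanish_order.simps mem_Collect_eq hvalue_mult v mult_zero_left) blast
  qed
  show ?thesis
  proof (rule vanish_order_all_imp_0)
    show "a \<in> vanish_order k" for k using *[of 1 k] by (simp only: mult_1_right)
  qed
qed

text \<open>If \<open>a = b * c\<close> with two nonunits, then \<open>c\<close> contributes at
  least one to the order, so the order of \<open>b\<close> obeys a smaller bound and the search
  ends.\<close>

lemma irreducible_factor_exists:
  fixes a :: "'n::finite hgerm"
  assumes "a \<noteq> 0" "\<not> a dvd 1" shows "\<exists>c. irreducible c \<and> c dvd a"
proof -
  obtain k where "a \<notin> vanish_order k" using assms(1) vanish_order_exact by blast
  with assms show ?thesis
  proof (induction k arbitrary: a)
    case 0
    then show ?case by simp
  next
    case (Suc k)
    show ?case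
    proof (cases "irreducible a")
      case True
      then show ?thesis using dvd_refl by blast
    next
      case False
      then obtain b c where bc: "a = b * c" "\<not> b dvd 1" "\<not> c dvd 1"
        using Suc.prems(1,2) unfolding irreducible_def by blast
      have "b \<notin> vanish_order k"
      proof
        assume "b \<in> vanish_order k"
        then have "b * c \<in> vanish_order (k + 1)"
          using bc(3) by (intro vanish_order_mult) (simp_all only: vanish_order_1 not_False_eq_True)
        with Suc.prems(3) bc(1) show False by simp
      qed
      moreover have "b \<noteq> 0" using bc(1) Suc.prems(1) by auto
      ultimately obtain d where "irreducible d" "d dvd b" using Suc.IH bc(2) by blast
      with bc show ?thesis by (metis dvd_mult2)
    qed
  qed
qed

section \<open>Division by germs and slices along a line\<close>

text \<open>The zeros of \<open>\<alpha>\<close> are isolated because \<open>\<alpha>\<close> is not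
  identically zero on the disc, and the bound keeps the quotient bounded near each of them;
  Riemann's theorem removes the singularities.\<close>

lemma removable_quotient:
  fixes \<alpha> \<beta> :: "complex \<Rightarrow> complex"
  assumes hol: "\<alpha> holomorphic_on ball 0 s" "\<beta> holomorphic_on ball 0 s"
    and bd: "\<And>t. t \<in> ball 0 s \<Longrightarrow> norm (\<beta> t) \<le> C * norm (\<alpha> t)"
    and nz: "t1 \<in> ball 0 s" "\<alpha> t1 \<noteq> 0"
  obtains \<gamma> where "\<gamma> holomorphic_on ball 0 s" "\<And>t. t \<in> ball 0 s \<Longrightarrow> \<beta> t = \<alpha> t * \<gamma> t"
proof
  define \<gamma> where "\<gamma> t = (if \<alpha> t \<noteq> 0 then \<beta> t / \<alpha> t else Lim (at t) (\<lambda>w. \<beta> w / \<alpha> w))" for t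
  \<comment> \<open>Where \<open>\<alpha>\<close> vanishes the bound forces
    \<open>\<beta> t = 0\<close>, so the product is right whatever value \<open>\<gamma>\<close>
    takes there.\<close>
  show "\<beta> t = \<alpha> t * \<gamma> t" if "t \<in> ball 0 s" for t
    using bd[OF that] by (auto simp: \<gamma>_def)
  have "\<gamma> field_differentiable at t" if t: "t \<in> ball 0 s" for t
  proof -
    have "\<forall>\<^sub>F w in at t. \<alpha> w \<noteq> 0 \<and> w \<in> ball 0 s"
      by (rule non_zero_neighbour_alt[OF hol(1)]) (use t nz in auto)
    then obtain d where d: "d > 0" "\<And>w. w \<noteq> t \<Longrightarrow> dist w t < d \<Longrightarrow> \<alpha> w \<noteq> 0 \<and> w \<in> ball 0 s"
      unfolding eventually_at by auto
    have sub: "ball t d - {t} \<subseteq> ball 0 s" "\<forall>w\<in>ball t d - {t}. \<alpha> w \<noteq> 0"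
      using d(2) by (metis DiffD1 DiffD2 dist_commute insertI1 mem_ball subsetI, metis DiffD1 DiffD2 dist_commute insertI1 mem_ball)
    have h: "(\<lambda>w. \<beta> w / \<alpha> w) holomorphic_on ball t d - {t}"
      using hol sub by (intro holomorphic_on_divide) (auto intro: holomorphic_on_subset)
    have "\<forall>\<^sub>F w in at t. norm (\<beta> w / \<alpha> w) \<le> C"
      unfolding eventually_at
    proof (intro exI[of _ d] conjI ballI impI d(1))
      fix w assume "w \<noteq> t \<and> dist w t < d"
      then have "\<alpha> w \<noteq> 0" "norm (\<beta> w) \<le> C * norm (\<alpha> w)" using d(2)[of w] bd[of w] by auto
      then show "norm (\<beta> w / \<alpha> w) \<le> C" by (simp add: norm_divide divide_le_eq)
    qed
    then obtain g where g: "g holomorphic_on ball t d" "\<And>w. w \<in> ball t d - {t} \<Longrightarrow> g w = \<beta> w / \<alpha> w"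
      using holomorphic_on_extend_bounded[OF h, of] d(1) by auto
    have "isCont g t"
      using g(1) d(1) by (metis centre_in_ball continuous_on_interior holomorphic_on_imp_continuous_on interior_open open_ball)
    then have "(g \<longlongrightarrow> g t) (at t)" by (simp add: isCont_def)
    then have "((\<lambda>w. \<beta> w / \<alpha> w) \<longlongrightarrow> g t) (at t)"
    proof (rule Lim_transform_eventually)
      show "\<forall>\<^sub>F w in at t. g w = \<beta> w / \<alpha> w"
        unfolding eventually_at using g(2) d(1) by (intro exI[of _ d]) (auto simp: dist_commute)
    qed
    then have L: "Lim (at t) (\<lambda>w. \<beta> w / \<alpha> w) = g t" by (intro tendsto_Lim) auto
    have "g w = \<gamma> w" if "w \<in> ball t d" for w
    proof (cases "w = t")
      case True
      show ?thesis
      proof (cases "\<alpha> t = 0")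
        case False
        have "isCont \<alpha> t" "isCont \<beta> t"
          using hol t by (metis continuous_on_interior holomorphic_on_imp_continuous_on interior_open open_ball)+
        then have "((\<lambda>w. \<beta> w / \<alpha> w) \<longlongrightarrow> \<beta> t / \<alpha> t) (at t)"
          using False by (intro tendsto_divide) (auto simp: isCont_def)
        then have "Lim (at t) (\<lambda>w. \<beta> w / \<alpha> w) = \<beta> t / \<alpha> t" by (intro tendsto_Lim) auto
        with True L False show ?thesis by (simp add: \<gamma>_def)
      qed (use True L in \<open>simp add: \<gamma>_def\<close>)
    next
      case False
      with that g(2)[of w] sub show ?thesis by (auto simp: \<gamma>_def)
    qed
    then have "\<gamma> holomorphic_on ball t d" using g(1) holomorphic_transform by blast
    then show ?thesis using d(1) by (simp add: holomorphic_on_imp_differentiable_at)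
  qed
  then show "\<gamma> holomorphic_on ball 0 s"
    by (simp add: field_differentiable_at_within holomorphic_on_def)
qed

text \<open>This is Weierstrass regularity in the direction \<open>v\<close>, phrased without its
  order. Excluding \<open>t = 0\<close> admits units and nonunits alike.\<close>

definition regular_along :: "complex^'n \<Rightarrow> 'n::finite hgerm \<Rightarrow> bool" where
  "regular_along v a \<longleftrightarrow> (\<exists>\<delta>>0. \<forall>t. t \<noteq> 0 \<longrightarrow> norm t < \<delta> \<longrightarrow> rep_hgerm a (t *s v) \<noteq> 0)"

lemma holo_on_near: "holo_on F {z. holo_near z F}"
  unfolding holo_on_def holo_near_def by (auto intro: centre_in_ball[THEN iffD2])

lemma holomorphic_on_line:
  assumes "\<And>t. t \<in> S \<Longrightarrow> holo_near (z + t *s v) F"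
  shows "(\<lambda>t. F (z + t *s v)) holomorphic_on S"
  by (rule holo_on_compose_line[OF holo_on_near]) (use assms in simp)

lemma rep_ball:
  fixes P :: "complex^'n::finite \<Rightarrow> bool" and a :: "'n hgerm"
  assumes "\<forall>\<^sub>F z in nhds 0. P z"
  obtains R where "R > 0" "\<And>z. norm z < R \<Longrightarrow> P z" "\<And>z. norm z < R \<Longrightarrow> holo_near z (rep_hgerm a)"
proof -
  have "\<forall>\<^sub>F z in nhds 0. P z \<and> holo_near z (rep_hgerm a)"
    using assms holo_near_eventually[OF holo_near_rep0] by eventually_elim auto
  then show ?thesis using that unfolding eventually_nhds_metric by (auto simp: dist_norm)
qed

lemma regular_along_exists:
  fixes a :: "'n::finite hgerm"
  assumes "a \<noteq> 0" obtains v i where "v $ i = 1" "regular_along v a"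
proof -
  obtain R where R: "R > 0" "\<And>z. norm z < R \<Longrightarrow> holo_near z (rep_hgerm a)"
    using rep_ball[of "\<lambda>_. True" a] by auto
  have "\<exists>w. norm w < R \<and> rep_hgerm a w \<noteq> 0"
  proof (rule ccontr)
    assume "\<not> ?thesis"
    then have "\<forall>\<^sub>F z in nhds 0. rep_hgerm a z = 0"
      unfolding eventually_nhds_metric using R(1) by (intro exI[of _ R]) (auto simp: dist_norm)
    then have "a = 0"
      unfolding hgerm_eq_iff[of a 0 0] using rep_eventually0(4) by eventually_elim simp
    with assms show False by simp
  qed
  then obtain w where w: "norm w < R" "rep_hgerm a w \<noteq> 0" by blast
  \<comment> \<open>Scaling one coordinate of the direction to 1 makes \<open>z - z $ i *s v\<close>
    a projection along \<open>v\<close>. If the nonzero value occurs at the origin itself, any axis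
    serves as direction.\<close>
  have "\<exists>v i \<beta>. v $ i = 1 \<and> w = \<beta> *s v"
  proof (cases "w = 0")
    case True
    then show ?thesis by (intro exI[of _ "axis undefined 1"] exI[of _ undefined] exI[of _ 0]) (auto simp: axis_def)
  next
    case False
    then obtain i where "w $ i \<noteq> 0" by (auto simp: vec_eq_iff)
    then show ?thesis
      by (intro exI[of _ "inverse (w $ i) *s w"] exI[of _ i] exI[of _ "w $ i"]) (simp add: vector_smult_assoc)
  qed
  then obtain v i \<beta> where v: "v $ i = 1" "w = \<beta> *s v" by blast
  then have nv: "norm v > 0" by auto
  have "\<forall>\<^sub>F t in at 0. rep_hgerm a (0 + t *s v) \<noteq> 0 \<and> t \<in> ball 0 (R / norm v)"
  proof (rule non_zero_neighbour_alt)
    show "(\<lambda>t. rep_hgerm a (0 + t *s v)) holomorphic_on ball 0 (R / norm v)"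
      by (rule holomorphic_on_line) (use R nv in \<open>simp add: norm_vector_scale field_simps\<close>)
    show "\<beta> \<in> ball 0 (R / norm v)" using w v nv by (simp add: norm_vector_scale field_simps)
  qed (use w v R nv in auto)
  then have "regular_along v a"
    unfolding regular_along_def eventually_at by auto
  with v that show ?thesis by blast
qed

text \<open>Uniform continuity on a compact ball transfers estimates on the line through the origin
  to all nearby parallel lines at once.\<close>

lemma line_uniform:
  fixes A :: "complex^'n \<Rightarrow> complex"
  assumes "continuous_on (ball 0 R) A" "compact T" "\<And>t. t \<in> T \<Longrightarrow> t *s v \<in> ball 0 R" "\<mu> > 0" "R > 0"
  obtains \<epsilon> where "\<epsilon> > 0"
    "\<And>z t. norm z < \<epsilon> \<Longrightarrow> t \<in> T \<Longrightarrow> z + t *s v \<in> ball 0 R \<and> norm (A (z + t *s v) - A (t *s v)) < \<mu>"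
proof -
  have c: "continuous_on T (\<lambda>t. t *s v)"
    by (intro bounded_linear.continuous_on[OF bounded_linear_scale_vec] continuous_on_id)
  obtain R' where R': "R' < R" "R' > 0" "\<And>t. t \<in> T \<Longrightarrow> norm (t *s v) \<le> R'"
  proof (cases "T = {}")
    case True
    then show ?thesis using that[of "R / 2"] assms(5) by auto
  next
    case False
    have "continuous_on T (\<lambda>t. norm (t *s v))" using c by (rule continuous_on_norm)
    from continuous_attains_sup[OF assms(2) False this]
    obtain t where "t \<in> T" "\<And>s. s \<in> T \<Longrightarrow> norm (s *s v) \<le> norm (t *s v)" by blast
    moreover have "norm (t *s v) < R" using assms(3) \<open>t \<in> T\<close> by auto
    ultimately show ?thesis using that[of "max (R / 2) (norm (t *s v))"] assms(5) by fastforce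
  qed
  \<comment> \<open>The radius lies midway between \<open>R'\<close>, which bounds the points of the
    central line, and \<open>R\<close>; the base point may therefore move by
    \<open>(R - R') / 2\<close>.\<close>
  define K where "K = cball (0 :: complex^'n) ((R + R') / 2)"
  have "K \<subseteq> ball 0 R" using R' by (auto simp: K_def)
  then have "uniformly_continuous_on K A"
    using assms(1) by (intro compact_uniformly_continuous) (auto simp: K_def intro: continuous_on_subset)
  then obtain d where d: "d > 0" "\<And>x y. x \<in> K \<Longrightarrow> y \<in> K \<Longrightarrow> dist y x < d \<Longrightarrow> dist (A y) (A x) < \<mu>"
    unfolding uniformly_continuous_on_def using assms(4) by metis
  show ?thesis
  proof (rule that[of "min d ((R - R') / 2)"])
    fix z :: "complex^'n" and t assume zt: "norm z < min d ((R - R') / 2)" "t \<in> T"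
    have 1: "norm (t *s v) \<le> R'" using R' zt by auto
    have "norm (z + t *s v) \<le> (R - R') / 2 + R'"
      using norm_triangle_ineq[of z "t *s v"] 1 zt(1) by (simp add: field_simps)
    then have "z + t *s v \<in> K" "t *s v \<in> K" using 1 R' by (auto simp: K_def field_simps)
    with d(2)[of "t *s v" "z + t *s v"] zt \<open>K \<subseteq> _\<close>
    show "z + t *s v \<in> ball 0 R \<and> norm (A (z + t *s v) - A (t *s v)) < \<mu>"
      by (auto simp: dist_norm)
  qed (use d R' in auto)
qed

text \<open>This is the setting for all slice arguments: on every slice near the origin,
  \<open>a\<close> stays uniformly away from zero on the circle of radius \<open>\<rho>\<close>. The
  radius \<open>2 * \<rho>\<close> leaves an open disc around the closed one, as Cauchy's formula
  and the maximum principle require.\<close>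

lemma regular_polydisc:
  fixes a :: "'n::finite hgerm"
  assumes "regular_along v a" "\<forall>\<^sub>F z in nhds 0. P z"
  obtains \<rho> \<epsilon> \<mu> where "\<rho> > 0" "\<epsilon> > 0" "\<mu> > 0"
    "\<And>z t. norm z < \<epsilon> \<Longrightarrow> norm t \<le> 2 * \<rho> \<Longrightarrow> P (z + t *s v)"
    "\<And>z t. norm z < \<epsilon> \<Longrightarrow> norm t \<le> 2 * \<rho> \<Longrightarrow> holo_near (z + t *s v) (rep_hgerm a)"
    "\<And>z t. norm z < \<epsilon> \<Longrightarrow> norm t = \<rho> \<Longrightarrow> \<mu> \<le> norm (rep_hgerm a (z + t *s v))"
proof -
  obtain R where R: "R > 0" "\<And>z. norm z < R \<Longrightarrow> P z" "\<And>z. norm z < R \<Longrightarrow> holo_near z (rep_hgerm a)"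
    using rep_ball[OF assms(2)] by blast
  obtain \<delta> where \<delta>: "\<delta> > 0" "\<And>t. t \<noteq> 0 \<Longrightarrow> norm t < \<delta> \<Longrightarrow> rep_hgerm a (t *s v) \<noteq> 0"
    using assms(1) unfolding regular_along_def by blast
  \<comment> \<open>Below \<open>\<delta>\<close>, the circle contains no zero on the central line;
    the second bound keeps \<open>2 * \<rho> * norm v\<close> under \<open>R / 2\<close>, leaving
    the other half of \<open>R\<close> to the base point. Adding 1 to \<open>norm v\<close> keeps
    the quotient meaningful for every \<open>v\<close>.\<close>
  define \<rho> where "\<rho> = min (\<delta> / 2) (R / (4 * (norm v + 1)))"
  have nv: "norm v + 1 > 0" by (simp add: add_nonneg_pos)
  have \<rho>: "\<rho> > 0" "\<rho> < \<delta>" using \<delta>(1) R(1) nv by (auto simp: \<rho>_def)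
  have "\<rho> * (4 * (norm v + 1)) \<le> R"
    using nv by (simp add: \<rho>_def pos_le_divide_eq[symmetric])
  then have \<rho>R: "2 * \<rho> * norm v < R / 2" using \<rho>(1) by (simp add: algebra_simps)
  have small: "norm (t *s v) < R / 2" if "norm t \<le> 2 * \<rho>" for t
    using mult_right_mono[OF that, of "norm v"] \<rho>R by (simp add: norm_vector_scale)
  have cont: "continuous_on (ball 0 R) (rep_hgerm a)"
    by (rule continuous_on_subset[OF holo_on_continuous[OF holo_on_near]]) (use R in auto)
  have c: "continuous_on (sphere 0 \<rho>) (\<lambda>t. norm (rep_hgerm a (t *s v)))"
  proof (intro continuous_on_norm continuous_on_compose2[OF cont])
    show "continuous_on (sphere 0 \<rho>) (\<lambda>t. t *s v)"
      by (intro bounded_linear.continuous_on[OF bounded_linear_scale_vec] continuous_on_id)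
    show "(\<lambda>t. t *s v) ` sphere 0 \<rho> \<subseteq> ball 0 R"
    proof
      fix x assume "x \<in> (\<lambda>t. t *s v) ` sphere 0 \<rho>"
      then obtain t where "x = t *s v" "t \<in> sphere 0 \<rho>" by blast
      with small[of t] \<rho>(1) R(1) show "x \<in> ball 0 R" by simp
    qed
  qed
  have ne: "sphere (0::complex) \<rho> \<noteq> {}" using \<rho>(1) by (simp add: sphere_eq_empty)
  from continuous_attains_inf[OF compact_sphere ne c]
  obtain t0 where t0: "t0 \<in> sphere 0 \<rho>" "\<And>t. t \<in> sphere 0 \<rho> \<Longrightarrow> norm (rep_hgerm a (t0 *s v)) \<le> norm (rep_hgerm a (t *s v))"
    by blast
  \<comment> \<open>Half of the minimum on the central circle: the other half absorbs the variation
    between neighbouring slices.\<close>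
  define \<mu> where "\<mu> = norm (rep_hgerm a (t0 *s v)) / 2"
  have \<mu>: "\<mu> > 0" using \<delta>(2)[of t0] t0(1) \<rho> by (auto simp: \<mu>_def)
  obtain \<epsilon> where \<epsilon>: "\<epsilon> > 0" "\<And>z t. norm z < \<epsilon> \<Longrightarrow> t \<in> sphere 0 \<rho> \<Longrightarrow>
      norm (rep_hgerm a (z + t *s v) - rep_hgerm a (t *s v)) < \<mu>"
  proof (rule line_uniform[OF cont compact_sphere _ \<mu> R(1)])
    show "t *s v \<in> ball 0 R" if "t \<in> sphere 0 \<rho>" for t using small[of t] \<rho>(1) R(1) that by simp
  qed blast
  have in_R: "norm (z + t *s v) < R" if "norm z < min \<epsilon> (R / 2)" "norm t \<le> 2 * \<rho>" for z t
    using norm_triangle_ineq[of z "t *s v"] small[OF that(2)] that(1) by simp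
  show ?thesis
  proof (rule that[of \<rho> "min \<epsilon> (R / 2)" \<mu>])
    fix z :: "complex^'n" and t :: complex assume z: "norm z < min \<epsilon> (R / 2)" and t: "norm t = \<rho>"
    have "norm (rep_hgerm a (z + t *s v) - rep_hgerm a (t *s v)) < \<mu>" using \<epsilon>(2)[of z t] z t by simp
    moreover have "2 * \<mu> \<le> norm (rep_hgerm a (t *s v))" using t0(2)[of t] t by (simp add: \<mu>_def)
    ultimately show "\<mu> \<le> norm (rep_hgerm a (z + t *s v))"
      using norm_triangle_ineq2[of "rep_hgerm a (t *s v)" "rep_hgerm a (z + t *s v)"]
      by (simp add: norm_minus_commute)
  qed (use \<rho> \<epsilon> \<mu> R in_R in auto)
qed

text \<open>Riemann extension: the quotient is recovered from a Cauchy integral over a circle on which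
  the denominator has no zero.\<close>

lemma dvd_if_bounded:
  fixes a b :: "'n::finite hgerm"
  assumes "a \<noteq> 0" "\<forall>\<^sub>F z in nhds 0. norm (rep_hgerm b z) \<le> C * norm (rep_hgerm a z)"
  shows "a dvd b"
proof -
  obtain v i where v: "v $ i = 1" "regular_along v a" using regular_along_exists[OF assms(1)] .
  have "\<forall>\<^sub>F z in nhds 0. norm (rep_hgerm b z) \<le> C * norm (rep_hgerm a z) \<and> holo_near z (rep_hgerm b)"
    using assms(2) holo_near_eventually[OF holo_near_rep0] by eventually_elim auto
  from regular_polydisc[OF v(2) this]
  obtain \<rho> \<epsilon> \<mu> where p: "\<rho> > 0" "\<epsilon> > 0" "\<mu> > 0" 
    and P: "\<And>z t. norm z < \<epsilon> \<Longrightarrow> norm t \<le> 2 * \<rho> \<Longrightarrow>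
        norm (rep_hgerm b (z + t *s v)) \<le> C * norm (rep_hgerm a (z + t *s v)) \<and> holo_near (z + t *s v) (rep_hgerm b)"
    and ha: "\<And>z t. norm z < \<epsilon> \<Longrightarrow> norm t \<le> 2 * \<rho> \<Longrightarrow> holo_near (z + t *s v) (rep_hgerm a)"
    and \<mu>: "\<And>z t. norm z < \<epsilon> \<Longrightarrow> norm t = \<rho> \<Longrightarrow> \<mu> \<le> norm (rep_hgerm a (z + t *s v))"
    by blast
  have nz: "rep_hgerm a (z + t *s v) \<noteq> 0" if "norm z < \<epsilon>" "norm t = \<rho>" for z t
    using \<mu>[OF that] p(3) by auto
  let ?f = "\<lambda>z \<zeta>. rep_hgerm b (z + \<zeta> *s v) / rep_hgerm a (z + \<zeta> *s v) / \<zeta>"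
  \<comment> \<open>Cauchy's formula for the quotient at the centre of the slice. Only points of the
    circle enter, where the denominator has no zero, so the integral is holomorphic in
    \<open>z\<close> although the quotient is undefined at zeros of \<open>a\<close>.\<close>
  define H where "H z = 1 / (2 * pi * \<i>) * contour_integral (circlepath 0 \<rho>) (?f z)" for z
  have hH: "holo_on H (ball 0 \<epsilon>)"
    unfolding H_def
  proof (intro holo_on_mult[OF holo_on_const] holo_on_contour_integral)
    show "holo_on (\<lambda>z. ?f z \<zeta>) (ball 0 \<epsilon>)" if \<zeta>: "norm \<zeta> = \<rho>" for \<zeta>
    proof (intro holo_on_divide)
      have "holo_on (\<lambda>z. F (z + \<zeta> *s v)) (ball 0 \<epsilon>)" if "\<And>z. norm z < \<epsilon> \<Longrightarrow> holo_near (z + \<zeta> *s v) F"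
        for F :: "complex^'n \<Rightarrow> complex"
        using holo_on_subset[OF holo_on_shift[OF holo_on_near[of F], of "\<zeta> *s v"], of "ball 0 \<epsilon>"] that
        by (simp add: add.commute[of "\<zeta> *s v"] subset_eq)
      then show "holo_on (\<lambda>z. rep_hgerm b (z + \<zeta> *s v)) (ball 0 \<epsilon>)"
        "holo_on (\<lambda>z. rep_hgerm a (z + \<zeta> *s v)) (ball 0 \<epsilon>)"
        using P ha \<zeta> p(1) by auto
    qed (use nz \<zeta> p(1) in \<open>auto intro: holo_on_const\<close>)
    have m: "continuous_on (ball 0 \<epsilon> \<times> sphere 0 \<rho>) (\<lambda>x. fst x + snd x *s v)"
      by (intro continuous_intros bounded_linear.continuous_on[OF bounded_linear_scale_vec])
    have "continuous_on (ball 0 \<epsilon> \<times> sphere 0 \<rho>) (\<lambda>x. F (fst x + snd x *s v))"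
      if "\<And>z t. norm z < \<epsilon> \<Longrightarrow> norm t = \<rho> \<Longrightarrow> holo_near (z + t *s v) F" for F :: "complex^'n \<Rightarrow> complex"
      by (rule continuous_on_compose2[OF holo_on_continuous[OF holo_on_near] m]) (use that in auto)
    then have "continuous_on (ball 0 \<epsilon> \<times> sphere 0 \<rho>) (\<lambda>x. rep_hgerm b (fst x + snd x *s v))"
      "continuous_on (ball 0 \<epsilon> \<times> sphere 0 \<rho>) (\<lambda>x. rep_hgerm a (fst x + snd x *s v))"
      using P ha p(1) by auto
    then show "continuous_on (ball 0 \<epsilon> \<times> sphere 0 \<rho>) (\<lambda>(z, \<zeta>). ?f z \<zeta>)"
      unfolding case_prod_unfold
      by (intro continuous_on_divide continuous_intros) (use nz p(1) in auto)
  qed (use p in auto)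
  have eq: "rep_hgerm b z = rep_hgerm a z * H z" if z: "norm z < \<epsilon>" for z
  proof -
    \<comment> \<open>On a fixed slice the bound lets the quotient extend to a holomorphic
      \<open>\<gamma>\<close>, and Cauchy's formula identifies \<open>H z\<close> with
      \<open>\<gamma> 0\<close>.\<close>
    define \<alpha> \<beta> where "\<alpha> t = rep_hgerm a (z + t *s v)" and "\<beta> t = rep_hgerm b (z + t *s v)" for t
    have "\<alpha> holomorphic_on ball 0 (2 * \<rho>)" "\<beta> holomorphic_on ball 0 (2 * \<rho>)"
      unfolding \<alpha>_def \<beta>_def using P ha z by (auto intro!: holomorphic_on_line)
    moreover have "norm (\<beta> t) \<le> C * norm (\<alpha> t)" if "t \<in> ball 0 (2 * \<rho>)" for t
      using P[OF z, of t] that by (simp add: \<alpha>_def \<beta>_def)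
    ultimately obtain \<gamma> where \<gamma>: "\<gamma> holomorphic_on ball 0 (2 * \<rho>)" "\<And>t. t \<in> ball 0 (2 * \<rho>) \<Longrightarrow> \<beta> t = \<alpha> t * \<gamma> t"
      by (rule removable_quotient[where ?t1.0 = "of_real \<rho>"]) (use nz[OF z, of "of_real \<rho>"] p(1) in \<open>auto simp: \<alpha>_def\<close>)
    have "\<gamma> holomorphic_on cball 0 \<rho>" using \<gamma>(1) p(1) by (auto intro: holomorphic_on_subset)
    from Cauchy_integral_circlepath_simple[OF this, of 0] p(1)
    have "contour_integral (circlepath 0 \<rho>) (\<lambda>u. \<gamma> u / u) = 2 * pi * \<i> * \<gamma> 0"
      by (intro contour_integral_unique) simp
    moreover have "contour_integral (circlepath 0 \<rho>) (?f z) = contour_integral (circlepath 0 \<rho>) (\<lambda>u. \<gamma> u / u)"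
    proof (rule contour_integral_eq)
      fix u assume "u \<in> path_image (circlepath 0 \<rho>)"
      then have "norm u = \<rho>" using p(1) by simp
      then show "?f z u = \<gamma> u / u" using \<gamma>(2)[of u] nz[OF z, of u] p(1) by (simp add: \<alpha>_def \<beta>_def)
    qed
    ultimately have "H z = \<gamma> 0" by (simp add: H_def)
    then show ?thesis using \<gamma>(2)[of 0] p(1) by (simp add: \<alpha>_def \<beta>_def)
  qed
  have nH: "holo_near 0 H" using hH p(2) by (auto simp: holo_near_def)
  have "germ_at 0 (rep_hgerm b) = germ_at 0 (\<lambda>z. rep_hgerm a z * H z)"
    by (rule germ_at_eqI[OF holo_near_rep0])
      (use eq p(2) in \<open>auto simp: eventually_nhds_metric dist_norm\<close>)
  then have "b = a * germ_at 0 H"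
    using germ_at_rep[of 0 a] germ_at_rep[of 0 b] by (simp add: germ_at_mult holo_near_rep0 nH)
  then show ?thesis by simp
qed

text \<open>Germs that are constant along the lines parallel to \<open>v\<close>; it is assumed that \<open>v $ i = 1\<close>, so
  that \<open>z - z $ i *s v\<close> is the projection along \<open>v\<close> to the hyperplane \<open>z $ i = 0\<close>.\<close>

definition const_along :: "complex^'n \<Rightarrow> 'n \<Rightarrow> 'n::finite hgerm set" where
  "const_along v i = {g. \<forall>\<^sub>F z in nhds 0. rep_hgerm g z = rep_hgerm g (z - z $ i *s v)}"

lemma filterlim_proj: "filterlim (\<lambda>z::complex^'n. z - z $ i *s v) (nhds 0) (nhds 0)"
proof -
  have "bounded_linear (\<lambda>z::complex^'n. z $ i *s v)"
    by (rule bounded_linear_compose[OF bounded_linear_scale_vec bounded_linear_vec_nth])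
  then have "isCont (\<lambda>z::complex^'n. z - z $ i *s v) 0"
    by (intro continuous_intros bounded_linear.isCont[of "\<lambda>z. z $ i *s v"])
  then show ?thesis
    using tendsto_at_iff_tendsto_nhds[of "\<lambda>z::complex^'n. z - z $ i *s v" 0] by (simp add: isCont_def)
qed

lemma const_along_binop:
  assumes op: "\<And>a b. \<forall>\<^sub>F z in nhds 0. rep_hgerm (f a b) z = g (rep_hgerm a z) (rep_hgerm b z)"
    and "a \<in> const_along v i" "b \<in> const_along v i"
  shows "f a b \<in> const_along v i"
proof -
  have "\<forall>\<^sub>F z in nhds 0. rep_hgerm (f a b) (z - z $ i *s v)
      = g (rep_hgerm a (z - z $ i *s v)) (rep_hgerm b (z - z $ i *s v))"
    by (rule eventually_compose_filterlim[OF op filterlim_proj])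
  with op[of a b] assms(2,3) show ?thesis
    unfolding const_along_def mem_Collect_eq by eventually_elim simp
qed

lemma const_along_mult: "a \<in> const_along v i \<Longrightarrow> b \<in> const_along v i \<Longrightarrow> a * b \<in> const_along v i"
  by (rule const_along_binop[where f = "(*)" and g = "(*)", OF rep_eventually0(1)])

lemma const_along_diff: "a \<in> const_along v i \<Longrightarrow> b \<in> const_along v i \<Longrightarrow> a - b \<in> const_along v i"
  by (rule const_along_binop[where f = "(-)" and g = "(-)", OF rep_eventually0(3)])

lemma const_along_0: "0 \<in> const_along v i"
  unfolding const_along_def mem_Collect_eq
  using rep_eventually0(4) eventually_compose_filterlim[OF rep_eventually0(4) filterlim_proj]
  by eventually_elim simp

text \<open>On the slice through \<open>z\<close> parallel to \<open>v\<close>, the cofactor of \<open>a\<close> is bounded by a multiple of \<open>r\<close>,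
  by the maximum principle, hence divisible by \<open>r\<close>.\<close>

lemma regular_cancel_const_along:
  fixes a r c :: "'n::finite hgerm"
  assumes "v $ i = 1" "regular_along v a" "r \<in> const_along v i" "r \<noteq> 0" "a dvd r * c"
  shows "a dvd c"
proof -
  obtain s where s: "r * c = a * s" using assms(5) by (rule dvdE)
  have "isCont (rep_hgerm c) 0" by (rule holo_near_continuous[OF holo_near_rep0])
  then have "(rep_hgerm c \<longlongrightarrow> rep_hgerm c 0) (nhds 0)"
    using tendsto_at_iff_tendsto_nhds[of "rep_hgerm c" 0] by (simp add: isCont_def)
  from tendstoD[OF this, of 1]
  have "\<forall>\<^sub>F z in nhds 0. dist (rep_hgerm c z) (rep_hgerm c 0) < 1" by simp
  then have "\<forall>\<^sub>F z in nhds 0. norm (rep_hgerm c z) \<le> norm (rep_hgerm c 0) + 1"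
  proof eventually_elim
    case (elim z)
    then show ?case using norm_triangle_ineq2[of "rep_hgerm c z" "rep_hgerm c 0"] by (simp add: dist_norm)
  qed
  moreover have "\<forall>\<^sub>F z in nhds 0. rep_hgerm r z * rep_hgerm c z = rep_hgerm a z * rep_hgerm s z"
    using rep_eventually0(1)[of r c] rep_eventually0(1)[of a s] by eventually_elim (simp add: s)
  moreover have "\<forall>\<^sub>F z in nhds 0. rep_hgerm r z = rep_hgerm r (z - z $ i *s v)"
    using assms(3) by (simp add: const_along_def)
  moreover have "\<forall>\<^sub>F z in nhds 0. holo_near z (rep_hgerm s)"
    by (rule holo_near_eventually[OF holo_near_rep0])
  ultimately have ev: "\<forall>\<^sub>F z in nhds 0. norm (rep_hgerm c z) \<le> norm (rep_hgerm c 0) + 1 \<and>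
      rep_hgerm r z * rep_hgerm c z = rep_hgerm a z * rep_hgerm s z \<and>
      rep_hgerm r z = rep_hgerm r (z - z $ i *s v) \<and> holo_near z (rep_hgerm s)" (is "\<forall>\<^sub>F z in _. ?P z")
    by eventually_elim blast
  obtain \<rho> \<epsilon> \<mu> where p: "\<rho> > 0" "\<epsilon> > 0" "\<mu> > 0" 
    and P: "\<And>z t. norm z < \<epsilon> \<Longrightarrow> norm t \<le> 2 * \<rho> \<Longrightarrow> ?P (z + t *s v)"
    and "\<And>z t. norm z < \<epsilon> \<Longrightarrow> norm t \<le> 2 * \<rho> \<Longrightarrow> holo_near (z + t *s v) (rep_hgerm a)"
    and \<mu>: "\<And>z t. norm z < \<epsilon> \<Longrightarrow> norm t = \<rho> \<Longrightarrow> \<mu> \<le> norm (rep_hgerm a (z + t *s v))"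
    by (rule regular_polydisc[OF assms(2) ev]) (rule that; assumption)
  \<comment> \<open>This bounds \<open>c\<close> near the origin. Since
    \<open>a * s = r * c\<close>, with \<open>a\<close> at least \<open>\<mu>\<close> in modulus on
    the circle and \<open>r\<close> constant on the slice, the bound for \<open>s\<close> there is
    \<open>M / \<mu>\<close> times the modulus of \<open>r\<close>.\<close>
  define M where "M = norm (rep_hgerm c 0) + 1"
  have "norm (rep_hgerm s z) \<le> M / \<mu> * norm (rep_hgerm r z)" if z: "norm z < \<epsilon>" for z
  proof -
    have r: "rep_hgerm r (z + t *s v) = rep_hgerm r z" if "norm t \<le> 2 * \<rho>" for t
    proof -
      have "(z + t *s v) - (z + t *s v) $ i *s v = z - z $ i *s v"
        using assms(1) by (simp add: vec_eq_iff algebra_simps)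
      moreover have "rep_hgerm r (z + t *s v) = rep_hgerm r ((z + t *s v) - (z + t *s v) $ i *s v)"
        using P[OF z that] by blast
      moreover have "rep_hgerm r z = rep_hgerm r (z - z $ i *s v)"
        using P[OF z, of 0] p(1) by simp
      ultimately show ?thesis by (simp only:)
    qed
    have hs: "(\<lambda>t. rep_hgerm s (z + t *s v)) holomorphic_on cball 0 \<rho>"
      using P z p(1) by (intro holomorphic_on_line) auto
    have "norm (rep_hgerm s (z + 0 *s v)) \<le> M / \<mu> * norm (rep_hgerm r z)"
    proof (rule maximum_modulus_frontier[where S = "ball 0 \<rho>" and f = "\<lambda>t. rep_hgerm s (z + t *s v)"])
      show "(\<lambda>t. rep_hgerm s (z + t *s v)) holomorphic_on interior (ball 0 \<rho>)"
        using hs by (rule holomorphic_on_subset) auto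
      show "continuous_on (closure (ball 0 \<rho>)) (\<lambda>t. rep_hgerm s (z + t *s v))"
        using holomorphic_on_imp_continuous_on[OF hs] p(1) by simp
      fix t assume "t \<in> frontier (ball (0::complex) \<rho>)"
      then have t: "norm t = \<rho>" "norm t \<le> 2 * \<rho>" using p(1) by (auto simp: frontier_ball)
      have "\<mu> * norm (rep_hgerm s (z + t *s v)) \<le> norm (rep_hgerm a (z + t *s v)) * norm (rep_hgerm s (z + t *s v))"
        using \<mu>[OF z t(1)] by (rule mult_right_mono) simp
      also have "\<dots> = norm (rep_hgerm r z) * norm (rep_hgerm c (z + t *s v))"
        using P[OF z t(2)] r[OF t(2)] by (metis norm_mult)
      also have "\<dots> \<le> norm (rep_hgerm r z) * M"
        using P[OF z t(2)] by (intro mult_left_mono) (simp_all add: M_def)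
      finally show "norm (rep_hgerm s (z + t *s v)) \<le> M / \<mu> * norm (rep_hgerm r z)"
        using p(3) by (simp add: pos_le_divide_eq mult.commute)
    qed (use p in auto)
    then show ?thesis by simp
  qed
  then have "\<forall>\<^sub>F z in nhds 0. norm (rep_hgerm s z) \<le> M / \<mu> * norm (rep_hgerm r z)"
    using p(2) by (auto simp: eventually_nhds_metric dist_norm)
  from dvd_if_bounded[OF assms(4) this] obtain k where "s = r * k" by (rule dvdE)
  with s have "r * c = r * (a * k)" by (simp only: mult.left_commute)
  with assms(4) have "c = a * k" by (metis mult_left_cancel)
  then show ?thesis by simp
qed

text \<open>A germ regular along \<open>v\<close> and vanishing at the origin has a zero on every line parallel
  to \<open>v\<close> near the origin.\<close>

lemma const_along_eq_0:
  fixes a r :: "'n::finite hgerm"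
  assumes "v $ i = 1" "regular_along v a" "\<not> a dvd 1" "r \<in> const_along v i"
    and "\<forall>\<^sub>F z in nhds 0. rep_hgerm a z = 0 \<longrightarrow> rep_hgerm r z = 0"
  shows "r = 0"
proof -
  have "\<forall>\<^sub>F z in nhds 0. rep_hgerm r z = rep_hgerm r (z - z $ i *s v)"
    using assms(4) by (simp add: const_along_def)
  with assms(5) have "\<forall>\<^sub>F z in nhds 0. (rep_hgerm a z = 0 \<longrightarrow> rep_hgerm r z = 0) \<and>
      rep_hgerm r z = rep_hgerm r (z - z $ i *s v)" (is "\<forall>\<^sub>F z in _. ?P z")
    by eventually_elim blast
  from regular_polydisc[OF assms(2) this]
  obtain \<rho> \<epsilon> \<mu> where p: "\<rho> > 0" "\<epsilon> > 0" "\<mu> > 0" 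
    and P: "\<And>z t. norm z < \<epsilon> \<Longrightarrow> norm t \<le> 2 * \<rho> \<Longrightarrow> ?P (z + t *s v)"
    and ha: "\<And>z t. norm z < \<epsilon> \<Longrightarrow> norm t \<le> 2 * \<rho> \<Longrightarrow> holo_near (z + t *s v) (rep_hgerm a)"
    and \<mu>: "\<And>z t. norm z < \<epsilon> \<Longrightarrow> norm t = \<rho> \<Longrightarrow> \<mu> \<le> norm (rep_hgerm a (z + t *s v))"
    by blast
  have "isCont (rep_hgerm a) 0" by (rule holo_near_continuous[OF holo_near_rep0])
  then have "(rep_hgerm a \<longlongrightarrow> rep_hgerm a 0) (nhds 0)"
    using tendsto_at_iff_tendsto_nhds[of "rep_hgerm a" 0] by (simp add: isCont_def)
  from tendstoD[OF this, of \<mu>] p(3)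
  have "\<forall>\<^sub>F z in nhds 0. dist (rep_hgerm a z) (rep_hgerm a 0) < \<mu>" by simp
  moreover have "rep_hgerm a 0 = 0" using assms(3) by (simp add: hgerm_unit_iff hvalue_rep)
  ultimately have "\<forall>\<^sub>F z in nhds 0. norm (rep_hgerm a z) < \<mu>" by simp
  moreover have "\<forall>\<^sub>F z in nhds 0. norm z < \<epsilon>" using p(2) by (auto simp: eventually_nhds_metric dist_norm)
  ultimately have "\<forall>\<^sub>F z in nhds 0. rep_hgerm r z = 0"
  proof eventually_elim
    case (elim z)
    note z = elim(2)
    \<comment> \<open>Without a zero in the disc the reciprocal would be holomorphic and, by the
      maximum principle, bounded by \<open>inverse \<mu>\<close> at the centre; but \<open>a\<close>
      is smaller than \<open>\<mu>\<close> there.\<close>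
    have "\<exists>t. norm t \<le> \<rho> \<and> rep_hgerm a (z + t *s v) = 0"
    proof (rule ccontr)
      assume "\<not> ?thesis"
      then have nz: "rep_hgerm a (z + t *s v) \<noteq> 0" if "norm t \<le> \<rho>" for t using that by blast
      have ha': "(\<lambda>t. rep_hgerm a (z + t *s v)) holomorphic_on cball 0 \<rho>"
        using ha z p(1) by (intro holomorphic_on_line) auto
      then have hs: "(\<lambda>t. inverse (rep_hgerm a (z + t *s v))) holomorphic_on cball 0 \<rho>"
        using nz by (intro holomorphic_on_inverse) auto
      have "norm (inverse (rep_hgerm a (z + 0 *s v))) \<le> inverse \<mu>"
      proof (rule maximum_modulus_frontier[where S = "ball 0 \<rho>" and f = "\<lambda>t. inverse (rep_hgerm a (z + t *s v))"])
        show "(\<lambda>t. inverse (rep_hgerm a (z + t *s v))) holomorphic_on interior (ball 0 \<rho>)"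
          using hs by (rule holomorphic_on_subset) auto
        show "continuous_on (closure (ball 0 \<rho>)) (\<lambda>t. inverse (rep_hgerm a (z + t *s v)))"
          using holomorphic_on_imp_continuous_on[OF hs] p(1) by simp
        fix t assume "t \<in> frontier (ball (0::complex) \<rho>)"
        then have t: "norm t = \<rho>" using p(1) by (auto simp: frontier_ball)
        show "norm (inverse (rep_hgerm a (z + t *s v))) \<le> inverse \<mu>"
          using \<mu>[OF z t] p(3) by (simp add: norm_inverse le_imp_inverse_le)
      qed (use p in auto)
      then have "inverse (norm (rep_hgerm a z)) \<le> inverse \<mu>" by (simp add: norm_inverse)
      moreover have "norm (rep_hgerm a z) > 0" using nz[of 0] p(1) by simp
      ultimately show False using elim(1) p(3) by (meson inverse_le_imp_le not_less)
    qed
    then obtain t where t: "norm t \<le> 2 * \<rho>" "rep_hgerm a (z + t *s v) = 0" using p(1) by force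
    have "(z + t *s v) - (z + t *s v) $ i *s v = z - z $ i *s v"
      using assms(1) by (simp add: vec_eq_iff algebra_simps)
    moreover have "rep_hgerm r (z + t *s v) = rep_hgerm r ((z + t *s v) - (z + t *s v) $ i *s v)"
      "rep_hgerm r (z + t *s v) = 0"
      using P[OF z t(1)] t(2) by blast+
    moreover have "rep_hgerm r z = rep_hgerm r (z - z $ i *s v)"
      using P[OF z, of 0] p(1) by simp
    ultimately show ?case by (simp only:)
  qed
  then show ?thesis
    unfolding hgerm_eq_iff[of r 0 0] using rep_eventually0(4) by eventually_elim simp
qed

section \<open>Weierstrass preparation\<close>

lemma cauchy_transform_holomorphic:
  assumes "continuous_on (sphere 0 \<rho>) h" "\<rho> > 0"
  shows "(\<lambda>t. contour_integral (circlepath 0 \<rho>) (\<lambda>\<zeta>. h \<zeta> / (\<zeta> - t))) holomorphic_on - sphere 0 \<rho>"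
proof -
  let ?g = "\<lambda>t. contour_integral (circlepath 0 \<rho>) (\<lambda>\<zeta>. h \<zeta> / (\<zeta> - t))"
  have pi: "path_image (circlepath 0 \<rho>) = sphere 0 \<rho>" using assms(2) by simp
  have "?g field_differentiable at t" if t: "t \<in> - sphere 0 \<rho>" for t
  proof -
    have "(?g has_field_derivative (of_nat 1 * contour_integral (circlepath 0 \<rho>) (\<lambda>u. h u / (u - t) ^ Suc 1))) (at t)"
    proof (rule Cauchy_next_derivative(2)[where S = UNIV and B = "2 * pi * \<rho>"])
      fix w assume "w \<in> UNIV - path_image (circlepath 0 \<rho>)"
      then have "continuous_on (path_image (circlepath 0 \<rho>)) (\<lambda>u. h u / (u - w) ^ 1)"
        using assms unfolding pi by (intro continuous_intros) auto
      from contour_integrable_continuous_circlepath[OF this]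
      show "((\<lambda>u. h u / (u - w) ^ 1) has_contour_integral ?g w) (circlepath 0 \<rho>)"
        by (simp add: has_contour_integral_integral)
    qed (use assms t pi in \<open>auto simp: vector_derivative_circlepath norm_mult\<close>)
    then show ?thesis by (auto simp: field_differentiable_def)
  qed
  then show ?thesis by (simp add: field_differentiable_at_within holomorphic_on_def)
qed

text \<open>The difference quotient of \<open>h\<close> at \<open>t\<close> extends over
  \<open>t\<close>, so its integrals over the two homotopic circles agree. The remaining terms
  integrate \<open>h t / (\<zeta> - t)\<close>, giving \<open>2 * pi * \<i> * h t\<close> on the
  outer circle and 0 on the inner one.\<close>

lemma annulus_Cauchy_formula:
  assumes h: "h holomorphic_on {t. s1 < norm t \<and> norm t < s2}"
    and r: "0 \<le> s1" "s1 < \<rho>1" "\<rho>1 < norm t" "norm t < \<rho>2" "\<rho>2 < s2"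
  shows "contour_integral (circlepath 0 \<rho>2) (\<lambda>\<zeta>. h \<zeta> / (\<zeta> - t))
    - contour_integral (circlepath 0 \<rho>1) (\<lambda>\<zeta>. h \<zeta> / (\<zeta> - t)) = 2 * pi * \<i> * h t"
proof -
  define \<Omega> where "\<Omega> = {t::complex. s1 < norm t \<and> norm t < s2}"
  have op: "open \<Omega>" unfolding \<Omega>_def by (intro open_Collect_conj open_Collect_less continuous_intros)
  have t: "t \<in> interior \<Omega>" using op r by (simp add: interior_open \<Omega>_def)
  define k where "k z = (if z = t then deriv h t else (h z - h t) / (z - t))" for z
  have k: "k holomorphic_on \<Omega>" unfolding k_def
    by (rule pole_lemma[OF _ t]) (use h in \<open>simp add: \<Omega>_def\<close>)
  have circ: "circlepath 0 \<rho> x = of_real \<rho> * exp (2 * of_real pi * \<i> * of_real x)" for \<rho> x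
    by (simp add: circlepath)
  have "homotopic_loops \<Omega> (circlepath 0 \<rho>2) (circlepath 0 \<rho>1)"
  proof (rule homotopic_loops_linear)
    fix x :: real
    show "closed_segment (circlepath 0 \<rho>2 x) (circlepath 0 \<rho>1 x) \<subseteq> \<Omega>"
    proof
      fix y assume "y \<in> closed_segment (circlepath 0 \<rho>2 x) (circlepath 0 \<rho>1 x)"
      then obtain u where u: "0 \<le> u" "u \<le> 1"
        "y = (1 - u) *\<^sub>R circlepath 0 \<rho>2 x + u *\<^sub>R circlepath 0 \<rho>1 x"
        by (auto simp: closed_segment_def)
      then have y: "y = of_real ((1 - u) * \<rho>2 + u * \<rho>1) * exp (2 * of_real pi * \<i> * of_real x)"
        by (simp add: circ scaleR_conv_of_real algebra_simps)
      have "norm y = \<bar>(1 - u) * \<rho>2 + u * \<rho>1\<bar>" unfolding y norm_mult norm_of_real by simp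
      moreover have "\<rho>1 \<le> (1 - u) * \<rho>2 + u * \<rho>1"
        using mult_right_mono[of \<rho>1 \<rho>2 "1 - u"] r u by (simp add: algebra_simps)
      moreover have "(1 - u) * \<rho>2 + u * \<rho>1 \<le> \<rho>2"
        using mult_right_mono[of \<rho>1 \<rho>2 u] r u by (simp add: algebra_simps)
      ultimately show "y \<in> \<Omega>" using r by (auto simp: \<Omega>_def)
    qed
  qed auto
  from Cauchy_theorem_homotopic_loops[OF this op k]
  have eq: "contour_integral (circlepath 0 \<rho>2) k = contour_integral (circlepath 0 \<rho>1) k" by simp
  have split: "contour_integral (circlepath 0 \<rho>) k = contour_integral (circlepath 0 \<rho>) (\<lambda>\<zeta>. h \<zeta> / (\<zeta> - t))
      - contour_integral (circlepath 0 \<rho>) (\<lambda>\<zeta>. h t / (\<zeta> - t))"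
    if \<rho>: "s1 < \<rho>" "\<rho> < s2" "\<rho> \<noteq> norm t" for \<rho>
  proof -
    have pi: "path_image (circlepath 0 \<rho>) = sphere 0 \<rho>" using \<rho> r by simp
    have ne: "u \<noteq> t" if "u \<in> sphere 0 \<rho>" for u using that \<rho> by auto
    have "continuous_on (sphere 0 \<rho>) h"
      using holomorphic_on_imp_continuous_on[OF h] by (rule continuous_on_subset) (use \<rho> in auto)
    then have "(\<lambda>\<zeta>. h \<zeta> / (\<zeta> - t)) contour_integrable_on circlepath 0 \<rho>"
      "(\<lambda>\<zeta>. h t / (\<zeta> - t)) contour_integrable_on circlepath 0 \<rho>"
      by (intro contour_integrable_continuous_circlepath; unfold pi; intro continuous_intros; use ne in force)+
    then have "contour_integral (circlepath 0 \<rho>) (\<lambda>\<zeta>. h \<zeta> / (\<zeta> - t))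
      - contour_integral (circlepath 0 \<rho>) (\<lambda>\<zeta>. h t / (\<zeta> - t)) =
      contour_integral (circlepath 0 \<rho>) (\<lambda>\<zeta>. h \<zeta> / (\<zeta> - t) - h t / (\<zeta> - t))"
      by (simp add: contour_integral_diff)
    also have "\<dots> = contour_integral (circlepath 0 \<rho>) k"
      by (rule contour_integral_eq) (use ne pi \<rho> r in \<open>auto simp: k_def diff_divide_distrib\<close>)
    finally show ?thesis by simp
  qed
  have "contour_integral (circlepath 0 \<rho>2) (\<lambda>\<zeta>. h t / (\<zeta> - t)) = 2 * pi * \<i> * h t"
    using Cauchy_integral_circlepath_simple[of "\<lambda>_. h t" 0 \<rho>2 t] r by (intro contour_integral_unique) auto
  moreover have "((\<lambda>\<zeta>. h t / (\<zeta> - t)) has_contour_integral 0) (circlepath 0 \<rho>1)"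
    by (rule Cauchy_theorem_convex_simple[where S = "ball 0 (norm t)"])
      (use r in \<open>auto intro!: holomorphic_intros\<close>)
  ultimately show ?thesis using eq split[of \<rho>1] split[of \<rho>2] r
    by (simp add: contour_integral_unique diff_eq_eq add.commute)
qed

text \<open>For functions of one variable. The quotient of \<open>\<alpha>\<close> by \<open>t ^ d * g\<close> has a logarithm on an
  annulus; splitting it into a part holomorphic inside and a part holomorphic outside leaves an
  entire function of growth \<open>t ^ d\<close>.\<close>

lemma weierstrass_slice:
  fixes \<alpha> g :: "complex \<Rightarrow> complex"
  assumes s: "s > 0" and hol: "\<alpha> holomorphic_on ball 0 s" "g holomorphic_on ball 0 s"
    and gnz: "\<And>t. t \<in> ball 0 s \<Longrightarrow> g t \<noteq> 0"
    and near: "\<And>t. s / 4 < norm t \<Longrightarrow> norm t < s \<Longrightarrow> norm (\<alpha> t - t ^ d * g t) < norm (t ^ d * g t)"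
  defines "hp \<equiv> \<lambda>t. 1 / (2 * pi * \<i>) *
      contour_integral (circlepath 0 (3 * s / 4)) (\<lambda>\<zeta>. Ln (\<alpha> \<zeta> / (\<zeta> ^ d * g \<zeta>)) / (\<zeta> - t))"
  defines "w \<equiv> \<lambda>t. \<alpha> t / (g t * exp (hp t))"
  defines "c \<equiv> \<lambda>k. 1 / (2 * pi * \<i>) * contour_integral (circlepath 0 (s / 2)) (\<lambda>\<zeta>. w \<zeta> / \<zeta> ^ Suc k)"
  shows "norm t < 3 * s / 4 \<Longrightarrow> w t = (\<Sum>k\<le>d. c k * t ^ k)"
    and "(\<And>t. t \<in> ball 0 s \<Longrightarrow> \<alpha> t = t ^ d * g t) \<Longrightarrow> k \<le> d \<Longrightarrow> c k = (if k = d then 1 else 0)"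
proof -
  define \<Omega> where "\<Omega> = {t::complex. s / 4 < norm t \<and> norm t < s}"
  define h where "h \<zeta> = Ln (\<alpha> \<zeta> / (\<zeta> ^ d * g \<zeta>))" for \<zeta>
  have nz: "t ^ d * g t \<noteq> 0" if "t \<in> \<Omega>" for t using near[of t] that by (auto simp: \<Omega>_def)
  have q: "norm (\<alpha> t / (t ^ d * g t) - 1) < 1" if t: "t \<in> \<Omega>" for t
  proof -
    have "\<alpha> t / (t ^ d * g t) - 1 = (\<alpha> t - t ^ d * g t) / (t ^ d * g t)"
      using nz[OF t] by (simp add: diff_divide_distrib)
    then show ?thesis using near[of t] t nz[OF t] by (simp add: norm_divide \<Omega>_def divide_less_eq)
  qed
  \<comment> \<open>Being within distance 1 of 1, the quotient lies in the right half-plane, where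
    the principal branch \<open>Ln\<close> is holomorphic; this is the purpose of the hypothesis
    \<open>near\<close>.\<close>
  have re: "0 < Re (\<alpha> t / (t ^ d * g t))" if "t \<in> \<Omega>" for t
    using q[OF that] abs_Re_le_cmod[of "\<alpha> t / (t ^ d * g t) - 1"] by simp
  have hh: "h holomorphic_on \<Omega>" unfolding h_def
  proof (rule holomorphic_on_Ln')
    show "(\<lambda>\<zeta>. \<alpha> \<zeta> / (\<zeta> ^ d * g \<zeta>)) holomorphic_on \<Omega>"
      by (intro holomorphic_intros holomorphic_on_subset[OF hol(1)] holomorphic_on_subset[OF hol(2)])
        (use nz in \<open>auto simp: \<Omega>_def\<close>)
    show "\<alpha> z / (z ^ d * g z) \<notin> \<real>\<^sub>\<le>\<^sub>0" if "z \<in> \<Omega>" for z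
      using re[OF that] complex_nonpos_Reals_iff by fastforce
  qed
  have hc: "continuous_on (sphere 0 \<rho>) h" if "s / 4 < \<rho>" "\<rho> < s" for \<rho>
    by (rule continuous_on_subset[OF holomorphic_on_imp_continuous_on[OF hh]]) (use that in \<open>auto simp: \<Omega>_def\<close>)
  define hm where "hm t = 1 / (2 * pi * \<i>) * contour_integral (circlepath 0 (s / 2)) (\<lambda>\<zeta>. h \<zeta> / (\<zeta> - t))" for t
  have hp: "hp holomorphic_on ball 0 (3 * s / 4)" unfolding hp_def h_def[symmetric]
    by (intro holomorphic_intros holomorphic_on_subset[OF cauchy_transform_holomorphic[OF hc]])
      (use s in auto)
  have hm: "hm holomorphic_on {t. s / 2 < norm t}" unfolding hm_def
    by (intro holomorphic_intros holomorphic_on_subset[OF cauchy_transform_holomorphic[OF hc]])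
      (use s in auto)
  have diff: "h t = hp t - hm t" if "s / 2 < norm t" "norm t < 3 * s / 4" for t
    using annulus_Cauchy_formula[of h "s / 4" s "s / 2" t "3 * s / 4"] hh s that
    by (simp add: hp_def hm_def h_def[symmetric] \<Omega>_def flip: diff_divide_distrib)
  \<comment> \<open>The two formulas agree for moduli between \<open>s / 2\<close> and
    \<open>3 * s / 4\<close>, because there \<open>h = hp - hm\<close>; gluing them yields the
    entire function.\<close>
  define E where "E t = (if norm t < 3 * s / 4 then w t else t ^ d * exp (- hm t))" for t
  have E: "E t = t ^ d * exp (- hm t)" if t: "s / 2 < norm t" for t
  proof (cases "norm t < 3 * s / 4")
    case True
    then have t\<Omega>: "t \<in> \<Omega>" using t s by (auto simp: \<Omega>_def)
    have "exp (h t) = \<alpha> t / (t ^ d * g t)" unfolding h_def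
      using re[OF t\<Omega>] by (intro exp_Ln) (metis less_irrefl zero_complex.sel(1))
    then have "\<alpha> t = t ^ d * g t * (exp (hp t) * exp (- hm t))"
      using nz[OF t\<Omega>] unfolding diff[OF t True] exp_add[symmetric] by (simp add: divide_eq_eq ac_simps)
    moreover have "g t \<noteq> 0" using nz[OF t\<Omega>] by auto
    ultimately show ?thesis using True by (simp add: E_def w_def)
  qed (simp add: E_def)
  have w: "w holomorphic_on ball 0 (3 * s / 4)" unfolding w_def
    by (intro holomorphic_intros hp holomorphic_on_subset[OF hol(1)] holomorphic_on_subset[OF hol(2)])
      (use gnz s in auto)
  have "E holomorphic_on ball 0 (3 * s / 4) \<union> {t. s / 2 < norm t}"
  proof (rule holomorphic_on_Un)
    show "E holomorphic_on ball 0 (3 * s / 4)"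
      by (rule holomorphic_transform[OF w]) (simp add: E_def)
    have "(\<lambda>t. t ^ d * exp (- hm t)) holomorphic_on {t. s / 2 < norm t}"
      by (intro holomorphic_intros hm)
    then show "E holomorphic_on {t. s / 2 < norm t}"
      by (rule holomorphic_transform) (simp add: E)
    show "open {t::complex. s / 2 < norm t}" by (intro open_Collect_less continuous_intros)
  qed simp
  moreover have "ball 0 (3 * s / 4) \<union> {t::complex. s / 2 < norm t} = UNIV"
    using s by (auto simp: not_less)
  ultimately have EU: "E holomorphic_on UNIV" by simp
  have "compact (h ` sphere 0 (s / 2))" by (intro compact_continuous_image hc compact_sphere) (use s in auto)
  then obtain B where B: "B > 0" "\<And>\<zeta>. norm \<zeta> = s / 2 \<Longrightarrow> norm (h \<zeta>) \<le> B"
    by (auto dest!: compact_imp_bounded simp: bounded_pos)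
  \<comment> \<open>For \<open>norm t\<close> at least \<open>s\<close> the circle of radius
    \<open>s / 2\<close> is at distance at least \<open>s / 2\<close> from \<open>t\<close>; this
    cancels against the length of the circle and leaves the bound \<open>B\<close>.\<close>
  have hm_bd: "norm (hm t) \<le> B" if t: "s \<le> norm t" for t
  proof -
    have "continuous_on (sphere 0 (s / 2)) (\<lambda>\<zeta>. h \<zeta> / (\<zeta> - t))"
      using hc[of "s / 2"] s t by (intro continuous_intros) auto
    then have "(\<lambda>\<zeta>. h \<zeta> / (\<zeta> - t)) contour_integrable_on circlepath 0 (s / 2)"
      using s by (intro contour_integrable_continuous_circlepath) simp
    then have "norm (contour_integral (circlepath 0 (s / 2)) (\<lambda>\<zeta>. h \<zeta> / (\<zeta> - t))) \<le> (B / (s / 2)) * (2 * pi * (s / 2))"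
    proof (intro has_contour_integral_bound_circlepath[OF has_contour_integral_integral])
      fix x :: complex assume "norm (x - 0) = s / 2"
      then have "norm (h x) \<le> B" "s / 2 \<le> norm (x - t)"
        using B(2)[of x] norm_triangle_ineq2[of t x] t by (auto simp: norm_minus_commute)
      then show "norm (h x / (x - t)) \<le> B / (s / 2)"
        unfolding norm_divide using s B(1) by (intro frac_le) auto
    qed (use s B in auto)
    then show ?thesis using s by (simp add: hm_def norm_mult norm_divide field_simps)
  qed
  have E_poly: "E t = (\<Sum>k\<le>d. (deriv ^^ k) E 0 / fact k * t ^ k)" for t
  proof (rule Liouville_polynomial[OF EU, where A = s and B = "exp B"])
    fix z :: complex assume z: "s \<le> norm z"
    then have "s / 2 < norm z" using s by simp
    then have "norm (E z) = norm z ^ d * norm (exp (- hm z))" by (simp add: E norm_mult norm_power)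
    moreover have "norm (exp (- hm z)) \<le> exp B"
      using hm_bd[OF z] norm_exp[of "- hm z"] by (metis exp_le_cancel_iff norm_minus_cancel order_trans)
    ultimately show "norm (E z) \<le> exp B * norm z ^ d"
      by (simp add: mult.commute[of "norm z ^ d"] mult_right_mono)
  qed
  \<comment> \<open>Writing the Taylor coefficients as integrals of \<open>w\<close> over a circle
    is what later makes them holomorphic in the base point of the slice.\<close>
  have coef: "(deriv ^^ k) E 0 / fact k = c k" for k
  proof -
    have "((\<lambda>u. E u / (u - 0) ^ Suc k) has_contour_integral (2 * pi * \<i>) / fact k * (deriv ^^ k) E 0) (circlepath 0 (s / 2))"
      by (rule Cauchy_has_contour_integral_higher_derivative_circlepath)
        (use s EU in \<open>auto intro: holomorphic_on_subset continuous_on_subset holomorphic_on_imp_continuous_on\<close>)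
    then have "contour_integral (circlepath 0 (s / 2)) (\<lambda>u. E u / u ^ Suc k) = (2 * pi * \<i>) / fact k * (deriv ^^ k) E 0"
      by (simp add: contour_integral_unique)
    moreover have "contour_integral (circlepath 0 (s / 2)) (\<lambda>u. E u / u ^ Suc k)
        = contour_integral (circlepath 0 (s / 2)) (\<lambda>u. w u / u ^ Suc k)"
      by (rule contour_integral_eq) (use s in \<open>simp add: E_def\<close>)
    ultimately have "c k = 1 / (2 * pi * \<i>) * ((2 * pi * \<i>) / fact k * (deriv ^^ k) E 0)"
      by (simp only: c_def)
    then show ?thesis by simp
  qed
  show "norm t < 3 * s / 4 \<Longrightarrow> w t = (\<Sum>k\<le>d. c k * t ^ k)"
    using E_poly[of t] by (simp add: coef E_def)
  \<comment> \<open>If \<open>\<alpha>\<close> equals \<open>t ^ d * g t\<close> exactly, the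
    logarithm \<open>h\<close> vanishes on the annulus and \<open>E\<close> is \<open>t ^ d\<close>.
    This fixes the coefficients on the central slice.\<close>
  show "c k = (if k = d then 1 else 0)" if eq: "\<And>t. t \<in> ball 0 s \<Longrightarrow> \<alpha> t = t ^ d * g t" and "k \<le> d"
  proof -
    have h0: "h t = 0" if "t \<in> \<Omega>" for t
      using eq[of t] nz[OF that] that by (simp add: h_def \<Omega>_def)
    have "hm t = 0" for t
    proof -
      have "contour_integral (circlepath 0 (s / 2)) (\<lambda>\<zeta>. h \<zeta> / (\<zeta> - t)) = contour_integral (circlepath 0 (s / 2)) (\<lambda>\<zeta>. 0)"
        by (rule contour_integral_eq) (use s h0 in \<open>simp add: \<Omega>_def\<close>)
      then show ?thesis by (simp add: hm_def)
    qed
    moreover have "hp t = 0" for t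
    proof -
      have "contour_integral (circlepath 0 (3 * s / 4)) (\<lambda>\<zeta>. h \<zeta> / (\<zeta> - t)) = contour_integral (circlepath 0 (3 * s / 4)) (\<lambda>\<zeta>. 0)"
        by (rule contour_integral_eq) (use s h0 in \<open>simp add: \<Omega>_def\<close>)
      then show ?thesis by (simp add: hp_def flip: h_def)
    qed
    ultimately have "E t = t ^ d" for t
      using eq[of t] gnz[of t] s by (simp add: E_def w_def)
    then have "(\<Sum>j\<le>d. c j * t ^ j) = (\<Sum>j\<le>d. (if j = d then 1 else 0) * t ^ j)" for t
      using E_poly[of t] by (simp add: coef if_distrib[of "\<lambda>x. x * _"] cong: if_cong)
    then show ?thesis using polyfun_eq_coeffs[of c d "\<lambda>j. if j = d then 1 else 0"] \<open>k \<le> d\<close> by simp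
  qed
qed

lemma Re_quotient_pos:
  fixes a b :: complex
  assumes "norm (a - b) < norm b" shows "0 < Re (a / b)"
proof -
  have nz: "b \<noteq> 0" using assms by auto
  then have "a / b - 1 = (a - b) / b" by (simp add: diff_divide_distrib)
  then have "norm (a / b - 1) < 1" using assms nz by (simp add: norm_divide divide_less_eq)
  then show ?thesis using abs_Re_le_cmod[of "a / b - 1"] by simp
qed

lemma zero_order_factor:
  assumes "\<phi> holomorphic_on ball 0 r0" "r0 > 0" "\<And>t. t \<noteq> 0 \<Longrightarrow> norm t < \<delta> \<Longrightarrow> \<phi> t \<noteq> 0" "\<delta> > 0"
  obtains d g r where "0 < r" "r \<le> r0" "g holomorphic_on ball 0 r"
    "\<And>t::complex. t \<in> ball 0 r \<Longrightarrow> \<phi> t = t ^ d * g t" "\<And>t. t \<in> ball 0 r \<Longrightarrow> g t \<noteq> 0"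
proof (cases "\<phi> 0 = 0")
  case False
  show ?thesis
    by (rule that[of "min r0 \<delta>" \<phi> 0]) (use assms(1,2,4) in \<open>auto intro: holomorphic_on_subset\<close>,
        use assms(3) False in metis)
next
  case True
  have nc: "\<not> \<phi> constant_on ball 0 r0"
  proof
    assume c: "\<phi> constant_on ball 0 r0"
    define \<tau> where "\<tau> = min r0 \<delta> / 2"
    have \<tau>: "\<tau> > 0" "\<tau> < r0" "\<tau> < \<delta>" using assms(2,4) by (auto simp: \<tau>_def)
    then have "\<phi> (of_real \<tau>) = \<phi> 0" using c by (auto simp: constant_on_def)
    then show False using assms(3)[of "of_real \<tau>"] \<tau> True by simp
  qed
  have z0: "0 \<in> ball 0 r0" using assms(2) by simp
  show ?thesis
  proof (rule holomorphic_factor_zero_nonconstant[OF assms(1) open_ball connected_ball z0 True nc])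
    fix g r and n :: nat
    assume "0 < r" "ball (0::complex) r \<subseteq> ball 0 r0" "g holomorphic_on ball 0 r"
      "\<And>w. w \<in> ball 0 r \<Longrightarrow> \<phi> w = (w - 0) ^ n * g w" "\<And>w. w \<in> ball 0 r \<Longrightarrow> g w \<noteq> 0"
    moreover from this(1,2) have "r \<le> r0" by (simp add: ball_subset_ball_iff)
    ultimately show ?thesis using that[of r g n] by simp
  qed
qed

text \<open>Every nearby slice is compared with the same model \<open>t ^ d * g t\<close>, taken
  from the slice through the origin, so all slices have the same degree \<open>d\<close> and the
  coefficients are integrals depending holomorphically on the base point. The coefficients are
  recorded only by their values at the origin: the top one is 1 there, hence a unit, and the lower
  ones vanish.\<close>

lemma weierstrass_preparation:
  fixes a :: "'n::finite hgerm"
  assumes v: "v $ i = 1" and reg: "regular_along v a"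
  obtains d u c where "u dvd 1" "\<And>k. c k \<in> const_along v i"
    "\<And>k. k \<le> d \<Longrightarrow> hvalue (c k) = (if k = d then 1 else 0)"
    "a = u * (\<Sum>k\<le>d. c k * germ_at 0 (\<lambda>z. z $ i) ^ k)"
proof -
  define A where "A = rep_hgerm a"
  obtain R where R: "R > 0" "\<And>z. norm z < R \<Longrightarrow> holo_near z A"
    using rep_ball[of "\<lambda>_. True" a] unfolding A_def by auto
  obtain \<delta> where \<delta>: "\<delta> > 0" "\<And>t. t \<noteq> 0 \<Longrightarrow> norm t < \<delta> \<Longrightarrow> A (t *s v) \<noteq> 0"
    using reg unfolding regular_along_def A_def by blast
  have nv: "norm v + 1 > 0" by (simp add: add_nonneg_pos)
  have small: "norm (t *s v) < R / 2" if "norm t \<le> R / (2 * (norm v + 1))" for t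
  proof -
    have "norm t * (2 * (norm v + 1)) \<le> R" using that nv by (simp add: pos_le_divide_eq)
    then have "2 * norm (t *s v) + 2 * norm t \<le> R" by (simp add: norm_vector_scale algebra_simps)
    moreover have "norm (t *s v) = 0" if "norm t = 0" using that by (simp add: norm_vector_scale)
    ultimately show ?thesis using R(1) norm_ge_zero[of t] by linarith
  qed
  have hA: "holo_on A (ball 0 R)"
    by (rule holo_on_subset[OF holo_on_near]) (use R(2) in auto)
  note cA = holo_on_continuous[OF hA]
  define r0 where "r0 = R / (2 * (norm v + 1))"
  have r0: "r0 > 0" using R(1) nv by (simp add: r0_def)
  have "(\<lambda>t. A (0 + t *s v)) holomorphic_on ball 0 r0"
  proof (rule holomorphic_on_line)
    fix t :: complex assume "t \<in> ball 0 r0"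
    then show "holo_near (0 + t *s v) A" using small[of t] R by (simp add: r0_def)
  qed
  then have hl: "(\<lambda>t. A (t *s v)) holomorphic_on ball 0 r0" by simp
  obtain d g r where r: "0 < r" "r \<le> r0" and g: "g holomorphic_on ball 0 r"
    and \<phi>: "\<And>t. t \<in> ball 0 r \<Longrightarrow> A (t *s v) = t ^ d * g t" and gnz: "\<And>t. t \<in> ball 0 r \<Longrightarrow> g t \<noteq> 0"
    by (rule zero_order_factor[OF hl r0 \<delta>(2,1)]) (assumption, assumption, rule that)
  define s where "s = r / 2"
  have s: "s > 0" "s < r" using r by (auto simp: s_def)
  have sR: "norm (t *s v) < R / 2" if "norm t \<le> s" for t
    using small[of t] that s r by (simp add: r0_def)
  define T where "T = {t::complex. s / 4 \<le> norm t \<and> norm t \<le> s}"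
  have "T = cball 0 s - ball 0 (s / 4)" by (auto simp: T_def)
  then have "compact T" by (simp add: compact_diff)
  have "of_real s \<in> T" using s by (simp add: T_def)
  then have "T \<noteq> {}" by blast
  have T_R: "t *s v \<in> ball 0 R" if "t \<in> T" for t using sR[of t] that R by (simp add: T_def)
  have "continuous_on T (\<lambda>t. norm (A (t *s v)))"
  proof (intro continuous_on_norm continuous_on_compose2[OF cA])
    show "continuous_on T (\<lambda>t. t *s v)"
      by (intro bounded_linear.continuous_on[OF bounded_linear_scale_vec] continuous_on_id)
  qed (use T_R in blast)
  from continuous_attains_inf[OF \<open>compact T\<close> \<open>T \<noteq> {}\<close> this]
  obtain t0 where t0: "t0 \<in> T" "\<And>t. t \<in> T \<Longrightarrow> norm (A (t0 *s v)) \<le> norm (A (t *s v))" by blast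
  have "A (t0 *s v) \<noteq> 0"
    using \<phi>[of t0] gnz[of t0] t0(1) s by (auto simp: T_def)
  then have "norm (A (t0 *s v)) > 0" by simp
  \<comment> \<open>On the compact annulus \<open>T\<close> the perturbation is kept below the
    minimum of the modulus of \<open>A\<close> on the central line, hence below the modulus of
    \<open>t ^ d * g t\<close>, as the comparison requires.\<close>
  from line_uniform[OF cA \<open>compact T\<close> T_R this R(1)]
  obtain \<epsilon>0 where \<epsilon>0: "\<epsilon>0 > 0" "\<And>z t. norm z < \<epsilon>0 \<Longrightarrow> t \<in> T \<Longrightarrow>
      norm (A (z + t *s v) - A (t *s v)) < norm (A (t0 *s v))" by metis
  define \<epsilon> where "\<epsilon> = min \<epsilon>0 (R / 2)"
  have \<epsilon>: "\<epsilon> > 0" using \<epsilon>0 R by (simp add: \<epsilon>_def)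
  have in_R: "norm (y + t *s v) < R" if "norm y < \<epsilon>" "norm t \<le> s" for y t
    using norm_triangle_ineq[of y "t *s v"] sR[OF that(2)] that(1) by (simp add: \<epsilon>_def)
  have near: "norm (A (y + t *s v) - t ^ d * g t) < norm (t ^ d * g t)"
    if "norm y < \<epsilon>" "s / 4 \<le> norm t" "norm t \<le> s" for y t
  proof -
    have t: "t \<in> T" using that by (simp add: T_def)
    have "t \<in> ball 0 r" using that s by simp
    then show ?thesis using \<epsilon>0(2)[of y t] t0(2)[OF t] t that \<phi> by (fastforce simp: \<epsilon>_def)
  qed
  define hp where "hp y t = 1 / (2 * pi * \<i>) *
      contour_integral (circlepath 0 (3 * s / 4)) (\<lambda>\<zeta>. Ln (A (y + \<zeta> *s v) / (\<zeta> ^ d * g \<zeta>)) / (\<zeta> - t))" for y t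
  define w where "w y t = A (y + t *s v) / (g t * exp (hp y t))" for y t
  define c where "c k y = 1 / (2 * pi * \<i>) * contour_integral (circlepath 0 (s / 2)) (\<lambda>\<zeta>. w y \<zeta> / \<zeta> ^ Suc k)" for k y
  have slice1: "w y t = (\<Sum>k\<le>d. c k y * t ^ k)" if y: "norm y < \<epsilon>" and t: "norm t < 3 * s / 4" for y t
    unfolding w_def c_def hp_def
  proof (rule weierstrass_slice(1)[OF s(1)])
    show "(\<lambda>t. A (y + t *s v)) holomorphic_on ball 0 s"
      by (rule holomorphic_on_line) (use in_R[OF y] R in auto)
    show "g holomorphic_on ball 0 s" using g by (rule holomorphic_on_subset) (use s in auto)
  qed (use gnz near[OF y] t s in auto)
  have slice2: "c k 0 = (if k = d then 1 else 0)" if "k \<le> d" for k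
    unfolding w_def c_def hp_def
  proof (rule weierstrass_slice(2)[OF s(1)])
    show "(\<lambda>t. A (0 + t *s v)) holomorphic_on ball 0 s"
      by (rule holomorphic_on_line) (use in_R[of 0] \<epsilon> R in auto)
    show "g holomorphic_on ball 0 s" using g by (rule holomorphic_on_subset) (use s in auto)
    show "A (0 + t *s v) = t ^ d * g t" if "t \<in> ball 0 s" for t using \<phi>[of t] that s by simp
  qed (use gnz near[of 0] that s \<epsilon> in auto)
  \<comment> \<open>A point splits into its base point \<open>pr z\<close>, whose
    \<open>i\<close>-th coordinate is zero, and the parameter \<open>z $ i\<close> along
    \<open>v\<close>; functions of base point and parameter thereby become functions of
    \<open>z\<close>.\<close>
  define pr where "pr z = z - z $ i *s v" for z
  have pr_i: "pr z $ i = 0" for z using v by (simp add: pr_def)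
  have pr_line: "pr (y + t *s v) = y" "(y + t *s v) $ i = t" if "y $ i = 0" for y t
    using v that by (simp_all add: pr_def vec_eq_iff)
  have pr_decomp: "pr z + z $ i *s v = z" for z by (simp add: pr_def)
  have pr_cont: "continuous_on S pr" for S
    unfolding pr_def
    by (intro continuous_intros bounded_linear.continuous_on[OF bounded_linear_compose[OF bounded_linear_scale_vec bounded_linear_vec_nth]])
  have pr_holo: "vholo_on (\<lambda>z. pr z + \<zeta> *s v) S" for \<zeta> S
    unfolding vholo_on_def pr_def
    by (simp add: algebra_simps) (intro allI holo_on_diff holo_on_add holo_on_mult holo_on_nth holo_on_const)
  \<comment> \<open>The bound on the parameter in \<open>D\<close> keeps it inside the circle
    defining \<open>hp\<close> and in the range of the slice identity. The coefficients depend on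
    the base point alone, so \<open>D0\<close> has no such bound.\<close>
  define D where "D = {z. norm (pr z) < \<epsilon> \<and> norm (z $ i) < 3 * s / 4}"
  define D0 where "D0 = {z. norm (pr z) < \<epsilon>}"
  have opD: "open D" "open D0" unfolding D_def D0_def
    by (intro open_Collect_conj open_Collect_less continuous_intros pr_cont)+
  have D0: "0 \<in> D" "0 \<in> D0" using \<epsilon> s by (auto simp: D_def D0_def pr_def)
  have DR: "z \<in> ball 0 R" if "z \<in> D" for z
    using in_R[of "pr z" "z $ i"] that s unfolding pr_decomp by (simp add: D_def)
  have re: "0 < Re (A (y + \<zeta> *s v) / (\<zeta> ^ d * g \<zeta>))" if y: "norm y < \<epsilon>" and \<zeta>: "norm \<zeta> = 3 * s / 4" for y \<zeta>
    using near[OF y, of \<zeta>] \<zeta> s by (intro Re_quotient_pos) simp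
  have gz: "\<zeta> ^ d * g \<zeta> \<noteq> 0" if "norm \<zeta> = 3 * s / 4" for \<zeta>
    using gnz[of \<zeta>] that s by auto
  have line_cont: "continuous_on (S \<times> S') (\<lambda>x. pr (fst x) + snd x *s v)" for S S'
    by (intro continuous_on_add continuous_on_compose2[OF pr_cont[of UNIV]] continuous_on_fst continuous_on_snd
        bounded_linear.continuous_on[OF bounded_linear_scale_vec] continuous_on_id) auto
  have hHp: "holo_on (\<lambda>z. hp (pr z) (z $ i)) D"
    unfolding hp_def
  proof (intro holo_on_mult[OF holo_on_const] holo_on_contour_integral opD)
    fix \<zeta> :: complex assume \<zeta>: "norm \<zeta> = 3 * s / 4"
    have "holo_on (\<lambda>z. A (pr z + \<zeta> *s v)) D"
      by (rule holo_on_compose[OF pr_holo hA]) (use in_R \<zeta> s in \<open>auto simp: D_def\<close>)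
    then have "holo_on (\<lambda>z. A (pr z + \<zeta> *s v) / (\<zeta> ^ d * g \<zeta>)) D"
      by (intro holo_on_divide holo_on_const) (use gz[OF \<zeta>] in auto)
    then have "holo_on (\<lambda>z. Ln (A (pr z + \<zeta> *s v) / (\<zeta> ^ d * g \<zeta>))) D"
    proof (rule holo_on_compose_outer)
      show "Ln holomorphic_on {z. 0 < Re z}"
        by (rule holomorphic_on_Ln) (auto simp: complex_nonpos_Reals_iff)
      show "open {z. 0 < Re z}" by (simp add: open_halfspace_Re_gt)
    qed (use re \<zeta> in \<open>auto simp: D_def\<close>)
    then show "holo_on (\<lambda>z. Ln (A (pr z + \<zeta> *s v) / (\<zeta> ^ d * g \<zeta>)) / (\<zeta> - z $ i)) D"
      by (intro holo_on_divide holo_on_diff holo_on_const holo_on_nth) (use \<zeta> in \<open>auto simp: D_def\<close>)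
  next
    let ?P = "D \<times> sphere 0 (3 * s / 4)"
    have "continuous_on ?P (\<lambda>x. A (pr (fst x) + snd x *s v))"
      by (rule continuous_on_compose2[OF cA line_cont]) (use in_R s in \<open>auto simp: D_def\<close>)
    moreover have "continuous_on ?P (\<lambda>x. g (snd x))"
      by (rule continuous_on_compose2[OF holomorphic_on_imp_continuous_on[OF g]])
        (use s in \<open>auto intro: continuous_intros\<close>)
    ultimately have "continuous_on ?P (\<lambda>x. A (pr (fst x) + snd x *s v) / (snd x ^ d * g (snd x)))"
      by (intro continuous_on_divide continuous_intros) (use gz in auto)
    then have L: "continuous_on ?P (\<lambda>x. Ln (A (pr (fst x) + snd x *s v) / (snd x ^ d * g (snd x))))"
      by (rule continuous_on_Ln') (use re in \<open>fastforce simp: D_def complex_nonpos_Reals_iff\<close>)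
    show "continuous_on ?P (\<lambda>(z, \<zeta>). Ln (A (pr z + \<zeta> *s v) / (\<zeta> ^ d * g \<zeta>)) / (\<zeta> - z $ i))"
      unfolding case_prod_unfold
      by (intro continuous_on_divide[OF L] continuous_intros) (auto simp: D_def)
  qed (use s in auto)
  define U where "U z = g (z $ i) * exp (hp (pr z) (z $ i))" for z
  define W where "W z = w (pr z) (z $ i)" for z
  have zi: "z $ i \<in> ball 0 r" if "z \<in> D" for z using that s by (auto simp: D_def)
  have hU: "holo_on U D" unfolding U_def
    by (intro holo_on_mult holo_on_compose_outer[OF holo_on_nth g open_ball zi]
        holo_on_compose_outer[OF hHp holomorphic_on_exp open_UNIV]) auto
  have Unz: "U z \<noteq> 0" if "z \<in> D" for z using gnz[OF zi[OF that]] by (simp add: U_def)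
  have W_eq: "W z = A z / U z" for z by (simp add: W_def w_def U_def pr_decomp)
  have hW: "holo_on W D" unfolding W_eq[abs_def]
    by (intro holo_on_divide hU holo_on_subset[OF hA] Unz) (use DR in auto)
  have hc: "holo_on (\<lambda>z. c k (pr z)) D0" for k
  proof -
    have W: "w (pr z) \<zeta> = W (pr z + \<zeta> *s v)" for z \<zeta> by (simp only: W_def pr_line[OF pr_i])
    have inD: "pr z + \<zeta> *s v \<in> D" if "z \<in> D0" "norm \<zeta> = s / 2" for z \<zeta>
      using that s unfolding D_def D0_def mem_Collect_eq pr_line[OF pr_i] by simp
    show ?thesis unfolding c_def W
    proof (intro holo_on_mult[OF holo_on_const] holo_on_contour_integral opD)
      fix \<zeta> :: complex assume \<zeta>: "norm \<zeta> = s / 2"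
      show "holo_on (\<lambda>z. W (pr z + \<zeta> *s v) / \<zeta> ^ Suc k) D0"
        by (intro holo_on_divide holo_on_const holo_on_compose[OF pr_holo hW] inD) (use \<zeta> s in auto)
    next
      have "continuous_on (D0 \<times> sphere 0 (s / 2)) (\<lambda>x. W (pr (fst x) + snd x *s v))"
        by (rule continuous_on_compose2[OF holo_on_continuous[OF hW] line_cont]) (use inD in auto)
      then show "continuous_on (D0 \<times> sphere 0 (s / 2)) (\<lambda>(z, \<zeta>). W (pr z + \<zeta> *s v) / \<zeta> ^ Suc k)"
        unfolding case_prod_unfold by (intro continuous_on_divide continuous_intros) (use s in auto)
    qed (use s in auto)
  qed
  have nc: "holo_near 0 (\<lambda>z. c k (pr z))" for k by (rule holo_nearI[OF opD(2) D0(2) hc])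
  have nU: "holo_near 0 U" by (rule holo_nearI[OF opD(1) D0(1) hU])
  have ni: "holo_near 0 (\<lambda>z::complex^'n. z $ i)" by (rule holo_nearI[OF open_UNIV UNIV_I holo_on_nth])
  show ?thesis
  proof (rule that[of "germ_at 0 U" "\<lambda>k. germ_at 0 (\<lambda>z. c k (pr z))" d])
    show "germ_at 0 U dvd 1" using Unz[OF D0(1)] by (simp add: hgerm_unit_iff hvalue_germ_at nU)
    fix k
    show "germ_at 0 (\<lambda>z. c k (pr z)) \<in> const_along v i"
    proof -
      have e: "\<forall>\<^sub>F z in nhds 0. rep_hgerm (germ_at 0 (\<lambda>z. c k (pr z))) z = c k (pr z)"
        using rep_germ_at[OF nc, of k] by simp
      have e2: "\<forall>\<^sub>F z in nhds 0. rep_hgerm (germ_at 0 (\<lambda>z. c k (pr z))) (z - z $ i *s v) = c k (pr (z - z $ i *s v))"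
        by (rule eventually_compose_filterlim[OF e filterlim_proj])
      have pr: "pr (z - z $ i *s v) = pr z" for z using pr_line(1)[OF pr_i, of z 0] by (simp add: pr_def)
      from e e2 show ?thesis unfolding const_along_def mem_Collect_eq
        by eventually_elim (simp only: pr)
    qed
    show "hvalue (germ_at 0 (\<lambda>z. c k (pr z))) = (if k = d then 1 else 0)" if "k \<le> d"
    proof -
      have "hvalue (germ_at 0 (\<lambda>z. c k (pr z))) = c k (pr 0)" by (rule hvalue_germ_at[OF nc])
      moreover have "pr 0 = 0" by (simp add: pr_def)
      ultimately show ?thesis using slice2[OF that] by (simp only:)
    qed
  next
    have "germ_at 0 A = germ_at 0 (\<lambda>z. U z * (\<Sum>k\<le>d. c k (pr z) * z $ i ^ k))"
    proof (rule germ_at_eqI)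
      show "holo_near 0 A" unfolding A_def by (rule holo_near_rep0)
      have "A z = U z * (\<Sum>k\<le>d. c k (pr z) * z $ i ^ k)" if "z \<in> D" for z
      proof -
        have "W z = (\<Sum>k\<le>d. c k (pr z) * z $ i ^ k)"
          using slice1[of "pr z" "z $ i"] that by (simp add: W_def D_def)
        moreover have "A z = U z * W z" using W_eq[of z] Unz[OF that] by simp
        ultimately show ?thesis by (simp only:)
      qed
      then show "\<forall>\<^sub>F z in nhds 0. A z = U z * (\<Sum>k\<le>d. c k (pr z) * z $ i ^ k)"
        using opD D0 unfolding eventually_nhds by blast
    qed
    also have "\<dots> = germ_at 0 U * germ_at 0 (\<lambda>z. \<Sum>k\<le>d. c k (pr z) * z $ i ^ k)"
      by (intro germ_at_mult nU holo_near_sum holo_near_mult nc holo_near_power ni)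
    also have "germ_at 0 (\<lambda>z. \<Sum>k\<le>d. c k (pr z) * z $ i ^ k)
        = (\<Sum>k\<le>d. germ_at 0 (\<lambda>z. c k (pr z)) * germ_at 0 (\<lambda>z. z $ i) ^ k)"
      by (subst germ_at_sum) (intro holo_near_mult nc holo_near_power ni sum.cong refl,
          subst germ_at_mult, intro nc holo_near_power ni, intro holo_near_power ni,
          simp add: germ_at_power ni)
    finally show "a = germ_at 0 U * (\<Sum>k\<le>d. germ_at 0 (\<lambda>z. c k (pr z)) * germ_at 0 (\<lambda>z. z $ i) ^ k)"
      using germ_at_rep[of 0 a] by (simp add: A_def)
  qed
qed

section \<open>Irreducible germs are prime\<close>

declare hring.scale_scale [simp del]

lemma rep_eq_0_iff: "a = 0 \<longleftrightarrow> (\<forall>\<^sub>F z in nhds 0. rep_hgerm a z = 0)"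
proof
  show "a = 0 \<Longrightarrow> \<forall>\<^sub>F z in nhds 0. rep_hgerm a z = 0" using rep_eventually0(4) by simp
  assume "\<forall>\<^sub>F z in nhds 0. rep_hgerm a z = 0"
  then show "a = 0" unfolding hgerm_eq_iff[of a 0 0] using rep_eventually0(4) by eventually_elim simp
qed

text \<open>If the bound failed at a zero of \<open>a\<close>, it would fail nearby by continuity,
  forcing \<open>a\<close> to vanish on an open set and hence identically. This form suits estimates
  obtained after dividing by \<open>a\<close>.\<close>

lemma dvd_if_bounded_where_nonzero:
  fixes a b :: "'n::finite hgerm"
  assumes a: "a \<noteq> 0"
    and bd: "\<forall>\<^sub>F z in nhds 0. rep_hgerm a z \<noteq> 0 \<longrightarrow> norm (rep_hgerm b z) \<le> C * norm (rep_hgerm a z)"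
  shows "a dvd b"
proof -
  define H where "H z \<longleftrightarrow> (rep_hgerm a z \<noteq> 0 \<longrightarrow> norm (rep_hgerm b z) \<le> C * norm (rep_hgerm a z)) \<and> holo_near z (rep_hgerm b)" for z
  have "\<forall>\<^sub>F z in nhds 0. H z"
    unfolding H_def using bd holo_near_eventually[OF holo_near_rep0[of b]] by eventually_elim simp
  from rep_ball[OF this, of a]
  obtain R where R: "R > 0" "\<And>z. norm z < R \<Longrightarrow> H z" "\<And>z. norm z < R \<Longrightarrow> holo_near z (rep_hgerm a)"
    by blast
  have "norm (rep_hgerm b z) \<le> C * norm (rep_hgerm a z)" if z: "norm z < R" for z
  proof (rule ccontr)
    assume less: "\<not> ?thesis"
    have "isCont (rep_hgerm a) z" "isCont (rep_hgerm b) z"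
      using R(2,3)[OF z] holo_near_continuous by (auto simp: H_def)
    then have "isCont (\<lambda>z. norm (rep_hgerm b z) - C * norm (rep_hgerm a z)) z"
      by (intro continuous_intros)
    then have "((\<lambda>z. norm (rep_hgerm b z) - C * norm (rep_hgerm a z)) \<longlongrightarrow>
        norm (rep_hgerm b z) - C * norm (rep_hgerm a z)) (nhds z)"
      using tendsto_at_iff_tendsto_nhds[of "\<lambda>z. norm (rep_hgerm b z) - C * norm (rep_hgerm a z)" z] by (simp add: isCont_def)
    from order_tendstoD(1)[OF this, of 0] less
    have 1: "\<forall>\<^sub>F w in nhds z. 0 < norm (rep_hgerm b w) - C * norm (rep_hgerm a w)" by simp
    have 2: "\<forall>\<^sub>F w in nhds z. norm w < R"
      using eventually_nhds_in_open[of "ball 0 R" z] z by simp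
    from 1 2 have "\<forall>\<^sub>F w in nhds z. rep_hgerm a w = 0"
    proof eventually_elim
      case (elim w)
      then show ?case using R(2)[of w] unfolding H_def by linarith
    qed
    moreover have "holo_on (rep_hgerm a) (ball 0 R)"
      by (rule holo_on_subset[OF holo_on_near]) (use R(3) in auto)
    ultimately have "rep_hgerm a w = 0" if "w \<in> ball 0 R" for w
      using holo_on_ball_identity[of "rep_hgerm a" 0 R z w] z that by simp
    then have "\<forall>\<^sub>F w in nhds 0. rep_hgerm a w = 0"
      using R(1) unfolding eventually_nhds by (intro exI[of _ "ball 0 R"]) auto
    with a show False by (simp add: rep_eq_0_iff)
  qed
  then show ?thesis
    using R(1) by (intro dvd_if_bounded[OF a, of _ C]) (auto simp: eventually_nhds_metric dist_norm)
qed

text \<open>These are the polynomials over germs in the variables transverse to \<open>v\<close>.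
  The coefficients remain in the full ring, so a single type of germs serves for both.\<close>

definition cpoly :: "complex^'n \<Rightarrow> 'n \<Rightarrow> 'n::finite hgerm poly \<Rightarrow> bool" where
  "cpoly v i P \<longleftrightarrow> (\<forall>k. coeff P k \<in> const_along v i)"

text \<open>Each step first scales by the leading coefficient of \<open>E\<close>, so nothing is
  divided in the coefficient ring. The last conjunct lets the remainder compete for the least degree
  in \<open>irreducible_bezout\<close>.\<close>

lemma pseudo_division:
  fixes P E :: "'n::finite hgerm poly"
  assumes "E \<noteq> 0"
  shows "\<exists>N Q S. smult (lead_coeff E ^ N) P = Q * E + S \<and> (S = 0 \<or> degree S < degree E) \<and>
    (cpoly v i P \<longrightarrow> cpoly v i E \<longrightarrow> cpoly v i S)"
proof (induction "degree P" arbitrary: P rule: less_induct)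
  case less
  show ?case
  proof (cases "P = 0 \<or> degree P < degree E")
    case True
    then show ?thesis by (intro exI[of _ 0] exI[of _ "0 :: 'n hgerm poly"] exI[of _ P]) auto
  next
    case False
    define k where "k = degree P - degree E"
    define M where "M = monom (lead_coeff P) k"
    define P' where "P' = smult (lead_coeff E) P - M * E"
    have c: "cpoly v i P'" if "cpoly v i P" "cpoly v i E"
      using that unfolding cpoly_def P'_def M_def
      by (auto simp: coeff_monom_mult intro!: const_along_diff const_along_mult const_along_0)
    have "degree P' \<le> degree P"
    proof -
      have "degree (M * E) \<le> k + degree E"
        by (rule order_trans[OF degree_mult_le]) (simp add: M_def degree_monom_le)
      then show ?thesis unfolding P'_def using False
        by (intro degree_diff_le) (auto simp: k_def intro: degree_smult_le)
    qed
    moreover have "coeff P' (degree P) = 0"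
      using False by (simp add: P'_def M_def coeff_monom_mult k_def)
    ultimately have dP': "P' = 0 \<or> degree P' < degree P"
      by (metis le_neq_implies_less leading_coeff_0_iff)
    have "\<exists>N Q S. smult (lead_coeff E ^ N) P' = Q * E + S \<and> (S = 0 \<or> degree S < degree E) \<and>
      (cpoly v i P' \<longrightarrow> cpoly v i E \<longrightarrow> cpoly v i S)"
    proof (cases "P' = 0")
      case True
      then show ?thesis
        by (intro exI[of _ 0] exI[of _ "0 :: 'n hgerm poly"] exI[of _ "0 :: 'n hgerm poly"]) auto
    qed (use dP' less in blast)
    then obtain N Q S where *: "smult (lead_coeff E ^ N) P' = Q * E + S" "S = 0 \<or> degree S < degree E"
      "cpoly v i P' \<longrightarrow> cpoly v i E \<longrightarrow> cpoly v i S" by blast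
    have "smult (lead_coeff E ^ Suc N) P = smult (lead_coeff E ^ N) (P' + M * E)"
      by (simp add: P'_def mult.commute)
    also have "\<dots> = (Q + smult (lead_coeff E ^ N) M) * E + S"
      by (simp add: smult_add_right *(1) algebra_simps)
    finally show ?thesis using * c by blast
  qed
qed

text \<open>Division by a monic \<open>E\<close> leaves a remainder whose multiple by
  \<open>r\<close> is divisible by \<open>E\<close> yet has smaller degree, so it is zero; the
  scalar \<open>r\<close> can be cancelled.\<close>

lemma monic_dvd_if_dvd_smult:
  fixes P E :: "'n::finite hgerm poly"
  assumes "lead_coeff E = 1" "r \<noteq> 0" "smult r P = Q * E"
  shows "E dvd P"
proof -
  have E0: "E \<noteq> 0" using assms(1) by auto
  from pseudo_division[OF E0, of P undefined undefined]
  obtain N Q' S where *: "smult (lead_coeff E ^ N) P = Q' * E + S" "S = 0 \<or> degree S < degree E" by blast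
  then have P: "P = Q' * E + S" using assms(1) by simp
  have "smult r S = (Q - smult r Q') * E"
    using assms(3) unfolding P by (simp add: algebra_simps smult_add_right)
  moreover have "Q - smult r Q' = 0 \<or> degree ((Q - smult r Q') * E) \<ge> degree E"
    using E0 by (metis degree_mult_eq le_add2)
  ultimately have "S = 0" using *(2) assms(2) by (metis degree_smult_eq mult_zero_left not_le smult_eq_0_iff)
  with P show ?thesis by simp
qed

section \<open>Specialized coefficients and bounds for roots\<close>

definition eval_coeffs :: "complex^'n \<Rightarrow> 'n::finite hgerm poly \<Rightarrow> complex poly" where
  "eval_coeffs z P = (\<Sum>k\<le>degree P. monom (rep_hgerm (coeff P k) z) k)"

text \<open>Beyond the degree the right-hand side is \<open>rep_hgerm 0 z\<close>, which is known to
  vanish only near the origin; one neighbourhood serves all \<open>k\<close>.\<close>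

lemma coeff_eval_coeffs: "\<forall>\<^sub>F z in nhds 0. \<forall>k. coeff (eval_coeffs z P) k = rep_hgerm (coeff P k) z"
  using rep_eventually0(4)
proof eventually_elim
  case (elim z)
  show ?case
  proof
    fix k
    have "coeff (eval_coeffs z P) k = (if k \<le> degree P then rep_hgerm (coeff P k) z else 0)"
      by (simp add: eval_coeffs_def coeff_sum coeff_monom)
    then show "coeff (eval_coeffs z P) k = rep_hgerm (coeff P k) z"
      using elim by (simp add: coeff_eq_0 not_le)
  qed
qed

lemma eval_coeffs_mult:
  "\<forall>\<^sub>F z in nhds 0. eval_coeffs z (P * Q) = eval_coeffs z P * eval_coeffs z Q"
proof -
  let ?M = "degree P + degree Q"
  have "\<forall>\<^sub>F z in nhds 0. \<forall>k\<in>{..?M}. rep_hgerm (coeff (P * Q) k) z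
      = (\<Sum>j\<le>k. rep_hgerm (coeff P j) z * rep_hgerm (coeff Q (k - j)) z)"
  proof (rule eventually_ball_finite, simp, rule ballI)
    fix k
    have "\<forall>\<^sub>F z in nhds 0. \<forall>j\<in>{..k}. rep_hgerm (coeff P j * coeff Q (k - j)) z
        = rep_hgerm (coeff P j) z * rep_hgerm (coeff Q (k - j)) z"
      by (rule eventually_ball_finite) (auto intro: rep_eventually0(1))
    with rep_eventually0(6)[of "\<lambda>j. coeff P j * coeff Q (k - j)" "{..k}"]
    show "\<forall>\<^sub>F z in nhds 0. rep_hgerm (coeff (P * Q) k) z
      = (\<Sum>j\<le>k. rep_hgerm (coeff P j) z * rep_hgerm (coeff Q (k - j)) z)"
      by eventually_elim (simp add: coeff_mult)
  qed
  with coeff_eval_coeffs[of P] coeff_eval_coeffs[of Q] coeff_eval_coeffs[of "P * Q"] rep_eventually0(4)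
  show ?thesis
  proof eventually_elim
    case (elim z)
    show ?case
    proof (rule poly_eqI)
      fix k
      show "coeff (eval_coeffs z (P * Q)) k = coeff (eval_coeffs z P * eval_coeffs z Q) k"
      proof (cases "k \<le> ?M")
        case True
        then show ?thesis using elim by (simp add: coeff_mult)
      next
        case False
        have d: "degree (eval_coeffs z R) \<le> degree R" for R
          unfolding eval_coeffs_def by (intro degree_sum_le) (auto intro: order_trans[OF degree_monom_le])
        have "degree (eval_coeffs z P * eval_coeffs z Q) < k"
          using False degree_mult_le[of "eval_coeffs z P" "eval_coeffs z Q"] d[of P] d[of Q] by linarith
        moreover have "degree (P * Q) < k" using False degree_mult_le[of P Q] by linarith
        ultimately show ?thesis using elim by (simp add: coeff_eq_0)
      qed
    qed
  qed
qed

text \<open>Splitting off a linear factor whose root has modulus at most \<open>B\<close> multiplies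
  a bound on the coefficients by at most \<open>1 + B\<close>.\<close>

lemma coeff_bound_by_roots:
  fixes p :: "complex poly"
  assumes "\<And>\<zeta>. poly p \<zeta> = 0 \<Longrightarrow> norm \<zeta> \<le> B" "B \<ge> 0"
  shows "norm (coeff p k) \<le> norm (lead_coeff p) * (1 + B) ^ degree p"
  using assms(1)
proof (induction "degree p" arbitrary: p k)
  case 0
  then show ?case by (cases k) (auto simp: coeff_eq_0)
next
  case (Suc n)
  then have "\<not> constant (poly p)" by (simp add: constant_degree)
  then obtain \<zeta> where \<zeta>: "poly p \<zeta> = 0" using fundamental_theorem_of_algebra by blast
  then obtain q where q: "p = [:- \<zeta>, 1:] * q" by (auto simp: poly_eq_0_iff_dvd)
  then have q0: "q \<noteq> 0" using Suc.hyps(2) by auto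
  then have dq: "degree p = Suc (degree q)" unfolding q
    using degree_mult_eq[OF _ q0, of "[:- \<zeta>, 1:]"] by (simp del: mult_pCons_left)
  have lq: "lead_coeff p = lead_coeff q" unfolding q by (simp add: lead_coeff_mult del: mult_pCons_left)
  have IH: "norm (coeff q k) \<le> norm (lead_coeff q) * (1 + B) ^ degree q" for k
    using Suc.hyps dq Suc.prems q by (intro Suc.hyps(1)) auto
  have "norm (coeff p k) \<le> norm \<zeta> * norm (coeff q k) + norm (case k of 0 \<Rightarrow> 0 | Suc j \<Rightarrow> coeff q j)"
  proof (cases k)
    case (Suc j)
    then show ?thesis unfolding q
      using norm_triangle_ineq4[of "coeff q j" "\<zeta> * coeff q (Suc j)"] by (simp add: norm_mult)
  qed (simp add: q norm_mult)
  also have "\<dots> \<le> B * (norm (lead_coeff q) * (1 + B) ^ degree q) + norm (lead_coeff q) * (1 + B) ^ degree q"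
    using IH Suc.prems[OF \<zeta>] assms(2)
    by (intro add_mono mult_mono) (auto split: nat.split)
  also have "\<dots> = norm (lead_coeff q) * (1 + B) ^ Suc (degree q)" by (simp add: algebra_simps)
  finally have "norm (coeff p k) \<le> norm (lead_coeff p) * (1 + B) ^ Suc (degree q)" by (simp only: lq)
  then show ?case by (simp only: dq)
qed

text \<open>At a root of larger modulus the leading term would outweigh all others. The factor 2
  compensates for a leading coefficient that is only known to be at least \<open>1 / 2\<close> in
  modulus.\<close>

lemma root_bound_by_coeffs:
  fixes p :: "complex poly" and M :: real
  assumes "1 / 2 \<le> norm (lead_coeff p)" "\<And>k. k < degree p \<Longrightarrow> norm (coeff p k) \<le> M" "poly p \<zeta> = 0" "M \<ge> 0"
  shows "norm \<zeta> \<le> 1 + 2 * degree p * M"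
proof (rule ccontr)
  assume *: "\<not> ?thesis"
  define d where "d = degree p"
  have big: "1 < norm \<zeta>" "2 * d * M < norm \<zeta>"
  proof -
    have "0 \<le> 2 * real d * M" using assms(4) by simp
    then show "1 < norm \<zeta>" "2 * d * M < norm \<zeta>" using * unfolding d_def by linarith+
  qed
  have "0 = (\<Sum>k\<le>d. coeff p k * \<zeta> ^ k)" using assms(3) by (simp add: poly_altdef d_def)
  also have "\<dots> = coeff p d * \<zeta> ^ d + (\<Sum>k<d. coeff p k * \<zeta> ^ k)"
    by (simp add: lessThan_Suc_atMost[symmetric])
  finally have "norm (coeff p d * \<zeta> ^ d) = norm (\<Sum>k<d. coeff p k * \<zeta> ^ k)"
    by (metis add_eq_0_iff norm_minus_cancel)
  also have "\<dots> \<le> (\<Sum>k<d. M * norm \<zeta> ^ (d - 1))"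
  proof (rule sum_norm_le)
    fix k assume "k \<in> {..<d}"
    then show "norm (coeff p k * \<zeta> ^ k) \<le> M * norm \<zeta> ^ (d - 1)"
      unfolding norm_mult norm_power using big(1) assms(2)[of k] assms(4)
      by (intro mult_mono power_increasing) (auto simp: d_def)
  qed
  finally have 1: "norm (coeff p d) * norm \<zeta> ^ d \<le> d * M * norm \<zeta> ^ (d - 1)"
    by (simp add: norm_mult norm_power)
  show False
  proof (cases "d = 0")
    case True
    then show False using 1 assms(1) by (simp add: d_def)
  next
    case False
    have "1 / 2 * norm \<zeta> ^ d \<le> norm (coeff p d) * norm \<zeta> ^ d"
      using assms(1) by (intro mult_right_mono) (auto simp: d_def)
    with 1 have "norm \<zeta> * norm \<zeta> ^ (d - 1) \<le> (2 * d * M) * norm \<zeta> ^ (d - 1)"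
      using False by (simp add: power_eq_if)
    moreover have "norm \<zeta> ^ (d - 1) > 0" using big(1) by (intro zero_less_power) linarith
    ultimately show False using big(2) by simp
  qed
qed

text \<open>A factor over the quotient field of a polynomial with unit leading coefficient is
  proportional to a monic polynomial over the ring: where \<open>r\<close> does not vanish its roots are roots of
  \<open>P\<close>, hence bounded.\<close>

lemma monic_factor:
  fixes P E Q :: "'n::finite hgerm poly"
  assumes lc: "hvalue (lead_coeff P) = 1" and E: "E \<noteq> 0" and eq: "smult (lead_coeff E ^ N) P = Q * E"
  obtains E' where "lead_coeff E' = 1" "E = smult (lead_coeff E) E'"
proof -
  define r where "r = lead_coeff E"
  have r0: "r \<noteq> 0" using E by (simp add: r_def)
  \<comment> \<open>Near the origin \<open>M\<close> bounds all coefficients of \<open>P\<close>,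
    each being within 1 of its value there; \<open>B\<close> is the resulting bound on the
    roots.\<close>
  define M where "M = (\<Sum>k\<le>degree P. norm (hvalue (coeff P k)) + 1)"
  define B where "B = 1 + 2 * degree P * M"
  have M0: "M \<ge> 0" unfolding M_def by (intro sum_nonneg) simp
  have B0: "B \<ge> 0" unfolding B_def using M0 by simp
  have near: "\<forall>\<^sub>F z in nhds 0. norm (rep_hgerm a z - hvalue a) < \<epsilon>" if "\<epsilon> > 0" for a :: "'n hgerm" and \<epsilon>
  proof -
    have "isCont (rep_hgerm a) 0" by (rule holo_near_continuous[OF holo_near_rep0])
    then have "(rep_hgerm a \<longlongrightarrow> rep_hgerm a 0) (nhds 0)"
      using tendsto_at_iff_tendsto_nhds[of "rep_hgerm a" 0] by (simp add: isCont_def)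
    from tendstoD[OF this that] show ?thesis by (simp add: dist_norm hvalue_rep)
  qed
  have "\<forall>\<^sub>F z in nhds 0. \<forall>k\<in>{..degree P}. norm (rep_hgerm (coeff P k) z - hvalue (coeff P k)) < 1 / 2"
    by (rule eventually_ball_finite, simp, rule ballI, rule near) simp
  moreover have "\<forall>\<^sub>F z in nhds 0. eval_coeffs z ([:r ^ N:] * P) = eval_coeffs z [:r ^ N:] * eval_coeffs z P"
    by (rule eval_coeffs_mult)
  moreover note coeff_eval_coeffs[of P] coeff_eval_coeffs[of E] eval_coeffs_mult[of Q E] rep_eventually0(8)[of r N]
  ultimately have ev: "\<forall>\<^sub>F z in nhds 0. rep_hgerm r z \<noteq> 0 \<longrightarrow>
      (\<forall>k. norm (rep_hgerm (coeff E k) z) \<le> (1 + B) ^ degree E * norm (rep_hgerm r z))"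
  proof eventually_elim
    case (elim z)
    show ?case
    proof (intro impI allI)
      fix k assume rz: "rep_hgerm r z \<noteq> 0"
      have "degree (eval_coeffs z E) = degree E" "lead_coeff (eval_coeffs z E) = rep_hgerm r z"
      proof -
        have "degree (eval_coeffs z E) \<le> degree E"
          unfolding eval_coeffs_def by (intro degree_sum_le) (auto intro: order_trans[OF degree_monom_le])
        moreover have "coeff (eval_coeffs z E) (degree E) \<noteq> 0" using elim rz by (simp add: r_def)
        ultimately show "degree (eval_coeffs z E) = degree E" by (meson le_antisym le_degree)
        then show "lead_coeff (eval_coeffs z E) = rep_hgerm r z" using elim by (simp add: r_def)
      qed
      moreover have "norm \<zeta> \<le> B" if "poly (eval_coeffs z E) \<zeta> = 0" for \<zeta>
      proof -
        have "eval_coeffs z [:r ^ N:] = [:rep_hgerm r z ^ N:]"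
          using elim by (simp add: eval_coeffs_def monom_0)
        then have "smult (rep_hgerm r z ^ N) (eval_coeffs z P) = eval_coeffs z Q * eval_coeffs z E"
          using elim eq by (simp add: r_def)
        from arg_cong[OF this, of "\<lambda>p. poly p \<zeta>"] that rz
        have root: "poly (eval_coeffs z P) \<zeta> = 0" by simp
        have l: "norm (rep_hgerm (lead_coeff P) z - 1) < 1 / 2" using elim lc by (metis atMost_iff le_refl)
        then have l2: "1 / 2 \<le> norm (rep_hgerm (lead_coeff P) z)"
          using norm_triangle_ineq2[of 1 "rep_hgerm (lead_coeff P) z"] by (simp add: norm_minus_commute)
        have dP: "degree (eval_coeffs z P) = degree P"
        proof -
          have "degree (eval_coeffs z P) \<le> degree P"
            unfolding eval_coeffs_def by (intro degree_sum_le) (auto intro: order_trans[OF degree_monom_le])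
          moreover have "coeff (eval_coeffs z P) (degree P) \<noteq> 0" using elim l2 by auto
          ultimately show ?thesis by (meson le_antisym le_degree)
        qed
        have "norm \<zeta> \<le> 1 + 2 * degree (eval_coeffs z P) * M"
        proof (rule root_bound_by_coeffs[OF _ _ root M0])
          show "1 / 2 \<le> norm (lead_coeff (eval_coeffs z P))" using l2 elim dP by simp
          fix k assume "k < degree (eval_coeffs z P)"
          then have k: "k \<in> {..degree P}" using dP by simp
          then have "norm (rep_hgerm (coeff P k) z) \<le> norm (hvalue (coeff P k)) + 1"
          proof -
            have "norm (rep_hgerm (coeff P k) z - hvalue (coeff P k)) < 1 / 2" using elim(1) k by blast
            then show ?thesis
              using norm_triangle_ineq2[of "rep_hgerm (coeff P k) z" "hvalue (coeff P k)"] by linarith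
          qed
          also have "\<dots> \<le> M" unfolding M_def by (rule member_le_sum[OF k]) auto
          finally show "norm (coeff (eval_coeffs z P) k) \<le> M" using elim by simp
        qed
        then show ?thesis by (simp add: B_def dP)
      qed
      ultimately have "norm (coeff (eval_coeffs z E) k) \<le> norm (rep_hgerm r z) * (1 + B) ^ degree E"
        using coeff_bound_by_roots[of "eval_coeffs z E" B k] B0 by simp
      then show "norm (rep_hgerm (coeff E k) z) \<le> (1 + B) ^ degree E * norm (rep_hgerm r z)"
        using elim by (simp add: mult.commute)
    qed
  qed
  \<comment> \<open>The ratio of a coefficient of \<open>E\<close> to the leading one is bounded
    wherever the latter is nonzero, which is the hypothesis of the extension criterion.\<close>
  have "r dvd coeff E k" for k
    by (rule dvd_if_bounded_where_nonzero[OF r0, of _ "(1 + B) ^ degree E"])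
      (use ev in \<open>eventually_elim, blast\<close>)
  then obtain e where e: "\<And>k. coeff E k = r * e k" unfolding dvd_def by metis
  define E' where "E' = (\<Sum>k\<le>degree E. monom (e k) k)"
  have ce: "coeff E' k = (if k \<le> degree E then e k else 0)" for k
    by (simp add: E'_def coeff_sum coeff_monom)
  have E_eq: "E = smult r E'" by (rule poly_eqI) (simp add: ce e[symmetric] coeff_eq_0)
  then have "degree E' = degree E" using r0 by (metis degree_smult_eq)
  moreover have "r * e (degree E) = r * 1" using e[of "degree E"] by (simp add: r_def)
  then have "e (degree E) = 1" using r0 by (metis mult_left_cancel)
  ultimately have "lead_coeff E' = 1" by (simp add: ce)
  with E_eq that show ?thesis by (simp add: r_def)
qed

lemma weierstrass_poly:
  fixes a :: "'n::finite hgerm"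
  assumes "v $ i = 1" "regular_along v a"
  obtains u P where "u dvd 1" "cpoly v i P" "a = u * poly P (germ_at 0 (\<lambda>z. z $ i))"
    "hvalue (lead_coeff P) = 1" "\<And>k. k < degree P \<Longrightarrow> hvalue (coeff P k) = 0"
proof -
  show ?thesis
  proof (rule weierstrass_preparation[OF assms])
    fix d u c
    assume w: "u dvd 1" "\<And>k. c k \<in> const_along v i"
      "\<And>k. k \<le> d \<Longrightarrow> hvalue (c k) = (if k = d then 1 else 0)"
      "a = u * (\<Sum>k\<le>d. c k * germ_at 0 (\<lambda>z. z $ i) ^ k)"
    define P where "P = (\<Sum>k\<le>d. monom (c k) k)"
    have cP: "coeff P k = (if k \<le> d then c k else 0)" for k by (simp add: P_def coeff_sum coeff_monom)
    have "degree P \<le> d" unfolding P_def by (intro degree_sum_le) (auto intro: order_trans[OF degree_monom_le])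
    moreover have "coeff P d \<noteq> 0" using w(3)[of d] by (auto simp: cP)
    ultimately have d: "degree P = d" by (meson le_antisym le_degree)
    have "poly P x = (\<Sum>k\<le>d. c k * x ^ k)" for x by (simp add: P_def poly_sum poly_monom)
    moreover have "cpoly v i P" unfolding cpoly_def cP using w(2) const_along_0[of v i] by simp
    ultimately show ?thesis using that[of u P] w(1,3,4) by (simp add: cP d)
  qed
qed

text \<open>A nonzero polynomial of least degree in the ideal generated by \<open>a\<close> and \<open>b\<close> divides both of
  them up to constants; unless it is a constant, this contradicts the irreducibility of \<open>a\<close>.\<close>

lemma irreducible_bezout:
  fixes a b :: "'n::finite hgerm"
  assumes irr: "irreducible a" and nd: "\<not> a dvd b"
  obtains v i r x y where "v $ i = 1" "regular_along v a" "r \<in> const_along v i" "r \<noteq> 0" "r = x * a + y * b"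
proof -
  have nz: "a \<noteq> 0" "b \<noteq> 0" using irr nd by auto
  then have "a * b \<noteq> 0" by simp
  \<comment> \<open>A direction regular for the product is regular for both factors.\<close>
  then obtain v i where v: "v $ i = 1" "regular_along v (a * b)" by (rule regular_along_exists)
  have reg: "regular_along v a" "regular_along v b"
  proof -
    obtain \<delta> where \<delta>: "\<delta> > 0" "\<And>t. t \<noteq> 0 \<Longrightarrow> norm t < \<delta> \<Longrightarrow> rep_hgerm (a * b) (t *s v) \<noteq> 0"
      using v(2) unfolding regular_along_def by blast
    obtain e where e: "e > 0" "\<And>z. norm z < e \<Longrightarrow> rep_hgerm (a * b) z = rep_hgerm a z * rep_hgerm b z"
      using rep_eventually0(1)[of a b] unfolding eventually_nhds_metric by (auto simp: dist_norm)
    have nv: "norm v + 1 > 0" by (simp add: add_nonneg_pos)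
    have "rep_hgerm a (t *s v) \<noteq> 0 \<and> rep_hgerm b (t *s v) \<noteq> 0" if "t \<noteq> 0" "norm t < min \<delta> (e / (norm v + 1))" for t
    proof -
      have "norm t * (norm v + 1) < e" using that nv by (simp add: pos_less_divide_eq)
      then have "norm (t *s v) < e" by (simp add: norm_vector_scale algebra_simps) (smt (verit) norm_ge_zero)
      from e(2)[OF this] show ?thesis using \<delta>(2)[of t] that by auto
    qed
    moreover have "min \<delta> (e / (norm v + 1)) > 0" using \<delta> e nv by simp
    ultimately show "regular_along v a" "regular_along v b" unfolding regular_along_def by blast+
  qed
  define Z where "Z = germ_at 0 (\<lambda>z. z $ i)"
  have Z0: "hvalue Z = 0"
    unfolding Z_def by (subst hvalue_germ_at) (auto intro: holo_nearI[OF open_UNIV UNIV_I holo_on_nth])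
  obtain u P where P: "u dvd 1" "cpoly v i P" "a = u * poly P Z" "hvalue (lead_coeff P) = 1"
    "\<And>k. k < degree P \<Longrightarrow> hvalue (coeff P k) = 0"
    by (rule weierstrass_poly[OF v(1) reg(1), folded Z_def]) (rule that; assumption)
  obtain u' P' where P': "u' dvd 1" "cpoly v i P'" "b = u' * poly P' Z"
    by (rule weierstrass_poly[OF v(1) reg(2), folded Z_def]) (rule that; assumption)
  obtain w w' where w: "1 = u * w" "1 = u' * w'" using P(1) P'(1) by (auto elim!: dvdE)
  have pa: "poly P Z = w * a + 0 * b" using w(1) unfolding P(3) by (simp add: mult.assoc[symmetric] mult.commute[of w u])
  have pb: "poly P' Z = 0 * a + w' * b" using w(2) unfolding P'(3) by (simp add: mult.assoc[symmetric] mult.commute[of w' u'])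
  \<comment> \<open>The competing polynomials: nonzero, with coefficients constant along
    \<open>v\<close>, and with value at the coordinate \<open>Z\<close> in the ideal generated by
    \<open>a\<close> and \<open>b\<close>. If the least degree is 0, the constant is the wanted
    element.\<close>
  define \<Sigma> where "\<Sigma> E \<longleftrightarrow> cpoly v i E \<and> E \<noteq> 0 \<and> (\<exists>x y. poly E Z = x * a + y * b)" for E
  have "P \<noteq> 0" using P(4) by auto
  then have "\<Sigma> P" using P(2) pa unfolding \<Sigma>_def by blast
  then obtain E where E: "\<Sigma> E" "\<And>S. \<Sigma> S \<Longrightarrow> degree E \<le> degree S"
    using ex_has_least_nat[of \<Sigma> P degree] by blast
  then have E0: "E \<noteq> 0" and Ec: "cpoly v i E" by (auto simp: \<Sigma>_def)
  obtain x y where xy: "poly E Z = x * a + y * b" using E(1) by (auto simp: \<Sigma>_def)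
  show ?thesis
  proof (cases "degree E = 0")
    case True
    then obtain r where r: "E = [:r:]" by (rule degree_eq_zeroE)
    have "r \<in> const_along v i" using Ec unfolding cpoly_def r by (metis coeff_pCons_0)
    then show ?thesis using that[OF v(1) reg(1), of r x y] xy E0 r by simp
  next
    case False
    have div: "\<exists>N Q. smult (lead_coeff E ^ N) R = Q * E"
      if R: "cpoly v i R" "poly R Z = x' * a + y' * b" for R x' y'
    proof -
      from pseudo_division[OF E0, of R v i] R(1) Ec
      obtain N Q S where S: "smult (lead_coeff E ^ N) R = Q * E + S" "S = 0 \<or> degree S < degree E" "cpoly v i S"
        by blast
      have "poly S Z = lead_coeff E ^ N * poly R Z - poly Q Z * poly E Z"
        using arg_cong[OF S(1), of "\<lambda>p. poly p Z"] by (simp add: algebra_simps)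
      also have "\<dots> = (lead_coeff E ^ N * x' - poly Q Z * x) * a + (lead_coeff E ^ N * y' - poly Q Z * y) * b"
        unfolding R(2) xy by (simp add: algebra_simps)
      finally have "S = 0" using E(2)[of S] S(2,3) unfolding \<Sigma>_def by fastforce
      with S(1) show ?thesis by auto
    qed
    obtain N Q where NQ: "smult (lead_coeff E ^ N) P = Q * E" using div[OF P(2) pa] by blast
    obtain N' Q' where NQ': "smult (lead_coeff E ^ N') P' = Q' * E" using div[OF P'(2) pb] by blast
    \<comment> \<open>Replacing \<open>E\<close> by a proportional monic polynomial removes the
      power of the leading coefficient, so the division of \<open>P\<close> and \<open>P'\<close>
      becomes exact.\<close>
    obtain E' where E': "lead_coeff E' = 1" "E = smult (lead_coeff E) E'"
      by (rule monic_factor[OF P(4) E0 NQ])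
    have l0: "lead_coeff E ^ k \<noteq> 0" for k using E0 by simp
    have dP: "E' dvd P"
      by (rule monic_dvd_if_dvd_smult[OF E'(1) l0, of N _ "smult (lead_coeff E) Q"]) (metis E'(2) NQ mult_smult_left mult_smult_right)
    have dP': "E' dvd P'"
      by (rule monic_dvd_if_dvd_smult[OF E'(1) l0, of N' _ "smult (lead_coeff E) Q'"]) (metis E'(2) NQ' mult_smult_left mult_smult_right)
    have da: "poly E' Z dvd a" using dP P(3) by (auto elim!: dvdE)
    have db: "poly E' Z dvd b" using dP' P'(3) by (auto elim!: dvdE)
    \<comment> \<open>Taking values of the coefficients at the origin turns \<open>P\<close> into a
      power of the variable. A root of the reduced \<open>E'\<close> is then 0, so the constant term
      of \<open>E'\<close>, and with it \<open>poly E' Z\<close>, vanishes at the origin. A nonunit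
      dividing the irreducible \<open>a\<close> is associated to \<open>a\<close>, and it divides
      \<open>b\<close> too: a contradiction.\<close>
    have "\<not> poly E' Z dvd 1"
    proof -
      have mp: "map_poly hvalue (R * S) = map_poly hvalue R * map_poly hvalue S" for R S :: "'n hgerm poly"
        by (rule poly_eqI) (simp add: coeff_map_poly coeff_mult)
      have "degree (map_poly hvalue E') = degree E'"
        using E'(1) by (intro map_poly_degree_eq) simp
      moreover have "degree E' = degree E" using E'(2) E0 by (metis degree_smult_eq leading_coeff_0_iff)
      ultimately have "\<not> constant (poly (map_poly hvalue E'))" using False by (simp add: constant_degree)
      then obtain \<zeta> where \<zeta>: "poly (map_poly hvalue E') \<zeta> = 0" using fundamental_theorem_of_algebra by blast
      obtain Q where Q: "P = E' * Q" using dP by (rule dvdE)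
      have "map_poly hvalue P = monom 1 (degree P)"
      proof (rule poly_eqI)
        fix k
        consider "k < degree P" | "k = degree P" | "degree P < k" by linarith
        then show "coeff (map_poly hvalue P) k = coeff (monom 1 (degree P)) k"
          by cases (use P(4,5) in \<open>simp_all add: coeff_map_poly coeff_monom coeff_eq_0\<close>)
      qed
      then have "poly (map_poly hvalue P) \<zeta> = \<zeta> ^ degree P" by (simp add: poly_monom)
      moreover have "poly (map_poly hvalue P) \<zeta> = 0" unfolding Q mp using \<zeta> by simp
      ultimately have "\<zeta> = 0" by simp
      with \<zeta> have "hvalue (coeff E' 0) = 0" by (simp add: poly_0_coeff_0 coeff_map_poly)
      moreover have "hvalue (poly E' Z) = hvalue (coeff E' 0)"
        by (cases E') (simp add: Z0)
      ultimately show ?thesis by (simp add: hgerm_unit_iff)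
    qed
    moreover obtain f where f: "a = poly E' Z * f" using da by (rule dvdE)
    ultimately have "f dvd 1" using irr unfolding irreducible_def by blast
    then obtain f' where "1 = f * f'" by (rule dvdE)
    then have "poly E' Z = a * f'" using f by (metis mult.assoc mult.right_neutral)
    then have "a dvd b" using db by (metis dvd_trans dvd_triv_left)
    with nd show ?thesis by simp
  qed
qed

text \<open>If \<open>a\<close> does not divide \<open>b\<close>, then \<open>a\<close> divides
  \<open>r * c\<close> for the combination \<open>r = x * a + y * b\<close>, and \<open>r\<close>
  can be cancelled because it is constant along a direction in which \<open>a\<close> is
  regular.\<close>

lemma irreducible_imp_prime_hgerm:
  fixes a :: "'n::finite hgerm"
  assumes "irreducible a" shows "prime_elem a"
  unfolding prime_elem_def
proof (intro conjI allI impI)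
  show "a \<noteq> 0" "\<not> a dvd 1" using assms by (auto simp: irreducible_def)
  fix b c assume bc: "a dvd b * c"
  show "a dvd b \<or> a dvd c"
  proof (cases "a dvd b")
    case False
    obtain v i r x y where r: "v $ i = 1" "regular_along v a" "r \<in> const_along v i" "r \<noteq> 0" "r = x * a + y * b"
      by (rule irreducible_bezout[OF assms False])
    obtain k where k: "b * c = a * k" using bc by (rule dvdE)
    have "r * c = a * (x * c + y * k)" proof -
      have "r * c = a * (x * c) + y * (b * c)" unfolding r(5) by (simp add: algebra_simps)
      also have "\<dots> = a * (x * c + y * k)" unfolding k by (simp add: algebra_simps)
      finally show ?thesis .
    qed
    then have "a dvd r * c" by simp
    from regular_cancel_const_along[OF r(1-4) this] show ?thesis by simp
  qed simp
qed

text \<open>Otherwise the nonzero combination \<open>r\<close> would vanish on the zeros of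
  \<open>a\<close>. Every line parallel to \<open>v\<close> near the origin meets these zeros and
  \<open>r\<close> is constant on it, so \<open>r\<close> would be zero.\<close>

theorem nullstellensatz_irreducible:
  fixes a :: "'n::finite hgerm"
  assumes "irreducible a" "\<forall>\<^sub>F z in nhds 0. rep_hgerm a z = 0 \<longrightarrow> rep_hgerm b z = 0"
  shows "a dvd b"
proof (rule ccontr)
  assume "\<not> a dvd b"
  from irreducible_bezout[OF assms(1) this]
  obtain v i r x y where r: "v $ i = 1" "regular_along v a" "r \<in> const_along v i" "r \<noteq> 0" "r = x * a + y * b"
    by blast
  have "\<forall>\<^sub>F z in nhds 0. rep_hgerm a z = 0 \<longrightarrow> rep_hgerm r z = 0"
    using assms(2) rep_eventually0(2)[of "x * a" "y * b"] rep_eventually0(1)[of x a] rep_eventually0(1)[of y b]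
    by eventually_elim (simp add: r(5))
  then have "r = 0"
    using const_along_eq_0[OF r(1,2) _ r(3)] assms(1) by (simp add: irreducible_def)
  with r(4) show False by simp
qed

section \<open>Factorial consequences\<close>

lemma prime_factor_exists_hgerm:
  "a \<noteq> 0 \<Longrightarrow> \<not> a dvd 1 \<Longrightarrow> \<exists>c :: 'n::finite hgerm. prime_elem c \<and> c dvd a"
  using irreducible_factor_exists irreducible_imp_prime_hgerm by blast

lemma prime_elem_imp_irreducible_idom:
  fixes p :: "'a::idom"
  assumes "prime_elem p" shows "irreducible p"
proof -
  have p: "p \<noteq> 0" using assms by (simp add: prime_elem_def)
  have "b dvd 1" if ab: "p = a * b" "p dvd a" for a b
  proof -
    obtain c where "a = p * c" using ab(2) by (rule dvdE)
    then have "p * 1 = p * (c * b)" using ab(1) by (metis mult.assoc mult_1_right)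
    then have "1 = b * c" using p by (metis mult_left_cancel mult.commute)
    then show ?thesis by (rule dvdI)
  qed
  then show ?thesis
    using assms unfolding irreducible_def prime_elem_def by (metis dvd_refl mult.commute)
qed

text \<open>A common prime is cancelled from \<open>b\<close> and \<open>m\<close>, with the order
  of \<open>b\<close> as measure. A prime \<open>\<sigma>\<close> of the cofactor still divides the
  rest of \<open>m\<close>: it could be lost only by dividing \<open>\<pi>\<close>, and then the
  square of \<open>\<pi>\<close> would divide \<open>b\<close>.\<close>

lemma squarefree_dvdI:
  fixes b m :: "'n::finite hgerm"
  assumes "squarefree b" "\<And>\<pi>. prime_elem \<pi> \<Longrightarrow> \<pi> dvd b \<Longrightarrow> \<pi> dvd m"
  shows "b dvd m"
proof -
  have "b \<noteq> 0"
  proof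
    assume "b = 0"
    then have "0\<^sup>2 dvd b" by simp
    then have "(0 :: 'n hgerm) dvd 1" by (rule squarefreeD[OF assms(1)])
    then show False by simp
  qed
  then obtain k where "b \<notin> vanish_order k" using vanish_order_exact by blast
  with assms show ?thesis
  proof (induction k arbitrary: b m)
    case 0
    then show ?case by simp
  next
    case (Suc k)
    show ?case
    proof (cases "b dvd 1")
      case True
      then show ?thesis using dvd_trans by (metis dvd_def one_dvd)
    next
      case False
      have "b \<noteq> 0" using Suc.prems(3) vanish_order_0 by metis
      then obtain \<pi> where \<pi>: "prime_elem \<pi>" "\<pi> dvd b" using prime_factor_exists_hgerm False by blast
      obtain b' where b: "b = \<pi> * b'" using \<pi>(2) by (rule dvdE)
      obtain m' where m: "m = \<pi> * m'" using Suc.prems(2)[OF \<pi>] by (rule dvdE)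
      have sq: "squarefree b'"
        by (rule squarefreeI) (metis Suc.prems(1) b dvd_mult squarefreeD)
      have "b' \<notin> vanish_order k"
      proof
        assume "b' \<in> vanish_order k"
        moreover have "\<pi> \<in> vanish_order 1" using \<pi>(1) unfolding vanish_order_1 prime_elem_def by blast
        ultimately have "\<pi> * b' \<in> vanish_order (1 + k)" by (intro vanish_order_mult)
        with Suc.prems(3) b show False by simp
      qed
      moreover have "\<sigma> dvd m'" if \<sigma>: "prime_elem \<sigma>" "\<sigma> dvd b'" for \<sigma>
      proof -
        have "\<sigma> dvd \<pi> * m'" using Suc.prems(2)[OF \<sigma>(1)] \<sigma>(2) b m by (metis dvd_mult)
        then consider "\<sigma> dvd \<pi>" | "\<sigma> dvd m'" using \<sigma>(1) unfolding prime_elem_def by blast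
        then show ?thesis
        proof cases
          case 1
          then obtain c where c: "\<pi> = \<sigma> * c" by (rule dvdE)
          have "irreducible \<pi>" using \<pi>(1) by (rule prime_elem_imp_irreducible_idom)
          moreover have "\<not> \<sigma> dvd 1" using \<sigma>(1) unfolding prime_elem_def by blast
          ultimately have "c dvd 1" using c unfolding irreducible_def by blast
          then obtain d where "1 = c * d" by (rule dvdE)
          then have "\<sigma> = \<pi> * d" using c by (metis mult.assoc mult.right_neutral)
          then have "\<pi> dvd b'" using \<sigma>(2) by (metis dvd_trans dvd_triv_left)
          then have "\<pi>\<^sup>2 dvd b" unfolding b power2_eq_square by (rule mult_dvd_mono[OF dvd_refl])
          then have "\<pi> dvd 1" by (rule squarefreeD[OF Suc.prems(1)])
          with \<pi>(1) show ?thesis unfolding prime_elem_def by blast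
        qed
      qed
      ultimately have "b' dvd m'" using Suc.IH[OF sq] by blast
      then show ?thesis unfolding b m by (rule mult_dvd_mono[OF dvd_refl])
    qed
  qed
qed

text \<open>Read contrapositively, a factor not divisible by the square of \<open>\<pi>\<close>
  passes at least one \<open>\<pi>\<close> on to the other factor. This is how a minor supplied by
  (B) is exploited.\<close>

lemma prime_square_dvd_multD:
  fixes \<pi> :: "'a::idom"
  assumes "prime_elem \<pi>" "\<pi>\<^sup>2 dvd a * b" "\<not> \<pi> dvd a" shows "\<pi>\<^sup>2 dvd b"
proof -
  obtain k where k: "a * b = \<pi> * (\<pi> * k)" using assms(2) unfolding power2_eq_square mult.assoc dvd_def by blast
  then have "\<pi> dvd b" using assms(1,3) unfolding prime_elem_def by (metis dvd_triv_left)
  then obtain b' where b: "b = \<pi> * b'" by (rule dvdE)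
  have "\<pi> * (a * b') = \<pi> * (\<pi> * k)" using k unfolding b by (simp only: mult.left_commute)
  then have "a * b' = \<pi> * k" using assms(1) unfolding prime_elem_def by (metis mult_left_cancel)
  then have "\<pi> dvd b'" using assms(1,3) unfolding prime_elem_def by (metis dvd_triv_left)
  then show ?thesis unfolding b power2_eq_square by (rule mult_dvd_mono[OF dvd_refl])
qed

lemma squarefree_nonzero: "squarefree b \<Longrightarrow> b \<noteq> (0 :: 'a::idom)"
  using squarefreeD[of b 0] by auto

lemma prime_imp_squarefree:
  fixes \<pi> :: "'a::idom"
  assumes "prime_elem \<pi>" shows "squarefree \<pi>"
proof (rule squarefreeI)
  fix x assume "x ^ 2 dvd \<pi>"
  then obtain c where c: "\<pi> = x * (x * c)"
    unfolding power2_eq_square mult.assoc dvd_def by blast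
  then have "x dvd 1 \<or> x * c dvd 1"
    using prime_elem_imp_irreducible_idom[OF assms] unfolding irreducible_def by blast
  then show "x dvd 1" by (metis dvd_mult_left)
qed

lemma nullstellensatz_squarefree:
  fixes f g :: "'n::finite hgerm"
  assumes "squarefree f" "\<forall>\<^sub>F z in nhds p. rep_hgerm f (z - p) = 0 \<longrightarrow> rep_hgerm g (z - p) = 0"
  shows "f dvd g"
proof (rule squarefree_dvdI[OF assms(1)])
  fix \<pi> :: "'n hgerm" assume \<pi>: "prime_elem \<pi>" "\<pi> dvd f"
  obtain c where c: "f = \<pi> * c" using \<pi>(2) by (rule dvdE)
  have "\<forall>\<^sub>F z in nhds 0. rep_hgerm f z = 0 \<longrightarrow> rep_hgerm g z = 0"
    using assms(2) eventually_nhds_shift'[of "\<lambda>z. rep_hgerm f z = 0 \<longrightarrow> rep_hgerm g z = 0" p] by blast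
  with rep_eventually0(1)[of \<pi> c]
  have "\<forall>\<^sub>F z in nhds 0. rep_hgerm \<pi> z = 0 \<longrightarrow> rep_hgerm g z = 0"
    by eventually_elim (simp add: c)
  then show "\<pi> dvd g"
    by (rule nullstellensatz_irreducible[OF prime_elem_imp_irreducible_idom[OF \<pi>(1)]])
qed

section \<open>Vanishing ideal and logarithmic fields of a reduced hypersurface\<close>

lemma dvd_imp_vanish:
  assumes "f dvd (g :: 'n::finite hgerm)"
  shows "\<forall>\<^sub>F z in nhds p. rep_hgerm f (z - p) = 0 \<longrightarrow> rep_hgerm g (z - p) = 0"
proof -
  obtain c where c: "g = f * c" using assms by (rule dvdE)
  show ?thesis unfolding c using rep_mult[of f c p] by eventually_elim simp
qed

lemma vanishing_ideal_eq:
  fixes f :: "'n::finite hgerm"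
  assumes "squarefree f" "defined_by p X {f}"
  shows "vanishing_ideal p X = {g. f dvd g}"
proof -
  have X: "\<forall>\<^sub>F z in nhds p. z \<in> X \<longleftrightarrow> rep_hgerm f (z - p) = 0"
    using assms(2) by (simp add: defined_by_def)
  show ?thesis
  proof (intro equalityI subsetI)
    fix g assume "g \<in> vanishing_ideal p X"
    then have "\<forall>\<^sub>F z in nhds p. z \<in> X \<longrightarrow> rep_hgerm g (z - p) = 0" by (simp add: vanishing_ideal_def)
    with X have "\<forall>\<^sub>F z in nhds p. rep_hgerm f (z - p) = 0 \<longrightarrow> rep_hgerm g (z - p) = 0"
      by eventually_elim simp
    with nullstellensatz_squarefree[OF assms(1)] show "g \<in> {g. f dvd g}" by blast
  next
    fix g assume "g \<in> {g. f dvd g}"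
    then have "\<forall>\<^sub>F z in nhds p. rep_hgerm f (z - p) = 0 \<longrightarrow> rep_hgerm g (z - p) = 0"
      using dvd_imp_vanish by blast
    with X have "\<forall>\<^sub>F z in nhds p. z \<in> X \<longrightarrow> rep_hgerm g (z - p) = 0" by eventually_elim simp
    then show "g \<in> vanishing_ideal p X" by (simp add: vanishing_ideal_def)
  qed
qed

lemma vapply_mult: "vapply \<eta> (a * b) = vapply \<eta> a * b + a * vapply \<eta> b"
  unfolding vapply_def dgerm_mult by (simp add: sum.distrib sum_distrib_left sum_distrib_right algebra_simps)

lemma vapply_add: "vapply (\<eta> + \<xi>) a = vapply \<eta> a + vapply \<xi> a"
  unfolding vapply_def by (simp add: sum.distrib algebra_simps)

lemma vapply_scale: "vapply (c *s \<eta>) a = c * vapply \<eta> a"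
  unfolding vapply_def by (simp add: sum_distrib_left algebra_simps)

lemma vapply_0: "vapply 0 a = 0"
  unfolding vapply_def by simp

lemma Der_log_eq:
  fixes f :: "'n::finite hgerm"
  assumes "squarefree f" "defined_by p X {f}"
  shows "Der_log p X = {\<eta>. f dvd vapply \<eta> f}"
  unfolding Der_log_def vanishing_ideal_eq[OF assms]
proof (intro equalityI subsetI CollectI ballI)
  fix \<eta> assume "\<eta> \<in> {\<eta>. \<forall>g\<in>{g. f dvd g}. vapply \<eta> g \<in> {g. f dvd g}}"
  then show "f dvd vapply \<eta> f" by simp
next
  fix \<eta> g assume \<eta>: "\<eta> \<in> {\<eta>. f dvd vapply \<eta> f}" and "g \<in> {g. f dvd g}"
  then obtain c where "g = f * c" by (auto elim: dvdE)
  then show "f dvd vapply \<eta> g" using \<eta> by (simp add: vapply_mult)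
qed

section \<open>Meromorphic forms with a squarefree denominator\<close>

lemma of_germ_eq_iff [simp]: "of_germ a = of_germ b \<longleftrightarrow> a = b"
  by (simp add: of_germ_def eq_fract)

lemma of_germ_0 [simp]: "of_germ 0 = 0" and of_germ_1 [simp]: "of_germ 1 = 1"
  by (simp_all add: of_germ_def Zero_fract_def One_fract_def)

lemma of_germ_add: "of_germ (a + b) = of_germ a + of_germ b"
  and of_germ_mult: "of_germ (a * b) = of_germ a * of_germ b"
  and of_germ_uminus: "of_germ (- a) = - of_germ a"
  and of_germ_diff: "of_germ (a - b) = of_germ a - of_germ b"
  by (simp_all add: of_germ_def)

lemma of_germ_eq_0_iff [simp]: "of_germ a = 0 \<longleftrightarrow> a = 0"
  using of_germ_eq_iff[of a 0] by simp

lemma of_germ_sum: "of_germ (\<Sum>x\<in>A. f x) = (\<Sum>x\<in>A. of_germ (f x))"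
  by (induction A rule: infinite_finite_induct) (auto simp: of_germ_add)

lemma of_germ_prod: "of_germ (\<Prod>x\<in>A. f x) = (\<Prod>x\<in>A. of_germ (f x))"
  by (induction A rule: infinite_finite_induct) (auto simp: of_germ_mult)

lemma of_germ_det:
  fixes A :: "'n::finite hgerm^'m^'m"
  shows "of_germ (det A) = det (\<chi> i j. of_germ (A $ i $ j))"
proof -
  have n: "of_germ (of_nat n :: 'n hgerm) = of_nat n" for n by (induction n) (auto simp: of_germ_add)
  have "of_germ (of_int k :: 'n hgerm) = of_int k" for k by (cases k) (auto simp: n of_germ_uminus of_germ_diff of_germ_add)
  then show ?thesis by (simp add: det_def of_germ_sum of_germ_mult of_germ_prod)
qed

lemma Fract_eq_divide: "b \<noteq> 0 \<Longrightarrow> Fraction_Field.Fract a b = of_germ a / of_germ b"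
  by (simp add: of_germ_def)

lemma divide_in_range_iff:
  assumes "b \<noteq> 0" shows "of_germ a / of_germ b \<in> range of_germ \<longleftrightarrow> b dvd a"
proof -
  have "of_germ a / of_germ b = of_germ c \<longleftrightarrow> a = b * c" for c
    using assms by (simp add: divide_eq_eq mult.commute flip: of_germ_mult)
  then show ?thesis by (auto simp: dvd_def image_iff)
qed

lemma fract_cases: obtains a b where "b \<noteq> 0" "w = of_germ a / of_germ b"
  by (cases w rule: Fract_cases) (metis Fract_eq_divide)

lemma dmero_divide:
  "b \<noteq> 0 \<Longrightarrow> dmero i (of_germ a / of_germ b) = of_germ (dgerm i a * b - a * dgerm i b) / of_germ (b * b)"
  using dmero_Fract[of b i a] by (simp flip: Fract_eq_divide)

text \<open>With \<open>a\<close> the coefficients of \<open>f\<omega>\<close>, the form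
  \<open>f d\<omega>\<close> is \<open>d(f\<omega>) - (df \<and> f\<omega>) / f\<close>; its first
  term is holomorphic, so only divisibility of \<open>df \<and> f\<omega>\<close> by
  \<open>f\<close> remains.\<close>

lemma log_forms_iff:
  fixes f :: "'n::finite hgerm"
  assumes "f \<noteq> 0"
  shows "\<omega> \<in> log_forms f \<longleftrightarrow> (\<exists>a. (\<forall>i. \<omega> $ i = of_germ (a i) / of_germ f) \<and>
    (\<forall>i j. f dvd dgerm i f * a j - dgerm j f * a i))"
proof -
  have "(\<forall>i. of_germ f * \<omega> $ i \<in> range of_germ) \<longleftrightarrow> (\<exists>a. \<forall>i. \<omega> $ i = of_germ (a i) / of_germ f)"
  proof
    assume "\<forall>i. of_germ f * \<omega> $ i \<in> range of_germ"
    then have "\<forall>i. \<exists>a. of_germ f * \<omega> $ i = of_germ a" by blast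
    then obtain a where "\<forall>i. of_germ f * \<omega> $ i = of_germ (a i)" by metis
    then have "\<forall>i. \<omega> $ i = of_germ (a i) / of_germ f"
      using assms by (simp add: eq_divide_eq mult.commute)
    then show "\<exists>a. \<forall>i. \<omega> $ i = of_germ (a i) / of_germ f" by blast
  qed (use assms in auto)
  moreover have "of_germ f * d_form \<omega> $ i $ j \<in> range of_germ \<longleftrightarrow> f dvd dgerm i f * a j - dgerm j f * a i"
    if a: "\<forall>i. \<omega> $ i = of_germ (a i) / of_germ f" for a i j
  proof -
    define m where "m = f * (dgerm i (a j) - dgerm j (a i)) - (dgerm i f * a j - dgerm j f * a i)"
    have nz: "of_germ f \<noteq> 0" using assms by simp
    have "d_form \<omega> $ i $ j = of_germ m / of_germ (f * f)"
      using assms by (simp add: d_form_def a dmero_divide m_def diff_divide_distrib[symmetric] of_germ_diff[symmetric]) 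
        (simp add: algebra_simps)
    then have "of_germ f * d_form \<omega> $ i $ j = of_germ m / of_germ f"
      using nz by (simp add: of_germ_mult)
    then have "of_germ f * d_form \<omega> $ i $ j \<in> range of_germ \<longleftrightarrow> f dvd m"
      using divide_in_range_iff[OF assms] by simp
    also have "\<dots> \<longleftrightarrow> f dvd dgerm i f * a j - dgerm j f * a i"
      unfolding m_def by (metis diff_add_cancel dvd_add_right_iff dvd_diff dvd_triv_left)
    finally show ?thesis .
  qed
  ultimately show ?thesis unfolding log_forms_def mem_Collect_eq by metis
qed

lemma pairing_divide:
  assumes "\<forall>i. \<omega> $ i = of_germ (a i) / of_germ f"
  shows "pairing \<eta> \<omega> = of_germ (\<Sum>i\<in>UNIV. a i * \<eta> $ i) / of_germ f"
  using assms by (simp add: pairing_def of_germ_sum of_germ_mult sum_divide_distrib)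

text \<open>For \<open>f = \<pi> * g\<close> the gradient of \<open>f\<close> is \<open>g\<close>
  times that of \<open>\<pi>\<close> modulo \<open>\<pi>\<close>. Squarefreeness excludes that
  \<open>\<pi>\<close> divides \<open>g\<close>, and no prime divides its own gradient.\<close>

lemma prime_not_dvd_gradient:
  fixes f \<pi> :: "'n::finite hgerm"
  assumes "squarefree f" "prime_elem \<pi>" "\<pi> dvd f"
  shows "\<exists>j. \<not> \<pi> dvd dgerm j f"
proof (rule ccontr)
  assume "\<not> ?thesis"
  then have all: "\<pi> dvd dgerm j f" for j by blast
  obtain g where g: "f = \<pi> * g" using assms(3) by (rule dvdE)
  have "\<not> \<pi> dvd g"
  proof
    assume "\<pi> dvd g"
    then have "\<pi>\<^sup>2 dvd f" unfolding g power2_eq_square by (rule mult_dvd_mono[OF dvd_refl])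
    from squarefreeD[OF assms(1) this] assms(2) show False by (simp add: prime_elem_def)
  qed
  have "\<pi> dvd dgerm j \<pi>" for j
  proof -
    have "\<pi> dvd dgerm j \<pi> * g"
      using all[of j] unfolding g dgerm_mult by (metis dvd_add_left_iff dvd_triv_left)
    with \<open>\<not> \<pi> dvd g\<close> assms(2) show ?thesis unfolding prime_elem_def by blast
  qed
  then have "\<pi> = 0" using dvd_dgerm_imp_0 assms(2) unfolding prime_elem_def by blast
  with assms(2) show False by simp
qed

text \<open>Contracting the divisible two-form \<open>df \<and> f\<omega>\<close> with \<open>\<eta>\<close> gives
  \<open>\<eta>(f) f\<omega> - (f\<omega>)(\<eta>) df\<close>; no prime factor of \<open>f\<close> divides \<open>df\<close>.\<close>

lemma log_pairing:
  fixes f :: "'n::finite hgerm"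
  assumes f: "squarefree f" and \<omega>: "\<omega> \<in> log_forms f" and \<eta>: "f dvd vapply \<eta> f"
  shows "pairing \<eta> \<omega> \<in> range of_germ"
proof -
  have f0: "f \<noteq> 0" using f by (rule squarefree_nonzero)
  obtain a where a: "\<forall>i. \<omega> $ i = of_germ (a i) / of_germ f"
    "\<And>i j. f dvd dgerm i f * a j - dgerm j f * a i"
    using \<omega> unfolding log_forms_iff[OF f0] by blast
  define s where "s = (\<Sum>i\<in>UNIV. a i * \<eta> $ i)"
  have "f dvd s"
  proof (rule squarefree_dvdI[OF f])
    fix \<pi> assume \<pi>: "prime_elem \<pi>" "\<pi> dvd f"
    obtain j where j: "\<not> \<pi> dvd dgerm j f" using prime_not_dvd_gradient[OF f \<pi>] by blast
    have "(\<Sum>i\<in>UNIV. \<eta> $ i * (dgerm i f * a j - dgerm j f * a i)) = vapply \<eta> f * a j - dgerm j f * s"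
      unfolding vapply_def s_def
      by (simp add: sum_subtractf sum_distrib_left sum_distrib_right algebra_simps)
    moreover have "f dvd (\<Sum>i\<in>UNIV. \<eta> $ i * (dgerm i f * a j - dgerm j f * a i))"
      by (intro dvd_sum dvd_mult a(2))
    ultimately have "f dvd vapply \<eta> f * a j - dgerm j f * s" by simp
    then have "f dvd vapply \<eta> f * a j - (vapply \<eta> f * a j - dgerm j f * s)"
      by (rule dvd_diff[OF dvd_mult2[OF \<eta>]])
    then have "f dvd dgerm j f * s" by simp
    then have "\<pi> dvd dgerm j f * s" using \<pi>(2) by (rule dvd_trans[rotated])
    with j \<pi>(1) show "\<pi> dvd s" unfolding prime_elem_def by blast
  qed
  then show ?thesis unfolding pairing_divide[OF a(1)] s_def using divide_in_range_iff[OF f0] by blast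
qed

text \<open>The form \<open>df / f\<close> is itself logarithmic, and pairing with it alone already
  tests whether \<open>f\<close> divides \<open>\<eta>(f)\<close>.\<close>

lemma R_forms_log_forms:
  fixes f :: "'n::finite hgerm"
  assumes f: "squarefree f"
  shows "R_forms (log_forms f) = {\<eta>. f dvd vapply \<eta> f}"
proof (intro equalityI subsetI)
  fix \<eta> assume \<eta>: "\<eta> \<in> R_forms (log_forms f)"
  have f0: "f \<noteq> 0" using f by (rule squarefree_nonzero)
  define \<omega> where "\<omega> = (\<chi> i. of_germ (dgerm i f) / of_germ f)"
  have \<omega>: "\<forall>i. \<omega> $ i = of_germ (dgerm i f) / of_germ f" by (simp add: \<omega>_def)
  then have "\<omega> \<in> log_forms f"
    unfolding log_forms_iff[OF f0] by (intro exI[of _ "\<lambda>i. dgerm i f"]) (simp add: mult.commute)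
  with \<eta> have "pairing \<eta> \<omega> \<in> range of_germ" by (simp add: R_forms_def)
  then have "f dvd (\<Sum>i\<in>UNIV. dgerm i f * \<eta> $ i)"
    unfolding pairing_divide[OF \<omega>] divide_in_range_iff[OF f0] .
  then show "\<eta> \<in> {\<eta>. f dvd vapply \<eta> f}" by (simp add: vapply_def mult.commute)
qed (use log_pairing[OF f] in \<open>auto simp: R_forms_def\<close>)

section \<open>Determinants and the dual of a submodule of full rank\<close>

text \<open>This is Cramer's rule for two rows at once, with a two-by-two minor of \<open>x\<close>
  and \<open>y\<close> as factor. It comes from the ordinary rule applied twice when
  \<open>x $ i\<close> is nonzero, and from additivity in \<open>x\<close> otherwise.\<close>

lemma det_two_rows_combination:
  fixes M :: "'a::field^'n^'n"
  assumes "i \<noteq> j"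
  shows "det (\<chi> r. if r = i then \<Sum>k\<in>UNIV. x $ k *s row k M else
      if r = j then \<Sum>k\<in>UNIV. y $ k *s row k M else row r M) = (x $ i * y $ j - x $ j * y $ i) * det M"
proof -
  define F where "F x = det (\<chi> r. if r = i then \<Sum>k\<in>UNIV. x $ k *s row k M else
      if r = j then \<Sum>k\<in>UNIV. y $ k *s row k M else row r M)" for x
  have nz: "F x = (x $ i * y $ j - x $ j * y $ i) * det M" if x: "x $ i \<noteq> 0" for x
  proof -
    define u where "u = (\<Sum>k\<in>UNIV. x $ k *s row k M)"
    define M1 where "M1 = (\<chi> r. if r = i then u else row r M)"
    \<comment> \<open>The coefficients of the second combination with respect to the rows of
      \<open>M1\<close>, in which row \<open>i\<close> has already been replaced by the first
      combination.\<close>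
    define z where "z = (\<chi> k. if k = i then y $ i / x $ i else y $ k - y $ i * x $ k / x $ i)"
    have M1: "det M1 = x $ i * det M" unfolding M1_def u_def by (rule cramer_lemma_transpose)
    have "(\<Sum>k\<in>UNIV. z $ k *s row k M1) = (\<Sum>k\<in>UNIV. y $ k *s row k M)"
    proof -
      have r: "row k M1 = (if k = i then u else row k M)" for k by (simp add: M1_def row_def vec_eq_iff)
      have "(\<Sum>k\<in>UNIV. z $ k *s row k M1) = z $ i *s u + (\<Sum>k\<in>UNIV - {i}. z $ k *s row k M)"
        by (subst sum.remove[of _ i]) (auto simp: r intro!: sum.cong)
      also have "u = x $ i *s row i M + (\<Sum>k\<in>UNIV - {i}. x $ k *s row k M)"
        unfolding u_def by (rule sum.remove) auto
      also have "z $ i *s (x $ i *s row i M + (\<Sum>k\<in>UNIV - {i}. x $ k *s row k M)) + (\<Sum>k\<in>UNIV - {i}. z $ k *s row k M)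
          = y $ i *s row i M + (\<Sum>k\<in>UNIV - {i}. (z $ i * x $ k + z $ k) *s row k M)"
      proof -
        have zi: "z $ i * x $ i = y $ i" using x by (simp add: z_def)
        show ?thesis
          by (simp only: vec.scale_right_distrib vec.scale_sum_right vec.scale_left_distrib sum.distrib
              vec.scale_scale zi add.assoc)
      qed
      also have "(\<Sum>k\<in>UNIV - {i}. (z $ i * x $ k + z $ k) *s row k M) = (\<Sum>k\<in>UNIV - {i}. y $ k *s row k M)"
        by (intro sum.cong) (auto simp: z_def)
      also have "y $ i *s row i M + \<dots> = (\<Sum>k\<in>UNIV. y $ k *s row k M)"
        by (rule sum.remove[symmetric]) auto
      finally show ?thesis .
    qed
    then have "F x = det (\<chi> r. if r = j then \<Sum>k\<in>UNIV. z $ k *s row k M1 else row r M1)"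
      using assms unfolding F_def
      by (intro arg_cong[of _ _ det]) (auto simp: vec_eq_iff M1_def row_def u_def)
    also have "\<dots> = z $ j * det M1" by (rule cramer_lemma_transpose)
    also have "\<dots> = (z $ j * x $ i) * det M" unfolding M1 by (simp only: mult.assoc)
    also have "z $ j * x $ i = x $ i * y $ j - x $ j * y $ i"
      using assms x by (simp add: z_def field_simps)
    finally show ?thesis .
  qed
  have "F x = (x $ i * y $ j - x $ j * y $ i) * det M" for x
  proof (cases "x $ i = 0")
    case True
    \<comment> \<open>Both \<open>x + axis i 1\<close> and \<open>axis i 1\<close> have
      \<open>i\<close>-th entry 1, so they fall under the case already proved.\<close>
    have "F (x + axis i 1) = F x + F (axis i 1)"
      unfolding F_def
      by (subst det_row_add[symmetric], intro arg_cong[of _ _ det])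
        (auto simp: vec_eq_iff algebra_simps sum.distrib)
    moreover have "F (x + axis i 1) = ((x + axis i 1) $ i * y $ j - (x + axis i 1) $ j * y $ i) * det M"
      by (rule nz) (simp add: True axis_def)
    moreover have "F (axis i 1) = (axis i 1 $ i * y $ j - axis i 1 $ j * y $ i) * det M"
      by (rule nz) (simp add: axis_def)
    ultimately show ?thesis using assms True by (simp add: axis_def algebra_simps eq_neg_iff_add_eq_0)
  qed (rule nz)
  then show ?thesis by (simp add: F_def)
qed

text \<open>The coefficients of \<open>df \<and> f\<omega>\<close> satisfy this divisibility: replace two rows of \<open>M\<close> by the
  values of \<open>df\<close> and of \<open>f\<omega>\<close> on the columns, both divisible by \<open>f\<close>.\<close>

lemma minor_times_det:
  fixes M :: "'n::finite hgerm^'n^'n"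
  assumes x: "\<And>c. f dvd (\<Sum>k\<in>UNIV. x k * M $ k $ c)" and y: "\<And>c. f dvd (\<Sum>k\<in>UNIV. y k * M $ k $ c)"
  shows "f * f dvd (x i * y j - x j * y i) * det M"
proof (cases "i = j")
  case False
  obtain p where p: "\<And>c. (\<Sum>k\<in>UNIV. x k * M $ k $ c) = f * p c" using x unfolding dvd_def by metis
  obtain q where q: "\<And>c. (\<Sum>k\<in>UNIV. y k * M $ k $ c) = f * q c" using y unfolding dvd_def by metis
  define M' :: "'n hgerm fract^'n^'n" where "M' = (\<chi> r c. of_germ (M $ r $ c))"
  define N where "N = (\<chi> r c. if r = i then p c else if r = j then q c else M $ r $ c)"
  have "of_germ ((x i * y j - x j * y i) * det M) =
      ((\<chi> k. of_germ (x k)) $ i * (\<chi> k. of_germ (y k)) $ j - (\<chi> k. of_germ (x k)) $ j * (\<chi> k. of_germ (y k)) $ i) * det M'"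
    by (simp add: of_germ_mult of_germ_diff of_germ_det M'_def)
  also have "\<dots> = det (\<chi> r. if r = i then \<Sum>k\<in>UNIV. (\<chi> k. of_germ (x k)) $ k *s row k M' else
      if r = j then \<Sum>k\<in>UNIV. (\<chi> k. of_germ (y k)) $ k *s row k M' else row r M')"
    by (rule det_two_rows_combination[OF False, symmetric])
  also have "\<dots> = det (\<chi> r. if r = i then of_germ f *s (\<chi> c. of_germ (p c)) else
      if r = j then of_germ f *s (\<chi> c. of_germ (q c)) else row r M')"
  proof -
    have "(\<Sum>k\<in>UNIV. of_germ (x k) * of_germ (M $ k $ c)) = of_germ f * of_germ (p c)"
      "(\<Sum>k\<in>UNIV. of_germ (y k) * of_germ (M $ k $ c)) = of_germ f * of_germ (q c)" for c
      using p[of c] q[of c] by (simp_all flip: of_germ_mult of_germ_sum)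
    then show ?thesis by (intro arg_cong[of _ _ det]) (auto simp: vec_eq_iff M'_def row_def)
  qed
  also have "\<dots> = of_germ f * det (\<chi> r. if r = i then (\<chi> c. of_germ (p c)) else
      if r = j then of_germ f *s (\<chi> c. of_germ (q c)) else row r M')"
    by (rule det_row_mul)
  also have "(\<chi> r. if r = i then (\<chi> c. of_germ (p c)) else if r = j then of_germ f *s (\<chi> c. of_germ (q c)) else row r M')
     = (\<chi> r. if r = j then of_germ f *s (\<chi> c. of_germ (q c)) else if r = i then (\<chi> c. of_germ (p c)) else row r M')"
    using False by (auto simp: vec_eq_iff)
  also have "det \<dots> = of_germ f * det (\<chi> r. if r = j then (\<chi> c. of_germ (q c)) else if r = i then (\<chi> c. of_germ (p c)) else row r M')"
    by (rule det_row_mul)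
  also have "(\<chi> r. if r = j then (\<chi> c. of_germ (q c)) else if r = i then (\<chi> c. of_germ (p c)) else row r M')
      = (\<chi> r c. of_germ (N $ r $ c))"
    using False by (auto simp: vec_eq_iff N_def M'_def row_def)
  finally have "of_germ ((x i * y j - x j * y i) * det M) = of_germ (f * f * det N)"
    by (simp add: of_germ_mult of_germ_det mult.assoc)
  then show ?thesis by simp
qed simp

lemma det_times_form:
  fixes M :: "'n::finite hgerm^'n^'n"
  assumes "\<And>c. pairing (column c M) \<omega> \<in> range of_germ"
  shows "of_germ (det M) * \<omega> $ i \<in> range of_germ"
proof -
  have "\<forall>c. \<exists>h. pairing (column c M) \<omega> = of_germ h" using assms by blast
  then obtain h where h: "\<And>c. pairing (column c M) \<omega> = of_germ (h c)" by metis
  define M' :: "'n hgerm fract^'n^'n" where "M' = (\<chi> r c. of_germ (M $ r $ c))"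
  have "\<omega> $ i * det M' = det (\<chi> r. if r = i then \<Sum>k\<in>UNIV. \<omega> $ k *s row k M' else row r M')"
    by (rule cramer_lemma_transpose[symmetric])
  also have "\<dots> = det (\<chi> r c. of_germ ((\<chi> r c. if r = i then h c else M $ r $ c) $ r $ c))"
  proof -
    have "(\<Sum>k\<in>UNIV. \<omega> $ k * of_germ (M $ k $ c)) = of_germ (h c)" for c
      using h[of c] by (simp add: pairing_def column_def)
    then show ?thesis by (intro arg_cong[of _ _ det]) (auto simp: vec_eq_iff M'_def row_def)
  qed
  also have "\<dots> = of_germ (det (\<chi> r c. if r = i then h c else M $ r $ c))" by (simp only: of_germ_det)
  finally have "\<omega> $ i * det M' = of_germ (det (\<chi> r c. if r = i then h c else M $ r $ c))" .
  moreover have "det M' = of_germ (det M)" by (simp only: M'_def of_germ_det)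
  ultimately have "of_germ (det M) * \<omega> $ i = of_germ (det (\<chi> r c. if r = i then h c else M $ r $ c))"
    by (simp only: mult.commute[of "of_germ (det M)"])
  then show ?thesis by (rule range_eqI)
qed

lemma R_fields_subset_log_forms:
  fixes f :: "'n::finite hgerm"
  assumes f: "squarefree f" and L: "\<And>\<eta>. \<eta> \<in> L \<Longrightarrow> f dvd vapply \<eta> f"
    and A: "\<And>\<pi>. prime_elem \<pi> \<Longrightarrow> (\<And>M. (\<forall>j. column j M \<in> L) \<Longrightarrow> \<pi> dvd det M) \<Longrightarrow> \<pi> dvd f"
    and B: "\<And>\<pi>. prime_elem \<pi> \<Longrightarrow> \<pi> dvd f \<Longrightarrow> \<exists>M. (\<forall>j. column j M \<in> L) \<and> \<not> \<pi>\<^sup>2 dvd det M"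
  shows "R_fields L \<subseteq> log_forms f"
proof
  fix \<omega> assume \<omega>: "\<omega> \<in> R_fields L"
  have f0: "f \<noteq> 0" using f by (rule squarefree_nonzero)
  have dM: "of_germ (det M) * \<omega> $ i \<in> range of_germ" if "\<forall>j. column j M \<in> L" for M i
    by (rule det_times_form) (use \<omega> that in \<open>auto simp: R_fields_def\<close>)
  have "\<exists>c. \<omega> $ i = of_germ c / of_germ f" for i
  proof -
    obtain a b where ab: "b \<noteq> 0" "\<omega> $ i = of_germ a / of_germ b" by (rule fract_cases)
    obtain k where "b \<notin> vanish_order k" using vanish_order_exact[OF ab(1)] by blast
    \<comment> \<open>Reduction to lowest terms: common primes are cancelled one by one, and the
      order of the denominator bounds the number of steps.\<close>
    then have "\<exists>a b. b \<noteq> 0 \<and> \<omega> $ i = of_germ a / of_germ b \<and> (\<forall>\<pi>. prime_elem \<pi> \<longrightarrow> \<pi> dvd b \<longrightarrow> \<not> \<pi> dvd a)"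
      using ab
    proof (induction k arbitrary: a b)
      case (Suc k)
      show ?case
      proof (cases "\<exists>\<pi>. prime_elem \<pi> \<and> \<pi> dvd b \<and> \<pi> dvd a")
        case True
        then obtain \<pi> a' b' where \<pi>: "prime_elem \<pi>" "b = \<pi> * b'" "a = \<pi> * a'" by (auto elim!: dvdE)
        have "\<pi> \<noteq> 0" "\<pi> \<in> vanish_order 1" using \<pi>(1) unfolding vanish_order_1 prime_elem_def by blast+
        then have "b' \<notin> vanish_order k"
          using vanish_order_mult[of \<pi> 1 b' k] Suc.prems(1) \<pi>(2) by (metis plus_1_eq_Suc)
        moreover have "b' \<noteq> 0" using Suc.prems(2) \<pi>(2) by auto
        moreover have "\<omega> $ i = of_germ a' / of_germ b'"
          using Suc.prems(3) \<open>\<pi> \<noteq> 0\<close> unfolding \<pi>(2,3) by (simp add: of_germ_mult)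
        ultimately show ?thesis by (rule Suc.IH)
      qed (use Suc.prems in blast)
    qed simp
    then obtain a b where ab: "b \<noteq> 0" "\<omega> $ i = of_germ a / of_germ b"
      "\<And>\<pi>. prime_elem \<pi> \<Longrightarrow> \<pi> dvd b \<Longrightarrow> \<not> \<pi> dvd a" by blast
    have bg: "b dvd a * det M" if M: "\<forall>j. column j M \<in> L" for M
      using dM[OF M, of i] divide_in_range_iff[OF ab(1), of "a * det M"] by (simp add: ab(2) of_germ_mult mult.commute)
    have \<pi>f: "\<pi> dvd f" if \<pi>: "prime_elem \<pi>" "\<pi> dvd b" for \<pi>
    proof (rule A[OF \<pi>(1)])
      fix M :: "'n hgerm^'n^'n" assume "\<forall>j. column j M \<in> L"
      then have "\<pi> dvd a * det M" using bg \<pi>(2) dvd_trans by blast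
      with ab(3)[OF \<pi>] \<pi>(1) show "\<pi> dvd det M" unfolding prime_elem_def by blast
    qed
    \<comment> \<open>A prime whose square divides the denominator is coprime to the numerator, so
      its square would divide every determinant with columns in \<open>L\<close>, against
      (B).\<close>
    have "squarefree b"
    proof (rule squarefreeI)
      fix y assume y: "y\<^sup>2 dvd b"
      show "y dvd 1"
      proof (rule ccontr)
        assume "\<not> y dvd 1"
        moreover have "y \<noteq> 0" using y ab(1) by auto
        ultimately obtain \<pi> where \<pi>: "prime_elem \<pi>" "\<pi> dvd y" using prime_factor_exists_hgerm by blast
        have "\<pi>\<^sup>2 dvd y\<^sup>2" unfolding power2_eq_square using \<pi>(2) by (intro mult_dvd_mono)
        then have p2: "\<pi>\<^sup>2 dvd b" using y by (rule dvd_trans)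
        have p1: "\<pi> dvd b" using p2 unfolding power2_eq_square by (rule dvd_mult_left)
        obtain M where M: "\<forall>j. column j M \<in> L" "\<not> \<pi>\<^sup>2 dvd det M" using B[OF \<pi>(1) \<pi>f[OF \<pi>(1) p1]] by blast
        have "\<pi>\<^sup>2 dvd a * det M" using bg[OF M(1)] p2 dvd_trans by blast
        then have "\<pi>\<^sup>2 dvd det M" using prime_square_dvd_multD[OF \<pi>(1)] ab(3)[OF \<pi>(1) p1] by blast
        with M(2) show False by blast
      qed
    qed
    then have "b dvd f" using \<pi>f by (rule squarefree_dvdI)
    then obtain c where c: "f = b * c" by (rule dvdE)
    then have "\<omega> $ i = of_germ (a * c) / of_germ f" using ab(1,2) f0 by (simp add: of_germ_mult)
    then show ?thesis by blast
  qed
  then obtain a where a: "\<And>i. \<omega> $ i = of_germ (a i) / of_germ f" by metis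
  have "f dvd dgerm i f * a j - dgerm j f * a i" for i j
  proof (rule squarefree_dvdI[OF f])
    fix \<pi> assume \<pi>: "prime_elem \<pi>" "\<pi> dvd f"
    obtain M where M: "\<forall>j. column j M \<in> L" "\<not> \<pi>\<^sup>2 dvd det M" using B[OF \<pi>] by blast
    have "f * f dvd (dgerm i f * a j - dgerm j f * a i) * det M"
    proof (rule minor_times_det)
      fix c
      show "f dvd (\<Sum>k\<in>UNIV. dgerm k f * M $ k $ c)"
        using L[of "column c M"] M(1) by (simp add: vapply_def column_def mult.commute)
      have "pairing (column c M) \<omega> \<in> range of_germ" using \<omega> M(1) by (simp add: R_fields_def)
      then show "f dvd (\<Sum>k\<in>UNIV. a k * M $ k $ c)"
        using pairing_divide[of \<omega> a f "column c M"] divide_in_range_iff[OF f0] a by (simp add: column_def)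
    qed
    moreover have "\<pi>\<^sup>2 dvd f * f" unfolding power2_eq_square using \<pi>(2) by (intro mult_dvd_mono)
    ultimately have "\<pi>\<^sup>2 dvd (dgerm i f * a j - dgerm j f * a i) * det M" using dvd_trans by blast
    then show "\<pi> dvd dgerm i f * a j - dgerm j f * a i"
      using prime_square_dvd_multD[OF \<pi>(1)] M(2) by blast
  qed
  with a show "\<omega> \<in> log_forms f" unfolding log_forms_iff[OF f0] by blast
qed

section \<open>Linear forms on a submodule of full rank\<close>

lemma module_dual_sum:
  fixes L :: "('n::finite hgerm^'n) set"
  assumes "hvec.subspace L" "\<phi> \<in> module_dual (*s) L" "finite A" "\<And>k. k \<in> A \<Longrightarrow> m k \<in> L"
  shows "(\<Sum>k\<in>A. c k *s m k) \<in> L \<and> \<phi> (\<Sum>k\<in>A. c k *s m k) = (\<Sum>k\<in>A. c k * \<phi> (m k))"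
  using assms(3,4)
proof (induction A rule: finite_induct)
  case empty
  have "\<phi> (0 *s 0) = 0 * \<phi> 0"
    using assms(1,2) hvec.subspace_0 unfolding module_dual_def by blast
  then show ?case using hvec.subspace_0[OF assms(1)] by simp
next
  case (insert k A)
  have "c k *s m k \<in> L" using hvec.subspace_scale[OF assms(1)] insert.prems by blast
  moreover have "\<phi> (c k *s m k) = c k * \<phi> (m k)"
    using assms(2) insert.prems unfolding module_dual_def by blast
  moreover have "\<phi> (x + y) = \<phi> x + \<phi> y" if "x \<in> L" "y \<in> L" for x y
    using assms(2) that unfolding module_dual_def by blast
  ultimately show ?case using insert hvec.subspace_add[OF assms(1)] by simp
qed

lemma matrix_vector_mult_nth: "(A *v x) $ r = (\<Sum>k\<in>UNIV. A $ r $ k * x $ k)"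
  by (simp add: matrix_vector_mult_def)

text \<open>A linear form on \<open>L\<close> is the pairing with a meromorphic form, by Cramer's rule for a matrix
  of full rank with columns in \<open>L\<close>; reflexivity is applied to the evaluation at \<open>\<eta>\<close> and tested on the
  coordinate functionals.\<close>

lemma reflexive_imp_R_R_subset:
  fixes L :: "('n::finite hgerm^'n) set" and M :: "'n hgerm^'n^'n"
  assumes L: "hvec.subspace L" and refl: "reflexive_module L"
    and M: "\<And>j. column j M \<in> L" and det: "det M \<noteq> 0"
  shows "R_forms (R_fields L) \<subseteq> L"
proof
  fix \<eta> assume \<eta>: "\<eta> \<in> R_forms (R_fields L)"
  define L' where "L' = module_dual (*s) L"
  define v where "v x = (\<chi> i. of_germ (x $ i))" for x :: "'n hgerm^'n"
  define M' :: "'n hgerm fract^'n^'n" where "M' = (\<chi> r c. of_germ (M $ r $ c))"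
  have dM': "det M' = of_germ (det M)" by (simp only: M'_def of_germ_det)
  then have "invertible M'" using det by (simp add: invertible_det_nz)
  then obtain B where B: "M' ** B = mat 1" by (auto simp: invertible_def)
  have MB: "M' *v (B *v y) = y" for y using B by (simp add: matrix_vector_mul_assoc)
  \<comment> \<open>The meromorphic form whose values on the columns of \<open>M\<close> are
    prescribed by \<open>\<phi>\<close>, obtained from the inverse matrix \<open>B\<close>.\<close>
  define \<omega> where "\<omega> \<phi> = (\<chi> i. \<Sum>k\<in>UNIV. of_germ (\<phi> (column k M)) * B $ k $ i)" for \<phi> :: "'n hgerm^'n \<Rightarrow> 'n hgerm"
  have pair: "pairing x (\<omega> \<phi>) = (\<Sum>k\<in>UNIV. of_germ (\<phi> (column k M)) * (B *v v x) $ k)" for x \<phi>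
  proof -
    have "pairing x (\<omega> \<phi>) = (\<Sum>i\<in>UNIV. \<Sum>k\<in>UNIV. of_germ (\<phi> (column k M)) * B $ k $ i * of_germ (x $ i))"
      by (simp add: pairing_def \<omega>_def sum_distrib_right)
    also have "\<dots> = (\<Sum>k\<in>UNIV. \<Sum>i\<in>UNIV. of_germ (\<phi> (column k M)) * B $ k $ i * of_germ (x $ i))"
      by (rule sum.swap)
    finally show ?thesis
      by (simp add: matrix_vector_mult_def v_def sum_distrib_left mult.assoc)
  qed
  have pair_L: "pairing x (\<omega> \<phi>) = of_germ (\<phi> x)" if \<phi>: "\<phi> \<in> L'" and x: "x \<in> L" for x \<phi>
  proof -
    define D where "D k = det (\<chi> i j. if j = k then x $ i else M $ i $ j)" for k
    have D: "of_germ (D k) = (B *v v x) $ k * of_germ (det M)" for k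
    proof -
      have "of_germ (D k) = det (\<chi> i j. if j = k then (M' *v (B *v v x)) $ i else M' $ i $ j)"
        unfolding D_def of_germ_det MB by (intro arg_cong[of _ _ det]) (auto simp: vec_eq_iff v_def M'_def)
      also have "\<dots> = (B *v v x) $ k * det M'" by (rule cramer_lemma)
      finally show ?thesis by (simp only: dM')
    qed
    \<comment> \<open>A multiple of \<open>x\<close> is a combination of the columns with
      coefficients in the ring itself, so linearity of \<open>\<phi>\<close> on \<open>L\<close>
      applies; afterwards \<open>det M\<close> is cancelled.\<close>
    have "det M *s x = (\<Sum>k\<in>UNIV. D k *s column k M)"
    proof (rule vec_eq_iff[THEN iffD2, rule_format])
      fix r
      have "v x $ r = (\<Sum>k\<in>UNIV. M' $ r $ k * (B *v v x) $ k)"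
        by (simp only: matrix_vector_mult_nth[symmetric] MB)
      then have "of_germ (det M) * of_germ (x $ r) = (\<Sum>k\<in>UNIV. of_germ (M $ r $ k) * of_germ (D k))"
        unfolding D by (simp add: v_def M'_def sum_distrib_left mult_ac)
      then have "of_germ (det M * x $ r) = of_germ (\<Sum>k\<in>UNIV. M $ r $ k * D k)"
        by (simp add: of_germ_mult of_germ_sum)
      then show "(det M *s x) $ r = (\<Sum>k\<in>UNIV. D k *s column k M) $ r"
        by (simp add: column_def mult.commute)
    qed
    then have "\<phi> (det M *s x) = (\<Sum>k\<in>UNIV. D k * \<phi> (column k M))"
      using module_dual_sum[OF L \<phi>[unfolded L'_def], of UNIV "\<lambda>k. column k M" D] M by simp
    moreover have "\<phi> (det M *s x) = det M * \<phi> x" using \<phi> x unfolding L'_def module_dual_def by blast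
    ultimately have "of_germ (det M * \<phi> x) = of_germ (\<Sum>k\<in>UNIV. D k * \<phi> (column k M))" by simp
    then have "of_germ (det M) * of_germ (\<phi> x) = (\<Sum>k\<in>UNIV. of_germ (D k) * of_germ (\<phi> (column k M)))"
      by (simp only: of_germ_mult of_germ_sum)
    also have "\<dots> = of_germ (det M) * pairing x (\<omega> \<phi>)"
    proof -
      have *: "a * b * c = b * (c * a)" for a b c :: "'n hgerm fract" by (simp add: ac_simps)
      show ?thesis unfolding D pair sum_distrib_left
        by (rule sum.cong, simp, rule *)
    qed
    finally show ?thesis using det by simp
  qed
  have "pairing \<eta> (\<omega> \<phi>) \<in> range of_germ" if \<phi>: "\<phi> \<in> L'" for \<phi>
  proof -
    have "\<omega> \<phi> \<in> R_fields L" using pair_L[OF \<phi>] by (auto simp: R_fields_def)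
    with \<eta> show ?thesis by (auto simp: R_forms_def)
  qed
  then have "\<forall>\<phi>. \<exists>q. \<phi> \<in> L' \<longrightarrow> pairing \<eta> (\<omega> \<phi>) = of_germ q" by blast
  then obtain q where q: "\<And>\<phi>. \<phi> \<in> L' \<Longrightarrow> pairing \<eta> (\<omega> \<phi>) = of_germ (q \<phi>)" by metis
  define \<Psi> where "\<Psi> \<phi> = (if \<phi> \<in> L' then q \<phi> else 0)" for \<phi>
  have "\<Psi> \<in> module_dual (\<lambda>a \<phi> x. a * \<phi> x) L'"
    unfolding module_dual_def mem_Collect_eq
  proof (intro conjI ballI allI impI)
    fix \<phi> \<psi> assume l: "\<phi> \<in> L'" "\<psi> \<in> L'"
    then have l': "\<phi> + \<psi> \<in> L'" unfolding L'_def module_dual_def by (simp add: algebra_simps)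
    have "of_germ (q (\<phi> + \<psi>)) = of_germ (q \<phi> + q \<psi>)"
      unfolding q[OF l', symmetric] of_germ_add q[OF l(1), symmetric] q[OF l(2), symmetric]
      by (simp add: pair of_germ_add sum.distrib algebra_simps)
    then show "\<Psi> (\<phi> + \<psi>) = \<Psi> \<phi> + \<Psi> \<psi>" using l l' by (simp add: \<Psi>_def)
  next
    fix a \<phi> assume l: "\<phi> \<in> L'"
    then have l': "(\<lambda>x. a * \<phi> x) \<in> L'" unfolding L'_def module_dual_def by (simp add: algebra_simps)
    have "of_germ (q (\<lambda>x. a * \<phi> x)) = of_germ (a * q \<phi>)"
      unfolding q[OF l', symmetric] of_germ_mult q[OF l, symmetric]
      by (simp add: pair of_germ_mult sum_distrib_left mult.assoc)
    then show "\<Psi> (\<lambda>x. a * \<phi> x) = a * \<Psi> \<phi>" using l l' by (simp add: \<Psi>_def)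
  qed (simp add: \<Psi>_def)
  then have "\<Psi> \<in> (\<lambda>x \<phi>. if \<phi> \<in> L' then \<phi> x else 0) ` L"
    using refl unfolding reflexive_module_def Let_def L'_def[symmetric] bij_betw_def by simp
  then obtain x where x: "x \<in> L" "\<Psi> = (\<lambda>\<phi>. if \<phi> \<in> L' then \<phi> x else 0)" by blast
  have "x = \<eta>"
  proof (rule vec_eq_iff[THEN iffD2, rule_format])
    fix i
    define \<phi> where "\<phi> y = (if y \<in> L then y $ i else 0)" for y :: "'n hgerm^'n"
    have l: "\<phi> \<in> L'"
      using hvec.subspace_add[OF L] hvec.subspace_scale[OF L] unfolding L'_def module_dual_def \<phi>_def by simp
    have "of_germ (q \<phi>) = (\<Sum>k\<in>UNIV. M' $ i $ k * (B *v v \<eta>) $ k)"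
      unfolding q[OF l, symmetric] pair using M by (simp add: \<phi>_def column_def M'_def)
    also have "\<dots> = of_germ (\<eta> $ i)"
      unfolding matrix_vector_mult_nth[symmetric] MB by (simp add: v_def)
    finally have "q \<phi> = \<eta> $ i" by simp
    moreover have "q \<phi> = x $ i"
      using fun_cong[OF x(2), of \<phi>] l x(1) by (simp add: \<Psi>_def \<phi>_def)
    ultimately show "x $ i = \<eta> $ i" by simp
  qed
  with x(1) show "\<eta> \<in> L" by simp
qed

section \<open>The prime factors of the equation and the components of the hypersurface\<close>

lemma span_singleton_hgerm: "hring.span {h} = {g :: 'n::finite hgerm. h dvd g}"
proof -
  have "g \<in> hring.span {h} \<longleftrightarrow> h dvd g" for g
    unfolding hring.span_singleton dvd_def by (simp only: image_iff mult.commute[of h]) blast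
  then show ?thesis by blast
qed

lemma fitting_ideal_subset_iff:
  "fitting_ideal L \<subseteq> {g. h dvd g} \<longleftrightarrow> (\<forall>M. (\<forall>j. column j M \<in> L) \<longrightarrow> h dvd det M)"
proof
  assume "fitting_ideal L \<subseteq> {g. h dvd g}"
  moreover have "{det M |M. \<forall>j. column j M \<in> L} \<subseteq> fitting_ideal L"
    unfolding fitting_ideal_def by (rule hring.span_superset)
  ultimately have "{det M |M. \<forall>j. column j M \<in> L} \<subseteq> {g. h dvd g}" by (rule subset_trans[rotated])
  then show "\<forall>M. (\<forall>j. column j M \<in> L) \<longrightarrow> h dvd det M" by blast
next
  assume *: "\<forall>M. (\<forall>j. column j M \<in> L) \<longrightarrow> h dvd det M"
  have "hring.subspace {g. h dvd g}" unfolding span_singleton_hgerm[symmetric]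
    by (rule hring.subspace_span)
  then show "fitting_ideal L \<subseteq> {g. h dvd g}"
    unfolding fitting_ideal_def using * by (intro hring.span_minimal) auto
qed

lemma ideal_mult_principal:
  "ideal_mult {g. h dvd g} {g. h dvd g} = {g :: 'n::finite hgerm. h\<^sup>2 dvd g}"
proof (intro equalityI)
  have "hring.subspace {g :: 'n hgerm. h\<^sup>2 dvd g}" unfolding span_singleton_hgerm[symmetric]
    by (rule hring.subspace_span)
  then show "ideal_mult {g. h dvd g} {g. h dvd g} \<subseteq> {g. h\<^sup>2 dvd g}"
    unfolding ideal_mult_def
    by (intro hring.span_minimal) (auto simp: power2_eq_square intro: mult_dvd_mono)
  show "{g. h\<^sup>2 dvd g} \<subseteq> ideal_mult {g. h dvd g} {g. h dvd g}"
  proof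
    fix g assume "g \<in> {g. h\<^sup>2 dvd g}"
    then obtain c where "g = h * (h * c)" by (auto simp: power2_eq_square mult.assoc dvd_def)
    then show "g \<in> ideal_mult {g. h dvd g} {g. h dvd g}"
      unfolding ideal_mult_def mem_Collect_eq
      by (intro hring.span_base CollectI exI[of _ h] exI[of _ "h * c"] conjI dvd_refl dvd_triv_left)
  qed
qed

section \<open>Prime factors as irreducible components\<close>

definition zero_set :: "complex^'n \<Rightarrow> 'n::finite hgerm \<Rightarrow> (complex^'n) set" where
  "zero_set p h = {z. rep_hgerm h (z - p) = 0}"

lemma defined_by_zero_set: "defined_by p (zero_set p h) {h}"
  by (simp add: defined_by_def zero_set_def)

text \<open>This makes the hypothesis on components available for each prime factor of
  \<open>f\<close>. For irreducibility: if neither part of a decomposition has all its equations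
  divisible by \<open>\<pi>\<close>, a product of two undivided equations vanishes on the zero set,
  and the Nullstellensatz contradicts primality.\<close>

lemma prime_component:
  fixes f \<pi> :: "'n::finite hgerm"
  assumes f: "squarefree f" "defined_by p X {f}" and \<pi>: "prime_elem \<pi>" "\<pi> dvd f"
  shows "component_germ p (zero_set p \<pi>) X \<and> hypersurface_germ p (zero_set p \<pi>)"
proof -
  let ?X0 = "zero_set p \<pi>"
  have \<pi>0: "\<pi> \<noteq> 0" "\<not> \<pi> dvd 1" using \<pi>(1) by (auto simp: prime_elem_def)
  obtain g where g: "f = \<pi> * g" using \<pi>(2) by (rule dvdE)
  have ng: "\<not> \<pi> dvd g"
  proof
    assume "\<pi> dvd g"
    then have "\<pi>\<^sup>2 dvd f" unfolding g power2_eq_square by (rule mult_dvd_mono[OF dvd_refl])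
    from squarefreeD[OF f(1) this] \<pi>0 show False by simp
  qed
  have sq: "squarefree \<pi>" by (rule prime_imp_squarefree[OF \<pi>(1)])
  have null: "\<pi> dvd h" if "\<forall>\<^sub>F z in nhds p. z \<in> ?X0 \<longrightarrow> rep_hgerm h (z - p) = 0" for h
    using nullstellensatz_squarefree[OF sq, of p h] that by (simp add: zero_set_def)
  have pX0: "p \<in> ?X0" using \<pi>0(2) by (simp add: zero_set_def hgerm_unit_iff hvalue_rep)
  have "analytic_germ p ?X0" unfolding analytic_germ_def
    by (intro exI[of _ "{\<pi>}"]) (simp add: defined_by_zero_set)
  moreover have "germ_eq p ?X0 Y \<or> germ_eq p ?X0 Z"
    if Y: "analytic_germ p Y" and Z: "analytic_germ p Z" and eq: "germ_eq p ?X0 (Y \<union> Z)" for Y Z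
  proof -
    obtain G H where G: "finite G" "defined_by p Y G" and H: "finite H" "defined_by p Z H"
      using Y Z unfolding analytic_germ_def by blast
    have dv: "\<pi> dvd h \<Longrightarrow> \<forall>\<^sub>F z in nhds p. z \<in> ?X0 \<longrightarrow> rep_hgerm h (z - p) = 0" for h
      using dvd_imp_vanish[of \<pi> h p] by (simp add: zero_set_def)
    have sub: "germ_eq p ?X0 Y'"
      if "finite G'" "defined_by p Y' G'" "\<forall>h\<in>G'. \<pi> dvd h" "germ_le p Y' ?X0" for Y' G'
    proof -
      have "\<forall>\<^sub>F z in nhds p. \<forall>h\<in>G'. z \<in> ?X0 \<longrightarrow> rep_hgerm h (z - p) = 0"
        using that(1,3) dv by (intro eventually_ball_finite) auto
      with that(2,4) show ?thesis unfolding defined_by_def germ_le_def germ_eq_def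
        by eventually_elim blast
    qed
    have le: "germ_le p Y ?X0" "germ_le p Z ?X0"
      using eq unfolding germ_eq_def germ_le_def by (eventually_elim, blast)+
    show ?thesis
    proof (cases "(\<forall>h\<in>G. \<pi> dvd h) \<or> (\<forall>h\<in>H. \<pi> dvd h)")
      case True
      then show ?thesis using sub[OF G] sub[OF H] le by blast
    next
      case False
      then obtain h k where hk: "h \<in> G" "\<not> \<pi> dvd h" "k \<in> H" "\<not> \<pi> dvd k" by blast
      have "\<forall>\<^sub>F z in nhds p. z \<in> ?X0 \<longrightarrow> rep_hgerm (h * k) (z - p) = 0"
        using eq G(2) H(2) rep_mult[of h k p] unfolding germ_eq_def defined_by_def
        by eventually_elim (use hk in auto)
      then have "\<pi> dvd h * k" by (rule null)
      with hk \<pi>(1) show ?thesis unfolding prime_elem_def by blast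
    qed
  qed
  ultimately have irr: "irreducible_germ p ?X0" using pX0 unfolding irreducible_germ_def by blast
  have leX: "germ_le p ?X0 X"
    using f(2) dvd_imp_vanish[OF \<pi>(2), of p] unfolding germ_le_def defined_by_def
    by eventually_elim (simp add: zero_set_def)
  have "germ_eq p ?X0 Y" if Y: "irreducible_germ p Y" "germ_le p ?X0 Y" "germ_le p Y X" for Y
  proof -
    obtain G where G: "finite G" "defined_by p Y G"
      using Y(1) unfolding irreducible_germ_def analytic_germ_def by blast
    \<comment> \<open>As \<open>f = \<pi> * g\<close>, a larger irreducible germ inside
      \<open>X\<close> splits along the zeros of \<open>\<pi>\<close> and of \<open>g\<close>; lying
      in the latter would make \<open>\<pi>\<close> divide \<open>g\<close> and contradict
      squarefreeness.\<close>
    let ?Y1 = "Y \<inter> ?X0" and ?Y2 = "Y \<inter> zero_set p g"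
    have "defined_by p ?Y1 (insert \<pi> G)" "defined_by p ?Y2 (insert g G)"
      using G(2) unfolding defined_by_def by (eventually_elim, auto simp: zero_set_def)+
    then have "analytic_germ p ?Y1" "analytic_germ p ?Y2"
      using G(1) unfolding analytic_germ_def by (metis finite_insert)+
    moreover have "germ_eq p Y (?Y1 \<union> ?Y2)"
      using Y(3) f(2) rep_mult[of \<pi> g p] unfolding germ_eq_def germ_le_def defined_by_def
      by eventually_elim (auto simp: zero_set_def g)
    ultimately have "germ_eq p Y ?Y1 \<or> germ_eq p Y ?Y2" using Y(1) unfolding irreducible_germ_def by blast
    then show ?thesis
    proof
      assume "germ_eq p Y ?Y1"
      with Y(2) show ?thesis unfolding germ_eq_def germ_le_def by eventually_elim blast
    next
      assume "germ_eq p Y ?Y2"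
      with Y(2) have "\<forall>\<^sub>F z in nhds p. z \<in> ?X0 \<longrightarrow> rep_hgerm g (z - p) = 0"
        unfolding germ_eq_def germ_le_def
      proof eventually_elim
        case (elim z)
        then have "z \<in> ?X0 \<longrightarrow> z \<in> zero_set p g" by blast
        then show ?case by (simp only: zero_set_def mem_Collect_eq)
      qed
      with null ng show ?thesis by blast
    qed
  qed
  then have "component_germ p ?X0 X" using irr leX unfolding component_germ_def by blast
  moreover have "hypersurface_germ p ?X0" unfolding hypersurface_germ_def
    using pX0 \<pi>0 defined_by_zero_set by blast
  ultimately show ?thesis by blast
qed

lemma cond_B1_zero_set:
  fixes \<pi> :: "'n::finite hgerm"
  assumes "prime_elem \<pi>" "cond_B1 p (zero_set p \<pi>) L"
  shows "\<exists>M. (\<forall>j. column j M \<in> L) \<and> \<not> \<pi>\<^sup>2 dvd det M"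
proof -
  have "vanishing_ideal p (zero_set p \<pi>) = {g. \<pi> dvd g}"
    by (rule vanishing_ideal_eq[OF prime_imp_squarefree[OF assms(1)] defined_by_zero_set])
  then have "\<not> fitting_ideal L \<subseteq> {g. \<pi>\<^sup>2 dvd g}"
    using assms(2) by (simp add: cond_B1_def ideal_mult_principal)
  then show ?thesis unfolding fitting_ideal_subset_iff by blast
qed

lemma log_forms_of_fitting_conditions:
  fixes p :: "complex^'n::finite" and X :: "(complex^'n) set"
    and f :: "'n hgerm" and L :: "('n hgerm^'n) set"
  assumes "p \<in> X" and f: "squarefree f" "defined_by p X {f}"
    and L: "hvec.subspace L" "L \<subseteq> Der_log p X"
    and A: "\<And>h. squarefree h \<Longrightarrow> fitting_ideal L \<subseteq> hring.span {h} \<Longrightarrow> h dvd f"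
    and B: "\<And>\<pi>. prime_elem \<pi> \<Longrightarrow> \<pi> dvd f \<Longrightarrow> \<exists>M. (\<forall>j. column j M \<in> L) \<and> \<not> \<pi>\<^sup>2 dvd det M"
  shows "R_fields L = log_forms f \<and> R_forms (R_fields L) = Der_log p X \<and>
    (reflexive_module L \<longrightarrow> L = Der_log p X)"
proof -
  note D = Der_log_eq[OF f]
  have R: "R_fields L = log_forms f"
  proof
    show "R_fields L \<subseteq> log_forms f"
    proof (rule R_fields_subset_log_forms[OF f(1)])
      fix \<pi> :: "'n hgerm"
      assume \<pi>: "prime_elem \<pi>" and *: "\<And>M. (\<forall>j. column j M \<in> L) \<Longrightarrow> \<pi> dvd det M"
      show "\<pi> dvd f"
        by (rule A[OF prime_imp_squarefree[OF \<pi>]]) (use * in \<open>simp add: span_singleton_hgerm fitting_ideal_subset_iff\<close>)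
    qed (use L(2) D B in auto)
    show "log_forms f \<subseteq> R_fields L"
      using log_pairing[OF f(1)] L(2) D by (auto simp: R_fields_def)
  qed
  then have RR: "R_forms (R_fields L) = Der_log p X" using R_forms_log_forms[OF f(1)] D by simp
  have "L = Der_log p X" if refl: "reflexive_module L"
  proof -
    \<comment> \<open>Because \<open>p\<close> lies on \<open>X\<close>, the germ \<open>f\<close>
      is a nonunit and has a prime factor; (B) for this factor provides a nonzero determinant, that
      is, full rank.\<close>
    have "rep_hgerm f 0 = 0"
      using eventually_nhds_x_imp_x[OF f(2)[unfolded defined_by_def]] assms(1) by simp
    then have "\<not> f dvd 1" by (simp add: hgerm_unit_iff hvalue_rep)
    then obtain \<pi> where "prime_elem \<pi>" "\<pi> dvd f"
      using prime_factor_exists_hgerm[OF squarefree_nonzero[OF f(1)]] by blast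
    then obtain M where M: "\<And>j. column j M \<in> L" "\<not> \<pi>\<^sup>2 dvd det M" using B by blast
    have "det M \<noteq> 0"
    proof
      assume "det M = 0"
      with M(2) show False by simp
    qed
    from reflexive_imp_R_R_subset[OF L(1) refl M(1) this] show ?thesis using RR L(2) by simp
  qed
  with R RR show ?thesis by blast
qed

section \<open>First order terms of determinants\<close>

lemma det_column_linear:
  fixes N :: "'a::comm_ring_1^'n^'n"
  shows "det (\<chi> i j. if j = l then x $ i else N $ i $ j)
    = (\<Sum>r\<in>UNIV. x $ r * det (\<chi> i j. if j = l then axis r 1 $ i else N $ i $ j))"
proof -
  have t: "det (\<chi> i j. if j = l then y $ i else N $ i $ j) = det (\<chi> i. if i = l then y else column i N)" for y
    by (subst det_transpose[symmetric], rule arg_cong[of _ _ det]) (auto simp: vec_eq_iff transpose_def column_def)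
  have "det (\<chi> i. if i = l then x else column i N) = det (\<chi> i. if i = l then \<Sum>r\<in>UNIV. x $ r *s axis r 1 else column i N)"
    by (simp only: basis_expansion)
  also have "\<dots> = (\<Sum>r\<in>UNIV. det (\<chi> i. if i = l then x $ r *s axis r 1 else column i N))"
    by (rule det_linear_row_sum) simp
  also have "\<dots> = (\<Sum>r\<in>UNIV. x $ r * det (\<chi> i. if i = l then axis r 1 else column i N))"
    by (simp add: det_row_mul)
  finally show ?thesis unfolding t .
qed

text \<open>By the product rule every term in which column \<open>l\<close> is left undifferentiated
  vanishes at the origin.\<close>

lemma derivative_det:
  fixes N :: "'n::finite hgerm^'m^'m"
  assumes "\<And>i. hvalue (N $ i $ l) = 0"
  shows "(\<Sum>k\<in>UNIV. w $ k * hvalue (dgerm k (det N))) =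
    det (\<chi> i j. if j = l then \<Sum>k\<in>UNIV. w $ k * hvalue (dgerm k (N $ i $ l)) else hvalue (N $ i $ j))"
proof -
  define C where "C r = det (\<chi> i j. if j = l then axis r 1 $ i else N $ i $ j)" for r
  have hC: "hvalue (C r) = det (\<chi> i j. if j = l then axis r 1 $ i else hvalue (N $ i $ j))" for r
    unfolding C_def hvalue_det by (intro arg_cong[of _ _ det]) (auto simp: vec_eq_iff axis_def)
  have "N = (\<chi> i j. if j = l then column l N $ i else N $ i $ j)"
    by (auto simp: vec_eq_iff column_def)
  then have dN: "det N = (\<Sum>r\<in>UNIV. N $ r $ l * C r)"
    using det_column_linear[of l "column l N" N] by (simp add: C_def column_def)
  have "hvalue (dgerm k (det N)) = (\<Sum>r\<in>UNIV. hvalue (dgerm k (N $ r $ l)) * hvalue (C r))" for k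
    unfolding dN dgerm_sum dgerm_mult by (simp add: assms)
  then have "(\<Sum>k\<in>UNIV. w $ k * hvalue (dgerm k (det N)))
      = (\<Sum>k\<in>UNIV. \<Sum>r\<in>UNIV. w $ k * (hvalue (dgerm k (N $ r $ l)) * hvalue (C r)))"
    by (simp add: sum_distrib_left)
  also have "\<dots> = (\<Sum>r\<in>UNIV. \<Sum>k\<in>UNIV. w $ k * (hvalue (dgerm k (N $ r $ l)) * hvalue (C r)))"
    by (rule sum.swap)
  also have "\<dots> = (\<Sum>r\<in>UNIV. (\<Sum>k\<in>UNIV. w $ k * hvalue (dgerm k (N $ r $ l))) * hvalue (C r))"
    by (simp add: sum_distrib_right mult.assoc)
  also have "\<dots> = (\<Sum>r\<in>UNIV. (\<chi> i. \<Sum>k\<in>UNIV. w $ k * hvalue (dgerm k (N $ i $ l))) $ r *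
      det (\<chi> i j. if j = l then axis r 1 $ i else (\<chi> i j. hvalue (N $ i $ j)) $ i $ j))"
    by (simp add: hC cong: if_cong)
  also have "\<dots> = det (\<chi> i j. if j = l then (\<chi> i. \<Sum>k\<in>UNIV. w $ k * hvalue (dgerm k (N $ i $ l))) $ i
      else (\<chi> i j. hvalue (N $ i $ j)) $ i $ j)"
    by (rule det_column_linear[symmetric])
  finally show ?thesis by (simp cong: if_cong)
qed

lemma not_vanish_order_2I:
  fixes a :: "'n::finite hgerm"
  assumes "(\<Sum>k\<in>UNIV. w $ k * hvalue (dgerm k a)) \<noteq> 0"
  shows "a \<notin> vanish_order 2"
proof
  assume "a \<in> vanish_order 2"
  then have "hvalue (dgerm k a) = 0" for k by (simp add: numeral_2_eq_2)
  with assms show False by simp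
qed

section \<open>Logarithmic fields whose values span a hyperplane\<close>

lemma holo_near_nth [intro]: "holo_near q (\<lambda>z. z $ k)"
  by (rule holo_nearI[OF open_UNIV UNIV_I holo_on_nth])

definition const_germ :: "complex \<Rightarrow> 'n::finite hgerm" where
  "const_germ c = germ_at 0 (\<lambda>_. c)"

definition coord_germ :: "'n \<Rightarrow> 'n::finite hgerm" where
  "coord_germ k = germ_at 0 (\<lambda>z. z $ k)"

lemma partial_const: "partial i (\<lambda>_. c) = (\<lambda>_. 0)"
  by (rule ext) (simp add: partial_def)

lemma partial_nth: "partial i (\<lambda>z::complex^'n. z $ k) = (\<lambda>_. if i = k then 1 else 0)"
proof
  fix z :: "complex^'n"
  have "((\<lambda>z::complex^'n. z $ k) has_derivative (\<lambda>v. v $ k)) (at z)"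
    by (rule bounded_linear_imp_has_derivative[OF bounded_linear_vec_nth])
  from partial_eq[OF this, of i] show "partial i (\<lambda>z. z $ k) z = (if i = k then 1 else 0)"
    by (auto simp: axis_def)
qed

lemma hvalue_const_germ [simp]: "hvalue (const_germ c) = c"
  unfolding const_germ_def by (rule hvalue_germ_at) (rule holo_near_const)

lemma dgerm_const_germ [simp]: "dgerm i (const_germ c) = 0"
  unfolding const_germ_def by (simp add: dgerm_germ_at holo_near_const partial_const)

lemma hvalue_coord_germ [simp]: "hvalue (coord_germ k) = 0"
  unfolding coord_germ_def by (subst hvalue_germ_at) auto

lemma dgerm_coord_germ [simp]: "dgerm i (coord_germ k) = (if i = k then 1 else 0)"
  unfolding coord_germ_def by (subst dgerm_germ_at) (auto simp: partial_nth)

text \<open>If \<open>\<xi>(f\<^sub>0) = \<gamma> f\<^sub>0\<close> with \<open>\<gamma>\<close> a unit while the linear part of \<open>\<xi>\<close> only takes values of logarithmic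
  fields, then the initial form of \<open>f\<^sub>0\<close> is annihilated by these values and \<open>\<xi>(f\<^sub>0)\<close> vanishes to
  higher order than \<open>f\<^sub>0\<close>.\<close>

lemma linear_part_transversal:
  fixes f0 :: "'n::finite hgerm"
  assumes f0: "f0 \<noteq> 0" "hvalue f0 = 0" and S: "\<And>\<eta>. \<eta> \<in> S \<Longrightarrow> f0 dvd vapply \<eta> f0"
    and \<xi>: "\<And>i. hvalue (\<xi> $ i) = 0" and \<gamma>: "vapply \<xi> f0 = \<gamma> * f0" "hvalue \<gamma> \<noteq> 0"
  shows "\<exists>k. \<forall>\<eta>\<in>S. (\<chi> i. hvalue (\<eta> $ i)) \<noteq> (\<chi> i. hvalue (dgerm k (\<xi> $ i)))"
proof (rule ccontr)
  assume "\<not> ?thesis"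
  then have V: "\<exists>\<eta>\<in>S. (\<chi> i. hvalue (\<eta> $ i)) = (\<chi> i. hvalue (dgerm k (\<xi> $ i)))" for k by blast
  obtain k0 where k0: "f0 \<in> vanish_order k0" "f0 \<notin> vanish_order (Suc k0)" using vanish_order_exact[OF f0(1)] .
  have "k0 \<noteq> 0"
  proof
    assume "k0 = 0"
    with k0(2) f0(2) show False by simp
  qed
  then obtain k1 where k1: "k0 = Suc k1" by (cases k0) auto
  have df: "dgerm i f0 \<in> vanish_order k1" for i using k0(1) k1 by simp
  \<comment> \<open>Replacing the coefficients of \<open>\<eta>\<close> by their values at the
    origin changes \<open>\<eta>(f0)\<close> only in order \<open>1 + k1 = k0\<close>. So the
    constant field with that value lowers the order of \<open>f0\<close> by nothing, instead of by
    one.\<close>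
  have T: "(\<Sum>i\<in>UNIV. const_germ (hvalue (\<eta> $ i)) * dgerm i f0) \<in> vanish_order k0" if "\<eta> \<in> S" for \<eta>
  proof -
    have "vapply \<eta> f0 \<in> vanish_order k0" using k0(1) S[OF that] by (rule vanish_order_dvd)
    moreover have "(\<Sum>i\<in>UNIV. (\<eta> $ i - const_germ (hvalue (\<eta> $ i))) * dgerm i f0) \<in> vanish_order (1 + k1)"
      by (intro vanish_order_sum vanish_order_mult df) simp
    ultimately have "vapply \<eta> f0 - (\<Sum>i\<in>UNIV. (\<eta> $ i - const_germ (hvalue (\<eta> $ i))) * dgerm i f0) \<in> vanish_order k0"
      unfolding k1 by (intro vanish_order_diff) simp_all
    then show ?thesis by (simp add: vapply_def left_diff_distrib sum_subtractf)
  qed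
  have T': "(\<Sum>i\<in>UNIV. const_germ (hvalue (dgerm k (\<xi> $ i))) * dgerm i f0) \<in> vanish_order k0" for k
  proof -
    obtain \<eta> where "\<eta> \<in> S" "\<And>i. hvalue (\<eta> $ i) = hvalue (dgerm k (\<xi> $ i))"
      using V[of k] by (auto simp: vec_eq_iff)
    then show ?thesis using T[of \<eta>] by simp
  qed
  \<comment> \<open>The linear part of \<open>\<xi>\<close>, a combination of constant fields with
    the coordinates as coefficients; these constant fields are values of \<open>S\<close> by
    assumption. Its action on \<open>f0\<close> and that of the remainder, of order 2, both have
    order at least \<open>k0 + 1\<close>.\<close>
  define lin where "lin i = (\<Sum>k\<in>UNIV. coord_germ k * const_germ (hvalue (dgerm k (\<xi> $ i))))" for i
  have "dgerm l (lin i) = const_germ (hvalue (dgerm l (\<xi> $ i)))" for l i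
    unfolding lin_def by (simp add: dgerm_sum dgerm_mult if_distrib[of "\<lambda>x. x * _"] cong: if_cong)
  then have r: "\<xi> $ i - lin i \<in> vanish_order 2" for i
    using \<xi> by (simp add: numeral_2_eq_2 dgerm_diff) (simp add: lin_def)
  have ks: "2 + k1 = Suc k0" "1 + k0 = Suc k0" using k1 by simp_all
  have "(\<Sum>i\<in>UNIV. (\<xi> $ i - lin i) * dgerm i f0) \<in> vanish_order (2 + k1)"
    by (intro vanish_order_sum vanish_order_mult df r)
  moreover have "(\<Sum>k\<in>UNIV. coord_germ k * (\<Sum>i\<in>UNIV. const_germ (hvalue (dgerm k (\<xi> $ i))) * dgerm i f0)) \<in> vanish_order (1 + k0)"
    by (intro vanish_order_sum vanish_order_mult T') simp
  moreover have "vapply \<xi> f0 = (\<Sum>i\<in>UNIV. (\<xi> $ i - lin i) * dgerm i f0)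
      + (\<Sum>k\<in>UNIV. coord_germ k * (\<Sum>i\<in>UNIV. const_germ (hvalue (dgerm k (\<xi> $ i))) * dgerm i f0))"
  proof -
    have "(\<Sum>k\<in>UNIV. coord_germ k * (\<Sum>i\<in>UNIV. const_germ (hvalue (dgerm k (\<xi> $ i))) * dgerm i f0))
        = (\<Sum>k\<in>UNIV. \<Sum>i\<in>UNIV. coord_germ k * const_germ (hvalue (dgerm k (\<xi> $ i))) * dgerm i f0)"
      by (simp add: sum_distrib_left mult.assoc)
    also have "\<dots> = (\<Sum>i\<in>UNIV. \<Sum>k\<in>UNIV. coord_germ k * const_germ (hvalue (dgerm k (\<xi> $ i))) * dgerm i f0)"
      by (rule sum.swap)
    also have "\<dots> = (\<Sum>i\<in>UNIV. lin i * dgerm i f0)" by (simp add: lin_def sum_distrib_right)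
    finally show ?thesis by (simp add: vapply_def left_diff_distrib sum_subtractf)
  qed
  ultimately have "\<gamma> * f0 \<in> vanish_order (Suc k0)" unfolding \<gamma>(1)[symmetric] ks by (simp only: vanish_order_add)
  moreover obtain \<gamma>' where "1 = \<gamma> * \<gamma>'" using \<gamma>(2) unfolding hgerm_unit_iff[symmetric] by (rule dvdE)
  then have "f0 = \<gamma>' * (\<gamma> * f0)" by (metis mult.assoc mult.commute mult_1)
  ultimately have "f0 \<in> vanish_order (Suc k0)" using vanish_order_times by metis
  with k0(2) show False by blast
qed

text \<open>Fields with values in a basis of the hyperplane \<open>V\<close> fill all columns but
  one, and \<open>\<xi>\<close> fills the last. The derivative of the determinant in direction
  \<open>w\<close> is the determinant of that basis together with the image of \<open>w\<close>
  under the linear part of \<open>\<xi>\<close>, which lies outside \<open>V\<close>.\<close>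

lemma det_not_vanish_order_2:
  fixes S :: "('n::finite hgerm^'n) set"
  assumes dim: "vec.dim V + 1 = CARD('n)" and V: "vec.subspace V"
    "\<And>y. y \<in> V \<Longrightarrow> \<exists>\<eta>\<in>S. (\<chi> i. hvalue (\<eta> $ i)) = y"
    and \<xi>: "\<xi> \<in> S" "\<And>i. hvalue (\<xi> $ i) = 0"
    and w: "(\<chi> i. \<Sum>k\<in>UNIV. w $ k * hvalue (dgerm k (\<xi> $ i))) \<notin> V"
  shows "\<exists>M. (\<forall>j. column j M \<in> S) \<and> det M \<notin> vanish_order 2"
proof -
  define y where "y = (\<chi> i. \<Sum>k\<in>UNIV. w $ k * hvalue (dgerm k (\<xi> $ i)))"
  obtain B where B: "B \<subseteq> V" "vec.independent B" "V \<subseteq> vec.span B" "card B = vec.dim V"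
    using vec.basis_exists[of V] by metis
  have fB: "finite B" by (rule vec.finiteI_independent[OF B(2)])
  have "vec.span B \<subseteq> V" using B(1) V(1) by (rule vec.span_minimal)
  then have yB: "y \<notin> vec.span B" using w unfolding y_def by blast
  then have ind: "vec.independent (insert y B)" using B(2) by (simp add: vec.independent_insertI)
  have "y \<notin> B" using yB vec.span_base by blast
  then have "card (insert y B) = CARD('n)" using fB B(4) dim by simp
  then obtain h where h: "bij_betw h (UNIV :: 'n set) (insert y B)"
    using fB finite_same_card_bij[of "UNIV :: 'n set" "insert y B"] by auto
  then obtain l where l: "h l = y" unfolding bij_betw_def by (metis imageE insertI1)
  have hB: "h j \<in> V" if "j \<noteq> l" for j
    using h that l B(1) unfolding bij_betw_def inj_on_def by blast
  then have "\<forall>j. \<exists>\<eta>. j \<noteq> l \<longrightarrow> \<eta> \<in> S \<and> (\<chi> i. hvalue (\<eta> $ i)) = h j" using V(2) by blast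
  then obtain \<eta> where \<eta>: "\<And>j. j \<noteq> l \<Longrightarrow> \<eta> j \<in> S" "\<And>j. j \<noteq> l \<Longrightarrow> (\<chi> i. hvalue (\<eta> j $ i)) = h j" by metis
  define M where "M = (\<chi> i j. if j = l then \<xi> $ i else \<eta> j $ i)"
  have col: "column j M = (if j = l then \<xi> else \<eta> j)" for j by (simp add: column_def M_def vec_eq_iff)
  have "(\<Sum>k\<in>UNIV. w $ k * hvalue (dgerm k (det M))) = det (\<chi> i j. h j $ i)"
  proof (subst derivative_det[of M l w])
    show "hvalue (M $ i $ l) = 0" for i by (simp add: M_def \<xi>(2))
    have "(\<chi> i j. if j = l then \<Sum>k\<in>UNIV. w $ k * hvalue (dgerm k (M $ i $ l)) else hvalue (M $ i $ j)) $ i $ j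
        = h j $ i" for i j
    proof (cases "j = l")
      case True
      then show ?thesis by (simp add: M_def l y_def)
    next
      case False
      then show ?thesis using \<eta>(2)[OF False] by (auto simp: M_def vec_eq_iff)
    qed
    then show "det (\<chi> i j. if j = l then \<Sum>k\<in>UNIV. w $ k * hvalue (dgerm k (M $ i $ l)) else hvalue (M $ i $ j))
        = det (\<chi> i j. h j $ i)" by (intro arg_cong[of _ _ det]) (simp add: vec_eq_iff)
  qed
  moreover have "det (\<chi> i j. h j $ i) \<noteq> 0"
  proof
    define H where "H = (\<chi> i j. h j $ i)"
    have c: "column j H = h j" for j by (simp add: column_def H_def vec_eq_iff)
    assume "det (\<chi> i j. h j $ i) = 0"
    then have "\<not> invertible H" by (simp add: invertible_det_nz H_def)
    then have "\<not> (\<forall>c. (\<Sum>i\<in>UNIV. c i *s column i H) = 0 \<longrightarrow> (\<forall>i. c i = 0))"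
      unfolding invertible_left_inverse matrix_left_invertible_independent_columns .
    then obtain c i where ci: "(\<Sum>i\<in>UNIV. c i *s h i) = 0" "c i \<noteq> 0" unfolding c by blast
    have inj: "inj h" using h by (simp add: bij_betw_def)
    have "(\<Sum>x\<in>insert y B. c (inv h x) *s x) = (\<Sum>i\<in>UNIV. c (inv h (h i)) *s h i)"
      using h sum.reindex_bij_betw[OF h, of "\<lambda>x. c (inv h x) *s x"] by simp
    also have "\<dots> = 0" using ci(1) inj by simp
    finally have "(\<Sum>x\<in>insert y B. c (inv h x) *s x) = 0" .
    moreover have "h i \<in> insert y B" using h unfolding bij_betw_def by blast
    moreover have "finite (insert y B)" using fB by simp
    ultimately have "c (inv h (h i)) = 0"
      using vec.independentD[OF ind _ subset_refl, of "\<lambda>x. c (inv h x)" "h i"] by blast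
    with ci(2) inj show False by simp
  qed
  ultimately have "det M \<notin> vanish_order 2" by (intro not_vanish_order_2I[of w]) simp
  moreover have "column j M \<in> S" for j using \<eta>(1) \<xi>(1) by (simp add: col)
  ultimately show ?thesis by blast
qed

text \<open>Writing \<open>f = \<sigma>\<^sup>k g\<close> with \<open>\<sigma>\<close> not dividing \<open>g\<close>, the derivation property shows that a logarithmic
  field of \<open>f\<close> is logarithmic for each prime factor \<open>\<sigma>\<close>.\<close>

lemma log_prime_factor:
  fixes f \<sigma> :: "'n::finite hgerm"
  assumes f: "f \<noteq> 0" and \<sigma>: "prime_elem \<sigma>" "\<sigma> dvd f" and \<eta>: "f dvd vapply \<eta> f"
  shows "\<sigma> dvd vapply \<eta> \<sigma>"
proof -
  have \<sigma>0: "\<sigma> \<noteq> 0" "\<not> \<sigma> dvd 1" using \<sigma>(1) by (auto simp: prime_elem_def)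
  obtain N where N: "f \<notin> vanish_order N" using vanish_order_exact[OF f] by blast
  have bound: "k < N" if "\<sigma> ^ k dvd f" for k
  proof (rule ccontr)
    assume "\<not> k < N"
    have "\<sigma> ^ k \<in> vanish_order k" for k
    proof (induction k)
      case (Suc k)
      have "\<sigma> \<in> vanish_order 1" using \<sigma>0(2) unfolding vanish_order_1 .
      from vanish_order_mult[OF this Suc] show ?case by simp
    qed simp
    then have "f \<in> vanish_order k" using that by (rule vanish_order_dvd)
    with N \<open>\<not> k < N\<close> vanish_order_mono[of f k N] show False by simp
  qed
  \<comment> \<open>The multiplicity of \<open>\<sigma>\<close> in \<open>f\<close>; it exists
    because powers of \<open>\<sigma>\<close> dividing \<open>f\<close> are bounded by the order of
    \<open>f\<close>.\<close>
  define k where "k = (GREATEST k. \<sigma> ^ k dvd f)"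
  have k: "\<sigma> ^ k dvd f" "\<And>l. \<sigma> ^ l dvd f \<Longrightarrow> l \<le> k"
    unfolding k_def using GreatestI_nat[of "\<lambda>k. \<sigma> ^ k dvd f" 0 N] Greatest_le_nat[of "\<lambda>k. \<sigma> ^ k dvd f" _ N] bound less_imp_le
    by (metis one_dvd power_0)+
  then have "1 \<le> k" using \<sigma>(2) by simp
  then obtain k' where k': "k = Suc k'" by (cases k) auto
  obtain g where g: "f = \<sigma> ^ k * g" using k(1) by (rule dvdE)
  have ng: "\<not> \<sigma> dvd g"
  proof
    assume "\<sigma> dvd g"
    then have "\<sigma> ^ Suc k dvd f" unfolding g power_Suc2 by (rule mult_dvd_mono[OF dvd_refl])
    with k(2)[of "Suc k"] show False by simp
  qed
  have pow: "vapply \<eta> (\<sigma> ^ Suc l) = of_nat (Suc l) * (\<sigma> ^ l * vapply \<eta> \<sigma>)" for l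
  proof (induction l)
    case (Suc l)
    show ?case unfolding power_Suc[of _ "Suc l"] vapply_mult Suc by (simp add: algebra_simps)
  qed simp
  obtain c where c: "vapply \<eta> f = f * c" using \<eta> by (rule dvdE)
  have "\<sigma> ^ k' * (of_nat k * vapply \<eta> \<sigma> * g) = \<sigma> ^ k' * (\<sigma> * (g * c - vapply \<eta> g))"
    using c unfolding g vapply_mult k' pow by (simp add: algebra_simps)
  moreover have "\<sigma> ^ k' \<noteq> 0" using \<sigma>0(1) by simp
  ultimately have "of_nat k * vapply \<eta> \<sigma> * g = \<sigma> * (g * c - vapply \<eta> g)" by (metis mult_left_cancel)
  then have "\<sigma> dvd (of_nat k * vapply \<eta> \<sigma>) * g" by (rule dvdI)
  with ng \<sigma>(1) have "\<sigma> dvd of_nat k * vapply \<eta> \<sigma>" unfolding prime_elem_def by blast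
  moreover have "\<not> \<sigma> dvd of_nat k"
  proof
    assume "\<sigma> dvd of_nat k"
    then obtain e where "of_nat k = \<sigma> * e" by (rule dvdE)
    then have "hvalue (of_nat k :: 'n hgerm) = hvalue \<sigma> * hvalue e" by simp
    moreover have "hvalue (of_nat l :: 'n hgerm) = of_nat l" for l by (induction l) auto
    ultimately have "of_nat k = hvalue \<sigma> * hvalue e" by metis
    moreover have "hvalue \<sigma> = 0" using \<sigma>0(2) by (simp add: hgerm_unit_iff)
    moreover have "(of_nat k :: complex) \<noteq> 0" using k' by (simp only: of_nat_eq_0_iff)
    ultimately show False by simp
  qed
  ultimately show ?thesis using \<sigma>(1) unfolding prime_elem_def by blast
qed

lemma log_squarefree_factor:
  fixes f f0 :: "'n::finite hgerm"
  assumes "f \<noteq> 0" "squarefree f0" "\<And>\<sigma>. prime_elem \<sigma> \<Longrightarrow> \<sigma> dvd f0 \<Longrightarrow> \<sigma> dvd f" "f dvd vapply \<eta> f"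
  shows "f0 dvd vapply \<eta> f0"
proof (rule squarefree_dvdI[OF assms(2)])
  fix \<sigma> assume \<sigma>: "prime_elem \<sigma>" "\<sigma> dvd f0"
  obtain g where g: "f0 = \<sigma> * g" using \<sigma>(2) by (rule dvdE)
  have "\<sigma> dvd vapply \<eta> \<sigma>" by (rule log_prime_factor[OF assms(1) \<sigma>(1) assms(3)[OF \<sigma>] assms(4)])
  then show "\<sigma> dvd vapply \<eta> f0" unfolding g vapply_mult by (intro dvd_add dvd_mult2 dvd_triv_left)
qed

section \<open>Smooth points\<close>

lemma vapply_germ_at:
  assumes "\<And>i. holo_near q (\<lambda>z. \<xi> z $ i)" "holo_near q G"
  shows "vapply (vgerm_at q \<xi>) (germ_at q G) = germ_at q (\<lambda>z. \<Sum>i\<in>UNIV. \<xi> z $ i * partial i G z)"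
  using assms
  by (simp add: vapply_def vgerm_at_def dgerm_germ_at germ_at_sum germ_at_mult holo_near_mult holo_near_partial)

lemma in_vanishing_ideal_germ_at:
  assumes "holo_near q G"
  shows "germ_at q G \<in> vanishing_ideal q X \<longleftrightarrow> (\<forall>\<^sub>F z in nhds q. z \<in> X \<longrightarrow> G z = 0)"
  unfolding vanishing_ideal_def mem_Collect_eq
proof
  assume "\<forall>\<^sub>F z in nhds q. z \<in> X \<longrightarrow> rep_hgerm (germ_at q G) (z - q) = 0"
  with rep_germ_at[OF assms] show "\<forall>\<^sub>F z in nhds q. z \<in> X \<longrightarrow> G z = 0" by eventually_elim simp
next
  assume "\<forall>\<^sub>F z in nhds q. z \<in> X \<longrightarrow> G z = 0"
  with rep_germ_at[OF assms] show "\<forall>\<^sub>F z in nhds q. z \<in> X \<longrightarrow> rep_hgerm (germ_at q G) (z - q) = 0"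
    by eventually_elim simp
qed

lemma vgerm_at_in_Der_log:
  assumes \<xi>: "\<And>i. holo_near q (\<lambda>z. \<xi> z $ i)"
    and tan: "\<And>G. holo_near q G \<Longrightarrow> \<forall>\<^sub>F z in nhds q. z \<in> X \<longrightarrow> G z = 0 \<Longrightarrow>
      \<forall>\<^sub>F z in nhds q. z \<in> X \<longrightarrow> (\<Sum>i\<in>UNIV. \<xi> z $ i * partial i G z) = 0"
  shows "vgerm_at q \<xi> \<in> Der_log q X"
  unfolding Der_log_def
proof (intro CollectI ballI)
  fix g assume g: "g \<in> vanishing_ideal q X"
  obtain G where G: "holo_near q G" "g = germ_at q G" by (rule hgerm_at_cases)
  have h: "holo_near q (\<lambda>z. \<Sum>i\<in>UNIV. \<xi> z $ i * partial i G z)"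
    by (intro holo_near_sum holo_near_mult holo_near_partial \<xi> G)
  show "vapply (vgerm_at q \<xi>) g \<in> vanishing_ideal q X"
    unfolding G(2) vapply_germ_at[OF \<xi> G(1)] in_vanishing_ideal_germ_at[OF h]
    by (rule tan[OF G(1)]) (use g in \<open>simp add: G(2) in_vanishing_ideal_germ_at[OF G(1)]\<close>)
qed

lemma partial_eq_0_if_zero_along_axis:
  assumes "\<forall>\<^sub>F t in nhds 0. F (z + t *s axis j 1) = 0" shows "partial j F z = 0"
proof -
  have "deriv (\<lambda>t. F (z + t *s axis j 1)) 0 = deriv (\<lambda>t. 0) 0"
    by (rule deriv_cong_ev) (use assms in auto)
  then show ?thesis by (simp add: partial_def)
qed

lemma vholo_on_nth: "vholo_on \<Phi> U \<Longrightarrow> holo_on (\<lambda>z. \<Phi> z $ i) U"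
  by (simp add: vholo_on_def)

lemma vholo_on_continuous: "vholo_on \<Phi> U \<Longrightarrow> continuous_on U \<Phi>"
  by (intro continuous_at_imp_continuous_on ballI)
    (rule has_derivative_continuous, rule vholo_on_has_derivative)

text \<open>At a smooth point the coordinate fields of a straightening, one of them multiplied by the
  equation, have a determinant vanishing to first order only. Codimension at least two cannot occur:
  a germ vanishing only where two coordinates vanish would have a zero on every line parallel to an
  axis.\<close>

lemma submanifold_at_det:
  fixes X :: "(complex^'n::finite) set"
  assumes sub: "submanifold_at d X q" and F: "defined_by q X {f}"
  shows "\<exists>M. (\<forall>j. column j M \<in> Der_log q X) \<and> det M \<notin> vanish_order 2"
proof -
  obtain W W' \<Phi> \<Psi> S where s: "open W" "q \<in> W" "open W'" "vholo_on \<Phi> W" "vholo_on \<Psi> W'"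
    "\<Phi> ` W = W'" "\<Psi> ` W' = W" "\<forall>z\<in>W. \<Psi> (\<Phi> z) = z" "\<forall>w\<in>W'. \<Phi> (\<Psi> w) = w"
    "\<Phi> ` (X \<inter> W) = {w\<in>W'. \<forall>i. i \<notin> (S :: 'n set) \<longrightarrow> w $ i = 0}" and qX: "q \<in> X"
    using sub unfolding submanifold_at_def by blast
  define w0 where "w0 = \<Phi> q"
  have w0: "w0 \<in> W'" "\<Psi> w0 = q" using s(2,6,8) by (auto simp: w0_def)
  have plane: "\<Psi> w \<in> X \<longleftrightarrow> (\<forall>i. i \<notin> S \<longrightarrow> w $ i = 0)" if w: "w \<in> W'" for w
  proof
    assume "\<Psi> w \<in> X"
    then have "\<Phi> (\<Psi> w) \<in> \<Phi> ` (X \<inter> W)" using w s(7) by blast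
    then show "\<forall>i. i \<notin> S \<longrightarrow> w $ i = 0" using w s(9,10) by auto
  next
    assume "\<forall>i. i \<notin> S \<longrightarrow> w $ i = 0"
    then have "w \<in> \<Phi> ` (X \<inter> W)" using w s(10) by blast
    then obtain z where "z \<in> X \<inter> W" "w = \<Phi> z" by blast
    then show "\<Psi> w \<in> X" using s(8) by simp
  qed
  have w0S: "w0 $ i = 0" if "i \<notin> S" for i using plane[OF w0(1)] w0(2) qX that by simp
  \<comment> \<open>The coordinate field in direction \<open>j\<close> carried over by
    \<open>\<Psi>\<close> and expressed at points of \<open>W\<close>. By the chain rule these
    fields are linearly independent at \<open>q\<close>.\<close>
  define \<xi> where "\<xi> j z = (\<chi> i. partial j (\<lambda>w. \<Psi> w $ i) (\<Phi> z))" for j z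
  have \<xi>_on: "holo_on (\<lambda>z. \<xi> j z $ i) W" for i j
    unfolding \<xi>_def using holo_on_compose[OF s(4) holo_on_partial[OF vholo_on_nth[OF s(5)] s(3)], of j i] s(6) by auto
  then have \<xi>_near: "holo_near q (\<lambda>z. \<xi> j z $ i)" for i j using s(1,2) by (metis holo_nearI)
  have \<Phi>_near: "holo_near q (\<lambda>z. \<Phi> z $ i)" for i by (rule holo_nearI[OF s(1,2) vholo_on_nth[OF s(4)]])
  have jac: "(\<Sum>k\<in>UNIV. partial j (\<lambda>w. \<Psi> w $ k) w0 * partial k (\<lambda>z. \<Phi> z $ l) q) = (if j = l then 1 else 0)" for j l
  proof -
    have "partial j (\<lambda>w. \<Phi> (\<Psi> w) $ l) w0 = (\<Sum>k\<in>UNIV. partial j (\<lambda>w. \<Psi> w $ k) w0 * partial k (\<lambda>z. \<Phi> z $ l) (\<Psi> w0))"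
      by (rule partial_compose[OF s(5) vholo_on_nth[OF s(4)]]) (use s(7) w0 in auto)
    moreover have "partial j (\<lambda>w. w $ l) w0 = partial j (\<lambda>w. \<Phi> (\<Psi> w) $ l) w0"
      by (rule partial_cong[OF s(3) w0(1) holo_on_nth]) (use s(9) in simp)
    ultimately show ?thesis using w0(2) by (simp add: partial_nth)
  qed
  define J where "J = (\<chi> i j. partial j (\<lambda>w. \<Psi> w $ i) w0)"
  have "(\<chi> l k. partial k (\<lambda>z. \<Phi> z $ l) q) ** J = mat 1"
    using jac by (auto simp: vec_eq_iff matrix_matrix_mult_def J_def mat_def mult.commute)
  then have detJ: "det J \<noteq> 0" unfolding invertible_det_nz[symmetric] invertible_left_inverse by blast
  have \<xi>q: "hvalue (vgerm_at q (\<xi> j) $ i) = J $ i $ j" for i j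
    by (simp add: vgerm_at_def hvalue_germ_at \<xi>_near) (simp add: \<xi>_def J_def w0_def)
  \<comment> \<open>Directions in \<open>S\<close> are tangent to \<open>X\<close>, so derivatives
    of a function vanishing on \<open>X\<close> vanish there; in the other directions a factor
    \<open>c\<close> vanishing on \<open>X\<close> achieves the same.\<close>
  have tangent: "\<forall>\<^sub>F z in nhds q. z \<in> X \<longrightarrow> c z * (\<Sum>i\<in>UNIV. \<xi> j z $ i * partial i G z) = 0"
    if c: "j \<in> S \<or> (\<forall>z\<in>X \<inter> W. c z = 0)" and G: "holo_near q G" "\<forall>\<^sub>F z in nhds q. z \<in> X \<longrightarrow> G z = 0" for c j G
  proof -
    obtain r where r: "r > 0" "holo_on G (ball q r)" using G(1) unfolding holo_near_def by blast
    obtain N0 where N0: "open N0" "q \<in> N0" "\<And>z. z \<in> N0 \<Longrightarrow> z \<in> X \<Longrightarrow> G z = 0"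
      using G(2) unfolding eventually_nhds by blast
    define N where "N = N0 \<inter> ball q r \<inter> W"
    have N: "open N" "q \<in> N" using N0 r s(1,2) by (auto simp: N_def)
    have "(\<Sum>i\<in>UNIV. \<xi> j z $ i * partial i G z) = 0" if z: "z \<in> N" "z \<in> X" and j: "j \<in> S" for z
    proof -
      have zW: "z \<in> W" using z by (simp add: N_def)
      define w where "w = \<Phi> z"
      have w: "w \<in> W'" "\<Psi> w = z" using zW s(6,8) by (auto simp: w_def)
      define V where "V = W' \<inter> \<Psi> -` N"
      have V: "open V" unfolding V_def
        using continuous_open_preimage[OF vholo_on_continuous[OF s(5)] s(3) N(1)] .
      have wV: "w \<in> V" using w z by (simp add: V_def)
      have "isCont (\<lambda>t::complex. w + t *s axis j 1) 0"
        by (intro continuous_intros bounded_linear.isCont[OF bounded_linear_scale_vec])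
      then have "((\<lambda>t::complex. w + t *s axis j 1) \<longlongrightarrow> w) (nhds 0)"
        using tendsto_at_iff_tendsto_nhds[of "\<lambda>t::complex. w + t *s axis j 1" 0] by (simp add: isCont_def)
      then have "\<forall>\<^sub>F t in nhds 0. w + t *s axis j 1 \<in> V" using V wV by (rule topological_tendstoD)
      then have "\<forall>\<^sub>F t in nhds 0. G (\<Psi> (w + t *s axis j 1)) = 0"
      proof eventually_elim
        case (elim t)
        have "(w + t *s axis j 1) $ i = 0" if "i \<notin> S" for i
        proof -
          have "i \<noteq> j" using that j by blast
          moreover have "w $ i = 0" using plane[OF w(1)] w(2) z(2) that by simp
          ultimately show ?thesis by (simp add: axis_def)
        qed
        then have "\<Psi> (w + t *s axis j 1) \<in> X" using plane elim by (simp add: V_def)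
        then show ?case using N0(3) elim by (simp add: V_def N_def)
      qed
      then have "partial j (\<lambda>w. G (\<Psi> w)) w = 0" by (rule partial_eq_0_if_zero_along_axis)
      moreover have "partial j (\<lambda>w. G (\<Psi> w)) w = (\<Sum>i\<in>UNIV. partial j (\<lambda>w. \<Psi> w $ i) w * partial i G (\<Psi> w))"
        by (rule partial_compose[of _ V _ "ball q r"])
          (use s(5) r wV in \<open>auto simp: V_def N_def vholo_on_def intro: holo_on_subset\<close>)
      ultimately show ?thesis by (simp add: \<xi>_def w(2) flip: w_def)
    qed
    then have "z \<in> X \<longrightarrow> c z * (\<Sum>i\<in>UNIV. \<xi> j z $ i * partial i G z) = 0" if "z \<in> N" for z
      using c that by (auto simp: N_def)
    then show ?thesis using N unfolding eventually_nhds by blast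
  qed
  have log1: "vgerm_at q (\<xi> j) \<in> Der_log q X" if "j \<in> S" for j
    using tangent[of j "\<lambda>_. 1"] that by (intro vgerm_at_in_Der_log \<xi>_near) simp
  \<comment> \<open>Codimension zero, one, and at least two.\<close>
  consider "S = UNIV" | l where "l \<notin> S" "\<And>i. i \<notin> S \<Longrightarrow> i = l" | l m where "l \<notin> S" "m \<notin> S" "l \<noteq> m" by blast
  then show ?thesis
  proof cases
    case 1
    define M where "M = (\<chi> i j. vgerm_at q (\<xi> j) $ i)"
    have "hvalue (det M) = det J" unfolding hvalue_det by (simp add: M_def \<xi>q)
    then have "det M \<notin> vanish_order 2" using detJ by (simp add: numeral_2_eq_2)
    moreover have "column j M = vgerm_at q (\<xi> j)" for j by (simp add: column_def M_def vec_eq_iff)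
    ultimately show ?thesis using log1 1 by (intro exI[of _ M]) simp
  next
    case (2 l)
    define \<zeta> where "\<zeta> z = \<Phi> z $ l *s \<xi> l z" for z
    have \<zeta>_near: "holo_near q (\<lambda>z. \<zeta> z $ i)" for i
      unfolding \<zeta>_def using holo_near_mult[OF \<Phi>_near \<xi>_near] by simp
    have log2: "vgerm_at q \<zeta> \<in> Der_log q X"
    proof (rule vgerm_at_in_Der_log[OF \<zeta>_near])
      fix G assume G: "holo_near q G" "\<forall>\<^sub>F z in nhds q. z \<in> X \<longrightarrow> G z = 0"
      have "\<forall>z\<in>X \<inter> W. \<Phi> z $ l = 0" using s(10) 2(1) by blast
      from tangent[OF disjI2[OF this] G, of l]
      show "\<forall>\<^sub>F z in nhds q. z \<in> X \<longrightarrow> (\<Sum>i\<in>UNIV. \<zeta> z $ i * partial i G z) = 0"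
        by (simp add: \<zeta>_def sum_distrib_left mult.assoc)
    qed
    define M where "M = (\<chi> i j. if j = l then vgerm_at q \<zeta> $ i else vgerm_at q (\<xi> j) $ i)"
    have col: "column j M = (if j = l then vgerm_at q \<zeta> else vgerm_at q (\<xi> j))" for j
      by (simp add: column_def M_def vec_eq_iff)
    have \<zeta>: "vgerm_at q \<zeta> $ i = germ_at q (\<lambda>z. \<Phi> z $ l) * vgerm_at q (\<xi> l) $ i" for i
      by (simp add: vgerm_at_def \<zeta>_def germ_at_mult \<Phi>_near \<xi>_near)
    have v0: "hvalue (germ_at q (\<lambda>z. \<Phi> z $ l)) = 0"
      using w0S[OF 2(1)] by (simp add: hvalue_germ_at \<Phi>_near w0_def)
    \<comment> \<open>In this direction the equation \<open>\<Phi> z $ l\<close> has derivative 1.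
      It is the scalar factor in column \<open>l\<close>, so the derivative of \<open>det M\<close>
      is the Jacobian determinant \<open>det J\<close>.\<close>
    define w where "w = (\<chi> k. partial l (\<lambda>w. \<Psi> w $ k) w0)"
    have dw: "(\<Sum>k\<in>UNIV. w $ k * hvalue (dgerm k (germ_at q (\<lambda>z. \<Phi> z $ l)))) = 1"
      using jac[of l l] by (simp add: w_def dgerm_germ_at \<Phi>_near hvalue_germ_at holo_near_partial)
    have "(\<Sum>k\<in>UNIV. w $ k * hvalue (dgerm k (det M))) =
      det (\<chi> i j. if j = l then \<Sum>k\<in>UNIV. w $ k * hvalue (dgerm k (M $ i $ l)) else hvalue (M $ i $ j))"
      by (rule derivative_det) (simp add: M_def \<zeta> v0)
    also have "\<dots> = det J"
    proof (rule arg_cong[of _ _ det], unfold vec_eq_iff, intro allI)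
      fix i j
      have "(\<Sum>k\<in>UNIV. w $ k * hvalue (dgerm k (M $ i $ l))) = J $ i $ l"
      proof -
        have "(\<Sum>k\<in>UNIV. w $ k * hvalue (dgerm k (M $ i $ l)))
            = (\<Sum>k\<in>UNIV. w $ k * hvalue (dgerm k (germ_at q (\<lambda>z. \<Phi> z $ l)))) * J $ i $ l"
          unfolding sum_distrib_right
          by (intro sum.cong refl) (simp add: M_def \<zeta> dgerm_mult v0 \<xi>q)
        then show ?thesis by (simp add: dw)
      qed
      then show "(\<chi> i j. if j = l then \<Sum>k\<in>UNIV. w $ k * hvalue (dgerm k (M $ i $ l)) else hvalue (M $ i $ j)) $ i $ j = J $ i $ j"
        by (simp add: M_def \<xi>q)
    qed
    finally have "det M \<notin> vanish_order 2" using detJ by (intro not_vanish_order_2I[of w]) simp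
    moreover have "column j M \<in> Der_log q X" for j using col log1 log2 2(2) by metis
    ultimately show ?thesis by blast
  next
    case (3 l m)
    obtain Fn where Fn: "holo_near q Fn" "f = germ_at q Fn" by (rule hgerm_at_cases)
    obtain r where r: "r > 0" "holo_on Fn (ball q r)" using Fn(1) unfolding holo_near_def by blast
    have "\<forall>\<^sub>F z in nhds q. z \<in> X \<longleftrightarrow> Fn z = 0"
      using F rep_germ_at[OF Fn(1)] unfolding defined_by_def Fn(2) by eventually_elim simp
    then obtain N0 where N0: "open N0" "q \<in> N0" "\<And>z. z \<in> N0 \<Longrightarrow> z \<in> X \<longleftrightarrow> Fn z = 0"
      unfolding eventually_nhds by blast
    define N where "N = N0 \<inter> ball q r"
    define V where "V = W' \<inter> \<Psi> -` N"
    have V: "open V" unfolding V_def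
      by (rule continuous_open_preimage[OF vholo_on_continuous[OF s(5)] s(3)]) (use N0 in \<open>simp add: N_def open_Int\<close>)
    have w0V: "w0 \<in> V" using w0 N0 r by (simp add: V_def N_def)
    \<comment> \<open>The equation in the straightened coordinates, centred at \<open>w0\<close>. It
      is regular along axis \<open>l\<close>, and the coordinate \<open>m\<close>, constant along
      that axis, vanishes on all its zeros; hence that coordinate would be the zero germ.\<close>
    define A where "A h = Fn (\<Psi> (w0 + h))" for h
    have "holo_on (\<lambda>w. Fn (\<Psi> w)) V"
      by (rule holo_on_compose[OF _ r(2)]) (use s(5) in \<open>auto simp: V_def N_def vholo_on_def intro: holo_on_subset\<close>)
    from holo_near_shift[THEN iffD1, OF holo_nearI[OF V w0V this]]
    have hA: "holo_near 0 A" by (simp only: A_def[abs_def])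
    have A0: "A h = 0 \<longleftrightarrow> (\<forall>i. i \<notin> S \<longrightarrow> h $ i = 0)" if "w0 + h \<in> V" for h
    proof -
      have "A h = 0 \<longleftrightarrow> \<Psi> (w0 + h) \<in> X" using N0(3) that by (simp add: A_def V_def N_def)
      also have "\<dots> \<longleftrightarrow> (\<forall>i. i \<notin> S \<longrightarrow> (w0 + h) $ i = 0)" using plane that by (simp add: V_def)
      finally show ?thesis using w0S by simp
    qed
    have inV: "\<forall>\<^sub>F h in nhds 0. w0 + h \<in> V"
      using eventually_nhds_in_open[OF V w0V] by (rule eventually_nhds_shift[THEN iffD2])
    define a where "a = germ_at 0 A"
    have repa: "\<forall>\<^sub>F h in nhds 0. rep_hgerm a h = A h" using rep_germ_at[OF hA] by (simp add: a_def)
    have za: "\<forall>\<^sub>F h in nhds 0. rep_hgerm a h = 0 \<longleftrightarrow> (\<forall>i. i \<notin> S \<longrightarrow> h $ i = 0)"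
      using repa inV by eventually_elim (use A0 in simp)
    have "regular_along (axis l 1) a"
    proof -
      obtain e where e: "e > 0" "\<And>h. norm h < e \<Longrightarrow> rep_hgerm a h = 0 \<longleftrightarrow> (\<forall>i. i \<notin> S \<longrightarrow> h $ i = 0)"
        using za unfolding eventually_nhds_metric by (auto simp: dist_norm)
      have "rep_hgerm a (t *s axis l 1) \<noteq> 0" if "t \<noteq> 0" "norm t < e" for t
      proof
        assume z: "rep_hgerm a (t *s axis l 1) = 0"
        have "norm (t *s axis l (1::complex)) < e" using that(2) by (simp only: norm_axis_scale)
        from e(2)[OF this] z 3(1) have "(t *s axis l (1::complex)) $ l = 0" by blast
        with that(1) show False by (simp add: axis_def)
      qed
      then show ?thesis unfolding regular_along_def using e(1) by blast
    qed
    moreover have "\<not> a dvd 1"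
      using eventually_nhds_x_imp_x[OF za] by (simp add: hgerm_unit_iff hvalue_rep)
    moreover have zm: "\<forall>\<^sub>F z in nhds 0. rep_hgerm (coord_germ m) z = z $ m"
      unfolding coord_germ_def using rep_germ_at[OF holo_near_nth, of 0 m] by simp
    moreover have "coord_germ m \<in> const_along (axis l 1) l"
    proof -
      have "\<forall>\<^sub>F z in nhds 0. rep_hgerm (coord_germ m) (z - z $ l *s axis l 1) = (z - z $ l *s axis l 1) $ m"
        by (rule eventually_compose_filterlim[OF zm filterlim_proj])
      with zm show ?thesis unfolding const_along_def mem_Collect_eq
        by eventually_elim (use 3(3) in \<open>simp add: axis_def\<close>)
    qed
    moreover have "\<forall>\<^sub>F z in nhds 0. rep_hgerm a z = 0 \<longrightarrow> rep_hgerm (coord_germ m) z = 0"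
      using za zm by eventually_elim (use 3(2) in simp)
    ultimately have "coord_germ m = (0 :: 'n hgerm)"
      by (intro const_along_eq_0[of "axis l 1" l a]) simp_all
    then have "dgerm m (coord_germ m :: 'n hgerm) = 0" by simp
    then show ?thesis by simp
  qed
qed

text \<open>The inverse function theorem for the map replacing the \<open>j\<close>-th coordinate by the equation.\<close>

lemma submanifold_at_if_partial_nonzero:
  fixes X :: "(complex^'n::finite) set"
  assumes F: "holo_near q F" "F q = 0" "partial j F q \<noteq> 0" and X: "\<forall>\<^sub>F z in nhds q. z \<in> X \<longleftrightarrow> F z = 0"
  shows "submanifold_at (CARD('n) - 1) X q"
proof -
  obtain r where r: "r > 0" "holo_on F (ball q r)" using F(1) unfolding holo_near_def by blast
  obtain N0 where N0: "open N0" "q \<in> N0" "\<And>z. z \<in> N0 \<Longrightarrow> z \<in> X \<longleftrightarrow> F z = 0"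
    using X unfolding eventually_nhds by blast
  define N where "N = N0 \<inter> ball q r"
  have N: "open N" "q \<in> N" "holo_on F N" using N0 r by (auto simp: N_def intro: holo_on_subset)
  define \<Phi> where "\<Phi> z = z + axis j (F z - z $ j)" for z :: "complex^'n"
  have \<Phi>_nth: "\<Phi> z $ k = (if k = j then F z else z $ k)" for z k by (simp add: \<Phi>_def axis_def)
  have lin: "linear (axis j :: complex \<Rightarrow> complex^'n)" by (rule linearI) (auto simp: axis_def vec_eq_iff)
  then have bl: "bounded_linear (axis j :: complex \<Rightarrow> complex^'n)" by (simp add: linear_conv_bounded_linear)
  define ax where "ax = Blinfun (axis j :: complex \<Rightarrow> complex^'n)"
  have ax: "blinfun_apply ax = axis j" unfolding ax_def by (rule bounded_linear_Blinfun_apply[OF bl])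
  define nj where "nj = Blinfun (\<lambda>v :: complex^'n. v $ j)"
  have nj: "blinfun_apply nj = (\<lambda>v. v $ j)"
    unfolding nj_def by (rule bounded_linear_Blinfun_apply[OF bounded_linear_vec_nth])
  define f' where "f' z = id_blinfun + (ax o\<^sub>L (partial_blinfun F z - nj))" for z
  have f': "blinfun_apply (f' z) v = v + axis j (blinfun_apply (partial_blinfun F z) v - v $ j)" for z v
    by (simp add: f'_def blinfun.add_left blinfun.diff_left ax nj)
  have f'_scale: "blinfun_apply (f' z) (c *s v) = c *s blinfun_apply (f' z) v" for z c v
    unfolding f' partial_blinfun_scale by (simp add: vec_eq_iff axis_def algebra_simps)
  define dF where "dF = partial_blinfun F q"
  define a where "a = partial j F q"
  have dF_axis: "blinfun_apply dF (axis j c) = c * a" for c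
    by (simp add: dF_def partial_blinfun_apply a_def axis_def if_distrib[of "\<lambda>x. x * _"] cong: if_cong)
  \<comment> \<open>An explicit left inverse of the derivative at \<open>q\<close>: the derivative
    only replaces entry \<open>j\<close> of \<open>v\<close> by the value of \<open>dF\<close>, and
    this entry is recovered by solving for it, with \<open>a\<close> in the denominator.\<close>
  define g0 where "g0 = id_blinfun + (ax o\<^sub>L (blinfun_mult_right (1 / a) o\<^sub>L (nj - dF)))"
  have inv: "g0 o\<^sub>L f' q = id_blinfun"
  proof (rule blinfun_eqI)
    fix v
    have g: "blinfun_apply g0 u = u + axis j ((u $ j - blinfun_apply dF u) / a)" for u
      by (simp add: g0_def blinfun.add_left blinfun.diff_left ax nj)
    define u where "u = blinfun_apply (f' q) v"
    have u: "u = v + axis j (blinfun_apply dF v - v $ j)" by (simp add: u_def f' dF_def)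
    have "blinfun_apply dF u = blinfun_apply dF v + (blinfun_apply dF v - v $ j) * a"
      by (simp add: u blinfun.add_right dF_axis)
    moreover have "u $ j = blinfun_apply dF v" by (simp add: u axis_def)
    ultimately have "(u $ j - blinfun_apply dF u) / a = - (blinfun_apply dF v - v $ j)"
      using F(3) by (simp add: a_def field_simps)
    then have "blinfun_apply g0 u = v"
      unfolding g by (simp add: u vec_eq_iff axis_def)
    then show "blinfun_apply (g0 o\<^sub>L f' q) v = blinfun_apply id_blinfun v" by (simp add: u_def)
  qed
  have der: "(\<Phi> has_derivative blinfun_apply (f' z)) (at z)" if "z \<in> N" for z
  proof -
    have "((\<lambda>z. F z - z $ j) has_derivative (\<lambda>v. blinfun_apply (partial_blinfun F z) v - v $ j)) (at z)"
      by (intro has_derivative_diff has_derivative_partial_blinfun[OF N(3) that]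
          bounded_linear_imp_has_derivative[OF bounded_linear_vec_nth])
    from bounded_linear.has_derivative[OF bl this]
    have "((\<lambda>z. z + axis j (F z - z $ j)) has_derivative (\<lambda>v. v + axis j (blinfun_apply (partial_blinfun F z) v - v $ j))) (at z)"
      by (intro has_derivative_add has_derivative_ident)
    then show ?thesis by (simp add: \<Phi>_def[abs_def] f'[abs_def])
  qed
  have cont: "continuous_on N f'" unfolding f'_def
    by (intro continuous_intros continuous_on_partial_blinfun[OF N(3,1)])
  obtain U' V g g' where ift: "open U'" "U' \<subseteq> N" "q \<in> U'" "open V" "\<Phi> q \<in> V" "homeomorphism U' V \<Phi> g"
    "\<And>y. y \<in> V \<Longrightarrow> (g has_derivative (g' y)) (at y)"
    "\<And>y. y \<in> V \<Longrightarrow> g' y = inv (blinfun_apply (f'(g y)))"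
    "\<And>y. y \<in> V \<Longrightarrow> bij (blinfun_apply (f'(g y)))"
    using inverse_function_theorem[OF N(1) der cont N(2) inv] by metis
  have hom: "\<And>z. z \<in> U' \<Longrightarrow> g (\<Phi> z) = z" "\<And>w. w \<in> V \<Longrightarrow> \<Phi> (g w) = w" "\<Phi> ` U' = V" "g ` V = U'"
    using ift(6) unfolding homeomorphism_def by auto
  have v\<Phi>: "vholo_on \<Phi> U'" unfolding vholo_on_def \<Phi>_nth
  proof
    fix k show "holo_on (\<lambda>z. if k = j then F z else z $ k) U'"
      using holo_on_subset[OF N(3) ift(2)] holo_on_nth by (cases "k = j") auto
  qed
  \<comment> \<open>The inverse function theorem gives real derivatives only; the inverse of a
    complex-linear bijection is complex-linear, which makes \<open>g\<close> holomorphic.\<close>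
  have vg: "vholo_on g V" unfolding vholo_on_def holo_on_def
  proof (intro allI ballI)
    fix k y assume y: "y \<in> V"
    have b: "bij (blinfun_apply (f'(g y)))" by (rule ift(9)[OF y])
    have sc: "g' y (c *s v) = c *s g' y v" for c v
    proof -
      have "blinfun_apply (f' (g y)) (c *s g' y v) = c *s v"
        unfolding f'_scale ift(8)[OF y] using b by (simp add: bij_is_surj surj_f_inv_f)
      then show ?thesis unfolding ift(8)[OF y] using b by (metis bij_inv_eq_iff)
    qed
    from bounded_linear.has_derivative[OF bounded_linear_vec_nth ift(7)[OF y]]
    have "((\<lambda>z. g z $ k) has_derivative (\<lambda>v. g' y v $ k)) (at y)" .
    then show "\<exists>D. ((\<lambda>z. g z $ k) has_derivative D) (at y) \<and> (\<forall>c v. D (c *s v) = c * D v)"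
      using sc by (intro exI[of _ "\<lambda>v. g' y v $ k"]) simp
  qed
  have im: "\<Phi> ` (X \<inter> U') = {w \<in> V. \<forall>i. i \<notin> - {j} \<longrightarrow> w $ i = 0}"
  proof -
    have iff: "z \<in> X \<longleftrightarrow> \<Phi> z $ j = 0" if "z \<in> U'" for z
      using N0(3)[of z] that ift(2) by (auto simp: \<Phi>_nth N_def)
    show ?thesis
    proof (intro equalityI subsetI)
      fix w assume "w \<in> \<Phi> ` (X \<inter> U')"
      then show "w \<in> {w \<in> V. \<forall>i. i \<notin> - {j} \<longrightarrow> w $ i = 0}" using iff hom(3) by auto
    next
      fix w assume w: "w \<in> {w \<in> V. \<forall>i. i \<notin> - {j} \<longrightarrow> w $ i = 0}"
      then obtain z where z: "z \<in> U'" "w = \<Phi> z" using hom(3) by auto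
      then have "z \<in> X" using iff w by simp
      with z show "w \<in> \<Phi> ` (X \<inter> U')" by blast
    qed
  qed
  have "q \<in> X" using N0 F(2) by simp
  moreover have "card (- {j}) = CARD('n) - 1" by (simp add: Compl_eq_Diff_UNIV card_Diff_singleton)
  ultimately show ?thesis unfolding submanifold_at_def
    using ift(1,3,4) v\<Phi> vg hom im by (intro conjI exI[of _ U'] exI[of _ V] exI[of _ \<Phi>] exI[of _ g] exI[of _ "- {j}"]) auto
qed

section \<open>The conditions on components\<close>

lemma vanish_order_2_if_square_dvd:
  assumes "hvalue \<pi> = 0" "\<pi>\<^sup>2 dvd a" shows "a \<in> vanish_order 2"
proof -
  have "\<pi> \<in> vanish_order 1" using assms(1) by simp
  from vanish_order_mult[OF this this] have "\<pi>\<^sup>2 \<in> vanish_order 2"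
    by (simp add: power2_eq_square numeral_2_eq_2 del: vanish_order.simps(2))
  then show ?thesis using assms(2) by (rule vanish_order_dvd)
qed

text \<open>Divisibility of all minors by the square of a germ vanishing at \<open>q\<close> puts
  every determinant of fields in the span into \<open>vanish_order 2\<close>. Each of (a)-(d) is
  refuted separately: (a) and (b) on elements of the Fitting ideal, (c) and (d) by determinants of
  fields in the span that are nonzero to order at most one.\<close>

lemma not_good_point:
  fixes q :: "complex^'n::finite"
  assumes U: "open U" "q \<in> U" and E: "\<And>j. j < m \<Longrightarrow> vholo_on (E j) U"
    and f: "f \<noteq> 0" "defined_by q X' {f}" and log: "\<And>j. j < m \<Longrightarrow> f dvd vapply (vgerm_at q (E j)) f"
    and \<pi>: "hvalue \<pi> = 0"
    and minors: "\<And>\<sigma>. range \<sigma> \<subseteq> {..<m} \<Longrightarrow> \<pi>\<^sup>2 dvd det (\<chi> i j. vgerm_at q (E (\<sigma> j)) $ i)"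
    and X0: "q \<in> X0'" "\<forall>\<^sub>F z in nhds q. z \<in> X0' \<longrightarrow> z \<in> X'"
  shows "\<not> good_point U X' X0' m E q"
proof -
  define G where "G = (\<lambda>j. vgerm_at q (E j)) ` {..<m}"
  have E_near: "holo_near q (\<lambda>z. E j z $ i)" if "j < m" for j i
    using holo_nearI[OF U vholo_on_nth[OF E[OF that]]] .
  have near_U: "\<forall>\<^sub>F z in nhds q. z \<in> U" using U by (rule eventually_nhds_in_open)
  have span: "vgerm_at q \<eta> \<in> hvec.span G \<and> (\<chi> i. hvalue (vgerm_at q \<eta> $ i)) = \<eta> q \<and> vholo_on \<eta> U"
    if \<eta>: "\<eta> \<in> span_on U m E" for \<eta>
  proof -
    obtain c where c: "\<And>j. j < m \<Longrightarrow> holo_on (c j) U" "\<And>z. z \<in> U \<Longrightarrow> \<eta> z = (\<Sum>j<m. c j z *s E j z)"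
      using \<eta> unfolding span_on_def by blast
    have cn: "holo_near q (c j)" if "j < m" for j by (rule holo_nearI[OF U c(1)[OF that]])
    have vh: "holo_on (\<lambda>z. \<eta> z $ i) U" for i
    proof -
      have "holo_on (\<lambda>z. \<Sum>j<m. c j z * E j z $ i) U"
        by (intro holo_on_sum holo_on_mult c(1) vholo_on_nth[OF E]) auto
      moreover have "\<And>z. z \<in> U \<Longrightarrow> (\<Sum>j<m. c j z * E j z $ i) = \<eta> z $ i" by (simp add: c(2))
      ultimately show ?thesis by (rule holo_on_cong[OF U(1), THEN iffD1, rotated])
    qed
    have n: "holo_near q (\<lambda>z. \<eta> z $ i)" for i by (rule holo_nearI[OF U vh])
    have "germ_at q (\<lambda>z. \<eta> z $ i) = (\<Sum>j<m. germ_at q (c j) * germ_at q (\<lambda>z. E j z $ i))" for i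
    proof -
      have "germ_at q (\<lambda>z. \<eta> z $ i) = germ_at q (\<lambda>z. \<Sum>j<m. c j z * E j z $ i)"
        by (rule germ_at_eqI[OF n]) (use near_U in \<open>eventually_elim, simp add: c(2)\<close>)
      also have "\<dots> = (\<Sum>j<m. germ_at q (\<lambda>z. c j z * E j z $ i))"
        by (rule germ_at_sum) (use cn E_near in auto)
      also have "\<dots> = (\<Sum>j<m. germ_at q (c j) * germ_at q (\<lambda>z. E j z $ i))"
        by (intro sum.cong refl germ_at_mult cn E_near) auto
      finally show ?thesis .
    qed
    then have "vgerm_at q \<eta> = (\<Sum>j<m. germ_at q (c j) *s vgerm_at q (E j))"
      by (simp add: vec_eq_iff vgerm_at_def)
    also have "\<dots> \<in> hvec.span G"
      by (intro hvec.span_sum hvec.span_scale hvec.span_base) (auto simp: G_def)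
    finally show ?thesis using n vh by (simp add: vec_eq_iff vgerm_at_def hvalue_germ_at vholo_on_def)
  qed
  have no_minor: "\<pi>\<^sup>2 dvd det M" if M: "\<forall>j. column j M \<in> hvec.span G" for M :: "'n hgerm^'n^'n"
  proof -
    have "\<forall>M. (\<forall>j. column j M \<in> G) \<longrightarrow> \<pi>\<^sup>2 dvd det M"
    proof (intro allI impI)
      fix M :: "'n hgerm^'n^'n" assume "\<forall>j. column j M \<in> G"
      then have "\<forall>j. \<exists>s. s < m \<and> column j M = vgerm_at q (E s)" unfolding G_def by blast
      then obtain \<sigma> where \<sigma>: "\<And>j. \<sigma> j < m" "\<And>j. column j M = vgerm_at q (E (\<sigma> j))" by metis
      have "M = (\<chi> i j. vgerm_at q (E (\<sigma> j)) $ i)"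
        using \<sigma>(2) by (simp add: vec_eq_iff column_def)
      moreover have "range \<sigma> \<subseteq> {..<m}" using \<sigma>(1) by blast
      ultimately show "\<pi>\<^sup>2 dvd det M" using minors by metis
    qed
    then have "fitting_ideal (hvec.span G) \<subseteq> {g. \<pi>\<^sup>2 dvd g}"
      unfolding fitting_ideal_span fitting_ideal_subset_iff .
    then show ?thesis using M unfolding fitting_ideal_subset_iff by blast
  qed
  have no_minor2: "det M \<in> vanish_order 2" if "\<forall>j. column j M \<in> hvec.span G" for M
    by (rule vanish_order_2_if_square_dvd[OF \<pi> no_minor[OF that]])
  have fit: "\<pi>\<^sup>2 dvd germ_at q g \<and> holo_near q g" if g: "g \<in> fitting_on U m E" for g
  proof -
    obtain c where c: "\<And>\<sigma>. holo_on (c \<sigma>) U"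
      "\<And>z. z \<in> U \<Longrightarrow> g z = (\<Sum>\<sigma> | range \<sigma> \<subseteq> {..<m}. c \<sigma> z * det (\<chi> i j :: 'n. E (\<sigma> j) z $ i))"
      using g unfolding fitting_on_def by blast
    let ?D = "\<lambda>\<sigma> z. det (\<chi> i j :: 'n. E (\<sigma> j) z $ i)"
    have cn: "holo_near q (c \<sigma>)" for \<sigma> by (rule holo_nearI[OF U c(1)])
    have en: "holo_near q (\<lambda>z. (\<chi> i j :: 'n. E (\<sigma> j) z $ i) $ i $ j)" if "range \<sigma> \<subseteq> {..<m}" for \<sigma> i j
      using E_near[of "\<sigma> j" i] that by auto
    have dn: "holo_near q (?D \<sigma>)" if "range \<sigma> \<subseteq> {..<m}" for \<sigma>
      by (rule holo_near_det[OF en[OF that]])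
    have d: "\<pi>\<^sup>2 dvd germ_at q (?D \<sigma>)" if "range \<sigma> \<subseteq> {..<m}" for \<sigma>
      using minors[OF that] germ_at_det[OF en[OF that]] by (simp add: vgerm_at_def)
    let ?g = "\<lambda>z. \<Sum>\<sigma> | range \<sigma> \<subseteq> {..<m}. c \<sigma> z * ?D \<sigma> z"
    have gn: "holo_near q ?g" by (intro holo_near_sum holo_near_mult cn dn) simp
    have ev: "\<forall>\<^sub>F z in nhds q. ?g z = g z" using near_U by eventually_elim (simp add: c(2))
    have "germ_at q ?g = (\<Sum>\<sigma> | range \<sigma> \<subseteq> {..<m}. germ_at q (\<lambda>z. c \<sigma> z * ?D \<sigma> z))"
      by (rule germ_at_sum) (use cn dn in auto)
    also have "\<dots> = (\<Sum>\<sigma> | range \<sigma> \<subseteq> {..<m}. germ_at q (c \<sigma>) * germ_at q (?D \<sigma>))"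
      by (intro sum.cong refl germ_at_mult cn dn) simp
    finally have "germ_at q g = (\<Sum>\<sigma> | range \<sigma> \<subseteq> {..<m}. germ_at q (c \<sigma>) * germ_at q (?D \<sigma>))"
      using germ_at_eqI[OF gn ev] by simp
    then have "\<pi>\<^sup>2 dvd germ_at q g" using d by (auto intro!: dvd_sum dvd_mult)
    then show ?thesis using holo_near_cong[OF gn ev] by blast
  qed
  have "\<not> cond_a U m E q"
  proof
    assume "cond_a U m E q"
    then obtain g where g: "g \<in> fitting_on U m E" "frechet_derivative g (at q) \<noteq> (\<lambda>_. 0)"
      unfolding cond_a_def by blast
    obtain r where r: "r > 0" "holo_on g (ball q r)" using fit[OF g(1)] unfolding holo_near_def by blast
    have "germ_at q g \<in> vanish_order 2"
      using fit[OF g(1)] vanish_order_2_if_square_dvd[OF \<pi>] by blast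
    then have "hvalue (dgerm i (germ_at q g)) = 0" for i by (simp add: numeral_2_eq_2)
    then have "partial i g q = 0" for i
      using fit[OF g(1)] by (simp add: dgerm_germ_at hvalue_germ_at holo_near_partial)
    then have "(g has_derivative (\<lambda>_. 0)) (at q)"
      using holo_on_has_derivative[OF r(2), of q] r(1) by simp
    then have "(\<lambda>_. 0) = frechet_derivative g (at q)" by (rule frechet_derivative_at)
    with g(2) show False by simp
  qed
  moreover have "\<not> cond_b U m E q"
  proof
    assume "cond_b U m E q"
    then obtain g where g: "g \<in> fitting_on U m E" "germ_at q g \<notin> ideal_mult max_ideal max_ideal"
      unfolding cond_b_def by blast
    obtain k where k: "germ_at q g = \<pi> * (\<pi> * k)"
      using fit[OF g(1)] unfolding power2_eq_square mult.assoc dvd_def by blast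
    have "\<pi> \<in> max_ideal" "\<pi> * k \<in> max_ideal" using \<pi> by (simp_all add: max_ideal_def)
    then have "germ_at q g \<in> ideal_mult max_ideal max_ideal"
      unfolding ideal_mult_def k by (intro hring.span_base) blast
    with g(2) show False by blast
  qed
  moreover have "\<not> cond_c U X' m E q"
  proof
    assume "cond_c U X' m E q"
    then obtain d where d: "submanifold_at d X' q"
      and D: "hvec.span (vgerm_at q ` span_on U m E) = Der_log q X'"
      unfolding cond_c_def smooth_point_def by blast
    obtain M where M: "\<forall>j. column j M \<in> Der_log q X'" "det M \<notin> vanish_order 2"
      using submanifold_at_det[OF d f(2)] by blast
    have "Der_log q X' \<subseteq> hvec.span G" unfolding D[symmetric]
      by (rule hvec.span_minimal) (use span in \<open>auto intro: hvec.subspace_span\<close>)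
    with M no_minor2[of M] show False by blast
  qed
  moreover have "\<not> cond_d U X0' m E q"
  proof
    assume d: "cond_d U X0' m E q"
    let ?V = "values_at U m E q"
    have dim: "vec.dim ?V + 1 = CARD('n)" using d unfolding cond_d_def by blast
    obtain \<xi> f0 where \<xi>: "\<xi> \<in> span_const U m E" "\<xi> q = 0" and f0: "squarefree f0" "defined_by q X0' {f0}"
      and c: "(\<exists>\<gamma>. vapply (vgerm_at q \<xi>) f0 = \<gamma> * f0 \<and> hvalue \<gamma> \<noteq> 0) \<or>
         (\<exists>i. hvalue (dgerm i (vapply (vgerm_at q \<xi>) f0)) \<noteq> 0) \<or>
         \<not> range (frechet_derivative \<xi> (at q)) \<subseteq> ?V"
      using d unfolding cond_d_def by blast
    have \<xi>_on: "\<xi> \<in> span_on U m E"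
    proof -
      obtain c where "\<And>z. z \<in> U \<Longrightarrow> \<xi> z = (\<Sum>j<m. c j *s E j z)" using \<xi>(1) unfolding span_const_def by blast
      then show ?thesis unfolding span_on_def by (auto intro!: exI[of _ "\<lambda>j _. c j"] holo_on_const)
    qed
    note \<xi>s = span[OF \<xi>_on]
    have V_sub: "vec.subspace ?V"
    proof -
      have "0 \<in> ?V"
      proof -
        have "(\<lambda>_. 0) \<in> span_on U m E"
          unfolding span_on_def by (auto intro!: exI[of _ "\<lambda>_ _. 0"] holo_on_const)
        then show ?thesis unfolding values_at_def by (rule image_eqI[rotated]) simp
      qed
      moreover have "x + y \<in> ?V" if "x \<in> ?V" "y \<in> ?V" for x y
      proof -
        obtain \<eta> \<zeta> where e: "\<eta> \<in> span_on U m E" "x = \<eta> q" "\<zeta> \<in> span_on U m E" "y = \<zeta> q"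
          using \<open>x \<in> ?V\<close> \<open>y \<in> ?V\<close> unfolding values_at_def by blast
        obtain c c' where "\<And>j. j < m \<Longrightarrow> holo_on (c j) U" "\<And>z. z \<in> U \<Longrightarrow> \<eta> z = (\<Sum>j<m. c j z *s E j z)"
          "\<And>j. j < m \<Longrightarrow> holo_on (c' j) U" "\<And>z. z \<in> U \<Longrightarrow> \<zeta> z = (\<Sum>j<m. c' j z *s E j z)"
          using e(1,3) unfolding span_on_def by blast
        then have "(\<lambda>z. \<eta> z + \<zeta> z) \<in> span_on U m E" unfolding span_on_def
          by (auto intro!: exI[of _ "\<lambda>j z. c j z + c' j z"] holo_on_add simp: sum.distrib vec.scale_left_distrib)
        then show ?thesis unfolding values_at_def by (rule image_eqI[rotated]) (simp add: e)
      qed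
      moreover have "a *s x \<in> ?V" if "x \<in> ?V" for a x
      proof -
        obtain \<eta> where e: "\<eta> \<in> span_on U m E" "x = \<eta> q" using \<open>x \<in> ?V\<close> unfolding values_at_def by blast
        obtain c where "\<And>j. j < m \<Longrightarrow> holo_on (c j) U" "\<And>z. z \<in> U \<Longrightarrow> \<eta> z = (\<Sum>j<m. c j z *s E j z)"
          using e(1) unfolding span_on_def by blast
        then have "(\<lambda>z. a *s \<eta> z) \<in> span_on U m E" unfolding span_on_def
          by (auto intro!: exI[of _ "\<lambda>j z. a * c j z"] holo_on_mult holo_on_const simp: vec.scale_sum_right)
        then show ?thesis unfolding values_at_def by (rule image_eqI[rotated]) (simp add: e)
      qed
      ultimately show ?thesis by (intro vec.subspaceI)
    qed
    have V_val: "\<exists>\<eta>\<in>hvec.span G. (\<chi> i. hvalue (\<eta> $ i)) = y" if "y \<in> ?V" for y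
    proof -
      from that obtain \<eta> where \<eta>: "\<eta> \<in> span_on U m E" "y = \<eta> q" unfolding values_at_def by (rule imageE)
      show ?thesis by (rule bexI[of _ "vgerm_at q \<eta>"]) (simp_all add: span[OF \<eta>(1)] \<eta>(2))
    qed
    have log_f: "f dvd vapply \<eta> f" if "\<eta> \<in> hvec.span G" for \<eta>
    proof -
      have "hvec.span G \<subseteq> {\<eta>. f dvd vapply \<eta> f}"
      proof (rule hvec.span_minimal)
        show "G \<subseteq> {\<eta>. f dvd vapply \<eta> f}" using log by (auto simp: G_def)
        show "hvec.subspace {\<eta>. f dvd vapply \<eta> f}"
          by (rule hvec.subspaceI) (auto simp: vapply_add vapply_scale vapply_0)
      qed
      with that show ?thesis by blast
    qed
    \<comment> \<open>Since \<open>X0'\<close> lies in \<open>X'\<close>, prime factors of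
      \<open>f0\<close> divide \<open>f\<close> by the Nullstellensatz, and logarithmic fields of
      \<open>f\<close> are logarithmic for them.\<close>
    have log_f0: "f0 dvd vapply \<eta> f0" if \<eta>: "\<eta> \<in> hvec.span G" for \<eta>
    proof (rule log_squarefree_factor[OF f(1) f0(1) _ log_f[OF \<eta>]])
      fix \<sigma> assume \<sigma>: "prime_elem \<sigma>" "\<sigma> dvd f0"
      have "\<forall>\<^sub>F z in nhds q. rep_hgerm \<sigma> (z - q) = 0 \<longrightarrow> rep_hgerm f (z - q) = 0"
        using dvd_imp_vanish[OF \<sigma>(2), of q] f0(2) f(2) X0(2) unfolding defined_by_def
        by eventually_elim simp
      then show "\<sigma> dvd f" by (rule nullstellensatz_squarefree[OF prime_imp_squarefree[OF \<sigma>(1)]])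
    qed
    have f00: "f0 \<noteq> 0" by (rule squarefree_nonzero[OF f0(1)])
    have f0q: "hvalue f0 = 0"
      using eventually_nhds_x_imp_x[OF f0(2)[unfolded defined_by_def]] X0(1) by (simp add: hvalue_rep)
    have \<xi>0: "hvalue (vgerm_at q \<xi> $ i) = 0" for i using \<xi>s \<xi>(2) by (simp add: vec_eq_iff)
    \<comment> \<open>All alternatives of (d) lead to a direction mapped outside the hyperplane. A
      nonzero derivative of \<open>\<xi>(f0)\<close> belongs to the first alternative:
      \<open>\<xi>(f0) = \<gamma> * f0\<close> for some \<open>\<gamma>\<close>, and if
      \<open>\<gamma>\<close> vanished at \<open>q\<close> this product would have zero derivative
      there.\<close>
    have "\<exists>w. (\<chi> i. \<Sum>k\<in>UNIV. w $ k * hvalue (dgerm k (vgerm_at q \<xi> $ i))) \<notin> ?V"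
    proof (cases "\<exists>\<gamma>. vapply (vgerm_at q \<xi>) f0 = \<gamma> * f0 \<and> hvalue \<gamma> \<noteq> 0")
      case True
      then obtain \<gamma> where \<gamma>: "vapply (vgerm_at q \<xi>) f0 = \<gamma> * f0" "hvalue \<gamma> \<noteq> 0" by blast
      obtain k where k: "\<forall>\<eta>\<in>hvec.span G. (\<chi> i. hvalue (\<eta> $ i)) \<noteq> (\<chi> i. hvalue (dgerm k (vgerm_at q \<xi> $ i)))"
        using linear_part_transversal[OF f00 f0q log_f0 \<xi>0 \<gamma>] by blast
      have "(\<chi> i. \<Sum>l\<in>UNIV. axis k 1 $ l * hvalue (dgerm l (vgerm_at q \<xi> $ i))) = (\<chi> i. hvalue (dgerm k (vgerm_at q \<xi> $ i)))"
        by (simp add: vec_eq_iff axis_def if_distrib[of "\<lambda>x. x * _"] cong: if_cong)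
      moreover have "\<dots> \<notin> ?V" using k V_val by blast
      ultimately show ?thesis by (intro exI[of _ "axis k 1"]) simp
    next
      case False
      have "hvalue (dgerm i (vapply (vgerm_at q \<xi>) f0)) = 0" for i
      proof -
        have "f0 dvd vapply (vgerm_at q \<xi>) f0" using \<xi>s by (intro log_f0) blast
        then obtain \<gamma> where \<gamma>: "vapply (vgerm_at q \<xi>) f0 = f0 * \<gamma>" by (rule dvdE)
        then have "hvalue \<gamma> = 0" using False by (metis mult.commute)
        then show ?thesis unfolding \<gamma> dgerm_mult by (simp add: f0q)
      qed
      with False c obtain v where v: "frechet_derivative \<xi> (at q) v \<notin> ?V" by blast
      have fr: "(\<lambda>v. \<chi> i. \<Sum>k\<in>UNIV. v $ k * partial k (\<lambda>z. \<xi> z $ i) q) = frechet_derivative \<xi> (at q)"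
        using \<xi>s U(2) by (intro frechet_derivative_at vholo_on_has_derivative) blast+
      have "partial k (\<lambda>z. \<xi> z $ i) q = hvalue (dgerm k (vgerm_at q \<xi> $ i))" for k i
      proof -
        have "holo_near q (\<lambda>z. \<xi> z $ i)" using \<xi>s vholo_on_nth holo_nearI[OF U] by blast
        then show ?thesis by (simp add: vgerm_at_def dgerm_germ_at hvalue_germ_at holo_near_partial)
      qed
      then have "frechet_derivative \<xi> (at q) v = (\<chi> i. \<Sum>k\<in>UNIV. v $ k * hvalue (dgerm k (vgerm_at q \<xi> $ i)))"
        by (simp add: fr[symmetric])
      with v show ?thesis by (intro exI[of _ v]) simp
    qed
    then obtain w where w: "(\<chi> i. \<Sum>k\<in>UNIV. w $ k * hvalue (dgerm k (vgerm_at q \<xi> $ i))) \<notin> ?V" by blast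
    have "vgerm_at q \<xi> \<in> hvec.span G" using \<xi>s by blast
    from det_not_vanish_order_2[OF dim V_sub V_val this \<xi>0 w] no_minor2 show False by blast
  qed
  ultimately show ?thesis unfolding good_point_def by blast
qed

section \<open>From germs at the given point to nearby points\<close>

lemma eventually_eq_if_germ_eq:
  assumes "holo_near p F" "germ_at p F = a * b"
  shows "\<forall>\<^sub>F z in nhds p. F z = rep_hgerm a (z - p) * rep_hgerm b (z - p)"
  using rep_germ_at[OF assms(1)] rep_mult[of a b p] unfolding assms(2)
  by eventually_elim simp

text \<open>The divisibility of the minors of \<open>L\<close> by \<open>\<pi>\<^sup>2\<close> at \<open>p\<close> persists at nearby points, where it makes the
  minors vanish to second order.\<close>

lemma no_good_point_near:
  fixes p :: "complex^'n::finite" and f \<pi> :: "'n hgerm"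
  assumes f: "squarefree f" "defined_by p X {f}" and L: "L \<subseteq> Der_log p X"
    and none: "\<forall>M. (\<forall>j. column j M \<in> L) \<longrightarrow> \<pi>\<^sup>2 dvd det M"
    and ad: "adapted p X L U X' m E" and X0: "component_in U X0' X'" "germ_eq p X0' (zero_set p \<pi>)"
  obtains r where "r > 0" "ball p r \<subseteq> U"
    "\<And>z. z \<in> ball p r \<Longrightarrow> z \<in> X' \<longleftrightarrow> rep_hgerm f (z - p) = 0"
    "\<And>z. z \<in> ball p r \<Longrightarrow> z \<in> X0' \<longleftrightarrow> rep_hgerm \<pi> (z - p) = 0"
    "\<And>z. z \<in> ball p r \<Longrightarrow> holo_near z (\<lambda>z. rep_hgerm \<pi> (z - p))"
    "\<And>q. q \<in> ball p r \<Longrightarrow> q \<in> X0' \<Longrightarrow> \<not> good_point U X' X0' m E q"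
proof -
  have U: "open U" "p \<in> U" and E: "\<And>j. j < m \<Longrightarrow> vholo_on (E j) U" and X': "germ_eq p X' X"
    and sp: "hvec.span ((\<lambda>j. vgerm_at p (E j)) ` {..<m}) = L"
    using ad unfolding adapted_def by blast+
  have sub: "X0' \<subseteq> X'" using X0(1) unfolding component_in_def by blast
  have EL: "vgerm_at p (E j) \<in> L" if "j < m" for j
    unfolding sp[symmetric] by (rule hvec.span_base) (use that in auto)
  define Pn where "Pn z = rep_hgerm \<pi> (z - p)" for z
  define Fn where "Fn z = rep_hgerm f (z - p)" for z
  have Pn: "holo_near p Pn" and Fn: "holo_near p Fn" and gf: "germ_at p Fn = f"
    unfolding Pn_def Fn_def by (rule holo_near_rep germ_at_rep)+
  have E_at: "holo_near q (\<lambda>z. E j z $ i)" if "j < m" "q \<in> U" for q j i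
    using holo_nearI[OF U(1) that(2) vholo_on_nth[OF E[OF that(1)]]] .
  have "\<exists>\<alpha>. vapply (vgerm_at p (E j)) f = f * \<alpha>" if "j < m" for j
    using EL[OF that] L Der_log_eq[OF f] by (auto elim!: dvdE)
  then obtain \<alpha> where \<alpha>: "\<And>j. j < m \<Longrightarrow> vapply (vgerm_at p (E j)) f = f * \<alpha> j" by metis
  have "\<exists>h. det (\<chi> i j. vgerm_at p (E (\<sigma> j)) $ i) = \<pi>\<^sup>2 * h" if "range \<sigma> \<subseteq> {..<m}" for \<sigma> :: "'n \<Rightarrow> nat"
  proof -
    have "column j (\<chi> i j. vgerm_at p (E (\<sigma> j)) $ i) = vgerm_at p (E (\<sigma> j))" for j
      by (simp add: column_def vec_eq_iff)
    moreover have "\<sigma> j < m" for j using that by blast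
    ultimately have "\<pi>\<^sup>2 dvd det (\<chi> i j. vgerm_at p (E (\<sigma> j)) $ i)" using EL none by simp
    then show ?thesis by (simp add: dvd_def)
  qed
  then obtain h where h: "\<And>\<sigma> :: 'n \<Rightarrow> nat. range \<sigma> \<subseteq> {..<m} \<Longrightarrow> det (\<chi> i j. vgerm_at p (E (\<sigma> j)) $ i) = \<pi>\<^sup>2 * h \<sigma>"
    by metis
  let ?D = "\<lambda>\<sigma> z. det (\<chi> i j :: 'n. E (\<sigma> j) z $ i)"
  have en: "holo_near q (\<lambda>z. (\<chi> i j :: 'n. E (\<sigma> j) z $ i) $ i $ j)" if "range \<sigma> \<subseteq> {..<m}" "q \<in> U" for \<sigma> i j q
    using E_at[of "\<sigma> j" q i] that by auto
  \<comment> \<open>Finitely many identities between germs at \<open>p\<close>, written for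
    representatives. Holding on a common ball, they give the corresponding identities of germs at
    each of its points.\<close>
  define C where "C z \<longleftrightarrow> holo_near z Pn \<and> holo_near z Fn \<and> z \<in> U \<and> (z \<in> X' \<longleftrightarrow> Fn z = 0) \<and> (z \<in> X0' \<longleftrightarrow> Pn z = 0) \<and>
      (\<forall>j\<in>{..<m}. (\<Sum>i\<in>UNIV. E j z $ i * partial i Fn z) = Fn z * rep_hgerm (\<alpha> j) (z - p) \<and>
        holo_near z (\<lambda>z. rep_hgerm (\<alpha> j) (z - p))) \<and>
      (\<forall>\<sigma>\<in>{\<sigma>. range \<sigma> \<subseteq> {..<m}}. ?D \<sigma> z = Pn z ^ 2 * rep_hgerm (h \<sigma>) (z - p) \<and>
        holo_near z (\<lambda>z. rep_hgerm (h \<sigma>) (z - p)))" for z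
  have fin: "finite {\<sigma> :: 'n \<Rightarrow> nat. range \<sigma> \<subseteq> {..<m}}"
  proof -
    have "{\<sigma> :: 'n \<Rightarrow> nat. range \<sigma> \<subseteq> {..<m}} = PiE UNIV (\<lambda>_. {..<m})" by auto
    then show ?thesis by (simp add: finite_PiE)
  qed
  have "\<forall>\<^sub>F z in nhds p. C z"
    unfolding C_def
  proof (intro eventually_conj)
    show "\<forall>\<^sub>F z in nhds p. holo_near z Pn" "\<forall>\<^sub>F z in nhds p. holo_near z Fn"
      by (rule holo_near_eventually[OF Pn], rule holo_near_eventually[OF Fn])
    show "\<forall>\<^sub>F z in nhds p. z \<in> U" using U by (rule eventually_nhds_in_open)
    show "\<forall>\<^sub>F z in nhds p. z \<in> X' \<longleftrightarrow> Fn z = 0"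
      using X' f(2) unfolding germ_eq_def defined_by_def Fn_def by eventually_elim simp
    show "\<forall>\<^sub>F z in nhds p. z \<in> X0' \<longleftrightarrow> Pn z = 0"
      using X0(2) unfolding germ_eq_def Pn_def by eventually_elim (simp add: zero_set_def)
    show "\<forall>\<^sub>F z in nhds p. \<forall>j\<in>{..<m}. (\<Sum>i\<in>UNIV. E j z $ i * partial i Fn z) = Fn z * rep_hgerm (\<alpha> j) (z - p) \<and>
        holo_near z (\<lambda>z. rep_hgerm (\<alpha> j) (z - p))"
    proof (rule eventually_ball_finite, simp, rule ballI, rule eventually_conj)
      fix j assume "j \<in> {..<m}"
      then have j: "j < m" by simp
      have "germ_at p (\<lambda>z. \<Sum>i\<in>UNIV. E j z $ i * partial i Fn z) = f * \<alpha> j"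
        using vapply_germ_at[OF E_at[OF j U(2)] Fn] \<alpha>[OF j] by (simp add: gf)
      moreover have "holo_near p (\<lambda>z. \<Sum>i\<in>UNIV. E j z $ i * partial i Fn z)"
        by (intro holo_near_sum holo_near_mult holo_near_partial E_at[OF j U(2)] Fn)
      ultimately have "\<forall>\<^sub>F z in nhds p. (\<Sum>i\<in>UNIV. E j z $ i * partial i Fn z) = rep_hgerm f (z - p) * rep_hgerm (\<alpha> j) (z - p)"
        by (intro eventually_eq_if_germ_eq)
      then show "\<forall>\<^sub>F z in nhds p. (\<Sum>i\<in>UNIV. E j z $ i * partial i Fn z) = Fn z * rep_hgerm (\<alpha> j) (z - p)"
        by (simp add: Fn_def[symmetric])
      show "\<forall>\<^sub>F z in nhds p. holo_near z (\<lambda>z. rep_hgerm (\<alpha> j) (z - p))"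
        by (rule holo_near_eventually[OF holo_near_rep])
    qed
    show "\<forall>\<^sub>F z in nhds p. \<forall>\<sigma>\<in>{\<sigma>. range \<sigma> \<subseteq> {..<m}}. ?D \<sigma> z = Pn z ^ 2 * rep_hgerm (h \<sigma>) (z - p) \<and>
        holo_near z (\<lambda>z. rep_hgerm (h \<sigma>) (z - p))"
    proof (rule eventually_ball_finite[OF fin], rule ballI, rule eventually_conj)
      fix \<sigma> :: "'n \<Rightarrow> nat" assume "\<sigma> \<in> {\<sigma>. range \<sigma> \<subseteq> {..<m}}"
      then have \<sigma>: "range \<sigma> \<subseteq> {..<m}" by simp
      have g: "germ_at p (?D \<sigma>) = \<pi>\<^sup>2 * h \<sigma>"
        using germ_at_det[OF en[OF \<sigma> U(2)]] h[OF \<sigma>] by (simp add: vgerm_at_def)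
      have "holo_near p (?D \<sigma>)" by (rule holo_near_det[OF en[OF \<sigma> U(2)]])
      from eventually_eq_if_germ_eq[OF this g] rep_power[of \<pi> 2 p]
      show "\<forall>\<^sub>F z in nhds p. ?D \<sigma> z = Pn z ^ 2 * rep_hgerm (h \<sigma>) (z - p)"
        by eventually_elim (simp add: Pn_def)
      show "\<forall>\<^sub>F z in nhds p. holo_near z (\<lambda>z. rep_hgerm (h \<sigma>) (z - p))"
        by (rule holo_near_eventually[OF holo_near_rep])
    qed
  qed
  then obtain r where r: "r > 0" "\<And>z. z \<in> ball p r \<Longrightarrow> C z"
    unfolding eventually_nhds_metric by (auto simp: dist_commute)
  have bad: "\<not> good_point U X' X0' m E q" if q: "q \<in> ball p r" "q \<in> X0'" for q
  proof -
    note Cq = r(2)[OF q(1), unfolded C_def]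
    have qU: "q \<in> U" and Pq: "holo_near q Pn" and Fq: "holo_near q Fn" and P0: "Pn q = 0" using Cq q(2) by blast+
    have inb: "\<forall>\<^sub>F z in nhds q. C z"
      using eventually_nhds_in_open[OF open_ball q(1)] by eventually_elim (rule r(2))
    show ?thesis
    proof (rule not_good_point[OF U(1) qU E, where f = "germ_at q Fn" and \<pi> = "germ_at q Pn"])
      show "germ_at q Fn \<noteq> 0"
      proof
        assume "germ_at q Fn = 0"
        then have "\<forall>\<^sub>F z in nhds q. rep_hgerm 0 (z - q) = Fn z" using rep_germ_at[OF Fq] by simp
        with rep_0[of q] have "\<forall>\<^sub>F z in nhds q. Fn z = 0" by eventually_elim simp
        moreover have "holo_on Fn (ball p r)"
          by (rule holo_on_subset[OF holo_on_near]) (use r(2) in \<open>auto simp: C_def\<close>)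
        ultimately have "Fn z = 0" if "z \<in> ball p r" for z using holo_on_ball_identity q(1) that by blast
        then have "\<forall>\<^sub>F z in nhds p. Fn z = 0"
          using eventually_nhds_in_open[OF open_ball, of p p r] r(1) by (auto elim: eventually_mono)
        then have "f = 0" unfolding hgerm_eq_iff[of f 0 p] Fn_def using rep_0[of p] by eventually_elim simp
        with squarefree_nonzero[OF f(1)] show False by simp
      qed
      show "defined_by q X' {germ_at q Fn}"
        using inb rep_germ_at[OF Fq] unfolding defined_by_def by eventually_elim (simp add: C_def)
      show "hvalue (germ_at q Pn) = 0" using P0 by (simp add: hvalue_germ_at Pq)
      show "\<forall>\<^sub>F z in nhds q. z \<in> X0' \<longrightarrow> z \<in> X'" using sub by (intro always_eventually) blast
      show "q \<in> X0'" by fact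
      show "germ_at q Fn dvd vapply (vgerm_at q (E j)) (germ_at q Fn)" if j: "j < m" for j
      proof -
        have "vapply (vgerm_at q (E j)) (germ_at q Fn) = germ_at q (\<lambda>z. \<Sum>i\<in>UNIV. E j z $ i * partial i Fn z)"
          by (rule vapply_germ_at[OF E_at[OF j qU] Fq])
        also have "\<dots> = germ_at q (\<lambda>z. Fn z * rep_hgerm (\<alpha> j) (z - p))"
        proof (rule germ_at_eqI)
          show "holo_near q (\<lambda>z. \<Sum>i\<in>UNIV. E j z $ i * partial i Fn z)"
            by (intro holo_near_sum holo_near_mult holo_near_partial E_at[OF j qU] Fq)
          show "\<forall>\<^sub>F z in nhds q. (\<Sum>i\<in>UNIV. E j z $ i * partial i Fn z) = Fn z * rep_hgerm (\<alpha> j) (z - p)"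
            using inb by eventually_elim (use j in \<open>simp add: C_def\<close>)
        qed
        also have "\<dots> = germ_at q Fn * germ_at q (\<lambda>z. rep_hgerm (\<alpha> j) (z - p))"
          using Cq j by (intro germ_at_mult Fq) simp
        finally show ?thesis by simp
      qed
      show "(germ_at q Pn)\<^sup>2 dvd det (\<chi> i j. vgerm_at q (E (\<sigma> j)) $ i)" if \<sigma>: "range \<sigma> \<subseteq> {..<m}" for \<sigma> :: "'n \<Rightarrow> nat"
      proof -
        have "det (\<chi> i j. vgerm_at q (E (\<sigma> j)) $ i) = germ_at q (?D \<sigma>)"
          using germ_at_det[OF en[OF \<sigma> qU]] by (simp add: vgerm_at_def)
        also have "\<dots> = germ_at q (\<lambda>z. Pn z ^ 2 * rep_hgerm (h \<sigma>) (z - p))"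
        proof (rule germ_at_eqI)
          show "holo_near q (?D \<sigma>)" by (rule holo_near_det[OF en[OF \<sigma> qU]])
          show "\<forall>\<^sub>F z in nhds q. ?D \<sigma> z = Pn z ^ 2 * rep_hgerm (h \<sigma>) (z - p)"
            using inb by eventually_elim (use \<sigma> in \<open>simp add: C_def\<close>)
        qed
        also have "\<dots> = germ_at q (\<lambda>z. Pn z ^ 2) * germ_at q (\<lambda>z. rep_hgerm (h \<sigma>) (z - p))"
          using Cq \<sigma> by (intro germ_at_mult holo_near_power Pq) simp
        finally show ?thesis by (simp add: germ_at_power Pq)
      qed
    qed
  qed
  show ?thesis
    by (rule that[OF r(1) _ _ _ _ bad]) (use r(2) in \<open>auto simp: C_def Pn_def[abs_def] Fn_def\<close>)
qed

text \<open>If the square of \<open>\<pi>\<close> divides every minor, (B1) fails by the description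
  of the vanishing ideal and (B2) because no nearby point of the component satisfies (a)-(d). For
  (B3) the exceptional set would have to absorb an open piece of a smooth hypersurface, against its
  codimension.\<close>

lemma cond_B_imp_minor:
  fixes p :: "complex^'n::finite" and f \<pi> :: "'n hgerm"
  assumes f: "squarefree f" "defined_by p X {f}" and L: "L \<subseteq> Der_log p X"
    and \<pi>: "prime_elem \<pi>" "\<pi> dvd f"
    and B: "cond_B1 p (zero_set p \<pi>) L \<or> cond_B2 p X (zero_set p \<pi>) L \<or> cond_B3 p X (zero_set p \<pi>) L"
  shows "\<exists>M. (\<forall>j. column j M \<in> L) \<and> \<not> \<pi>\<^sup>2 dvd det M"
proof (rule ccontr)
  assume "\<not> ?thesis"
  then have none: "\<forall>M. (\<forall>j. column j M \<in> L) \<longrightarrow> \<pi>\<^sup>2 dvd det M" by blast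
  have nB1: "\<not> cond_B1 p (zero_set p \<pi>) L" using cond_B1_zero_set[OF \<pi>(1)] none by blast
  have nB2: "\<not> cond_B2 p X (zero_set p \<pi>) L"
  proof
    assume "cond_B2 p X (zero_set p \<pi>) L"
    then obtain U X' X0' m E where ad: "adapted p X L U X' m E" "component_in U X0' X'" "germ_eq p X0' (zero_set p \<pi>)"
      and *: "\<And>V. open V \<Longrightarrow> V \<subseteq> U \<Longrightarrow> p \<in> V \<Longrightarrow> \<exists>q\<in>X0' \<inter> V. good_point U X' X0' m E q"
      unfolding cond_B2_def by metis
    show False
    proof (rule no_good_point_near[OF f L none ad])
      fix r assume "r > 0" "ball p r \<subseteq> U" "\<And>q. q \<in> ball p r \<Longrightarrow> q \<in> X0' \<Longrightarrow> \<not> good_point U X' X0' m E q"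
      then show False using *[of "ball p r"] by auto
    qed
  qed
  have "\<not> cond_B3 p X (zero_set p \<pi>) L"
  proof
    assume "cond_B3 p X (zero_set p \<pi>) L"
    then obtain U X' X0' m E where ad: "adapted p X L U X' m E" "component_in U X0' X'" "germ_eq p X0' (zero_set p \<pi>)"
      and *: "\<And>V. open V \<Longrightarrow> V \<subseteq> U \<Longrightarrow> p \<in> V \<Longrightarrow> \<exists>Y. analytic_in V Y \<and> Y \<subseteq> V \<inter> X0' \<and> codim_ge2 Y \<and>
          (\<forall>q\<in>X0' \<inter> V - Y. smooth_point X' q \<longrightarrow> good_point U X' X0' m E q)"
      unfolding cond_B3_def by metis
    obtain r where r: "r > 0" "ball p r \<subseteq> U" and rX': "\<And>z. z \<in> ball p r \<Longrightarrow> z \<in> X' \<longleftrightarrow> rep_hgerm f (z - p) = 0"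
      and rX0: "\<And>z. z \<in> ball p r \<Longrightarrow> z \<in> X0' \<longleftrightarrow> rep_hgerm \<pi> (z - p) = 0"
      and rh: "\<And>z. z \<in> ball p r \<Longrightarrow> holo_near z (\<lambda>z. rep_hgerm \<pi> (z - p))"
      and bad: "\<And>q. q \<in> ball p r \<Longrightarrow> q \<in> X0' \<Longrightarrow> \<not> good_point U X' X0' m E q"
      by (rule no_good_point_near[OF f L none ad]) (rule that; assumption)
    obtain Y where Y: "Y \<subseteq> ball p r \<inter> X0'" "codim_ge2 Y"
      "\<And>q. q \<in> X0' \<inter> ball p r - Y \<Longrightarrow> smooth_point X' q \<Longrightarrow> good_point U X' X0' m E q"
      using *[of "ball p r"] r by auto
    define P where "P z = rep_hgerm \<pi> (z - p)" for z
    have \<pi>0: "\<pi> \<noteq> 0" "\<not> \<pi> dvd 1" using \<pi>(1) by (auto simp: prime_elem_def)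
    obtain g where g: "f = \<pi> * g" using \<pi>(2) by (rule dvdE)
    define G where "G z = rep_hgerm g (z - p)" for z
    have ng: "\<not> \<pi> dvd g"
    proof
      assume "\<pi> dvd g"
      then have "\<pi>\<^sup>2 dvd f" unfolding g power2_eq_square by (rule mult_dvd_mono[OF dvd_refl])
      from squarefreeD[OF f(1) this] \<pi>0 show False by simp
    qed
    \<comment> \<open>Neither the cofactor \<open>g\<close> nor this partial derivative of
      \<open>\<pi>\<close> is divisible by \<open>\<pi>\<close>, hence by primality neither is their
      product.\<close>
    obtain j where "\<not> \<pi> dvd dgerm j \<pi>" using dvd_dgerm_imp_0[of \<pi>] \<pi>0 by blast
    then have nd: "\<not> \<pi> dvd g * dgerm j \<pi>" using ng \<pi>(1) unfolding prime_elem_def by blast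
    define C where "C z \<longleftrightarrow> rep_hgerm f (z - p) = P z * G z \<and> rep_hgerm (g * dgerm j \<pi>) (z - p) = G z * partial j P z
      \<and> holo_near z G \<and> z \<in> ball p r" for z
    have "\<forall>\<^sub>F z in nhds p. C z"
      unfolding C_def
    proof (intro eventually_conj)
      show "\<forall>\<^sub>F z in nhds p. rep_hgerm f (z - p) = P z * G z"
        using rep_mult[of \<pi> g p] unfolding g P_def G_def .
      show "\<forall>\<^sub>F z in nhds p. rep_hgerm (g * dgerm j \<pi>) (z - p) = G z * partial j P z"
        using rep_mult[of g "dgerm j \<pi>" p] rep_dgerm[of j \<pi> p] unfolding P_def[abs_def] G_def
        by eventually_elim simp
      show "\<forall>\<^sub>F z in nhds p. holo_near z G"
        unfolding G_def by (rule holo_near_eventually[OF holo_near_rep])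
      show "\<forall>\<^sub>F z in nhds p. z \<in> ball p r" using r(1) by (intro eventually_nhds_in_open) auto
    qed
    then obtain s where s: "s > 0" "\<And>z. z \<in> ball p s \<Longrightarrow> C z"
      unfolding eventually_nhds_metric by (auto simp: dist_commute)
    \<comment> \<open>By the Nullstellensatz the product cannot vanish on all zeros of
      \<open>\<pi>\<close>. Where the cofactor is nonzero \<open>X'\<close> coincides locally with
      the zeros of \<open>\<pi>\<close>, and the nonzero derivative makes it smooth.\<close>
    have "\<exists>q\<in>ball p s. P q = 0 \<and> G q * partial j P q \<noteq> 0"
    proof (rule ccontr)
      assume "\<not> ?thesis"
      then have "\<forall>z\<in>ball p s. rep_hgerm \<pi> (z - p) = 0 \<longrightarrow> rep_hgerm (g * dgerm j \<pi>) (z - p) = 0"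
        using s(2) unfolding C_def P_def by metis
      then have "\<forall>\<^sub>F z in nhds p. rep_hgerm \<pi> (z - p) = 0 \<longrightarrow> rep_hgerm (g * dgerm j \<pi>) (z - p) = 0"
        unfolding eventually_nhds using s(1) by (intro exI[of _ "ball p s"]) auto
      from nullstellensatz_squarefree[OF prime_imp_squarefree[OF \<pi>(1)] this] nd show False by blast
    qed
    then obtain q where q: "q \<in> ball p s" "P q = 0" "G q \<noteq> 0" "partial j P q \<noteq> 0" by auto
    have Pn: "holo_near z P" if "z \<in> ball p s" for z
      using rh[of z] s(2)[OF that] unfolding C_def P_def by blast
    have inY: "z \<in> Y" if z: "z \<in> ball p s" "P z = 0" "G z \<noteq> 0" "partial j P z \<noteq> 0" for z
    proof (rule ccontr)
      assume "z \<notin> Y"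
      have zr: "z \<in> ball p r" using s(2)[OF z(1)] unfolding C_def by blast
      then have zX0: "z \<in> X0'" using rX0 z(2) by (simp add: P_def)
      have "isCont G z" using s(2)[OF z(1)] unfolding C_def by (intro holo_near_continuous) blast
      then have "(G \<longlongrightarrow> G z) (nhds z)" using tendsto_at_iff_tendsto_nhds[of G z] by (simp add: isCont_def)
      from tendsto_imp_eventually_ne[OF this z(3)]
      have "\<forall>\<^sub>F x in nhds z. x \<in> X' \<longleftrightarrow> P x = 0"
        using eventually_nhds_in_open[OF open_ball z(1)]
      proof eventually_elim
        case (elim x)
        then have "C x" using s(2) by blast
        then show ?case using rX'[of x] elim(1) by (simp add: C_def)
      qed
      from submanifold_at_if_partial_nonzero[OF Pn[OF z(1)] z(2,4) this]
      have "smooth_point X' z" unfolding smooth_point_def by blast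
      then have "good_point U X' X0' m E z" using Y(3)[of z] zX0 zr \<open>z \<notin> Y\<close> by blast
      with bad[OF zr zX0] show False by blast
    qed
    have "isCont G q" using s(2)[OF q(1)] unfolding C_def by (intro holo_near_continuous) blast
    then have G: "(G \<longlongrightarrow> G q) (nhds q)" using tendsto_at_iff_tendsto_nhds[of G q] by (simp add: isCont_def)
    have "isCont (partial j P) q" by (intro holo_near_continuous holo_near_partial Pn q(1))
    then have dP: "(partial j P \<longlongrightarrow> partial j P q) (nhds q)"
      using tendsto_at_iff_tendsto_nhds[of "partial j P" q] by (simp add: isCont_def)
    \<comment> \<open>Both nonvanishing conditions persist near \<open>q\<close>, so all zeros of
      \<open>P\<close> near \<open>q\<close> are smooth points of \<open>X'\<close> without (a)-(d)
      and must lie in \<open>Y\<close>; there \<open>Y\<close> is a manifold of codimension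
      one.\<close>
    from tendsto_imp_eventually_ne[OF G q(3)] tendsto_imp_eventually_ne[OF dP q(4)]
      eventually_nhds_in_open[OF open_ball q(1)]
    have "\<forall>\<^sub>F z in nhds q. z \<in> Y \<longleftrightarrow> P z = 0"
    proof eventually_elim
      case (elim z)
      have "P z = 0" if "z \<in> Y" using Y(1) rX0[of z] that unfolding P_def by blast
      with inY elim show ?case by blast
    qed
    from submanifold_at_if_partial_nonzero[OF Pn[OF q(1)] q(2,4) this]
    have "(CARD('n) - 1) + 2 \<le> CARD('n)" using Y(2) unfolding codim_ge2_def by blast
    then show False using zero_less_card_finite[where 'a = 'n] by linarith
  qed
  with B nB1 nB2 show False by blast
qed

theorem theorem5p4:
  fixes p :: "complex^'n" and X :: "(complex^'n) set"
    and f :: "'n hgerm" and L :: "('n hgerm^'n) set"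
  assumes "p \<in> X" and "squarefree f" and "defined_by p X {f}"
    and "hvec.subspace L" and "L \<subseteq> Der_log p X"
    and A: "\<And>h. squarefree h \<Longrightarrow> fitting_ideal L \<subseteq> hring.span {h} \<Longrightarrow> h dvd f"
    and B: "\<And>X0. component_germ p X0 X \<Longrightarrow> hypersurface_germ p X0 \<Longrightarrow>
      cond_B1 p X0 L \<or> cond_B2 p X X0 L \<or> cond_B3 p X X0 L"
  shows "R_fields L = log_forms f \<and>
    R_forms (R_fields L) = Der_log p X \<and>
    (reflexive_module L \<longrightarrow> L = Der_log p X)"
proof (rule log_forms_of_fitting_conditions[OF assms(1-5) A])
  fix \<pi> :: "'n hgerm" assume \<pi>: "prime_elem \<pi>" "\<pi> dvd f"
  have "cond_B1 p (zero_set p \<pi>) L \<or> cond_B2 p X (zero_set p \<pi>) L \<or> cond_B3 p X (zero_set p \<pi>) L"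
    using prime_component[OF assms(2,3) \<pi>] by (intro B) blast+
  then show "\<exists>M. (\<forall>j. column j M \<in> L) \<and> \<not> \<pi>\<^sup>2 dvd det M"
    by (rule cond_B_imp_minor[OF assms(2,3,5) \<pi>])
qed

end
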